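(* Let $\Phi(\underline a)$ be a formula of $\mathrm{E\text{-}HA}^{\omega*}_{\mathrm{st}}$ and let $\Delta_{\mathrm{int}}$ be a set of internal sentences. If \[\mathrm{E\text{-}HA}^{\omega*}_{\mathrm{st}} + \mathrm{I} + \mathrm{NCR} + \mathrm{HAC} + \mathrm{HGMP} + \mathrm{HIP}_{\forall^{\mathrm{st}}} + \Delta_{\mathrm{int}} \vdash \Phi(\underline a)\] and $\Phi(\underline a)^{D}\equiv \exists^{\mathrm{st}}\underline x\,\forall^{\mathrm{st}}\underline y\,\varphi_D(\underline x,\underline y,\underline a)$, then from the proof one can extract a tuple of closed terms $\underline t$ of $\mathcal T^*$ such that \[\mathrm{E\text{-}HA}^{\omega*} + \Delta_{\mathrm{int}} \vdash \forall \underline y\,\varphi_D(\underline t,\underline y,\underline a).\]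
   Context: Finite types: $0$; $\sigma\to\tau$; $\sigma^*$ (finite sequences of objects of type $\sigma$). $\mathcal T^*$ is Gödel's system T for these types extended, for each $\sigma$, with constants $\varepsilon_\sigma:\sigma^*$ (empty sequence), $c:\sigma\to\sigma^*\to\sigma^*$ (prepending) and (simultaneous) list recursors $L$ with $L\,\varepsilon\,\underline y\,\underline z=\underline y$, $L\,c(a,x)\,\underline y\,\underline z=\underline z(L\,x\,\underline y\,\underline z)a$. $\mathrm{E\text{-}HA}^{\omega*}$ is intuitionistic extensional arithmetic in all these types (extending $\mathrm{E\text{-}HA}^\omega$): primitive equality at all types with congruence axioms, function extensionality $f=g\leftrightarrow\forall x\,(fx=gx)$, defining equations of $\mathcal T^*$, induction for all its formulas, and the sequence axiom $\forall y^{\sigma^*}(y=\varepsilon_\sigma\lor\exists a^\sigma,x^{\sigma^*}\,y=c(a,x))$. In $\mathcal T^*$ one defines length $|x|$, projections $(x)_i$, lists $\langle x_0,\dots,x_{n-1}\rangle$ and concatenation $*$. Write $s\in t:\equiv\exists i<|t|\,(s=(t)_i)$ and $s\preceq t:\equiv\forall x\,(x\in s\to x\in t)$ (componentwise for tuples). For $s:(\sigma\to\tau^* )^*$ and $t:\sigma$, $s[t]:=(s)_0(t)*\dots*(s)_{|s|-1}(t):\tau^*$ (iterated for several arguments, componentwise for tuples), and $\Lambda x.s(x):=\langle\lambda x.s(x)\rangle$. $\mathrm{E\text{-}HA}^{\omega*}_{\mathrm{st}}$: language of $\mathrm{E\text{-}HA}^{\omega*}$ plus unary predicates $\mathrm{st}^\sigma$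 and quantifiers $\forall^{\mathrm{st}}x^\sigma,\exists^{\mathrm{st}}x^\sigma$; formulas without these are internal (lower-case Greek letters denote internal formulas, upper-case arbitrary ones; extra parameters allowed). Axioms: those of $\mathrm{E\text{-}HA}^{\omega*}$ (induction only for internal formulas), intuitionistic logic for all formulas, $\forall^{\mathrm{st}}x\Phi\leftrightarrow\forall x(\mathrm{st}(x)\to\Phi)$, $\exists^{\mathrm{st}}x\Phi\leftrightarrow\exists x(\mathrm{st}(x)\land\Phi)$, $\mathrm{st}(x)\land x=y\to\mathrm{st}(y)$, $\mathrm{st}(t)$ for each closed term $t$ of $\mathcal T^*$, $\mathrm{st}(f)\land\mathrm{st}(x)\to\mathrm{st}(fx)$, and external induction $\Phi(0)\land\forall^{\mathrm{st}}n^0(\Phi(n)\to\Phi(n+1))\to\forall^{\mathrm{st}}n^0\Phi(n)$ for all $\Phi$. Principles (all types): $\mathrm{I}$: $\forall^{\mathrm{st}}x^{\sigma^*}\exists y^\tau\forall x'\in x\,\varphi(x',y)\to\exists y^\tau\forall^{\mathrm{st}}x^\sigma\varphi(x,y)$. $\mathrm{NCR}$: $\forall y^\tau\exists^{\mathrm{st}}x^\sigma\Phi(x,y)\to\exists^{\mathrm{st}}x^{\sigma^*}\forall y^\tau\exists x'\in x\,\Phi(x',y)$. $\mathrm{HAC}$: $\forall^{\mathrm{st}}x\exists^{\mathrm{st}}y\,\Phi(x,y)\to\exists^{\mathrm{st}}F\forall^{\mathrm{st}}x\exists y\in F(x)\,\Phi(x,y)$. $\mathrm{HIP}_{\forall^{\mathrm{st}}}$: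 $(\forall^{\mathrm{st}}x\varphi(x)\to\exists^{\mathrm{st}}y\Psi(y))\to\exists^{\mathrm{st}}y(\forall^{\mathrm{st}}x\varphi(x)\to\exists y'\in y\,\Psi(y'))$. $\mathrm{HGMP}$: $(\forall^{\mathrm{st}}x\varphi(x)\to\psi)\to\exists^{\mathrm{st}}x(\forall x'\in x\,\varphi(x')\to\psi)$. D-interpretation: to each $\Phi(\underline a)$ assign $\Phi^D\equiv\exists^{\mathrm{st}}\underline x\forall^{\mathrm{st}}\underline y\,\varphi_D(\underline x,\underline y,\underline a)$, $\varphi_D$ internal, all $\underline x$ of sequence type: $\varphi^D:\equiv\varphi$ for internal atomic $\varphi$; $\mathrm{st}^\sigma(u)^D:\equiv\exists^{\mathrm{st}}x^{\sigma^*}(u\in x)$; if $\Phi^D\equiv\exists^{\mathrm{st}}\underline x\forall^{\mathrm{st}}\underline y\varphi_D$ and $\Psi^D\equiv\exists^{\mathrm{st}}\underline u\forall^{\mathrm{st}}\underline v\psi_D$ then $(\Phi\land\Psi)^D:\equiv\exists^{\mathrm{st}}\underline x,\underline u\forall^{\mathrm{st}}\underline y,\underline v(\varphi_D\land\psi_D)$, $(\Phi\lor\Psi)^D$ the same with $\lor$, $(\Phi\to\Psi)^D:\equiv\exists^{\mathrm{st}}\underline U,\underline Y\forall^{\mathrm{st}}\underline x,\underline v(\forall\underline y\in\underline Y[\underline x,\underline v]\varphi_D(\underline x,\underline y,\underline a)\to\psi_D(\underline U[\underline x],\underline v,\underline b))$, $(\forall z\Phi)^D:\equiv\exists^{\mathrm{st}}\underline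 x\forall^{\mathrm{st}}\underline y\forall z\varphi_D(\underline x,\underline y,z,\underline a)$, $(\exists z\Phi)^D:\equiv\exists^{\mathrm{st}}\underline x\forall^{\mathrm{st}}\underline y\exists z\forall\underline y'\in\underline y\,\varphi_D(\underline x,\underline y',z,\underline a)$, $(\forall^{\mathrm{st}}z\Phi)^D:\equiv\exists^{\mathrm{st}}\underline X\forall^{\mathrm{st}}z,\underline y\,\varphi_D(\underline X[z],\underline y,z,\underline a)$, $(\exists^{\mathrm{st}}z\Phi)^D:\equiv\exists^{\mathrm{st}}\underline x,z\forall^{\mathrm{st}}\underline y\exists z'\in z\forall\underline y'\in\underline y\,\varphi_D(\underline x,\underline y',z',\underline a)$ (new variables $\underline U,\underline Y,\underline X$, and in the $\exists$/$\exists^{\mathrm{st}}$ clauses $\underline y$ and $z$, of the appropriate sequence types). *)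

theory Defs
  imports Main
begin

section \<open>Finite types and the terms of system T with finite sequences\<close>

datatype ty = TNat | TFun ty ty | TSeq ty

abbreviation TFuns :: "ty list \<Rightarrow> ty \<Rightarrow> ty" where
  "TFuns \<sigma>s \<tau> \<equiv> foldr TFun \<sigma>s \<tau>"

text \<open>Variables are de Bruijn indices. \<open>RecC \<rho>s i\<close> and \<open>LRecC \<sigma> \<rho>s i\<close> are the \<open>i\<close>-th components of
  the simultaneous recursors over numbers and over sequences of type \<open>\<sigma>\<^sup>*\<close>, for the tuple \<open>\<rho>s\<close> of
  result types. Abstraction is primitive, with \<open>\<beta>\<close> among the defining equations, instead of being derived from combinators.\<close>

datatype tm =
    Var nat
  | Lam ty tm
  | App tm tm  (infixl "\<cdot>" 200)
  | ZeroC
  | SucC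
  | RecC "ty list" nat
  | NilC ty
  | ConsC ty
  | LRecC ty "ty list" nat

abbreviation Apps :: "tm \<Rightarrow> tm list \<Rightarrow> tm" where
  "Apps t ts \<equiv> foldl App t ts"

text \<open>A context lists the types of the free variables; index 0 is its head.\<close>

type_synonym ctx = "ty list"

inductive has_type :: "ctx \<Rightarrow> tm \<Rightarrow> ty \<Rightarrow> bool" where
  "n < length \<Gamma> \<Longrightarrow> has_type \<Gamma> (Var n) (\<Gamma> ! n)"
| "has_type (\<sigma> # \<Gamma>) t \<tau> \<Longrightarrow> has_type \<Gamma> (Lam \<sigma> t) (TFun \<sigma> \<tau>)"
| "has_type \<Gamma> s (TFun \<sigma> \<tau>) \<Longrightarrow> has_type \<Gamma> t \<sigma> \<Longrightarrow> has_type \<Gamma> (s \<cdot> t) \<tau>"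
| "has_type \<Gamma> ZeroC TNat"
| "has_type \<Gamma> SucC (TFun TNat TNat)"
| "i < length \<rho>s \<Longrightarrow> has_type \<Gamma> (RecC \<rho>s i)
     (TFun TNat (TFuns \<rho>s (TFuns (map (\<lambda>\<rho>. TFuns \<rho>s (TFun TNat \<rho>)) \<rho>s) (\<rho>s ! i))))"
| "has_type \<Gamma> (NilC \<sigma>) (TSeq \<sigma>)"
| "has_type \<Gamma> (ConsC \<sigma>) (TFun \<sigma> (TFun (TSeq \<sigma>) (TSeq \<sigma>)))"
| "i < length \<rho>s \<Longrightarrow> has_type \<Gamma> (LRecC \<sigma> \<rho>s i)
     (TFun (TSeq \<sigma>) (TFuns \<rho>s (TFuns (map (\<lambda>\<rho>. TFuns \<rho>s (TFun \<sigma> \<rho>)) \<rho>s) (\<rho>s ! i))))"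

definition have_types :: "ctx \<Rightarrow> tm list \<Rightarrow> ty list \<Rightarrow> bool" where
  "have_types \<Gamma> = list_all2 (has_type \<Gamma>)"

subsection \<open>Renaming and simultaneous substitution\<close>

definition up_ren :: "(nat \<Rightarrow> nat) \<Rightarrow> nat \<Rightarrow> nat" where
  "up_ren r = case_nat 0 (\<lambda>n. Suc (r n))"

primrec ren :: "(nat \<Rightarrow> nat) \<Rightarrow> tm \<Rightarrow> tm" where
  "ren r (Var n) = Var (r n)"
| "ren r (Lam \<sigma> t) = Lam \<sigma> (ren (up_ren r) t)"
| "ren r (s \<cdot> t) = ren r s \<cdot> ren r t"
| "ren r ZeroC = ZeroC"
| "ren r SucC = SucC"
| "ren r (RecC \<rho>s i) = RecC \<rho>s i"
| "ren r (NilC \<sigma>) = NilC \<sigma>"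
| "ren r (ConsC \<sigma>) = ConsC \<sigma>"
| "ren r (LRecC \<sigma> \<rho>s i) = LRecC \<sigma> \<rho>s i"

abbreviation shift :: "nat \<Rightarrow> tm \<Rightarrow> tm" where
  "shift k \<equiv> ren (\<lambda>n. n + k)"

definition up :: "(nat \<Rightarrow> tm) \<Rightarrow> nat \<Rightarrow> tm" where
  "up \<rho> = case_nat (Var 0) (\<lambda>n. shift 1 (\<rho> n))"

primrec sub :: "(nat \<Rightarrow> tm) \<Rightarrow> tm \<Rightarrow> tm" where
  "sub \<rho> (Var n) = \<rho> n"
| "sub \<rho> (Lam \<sigma> t) = Lam \<sigma> (sub (up \<rho>) t)"
| "sub \<rho> (s \<cdot> t) = sub \<rho> s \<cdot> sub \<rho> t"
| "sub \<rho> ZeroC = ZeroC"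
| "sub \<rho> SucC = SucC"
| "sub \<rho> (RecC \<rho>s i) = RecC \<rho>s i"
| "sub \<rho> (NilC \<sigma>) = NilC \<sigma>"
| "sub \<rho> (ConsC \<sigma>) = ConsC \<sigma>"
| "sub \<rho> (LRecC \<sigma> \<rho>s i) = LRecC \<sigma> \<rho>s i"

text \<open>\<open>inst t\<close> replaces variable 0 by \<open>t\<close> and drops it from the context; \<open>succ_sub\<close> replaces variable 0
  by its successor and keeps it; \<open>skip k\<close> makes room for one new variable of index \<open>k\<close>.\<close>

abbreviation inst :: "tm \<Rightarrow> nat \<Rightarrow> tm" where
  "inst t \<equiv> case_nat t Var"

abbreviation succ_sub :: "nat \<Rightarrow> tm" where
  "succ_sub \<equiv> case_nat (SucC \<cdot> Var 0) (\<lambda>n. Var (Suc n))"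

definition skip :: "nat \<Rightarrow> nat \<Rightarrow> nat" where
  "skip k n = (if n < k then n else Suc n)"

subsection \<open>Defined closed terms\<close>

primrec default_tm :: "ty \<Rightarrow> tm" where
  "default_tm TNat = ZeroC"
| "default_tm (TFun \<sigma> \<tau>) = Lam \<sigma> (default_tm \<tau>)"
| "default_tm (TSeq \<sigma>) = NilC \<sigma>"

text \<open>Addition, recursive in its second argument.\<close>

definition plusC :: tm where
  "plusC = Lam TNat (Lam TNat
     (RecC [TNat] 0 \<cdot> Var 0 \<cdot> Var 1 \<cdot> Lam TNat (Lam TNat (SucC \<cdot> Var 1))))"

definition lenC :: "ty \<Rightarrow> tm" where
  "lenC \<sigma> = Lam (TSeq \<sigma>)
     (LRecC \<sigma> [TNat] 0 \<cdot> Var 0 \<cdot> ZeroC \<cdot> Lam TNat (Lam \<sigma> (SucC \<cdot> Var 1)))"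

text \<open>Projection: \<open>(\<epsilon>)\<^sub>i\<close> is the default object,
  and \<open>(c(a,x))\<^sub>i\<close> is \<open>a\<close> for \<open>i = 0\<close> and \<open>(x)\<^sub>j\<close> for \<open>i = j + 1\<close>.\<close>

definition projC :: "ty \<Rightarrow> tm" where
  "projC \<sigma> = Lam (TSeq \<sigma>)
     (LRecC \<sigma> [TFun TNat \<sigma>] 0 \<cdot> Var 0 \<cdot> default_tm (TFun TNat \<sigma>)
       \<cdot> Lam (TFun TNat \<sigma>) (Lam \<sigma> (Lam TNat
            (RecC [\<sigma>] 0 \<cdot> Var 0 \<cdot> Var 1 \<cdot> Lam \<sigma> (Lam TNat (Var 4 \<cdot> Var 0))))))"

definition appendC :: "ty \<Rightarrow> tm" where
  "appendC \<sigma> = Lam (TSeq \<sigma>) (Lam (TSeq \<sigma>)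
     (LRecC \<sigma> [TSeq \<sigma>] 0 \<cdot> Var 1 \<cdot> Var 0
       \<cdot> Lam (TSeq \<sigma>) (Lam \<sigma> (ConsC \<sigma> \<cdot> Var 0 \<cdot> Var 1))))"

text \<open>\<open>sappC \<sigma> \<tau> \<cdot> s \<cdot> t\<close> is \<open>s[t]\<close> for \<open>s : (\<sigma> \<rightarrow> \<tau>\<^sup>*)\<^sup>*\<close> and \<open>t : \<sigma>\<close>; the concatenation of
  the \<open>(s)\<^sub>i(t)\<close> is a recursion on the number \<open>|s|\<close> of its factors.\<close>

definition sappC :: "ty \<Rightarrow> ty \<Rightarrow> tm" where
  "sappC \<sigma> \<tau> = (let \<phi> = TFun \<sigma> (TSeq \<tau>) in
     Lam (TSeq \<phi>) (Lam \<sigma>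
       (RecC [TSeq \<tau>] 0 \<cdot> (lenC \<phi> \<cdot> Var 1) \<cdot> NilC \<tau>
         \<cdot> Lam (TSeq \<tau>) (Lam TNat
              (appendC \<tau> \<cdot> Var 1 \<cdot> (projC \<phi> \<cdot> Var 3 \<cdot> Var 0 \<cdot> Var 2))))))"

text \<open>Iterated application \<open>s[t\<^sub>1]\<dots>[t\<^sub>n]\<close>, with \<open>t\<^sub>i\<close> of type \<open>\<sigma>\<^sub>i\<close> and result type \<open>\<tau>\<^sup>*\<close>:
  the type of \<open>s\<close> is \<open>TSeq (sapp_elem [\<sigma>\<^sub>1, \<dots>, \<sigma>\<^sub>n] \<tau>)\<close>.\<close>

primrec sapp_elem :: "ty list \<Rightarrow> ty \<Rightarrow> ty" where
  "sapp_elem [] \<tau> = \<tau>"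
| "sapp_elem (\<sigma> # \<sigma>s) \<tau> = TFun \<sigma> (TSeq (sapp_elem \<sigma>s \<tau>))"

fun sapps :: "ty list \<Rightarrow> ty \<Rightarrow> tm \<Rightarrow> tm list \<Rightarrow> tm" where
  "sapps (\<sigma> # \<sigma>s) \<tau> s (t # ts) = sapps \<sigma>s \<tau> (sappC \<sigma> (sapp_elem \<sigma>s \<tau>) \<cdot> s \<cdot> t) ts"
| "sapps _ \<tau> s _ = s"

section \<open>Formulas\<close>

datatype fm =
    Bot
  | Eq ty tm tm
  | St ty tm
  | And fm fm
  | Or fm fm
  | Imp fm fm
  | Forall ty fm
  | Exists ty fm
  | ForallSt ty fm
  | ExistsSt ty fm

abbreviation Neg :: "fm \<Rightarrow> fm" where
  "Neg A \<equiv> Imp A Bot"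

abbreviation Iff :: "fm \<Rightarrow> fm \<Rightarrow> fm" where
  "Iff A B \<equiv> And (Imp A B) (Imp B A)"

primrec wf_fm :: "ctx \<Rightarrow> fm \<Rightarrow> bool" where
  "wf_fm \<Gamma> Bot \<longleftrightarrow> True"
| "wf_fm \<Gamma> (Eq \<sigma> s t) \<longleftrightarrow> has_type \<Gamma> s \<sigma> \<and> has_type \<Gamma> t \<sigma>"
| "wf_fm \<Gamma> (St \<sigma> t) \<longleftrightarrow> has_type \<Gamma> t \<sigma>"
| "wf_fm \<Gamma> (And A B) \<longleftrightarrow> wf_fm \<Gamma> A \<and> wf_fm \<Gamma> B"
| "wf_fm \<Gamma> (Or A B) \<longleftrightarrow> wf_fm \<Gamma> A \<and> wf_fm \<Gamma> B"
| "wf_fm \<Gamma> (Imp A B) \<longleftrightarrow> wf_fm \<Gamma> A \<and> wf_fm \<Gamma> B"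
| "wf_fm \<Gamma> (Forall \<sigma> A) \<longleftrightarrow> wf_fm (\<sigma> # \<Gamma>) A"
| "wf_fm \<Gamma> (Exists \<sigma> A) \<longleftrightarrow> wf_fm (\<sigma> # \<Gamma>) A"
| "wf_fm \<Gamma> (ForallSt \<sigma> A) \<longleftrightarrow> wf_fm (\<sigma> # \<Gamma>) A"
| "wf_fm \<Gamma> (ExistsSt \<sigma> A) \<longleftrightarrow> wf_fm (\<sigma> # \<Gamma>) A"

primrec internal :: "fm \<Rightarrow> bool" where
  "internal Bot \<longleftrightarrow> True"
| "internal (Eq \<sigma> s t) \<longleftrightarrow> True"
| "internal (St \<sigma> t) \<longleftrightarrow> False"
| "internal (And A B) \<longleftrightarrow> internal A \<and> internal B"
| "internal (Or A B) \<longleftrightarrow> internal A \<and> internal B"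
| "internal (Imp A B) \<longleftrightarrow> internal A \<and> internal B"
| "internal (Forall \<sigma> A) \<longleftrightarrow> internal A"
| "internal (Exists \<sigma> A) \<longleftrightarrow> internal A"
| "internal (ForallSt \<sigma> A) \<longleftrightarrow> False"
| "internal (ExistsSt \<sigma> A) \<longleftrightarrow> False"

definition wf_int :: "ctx \<Rightarrow> fm \<Rightarrow> bool" where
  "wf_int \<Gamma> A \<longleftrightarrow> wf_fm \<Gamma> A \<and> internal A"

primrec fren :: "(nat \<Rightarrow> nat) \<Rightarrow> fm \<Rightarrow> fm" where
  "fren r Bot = Bot"
| "fren r (Eq \<sigma> s t) = Eq \<sigma> (ren r s) (ren r t)"
| "fren r (St \<sigma> t) = St \<sigma> (ren r t)"
| "fren r (And A B) = And (fren r A) (fren r B)"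
| "fren r (Or A B) = Or (fren r A) (fren r B)"
| "fren r (Imp A B) = Imp (fren r A) (fren r B)"
| "fren r (Forall \<sigma> A) = Forall \<sigma> (fren (up_ren r) A)"
| "fren r (Exists \<sigma> A) = Exists \<sigma> (fren (up_ren r) A)"
| "fren r (ForallSt \<sigma> A) = ForallSt \<sigma> (fren (up_ren r) A)"
| "fren r (ExistsSt \<sigma> A) = ExistsSt \<sigma> (fren (up_ren r) A)"

primrec fsub :: "(nat \<Rightarrow> tm) \<Rightarrow> fm \<Rightarrow> fm" where
  "fsub \<rho> Bot = Bot"
| "fsub \<rho> (Eq \<sigma> s t) = Eq \<sigma> (sub \<rho> s) (sub \<rho> t)"
| "fsub \<rho> (St \<sigma> t) = St \<sigma> (sub \<rho> t)"
| "fsub \<rho> (And A B) = And (fsub \<rho> A) (fsub \<rho> B)"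
| "fsub \<rho> (Or A B) = Or (fsub \<rho> A) (fsub \<rho> B)"
| "fsub \<rho> (Imp A B) = Imp (fsub \<rho> A) (fsub \<rho> B)"
| "fsub \<rho> (Forall \<sigma> A) = Forall \<sigma> (fsub (up \<rho>) A)"
| "fsub \<rho> (Exists \<sigma> A) = Exists \<sigma> (fsub (up \<rho>) A)"
| "fsub \<rho> (ForallSt \<sigma> A) = ForallSt \<sigma> (fsub (up \<rho>) A)"
| "fsub \<rho> (ExistsSt \<sigma> A) = ExistsSt \<sigma> (fsub (up \<rho>) A)"

subsection \<open>Defined formulas\<close>

text \<open>\<open>s < t\<close> is \<open>\<exists>k (k + Ss = t)\<close>.\<close>

definition less_fm :: "tm \<Rightarrow> tm \<Rightarrow> fm" where
  "less_fm s t = Exists TNat (Eq TNat (plusC \<cdot> Var 0 \<cdot> (SucC \<cdot> shift 1 s)) (shift 1 t))"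

definition mem_fm :: "ty \<Rightarrow> tm \<Rightarrow> tm \<Rightarrow> fm" where
  "mem_fm \<sigma> s t = Exists TNat
     (And (less_fm (Var 0) (lenC \<sigma> \<cdot> shift 1 t))
          (Eq \<sigma> (shift 1 s) (projC \<sigma> \<cdot> shift 1 t \<cdot> Var 0)))"

text \<open>In the bounded quantifiers \<open>\<forall>x' \<in> t. A\<close> and \<open>\<exists>x' \<in> t. A\<close>, the term \<open>t\<close> lives in the outer
  context; \<open>x'\<close> is variable 0 of \<open>A\<close>.\<close>

definition ball_fm :: "ty \<Rightarrow> tm \<Rightarrow> fm \<Rightarrow> fm" where
  "ball_fm \<sigma> t A = Forall \<sigma> (Imp (mem_fm \<sigma> (Var 0) (shift 1 t)) A)"

definition bex_fm :: "ty \<Rightarrow> tm \<Rightarrow> fm \<Rightarrow> fm" where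
  "bex_fm \<sigma> t A = Exists \<sigma> (And (mem_fm \<sigma> (Var 0) (shift 1 t)) A)"

text \<open>Quantification over tuples. The first component of the tuple is bound outermost, so in the
  body of a quantifier over an \<open>n\<close>-tuple the tuple itself is \<open>vars n\<close>.\<close>

definition vars :: "nat \<Rightarrow> tm list" where
  "vars n = map Var (rev [0..<n])"

abbreviation Foralls :: "ty list \<Rightarrow> fm \<Rightarrow> fm" where
  "Foralls \<sigma>s A \<equiv> foldr Forall \<sigma>s A"

abbreviation ForallSts :: "ty list \<Rightarrow> fm \<Rightarrow> fm" where
  "ForallSts \<sigma>s A \<equiv> foldr ForallSt \<sigma>s A"

abbreviation ExistsSts :: "ty list \<Rightarrow> fm \<Rightarrow> fm" where
  "ExistsSts \<sigma>s A \<equiv> foldr ExistsSt \<sigma>s A"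

fun balls_fm :: "ty list \<Rightarrow> tm list \<Rightarrow> fm \<Rightarrow> fm" where
  "balls_fm (\<sigma> # \<sigma>s) (t # ts) A = ball_fm \<sigma> t (balls_fm \<sigma>s (map (shift 1) ts) A)"
| "balls_fm _ _ A = A"

section \<open>Formal systems\<close>

text \<open>Intuitionistic many-sorted predicate logic (Goedel's Hilbert-style axiomatization). \<open>L\<close> says which formulas
  belong to the language, \<open>Ax\<close> which are non-logical axioms; \<open>derives L Ax \<Gamma> A\<close> means that \<open>A\<close>, with
  free variables of the types listed in \<open>\<Gamma>\<close>, is derivable.\<close>

inductive derives :: "(ctx \<Rightarrow> fm \<Rightarrow> bool) \<Rightarrow> (ctx \<Rightarrow> fm \<Rightarrow> bool) \<Rightarrow> ctx \<Rightarrow> fm \<Rightarrow> bool"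
  for L Ax where
  axiom: "Ax \<Gamma> A \<Longrightarrow> derives L Ax \<Gamma> A"
| or_contr: "L \<Gamma> A \<Longrightarrow> derives L Ax \<Gamma> (Imp (Or A A) A)"
| and_contr: "L \<Gamma> A \<Longrightarrow> derives L Ax \<Gamma> (Imp A (And A A))"
| or_weak: "L \<Gamma> A \<Longrightarrow> L \<Gamma> B \<Longrightarrow> derives L Ax \<Gamma> (Imp A (Or A B))"
| and_weak: "L \<Gamma> A \<Longrightarrow> L \<Gamma> B \<Longrightarrow> derives L Ax \<Gamma> (Imp (And A B) A)"
| or_perm: "L \<Gamma> A \<Longrightarrow> L \<Gamma> B \<Longrightarrow> derives L Ax \<Gamma> (Imp (Or A B) (Or B A))"
| and_perm: "L \<Gamma> A \<Longrightarrow> L \<Gamma> B \<Longrightarrow> derives L Ax \<Gamma> (Imp (And A B) (And B A))"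
| ex_falso: "L \<Gamma> A \<Longrightarrow> derives L Ax \<Gamma> (Imp Bot A)"
| forall_elim: "L \<Gamma> (Forall \<sigma> A) \<Longrightarrow> has_type \<Gamma> t \<sigma> \<Longrightarrow>
    derives L Ax \<Gamma> (Imp (Forall \<sigma> A) (fsub (inst t) A))"
| exists_intro: "L \<Gamma> (Exists \<sigma> A) \<Longrightarrow> has_type \<Gamma> t \<sigma> \<Longrightarrow>
    derives L Ax \<Gamma> (Imp (fsub (inst t) A) (Exists \<sigma> A))"
| mp: "derives L Ax \<Gamma> A \<Longrightarrow> derives L Ax \<Gamma> (Imp A B) \<Longrightarrow> derives L Ax \<Gamma> B"
| syll: "derives L Ax \<Gamma> (Imp A B) \<Longrightarrow> derives L Ax \<Gamma> (Imp B C) \<Longrightarrow> derives L Ax \<Gamma> (Imp A C)"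
| exportation: "derives L Ax \<Gamma> (Imp (And A B) C) \<Longrightarrow> derives L Ax \<Gamma> (Imp A (Imp B C))"
| importation: "derives L Ax \<Gamma> (Imp A (Imp B C)) \<Longrightarrow> derives L Ax \<Gamma> (Imp (And A B) C)"
| or_expansion: "L \<Gamma> C \<Longrightarrow> derives L Ax \<Gamma> (Imp A B) \<Longrightarrow> derives L Ax \<Gamma> (Imp (Or C A) (Or C B))"
| forall_rule: "L \<Gamma> B \<Longrightarrow> derives L Ax (\<sigma> # \<Gamma>) (Imp (fren Suc B) A) \<Longrightarrow>
    derives L Ax \<Gamma> (Imp B (Forall \<sigma> A))"
| exists_rule: "L \<Gamma> B \<Longrightarrow> derives L Ax (\<sigma> # \<Gamma>) (Imp A (fren Suc B)) \<Longrightarrow>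
    derives L Ax \<Gamma> (Imp (Exists \<sigma> A) B)"

text \<open>The non-logical axioms of \<open>E-HA\<^sup>\<omega>\<^sup>*\<close>.\<close>

inductive EHA_axiom :: "ctx \<Rightarrow> fm \<Rightarrow> bool" where
  eq_refl: "has_type \<Gamma> t \<sigma> \<Longrightarrow> EHA_axiom \<Gamma> (Eq \<sigma> t t)"
| eq_sym: "has_type \<Gamma> s \<sigma> \<Longrightarrow> has_type \<Gamma> t \<sigma> \<Longrightarrow> EHA_axiom \<Gamma> (Imp (Eq \<sigma> s t) (Eq \<sigma> t s))"
| eq_trans: "has_type \<Gamma> s \<sigma> \<Longrightarrow> has_type \<Gamma> t \<sigma> \<Longrightarrow> has_type \<Gamma> u \<sigma> \<Longrightarrow>
    EHA_axiom \<Gamma> (Imp (And (Eq \<sigma> s t) (Eq \<sigma> t u)) (Eq \<sigma> s u))"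
| eq_cong: "has_type \<Gamma> f (TFun \<sigma> \<tau>) \<Longrightarrow> has_type \<Gamma> g (TFun \<sigma> \<tau>) \<Longrightarrow>
    has_type \<Gamma> s \<sigma> \<Longrightarrow> has_type \<Gamma> t \<sigma> \<Longrightarrow>
    EHA_axiom \<Gamma> (Imp (And (Eq (TFun \<sigma> \<tau>) f g) (Eq \<sigma> s t)) (Eq \<tau> (f \<cdot> s) (g \<cdot> t)))"
| extensionality: "has_type \<Gamma> f (TFun \<sigma> \<tau>) \<Longrightarrow> has_type \<Gamma> g (TFun \<sigma> \<tau>) \<Longrightarrow>
    EHA_axiom \<Gamma> (Iff (Eq (TFun \<sigma> \<tau>) f g)
      (Forall \<sigma> (Eq \<tau> (shift 1 f \<cdot> Var 0) (shift 1 g \<cdot> Var 0))))"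
| suc_not_zero: "has_type \<Gamma> t TNat \<Longrightarrow> EHA_axiom \<Gamma> (Neg (Eq TNat (SucC \<cdot> t) ZeroC))"
| suc_inj: "has_type \<Gamma> s TNat \<Longrightarrow> has_type \<Gamma> t TNat \<Longrightarrow>
    EHA_axiom \<Gamma> (Imp (Eq TNat (SucC \<cdot> s) (SucC \<cdot> t)) (Eq TNat s t))"
| beta: "has_type (\<sigma> # \<Gamma>) s \<tau> \<Longrightarrow> has_type \<Gamma> t \<sigma> \<Longrightarrow>
    EHA_axiom \<Gamma> (Eq \<tau> (Lam \<sigma> s \<cdot> t) (sub (inst t) s))"
| rec_zero: "i < length \<rho>s \<Longrightarrow> have_types \<Gamma> ys \<rho>s \<Longrightarrow>
    have_types \<Gamma> zs (map (\<lambda>\<rho>. TFuns \<rho>s (TFun TNat \<rho>)) \<rho>s) \<Longrightarrow>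
    EHA_axiom \<Gamma> (Eq (\<rho>s ! i) (Apps (RecC \<rho>s i \<cdot> ZeroC) (ys @ zs)) (ys ! i))"
| rec_suc: "i < length \<rho>s \<Longrightarrow> have_types \<Gamma> ys \<rho>s \<Longrightarrow>
    have_types \<Gamma> zs (map (\<lambda>\<rho>. TFuns \<rho>s (TFun TNat \<rho>)) \<rho>s) \<Longrightarrow> has_type \<Gamma> n TNat \<Longrightarrow>
    EHA_axiom \<Gamma> (Eq (\<rho>s ! i) (Apps (RecC \<rho>s i \<cdot> (SucC \<cdot> n)) (ys @ zs))
      (Apps (zs ! i) (map (\<lambda>j. Apps (RecC \<rho>s j \<cdot> n) (ys @ zs)) [0..<length \<rho>s]) \<cdot> n))"
| lrec_nil: "i < length \<rho>s \<Longrightarrow> have_types \<Gamma> ys \<rho>s \<Longrightarrow>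
    have_types \<Gamma> zs (map (\<lambda>\<rho>. TFuns \<rho>s (TFun \<sigma> \<rho>)) \<rho>s) \<Longrightarrow>
    EHA_axiom \<Gamma> (Eq (\<rho>s ! i) (Apps (LRecC \<sigma> \<rho>s i \<cdot> NilC \<sigma>) (ys @ zs)) (ys ! i))"
| lrec_cons: "i < length \<rho>s \<Longrightarrow> have_types \<Gamma> ys \<rho>s \<Longrightarrow>
    have_types \<Gamma> zs (map (\<lambda>\<rho>. TFuns \<rho>s (TFun \<sigma> \<rho>)) \<rho>s) \<Longrightarrow>
    has_type \<Gamma> a \<sigma> \<Longrightarrow> has_type \<Gamma> x (TSeq \<sigma>) \<Longrightarrow>
    EHA_axiom \<Gamma> (Eq (\<rho>s ! i) (Apps (LRecC \<sigma> \<rho>s i \<cdot> (ConsC \<sigma> \<cdot> a \<cdot> x)) (ys @ zs))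
      (Apps (zs ! i) (map (\<lambda>j. Apps (LRecC \<sigma> \<rho>s j \<cdot> x) (ys @ zs)) [0..<length \<rho>s]) \<cdot> a))"
| seq_cases: "EHA_axiom \<Gamma> (Forall (TSeq \<sigma>)
    (Or (Eq (TSeq \<sigma>) (Var 0) (NilC \<sigma>))
        (Exists \<sigma> (Exists (TSeq \<sigma>) (Eq (TSeq \<sigma>) (Var 2) (ConsC \<sigma> \<cdot> Var 1 \<cdot> Var 0))))))"
| induction: "wf_int (TNat # \<Gamma>) A \<Longrightarrow>
    EHA_axiom \<Gamma> (Imp (And (fsub (inst ZeroC) A) (Forall TNat (Imp A (fsub succ_sub A))))
      (Forall TNat A))"

text \<open>The additional axioms of \<open>E-HA\<^sup>\<omega>\<^sup>*\<^sub>s\<^sub>t\<close>.\<close>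

inductive st_axiom :: "ctx \<Rightarrow> fm \<Rightarrow> bool" where
  forall_st: "wf_fm (\<sigma> # \<Gamma>) A \<Longrightarrow>
    st_axiom \<Gamma> (Iff (ForallSt \<sigma> A) (Forall \<sigma> (Imp (St \<sigma> (Var 0)) A)))"
| exists_st: "wf_fm (\<sigma> # \<Gamma>) A \<Longrightarrow>
    st_axiom \<Gamma> (Iff (ExistsSt \<sigma> A) (Exists \<sigma> (And (St \<sigma> (Var 0)) A)))"
| st_eq: "has_type \<Gamma> s \<sigma> \<Longrightarrow> has_type \<Gamma> t \<sigma> \<Longrightarrow>
    st_axiom \<Gamma> (Imp (And (St \<sigma> s) (Eq \<sigma> s t)) (St \<sigma> t))"
| st_closed: "has_type [] t \<sigma> \<Longrightarrow> st_axiom \<Gamma> (St \<sigma> t)"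
| st_app: "has_type \<Gamma> f (TFun \<sigma> \<tau>) \<Longrightarrow> has_type \<Gamma> t \<sigma> \<Longrightarrow>
    st_axiom \<Gamma> (Imp (And (St (TFun \<sigma> \<tau>) f) (St \<sigma> t)) (St \<tau> (f \<cdot> t)))"
| ext_induction: "wf_fm (TNat # \<Gamma>) A \<Longrightarrow>
    st_axiom \<Gamma> (Imp (And (fsub (inst ZeroC) A) (ForallSt TNat (Imp A (fsub succ_sub A))))
      (ForallSt TNat A))"

text \<open>In each principle \<open>skip k\<close> adapts a formula to the extra quantifier that the principle inserts
  outside the \<open>k\<close> innermost ones.\<close>

inductive idealization :: "ctx \<Rightarrow> fm \<Rightarrow> bool" where
  "wf_int (\<sigma> # \<tau> # \<Gamma>) A \<Longrightarrow> idealization \<Gamma>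
    (Imp (ForallSt (TSeq \<sigma>) (Exists \<tau> (ball_fm \<sigma> (Var 1) (fren (skip 2) A))))
         (Exists \<tau> (ForallSt \<sigma> A)))"

inductive NCR :: "ctx \<Rightarrow> fm \<Rightarrow> bool" where
  "wf_fm (\<sigma> # \<tau> # \<Gamma>) A \<Longrightarrow> NCR \<Gamma>
    (Imp (Forall \<tau> (ExistsSt \<sigma> A))
         (ExistsSt (TSeq \<sigma>) (Forall \<tau> (bex_fm \<sigma> (Var 1) (fren (skip 2) A)))))"

inductive HAC :: "ctx \<Rightarrow> fm \<Rightarrow> bool" where
  "wf_fm (\<tau> # \<sigma> # \<Gamma>) A \<Longrightarrow> HAC \<Gamma>
    (Imp (ForallSt \<sigma> (ExistsSt \<tau> A))
         (ExistsSt (TFun \<sigma> (TSeq \<tau>))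
           (ForallSt \<sigma> (bex_fm \<tau> (Var 1 \<cdot> Var 0) (fren (skip 2) A)))))"

inductive HIP :: "ctx \<Rightarrow> fm \<Rightarrow> bool" where
  "wf_int (\<sigma> # \<Gamma>) A \<Longrightarrow> wf_fm (\<tau> # \<Gamma>) B \<Longrightarrow> HIP \<Gamma>
    (Imp (Imp (ForallSt \<sigma> A) (ExistsSt \<tau> B))
         (ExistsSt (TSeq \<tau>)
           (Imp (ForallSt \<sigma> (fren (skip 1) A)) (bex_fm \<tau> (Var 0) (fren (skip 1) B)))))"

inductive HGMP :: "ctx \<Rightarrow> fm \<Rightarrow> bool" where
  "wf_int (\<sigma> # \<Gamma>) A \<Longrightarrow> wf_int \<Gamma> B \<Longrightarrow> HGMP \<Gamma>
    (Imp (Imp (ForallSt \<sigma> A) B)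
         (ExistsSt (TSeq \<sigma>) (Imp (ball_fm \<sigma> (Var 0) (fren (skip 1) A)) (fren Suc B))))"

definition internal_sentence :: "fm \<Rightarrow> bool" where
  "internal_sentence A \<longleftrightarrow> wf_int [] A"

text \<open>\<open>E-HA\<^sup>\<omega>\<^sup>* + \<Delta>\<close>: every formula occurring in a derivation is internal.\<close>

definition EHA_derives :: "fm set \<Rightarrow> ctx \<Rightarrow> fm \<Rightarrow> bool" where
  "EHA_derives \<Delta> = derives wf_int (\<lambda>\<Gamma> A. EHA_axiom \<Gamma> A \<or> A \<in> \<Delta>)"

text \<open>\<open>E-HA\<^sup>\<omega>\<^sup>*\<^sub>s\<^sub>t + I + NCR + HAC + HGMP + HIP + \<Delta>\<close>.\<close>

definition EHAst_plus_derives :: "fm set \<Rightarrow> ctx \<Rightarrow> fm \<Rightarrow> bool" where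
  "EHAst_plus_derives \<Delta> = derives wf_fm
     (\<lambda>\<Gamma> A. EHA_axiom \<Gamma> A \<or> st_axiom \<Gamma> A \<or> idealization \<Gamma> A \<or> NCR \<Gamma> A \<or> HAC \<Gamma> A \<or>
            HGMP \<Gamma> A \<or> HIP \<Gamma> A \<or> A \<in> \<Delta>)"

section \<open>The D-interpretation\<close>

text \<open>For \<open>\<Phi>\<^sup>D = \<exists>\<^sup>s\<^sup>tx \<forall>\<^sup>s\<^sup>ty \<phi>\<^sub>D(x,y,a)\<close>, all \<open>x\<close> have sequence types \<open>TSeq \<sigma>\<close> and \<open>D_elems \<Phi>\<close> lists
  these \<open>\<sigma>\<close>; \<open>D_univ \<Phi>\<close> lists the types of the \<open>y\<close>.\<close>

fun D_elems :: "fm \<Rightarrow> ty list" and D_univ :: "fm \<Rightarrow> ty list" where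
  "D_elems Bot = []"
| "D_elems (Eq \<sigma> s t) = []"
| "D_elems (St \<sigma> t) = [\<sigma>]"
| "D_elems (And A B) = D_elems A @ D_elems B"
| "D_elems (Or A B) = D_elems A @ D_elems B"
| "D_elems (Imp A B) =
     map (sapp_elem (map TSeq (D_elems A))) (D_elems B) @
     map (sapp_elem (map TSeq (D_elems A) @ D_univ B)) (D_univ A)"
| "D_elems (Forall \<sigma> A) = D_elems A"
| "D_elems (Exists \<sigma> A) = D_elems A"
| "D_elems (ForallSt \<sigma> A) = map (sapp_elem [\<sigma>]) (D_elems A)"
| "D_elems (ExistsSt \<sigma> A) = D_elems A @ [\<sigma>]"
| "D_univ Bot = []"
| "D_univ (Eq \<sigma> s t) = []"
| "D_univ (St \<sigma> t) = []"
| "D_univ (And A B) = D_univ A @ D_univ B"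
| "D_univ (Or A B) = D_univ A @ D_univ B"
| "D_univ (Imp A B) = map TSeq (D_elems A) @ D_univ B"
| "D_univ (Forall \<sigma> A) = D_univ A"
| "D_univ (Exists \<sigma> A) = map TSeq (D_univ A)"
| "D_univ (ForallSt \<sigma> A) = \<sigma> # D_univ A"
| "D_univ (ExistsSt \<sigma> A) = map TSeq (D_univ A)"

definition D_exist :: "fm \<Rightarrow> ty list" where
  "D_exist A = map TSeq (D_elems A)"

text \<open>\<open>D_matrix A \<rho> xs ys\<close> is \<open>\<phi>\<^sub>D(xs, ys, \<rho>(a))\<close>: the matrix for \<open>A\<close> with its two tuples of variables
  replaced by the terms \<open>xs\<close> and \<open>ys\<close> and its parameters by the terms \<open>\<rho> 0, \<rho> 1, \<dots>\<close>.\<close>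

primrec D_matrix :: "fm \<Rightarrow> (nat \<Rightarrow> tm) \<Rightarrow> tm list \<Rightarrow> tm list \<Rightarrow> fm" where
  "D_matrix Bot \<rho> xs ys = Bot"
| "D_matrix (Eq \<sigma> s t) \<rho> xs ys = Eq \<sigma> (sub \<rho> s) (sub \<rho> t)"
| "D_matrix (St \<sigma> t) \<rho> xs ys = mem_fm \<sigma> (sub \<rho> t) (hd xs)"
| "D_matrix (And A B) \<rho> xs ys =
     (let m = length (D_exist A); n = length (D_univ A) in
      And (D_matrix A \<rho> (take m xs) (take n ys)) (D_matrix B \<rho> (drop m xs) (drop n ys)))"
| "D_matrix (Or A B) \<rho> xs ys =
     (let m = length (D_exist A); n = length (D_univ A) in
      Or (D_matrix A \<rho> (take m xs) (take n ys)) (D_matrix B \<rho> (drop m xs) (drop n ys)))"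
| "D_matrix (Imp A B) \<rho> XS ys =
     (let Us = take (length (D_exist B)) XS; Ys = drop (length (D_exist B)) XS;
          xs = take (length (D_exist A)) ys; vs = drop (length (D_exist A)) ys;
          n = length (D_univ A)
      in Imp
        (balls_fm (D_univ A)
          (map2 (\<lambda>\<tau> Y. sapps (D_exist A @ D_univ B) \<tau> Y (xs @ vs)) (D_univ A) Ys)
          (D_matrix A (\<lambda>i. shift n (\<rho> i)) (map (shift n) xs) (vars n)))
        (D_matrix B \<rho> (map2 (\<lambda>\<tau> U. sapps (D_exist A) \<tau> U xs) (D_elems B) Us) vs))"
| "D_matrix (Forall \<sigma> A) \<rho> xs ys =
     Forall \<sigma> (D_matrix A (up \<rho>) (map (shift 1) xs) (map (shift 1) ys))"
| "D_matrix (Exists \<sigma> A) \<rho> xs ys =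
     (let n = length (D_univ A) in
      Exists \<sigma> (balls_fm (D_univ A) (map (shift 1) ys)
        (D_matrix A (\<lambda>i. shift n (up \<rho> i)) (map (shift (Suc n)) xs) (vars n))))"
| "D_matrix (ForallSt \<sigma> A) \<rho> XS zys =
     D_matrix A (case_nat (hd zys) \<rho>)
       (map2 (\<lambda>\<tau> X. sapps [\<sigma>] \<tau> X [hd zys]) (D_elems A) XS) (tl zys)"
| "D_matrix (ExistsSt \<sigma> A) \<rho> xzs ys =
     (let n = length (D_univ A) in
      bex_fm \<sigma> (last xzs) (balls_fm (D_univ A) (map (shift 1) ys)
        (D_matrix A (\<lambda>i. shift n (up \<rho> i)) (map (shift (Suc n)) (butlast xzs)) (vars n))))"

definition D_interp :: "fm \<Rightarrow> fm" where
  "D_interp A =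
     (let m = length (D_exist A); n = length (D_univ A) in
      ExistsSts (D_exist A) (ForallSts (D_univ A)
        (D_matrix A (\<lambda>i. Var (i + m + n)) (map (shift n) (vars m)) (vars n))))"

end

theory Submission
  imports Defs
begin

text \<open>Derivability is treated as forcing in a Kripke model whose worlds are contexts with a hypothesis.
  In that model a formula is valid if closed terms of its existential types make the matrix forced for all
  values of its universal variables, and validity is preserved along every derivation. Monotonicity of the
  matrix in these terms replaces the choice between disjuncts and between counterexamples by concatenation.\<close>

section \<open>Substitution\<close>

text \<open>Hilbert-style derivations are too unwieldy for the arithmetic of sequences, so
  introduction and elimination rules for forcing do the work of natural deduction. Three obstacles
  shape the realizers. The antecedent of an implication is assumed only for universal arguments
  taken from finite sequences, one per component of the tuple, and one empty sequence makes the
  whole assumption vacuous; default objects are added wherever one conjunct must be extracted. In a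
  syllogism the arguments at which the middle formula is needed are themselves known only up to
  membership, which calls for unions of \<open>s[a]\<close> over all members \<open>a\<close> of a
  sequence. Expanding a disjunction needs a law that pulls a fixed disjunct out of a bounded
  universal quantifier, and this rests on the finiteness of sequences. External induction is proved
  as a rule first, since under a hypothesis the counterexamples would have to be traced back through
  the whole recursion; the axiom is recovered in a second calculus of the same kind, whose axioms
  are all valid formulas.\<close>

lemma up_ren_simps [simp]: "up_ren r 0 = 0" "up_ren r (Suc n) = Suc (r n)"
  by (simp_all add: up_ren_def)

lemma up_simps [simp]: "up \<theta> 0 = Var 0" "up \<theta> (Suc n) = ren Suc (\<theta> n)"
  by (simp_all add: up_def)

lemma up_ren_comp: "up_ren r (up_ren s n) = up_ren (\<lambda>i. r (s i)) n"
  by (cases n) auto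

lemma up_ren_id: "up_ren (\<lambda>n. n) = (\<lambda>n. n)"
  by (rule ext) (simp add: up_ren_def split: nat.split)

lemma ren_id [simp]: "ren (\<lambda>n. n) t = t"
  by (induction t) (auto simp: up_ren_id)

lemma ren_ren [simp]: "ren r (ren s t) = ren (\<lambda>i. r (s i)) t"
  by (induction t arbitrary: r s) (auto simp: up_ren_comp)

lemma up_up_ren: "(\<lambda>i. up \<theta> (up_ren r i)) = up (\<lambda>i. \<theta> (r i))"
  by (rule ext) (simp add: up_ren_def up_def split: nat.split)

lemma sub_ren [simp]: "sub \<theta> (ren r t) = sub (\<lambda>i. \<theta> (r i)) t"
  by (induction t arbitrary: \<theta> r) (auto simp: up_up_ren)

lemma ren_up: "(\<lambda>i. ren (up_ren r) (up \<theta> i)) = up (\<lambda>i. ren r (\<theta> i))"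
  by (rule ext) (simp add: up_def split: nat.split)

lemma ren_sub: "ren r (sub \<theta> t) = sub (\<lambda>i. ren r (\<theta> i)) t"
  by (induction t arbitrary: \<theta> r) (auto simp: ren_up)

lemma sub_up_up: "(\<lambda>i. sub (up \<theta>) (up \<eta> i)) = up (\<lambda>i. sub \<theta> (\<eta> i))"
  by (rule ext) (simp add: up_def ren_sub split: nat.split)

lemma sub_sub [simp]: "sub \<theta> (sub \<eta> t) = sub (\<lambda>i. sub \<theta> (\<eta> i)) t"
  by (induction t arbitrary: \<theta> \<eta>) (auto simp: sub_up_up)

lemma up_Var [simp]: "up Var = Var"
  by (rule ext) (simp add: up_def split: nat.split)

lemma sub_Var [simp]: "sub Var t = t"
  by (induction t) auto

lemma ren_eq_sub: "ren r t = sub (\<lambda>i. Var (r i)) t"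
  by (metis sub_ren sub_Var)

lemma fren_id [simp]: "fren (\<lambda>n. n) A = A"
  by (induction A) (auto simp: up_ren_id)

lemma fren_fren [simp]: "fren r (fren s A) = fren (\<lambda>i. r (s i)) A"
  by (induction A arbitrary: r s) (auto simp: up_ren_comp)

lemma fsub_fren [simp]: "fsub \<theta> (fren r A) = fsub (\<lambda>i. \<theta> (r i)) A"
  by (induction A arbitrary: \<theta> r) (auto simp: up_up_ren)

lemma fsub_fsub [simp]: "fsub \<theta> (fsub \<eta> A) = fsub (\<lambda>i. sub \<theta> (\<eta> i)) A"
  by (induction A arbitrary: \<theta> \<eta>) (auto simp: sub_up_up)

lemma fsub_Var [simp]: "fsub Var A = A"
  by (induction A) auto

lemma fren_eq_fsub: "fren r A = fsub (\<lambda>i. Var (r i)) A"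
  by (metis fsub_fren fsub_Var)

lemma fren_fsub: "fren r (fsub \<theta> A) = fsub (\<lambda>i. ren r (\<theta> i)) A"
  by (simp add: fren_eq_fsub ren_eq_sub)

lemma sub_case_nat: "(\<lambda>i. sub \<theta> (case_nat a f i)) = case_nat (sub \<theta> a) (\<lambda>i. sub \<theta> (f i))"
  by (rule ext) (simp split: nat.split)

text \<open>Bound variables are handled below by environments rather than by shifting: opening a
  binder whose body has been substituted into then just adds a value at index 0.\<close>

lemma case_nat_up [simp]: "(\<lambda>i. sub (case_nat a \<eta>) (up \<theta> i)) = case_nat a (\<lambda>i. sub \<eta> (\<theta> i))"
  by (rule ext) (simp add: up_def split: nat.split)

lemma sub_inst_up [simp]: "sub (inst a) (sub (up \<theta>) t) = sub (case_nat a \<theta>) t"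
  by (simp add: case_nat_up)

lemma fsub_inst_up [simp]: "fsub (inst a) (fsub (up \<theta>) A) = fsub (case_nat a \<theta>) A"
  by (simp add: case_nat_up)

text \<open>The last entry of the list ends up at index 0. This matches \<open>vars\<close>, where
  the first component of a tuple is bound outermost and so has the largest index.\<close>

primrec envl :: "tm list \<Rightarrow> (nat \<Rightarrow> tm) \<Rightarrow> nat \<Rightarrow> tm" where
  "envl [] \<theta> = \<theta>"
| "envl (x # xs) \<theta> = envl xs (case_nat x \<theta>)"

lemma envl_append: "envl (xs @ ys) \<theta> = envl ys (envl xs \<theta>)"
  by (induction xs arbitrary: \<theta>) auto

lemma envl_add: "envl xs \<theta> (i + length xs) = \<theta> i"
proof (induction xs arbitrary: \<theta> i)
  case (Cons x xs)
  show ?case using Cons[of "case_nat x \<theta>" "Suc i"] by simp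
qed auto

lemma sub_envl_shift [simp]: "length xs = n \<Longrightarrow> sub (envl xs \<theta>) (shift n t) = sub \<theta> t"
  using envl_add[of xs \<theta>] by (simp del: One_nat_def)

lemma length_vars [simp]: "length (vars n) = n"
  by (simp add: vars_def)

lemma vars_Suc: "vars (Suc n) = Var n # vars n"
  by (simp add: vars_def)

lemma map_sub_envl_vars [simp]: "length xs = n \<Longrightarrow> map (sub (envl xs \<theta>)) (vars n) = xs"
proof (induction xs arbitrary: \<theta> n)
  case (Cons x xs)
  then obtain m where m: "n = Suc m" "length xs = m" by auto
  have "envl xs (case_nat x \<theta>) m = x"
    using envl_add[of xs "case_nat x \<theta>" 0] m by simp
  then show ?case using Cons m by (simp add: vars_Suc)
qed (simp add: vars_def)

text \<open>The n-fold lifting of a substitution. The extra \<open>up\<close> is applied to the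
  argument, so that induction over a block of binders can peel off the outermost one.\<close>

primrec ups :: "nat \<Rightarrow> (nat \<Rightarrow> tm) \<Rightarrow> nat \<Rightarrow> tm" where
  "ups 0 \<theta> = \<theta>"
| "ups (Suc n) \<theta> = ups n (up \<theta>)"

lemma ups_add [simp]: "ups n \<theta> (i + n) = shift n (\<theta> i)"
proof (induction n arbitrary: \<theta> i)
  case (Suc n)
  show ?case using Suc[of "up \<theta>" "Suc i"] by simp
qed simp

lemma ups_less: "i < n \<Longrightarrow> ups n \<theta> i = Var i"
proof (induction n arbitrary: i \<theta>)
  case (Suc n)
  then show ?case using ups_add[of n "up \<theta>" 0] by (cases "i = n") simp_all
qed simp

lemma map_sub_ups_vars [simp]: "map (sub (ups n \<theta>)) (vars n) = vars n"
  by (auto simp: vars_def ups_less)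

lemma sub_ups_shift [simp]: "sub (ups n \<theta>) (shift n t) = shift n (sub \<theta> t)"
  by (simp add: ren_sub)

lemma envl_ups: "length xs = n \<Longrightarrow> (\<lambda>i. sub (envl xs \<eta>) (ups n \<theta> i)) = envl xs (\<lambda>i. sub \<eta> (\<theta> i))"
proof (induction xs arbitrary: n \<eta> \<theta>)
  case (Cons x xs)
  then show ?case by (cases n) (auto simp: case_nat_up)
qed simp

section \<open>Typing\<close>

text \<open>Types are unique because abstractions and constants are annotated, so typing can be
  computed. With \<open>has_type_iff\<close> the simplifier settles most of the typing side
  conditions below.\<close>

primrec typeof :: "tm \<Rightarrow> ctx \<Rightarrow> ty option" where
  "typeof (Var n) \<Gamma> = (if n < length \<Gamma> then Some (\<Gamma> ! n) else None)"
| "typeof (Lam \<sigma> t) \<Gamma> = map_option (TFun \<sigma>) (typeof t (\<sigma> # \<Gamma>))"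
| "typeof (s \<cdot> t) \<Gamma> = (case typeof s \<Gamma> of
     Some (TFun \<sigma> \<tau>) \<Rightarrow> if typeof t \<Gamma> = Some \<sigma> then Some \<tau> else None | _ \<Rightarrow> None)"
| "typeof ZeroC \<Gamma> = Some TNat"
| "typeof SucC \<Gamma> = Some (TFun TNat TNat)"
| "typeof (RecC \<rho>s i) \<Gamma> = (if i < length \<rho>s then
     Some (TFun TNat (TFuns \<rho>s (TFuns (map (\<lambda>\<rho>. TFuns \<rho>s (TFun TNat \<rho>)) \<rho>s) (\<rho>s ! i)))) else None)"
| "typeof (NilC \<sigma>) \<Gamma> = Some (TSeq \<sigma>)"
| "typeof (ConsC \<sigma>) \<Gamma> = Some (TFun \<sigma> (TFun (TSeq \<sigma>) (TSeq \<sigma>)))"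
| "typeof (LRecC \<sigma> \<rho>s i) \<Gamma> = (if i < length \<rho>s then
     Some (TFun (TSeq \<sigma>) (TFuns \<rho>s (TFuns (map (\<lambda>\<rho>. TFuns \<rho>s (TFun \<sigma> \<rho>)) \<rho>s) (\<rho>s ! i)))) else None)"

lemma typeof_App_iff:
  "typeof (s \<cdot> t) \<Gamma> = Some \<tau> \<longleftrightarrow> (\<exists>\<sigma>. typeof s \<Gamma> = Some (TFun \<sigma> \<tau>) \<and> typeof t \<Gamma> = Some \<sigma>)"
  by (auto split: option.splits ty.splits)

lemma has_type_iff: "has_type \<Gamma> t \<tau> \<longleftrightarrow> typeof t \<Gamma> = Some \<tau>"
proof
  show "has_type \<Gamma> t \<tau> \<Longrightarrow> typeof t \<Gamma> = Some \<tau>"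
    by (induction rule: has_type.induct) auto
  show "typeof t \<Gamma> = Some \<tau> \<Longrightarrow> has_type \<Gamma> t \<tau>"
  proof (induction t arbitrary: \<Gamma> \<tau>)
    case (App s t)
    then show ?case unfolding typeof_App_iff by (blast intro: has_type.intros)
  qed (auto intro: has_type.intros split: if_splits)
qed

lemma have_types_iff: "have_types \<Gamma> ts \<sigma>s \<longleftrightarrow> map (\<lambda>t. typeof t \<Gamma>) ts = map Some \<sigma>s"
  unfolding have_types_def
  by (induction ts arbitrary: \<sigma>s) (auto simp: list_all2_Cons1 has_type_iff map_eq_Cons_conv)

text \<open>The first premise is an equivalence so that untypable terms stay untypable and both
  sides can be \<open>None\<close> together. Shifted terms can then be rewritten without knowing
  that they are typed.\<close>

lemma typeof_ren:
  assumes "\<And>n. n < length \<Gamma> \<longleftrightarrow> r n < length \<Gamma>'" "\<And>n. n < length \<Gamma> \<Longrightarrow> \<Gamma>' ! r n = \<Gamma> ! n"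
  shows "typeof (ren r t) \<Gamma>' = typeof t \<Gamma>"
  using assms
proof (induction t arbitrary: r \<Gamma> \<Gamma>')
  case (Lam \<sigma> t)
  have "typeof (ren (up_ren r) t) (\<sigma> # \<Gamma>') = typeof t (\<sigma> # \<Gamma>)"
    by (rule Lam.IH) (auto simp: up_ren_def Lam.prems nth_Cons split: nat.split)
  then show ?case by simp
next
  case (App s t)
  show ?case using App.IH[OF App.prems] by (simp split: option.split ty.split)
qed auto

lemma typeof_shift: "length \<Delta> = k \<Longrightarrow> typeof (shift k t) (\<Delta> @ \<Gamma>) = typeof t \<Gamma>"
  by (rule typeof_ren) (auto simp: nth_append)

lemma typeof_ren_Suc [simp]: "typeof (ren Suc t) (\<sigma> # \<Gamma>) = typeof t \<Gamma>"
  by (rule typeof_ren) auto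

lemma typeof_sub:
  assumes "typeof t \<Gamma> = Some \<tau>" "\<And>n. n < length \<Gamma> \<Longrightarrow> typeof (\<theta> n) \<Gamma>' = Some (\<Gamma> ! n)"
  shows "typeof (sub \<theta> t) \<Gamma>' = Some \<tau>"
  using assms
proof (induction t arbitrary: \<theta> \<Gamma> \<Gamma>' \<tau>)
  case (Lam \<sigma> t)
  then obtain \<tau>' where t: "\<tau> = TFun \<sigma> \<tau>'" "typeof t (\<sigma> # \<Gamma>) = Some \<tau>'" by auto
  have "typeof (sub (up \<theta>) t) (\<sigma> # \<Gamma>') = Some \<tau>'"
    by (rule Lam.IH[OF t(2)]) (auto simp: up_def Lam.prems nth_Cons split: nat.split)
  then show ?case by (simp add: t)
next
  case (App s t)
  then show ?case unfolding sub.simps typeof_App_iff by blast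
qed (auto split: if_splits)

lemma typeof_append: "typeof t \<Gamma> = Some \<tau> \<Longrightarrow> typeof t (\<Gamma> @ \<Gamma>') = Some \<tau>"
  using typeof_sub[of t \<Gamma> \<tau> Var "\<Gamma> @ \<Gamma>'"] by (simp add: nth_append)

lemma typeof_closed: "typeof t [] = Some \<tau> \<Longrightarrow> typeof t \<Gamma> = Some \<tau>"
  using typeof_append[of t "[]"] by simp

text \<open>Only variables of the context can occur in a typed term. For the empty context this
  shows that closed terms are fixed by every substitution, which keeps the extracted realizers
  unchanged when they are placed in other contexts.\<close>

lemma sub_cong:
  assumes "typeof t \<Gamma> = Some \<tau>" "\<And>n. n < length \<Gamma> \<Longrightarrow> \<theta> n = \<theta>' n"
  shows "sub \<theta> t = sub \<theta>' t"
  using assms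
proof (induction t arbitrary: \<theta> \<theta>' \<Gamma> \<tau>)
  case (Lam \<sigma> t)
  then obtain \<tau>' where t: "typeof t (\<sigma> # \<Gamma>) = Some \<tau>'" by auto
  have "sub (up \<theta>) t = sub (up \<theta>') t"
    by (rule Lam.IH[OF t]) (auto simp: up_def Lam.prems nth_Cons split: nat.split)
  then show ?case by simp
next
  case (App s t)
  then show ?case unfolding sub.simps typeof_App_iff by metis
qed (auto split: if_splits)

lemma sub_closed: "typeof t [] = Some \<tau> \<Longrightarrow> sub \<theta> t = t"
  using sub_cong[of t "[]" \<tau> \<theta> Var] by simp

lemma ren_closed: "typeof t [] = Some \<tau> \<Longrightarrow> ren r t = t"
  by (simp add: ren_eq_sub sub_closed)

lemma wf_fsub:
  assumes "wf_fm \<Gamma> A" "\<And>n. n < length \<Gamma> \<Longrightarrow> typeof (\<theta> n) \<Gamma>' = Some (\<Gamma> ! n)"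
  shows "wf_fm \<Gamma>' (fsub \<theta> A)"
proof -
  have up: "n < length (\<sigma> # \<Gamma>) \<Longrightarrow> typeof (up \<theta> n) (\<sigma> # \<Gamma>') = Some ((\<sigma> # \<Gamma>) ! n)"
    if "\<And>n. n < length \<Gamma> \<Longrightarrow> typeof (\<theta> n) \<Gamma>' = Some (\<Gamma> ! n)" for n \<sigma> \<theta> \<Gamma> \<Gamma>'
    using that by (auto simp: up_def nth_Cons split: nat.split)
  show ?thesis using assms
  proof (induction A arbitrary: \<theta> \<Gamma> \<Gamma>')
    case (Eq \<sigma> s t)
    then show ?case by (auto simp: has_type_iff intro: typeof_sub)
  next
    case (St \<sigma> t)
    then show ?case by (auto simp: has_type_iff intro: typeof_sub)
  next
    case (Forall \<sigma> A)
    show ?case using Forall.IH[of "\<sigma> # \<Gamma>" "up \<theta>" "\<sigma> # \<Gamma>'"] Forall.prems(1) up[OF Forall.prems(2)]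
      by auto
  next
    case (Exists \<sigma> A)
    show ?case using Exists.IH[of "\<sigma> # \<Gamma>" "up \<theta>" "\<sigma> # \<Gamma>'"] Exists.prems(1) up[OF Exists.prems(2)]
      by auto
  next
    case (ForallSt \<sigma> A)
    show ?case using ForallSt.IH[of "\<sigma> # \<Gamma>" "up \<theta>" "\<sigma> # \<Gamma>'"] ForallSt.prems(1) up[OF ForallSt.prems(2)]
      by auto
  next
    case (ExistsSt \<sigma> A)
    show ?case using ExistsSt.IH[of "\<sigma> # \<Gamma>" "up \<theta>" "\<sigma> # \<Gamma>'"] ExistsSt.prems(1) up[OF ExistsSt.prems(2)]
      by auto
  qed auto
qed

lemma internal_fsub [simp]: "internal (fsub \<theta> A) = internal A"
  by (induction A arbitrary: \<theta>) auto

lemma internal_fren [simp]: "internal (fren r A) = internal A"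
  by (simp add: fren_eq_fsub)

lemma wf_fren:
  assumes "\<And>n. n < length \<Gamma> \<longleftrightarrow> r n < length \<Gamma>'" "\<And>n. n < length \<Gamma> \<Longrightarrow> \<Gamma>' ! r n = \<Gamma> ! n"
  shows "wf_fm \<Gamma>' (fren r A) = wf_fm \<Gamma> A"
proof -
  have up: "n < length (\<sigma> # \<Gamma>) \<longleftrightarrow> up_ren r n < length (\<sigma> # \<Gamma>')"
       "n < length (\<sigma> # \<Gamma>) \<Longrightarrow> (\<sigma> # \<Gamma>') ! up_ren r n = (\<sigma> # \<Gamma>) ! n"
    if "\<And>n. n < length \<Gamma> \<longleftrightarrow> r n < length \<Gamma>'" "\<And>n. n < length \<Gamma> \<Longrightarrow> \<Gamma>' ! r n = \<Gamma> ! n"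
    for n \<sigma> r and \<Gamma> \<Gamma>' :: ctx
    using that by (auto simp: up_ren_def nth_Cons split: nat.split)
  show ?thesis using assms
  proof (induction A arbitrary: r \<Gamma> \<Gamma>')
    case (And A B)
    show ?case using And.IH(1)[of \<Gamma> r \<Gamma>', OF And.prems] And.IH(2)[of \<Gamma> r \<Gamma>', OF And.prems] by simp
  next
    case (Or A B)
    show ?case using Or.IH(1)[of \<Gamma> r \<Gamma>', OF Or.prems] Or.IH(2)[of \<Gamma> r \<Gamma>', OF Or.prems] by simp
  next
    case (Imp A B)
    show ?case using Imp.IH(1)[of \<Gamma> r \<Gamma>', OF Imp.prems] Imp.IH(2)[of \<Gamma> r \<Gamma>', OF Imp.prems] by simp
  next
    case (Forall \<sigma> A)
    show ?case using Forall.IH[of "\<sigma> # \<Gamma>" "up_ren r" "\<sigma> # \<Gamma>'"] up[OF Forall.prems] by auto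
  next
    case (Exists \<sigma> A)
    show ?case using Exists.IH[of "\<sigma> # \<Gamma>" "up_ren r" "\<sigma> # \<Gamma>'"] up[OF Exists.prems] by auto
  next
    case (ForallSt \<sigma> A)
    show ?case using ForallSt.IH[of "\<sigma> # \<Gamma>" "up_ren r" "\<sigma> # \<Gamma>'"] up[OF ForallSt.prems] by auto
  next
    case (ExistsSt \<sigma> A)
    show ?case using ExistsSt.IH[of "\<sigma> # \<Gamma>" "up_ren r" "\<sigma> # \<Gamma>'"] up[OF ExistsSt.prems] by auto
  next
    case (Eq \<sigma> s t)
    show ?case using typeof_ren[of \<Gamma> r \<Gamma>', OF Eq.prems] by (simp add: has_type_iff)
  next
    case (St \<sigma> t)
    show ?case using typeof_ren[of \<Gamma> r \<Gamma>', OF St.prems] by (simp add: has_type_iff)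
  qed simp
qed

lemma wf_fren_Suc [simp]: "wf_fm (\<sigma> # \<Gamma>) (fren Suc A) = wf_fm \<Gamma> A"
  by (rule wf_fren) auto

lemma wf_append: "wf_fm \<Gamma> A \<Longrightarrow> wf_fm (\<Gamma> @ \<Gamma>') A"
  using wf_fsub[of \<Gamma> A Var "\<Gamma> @ \<Gamma>'"] by (simp add: nth_append)

lemma fsub_cong:
  assumes "wf_fm \<Gamma> A" "\<And>n. n < length \<Gamma> \<Longrightarrow> \<theta> n = \<theta>' n"
  shows "fsub \<theta> A = fsub \<theta>' A"
proof -
  have up: "n < length (\<sigma> # \<Gamma>) \<Longrightarrow> up \<theta> n = up \<theta>' n"
    if "\<And>n. n < length \<Gamma> \<Longrightarrow> \<theta> n = \<theta>' n" for n \<sigma> \<theta> \<theta>' and \<Gamma> :: ctx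
    using that by (auto simp: up_def split: nat.split)
  show ?thesis using assms
  proof (induction A arbitrary: \<theta> \<theta>' \<Gamma>)
    case (Eq \<sigma> s t)
    then show ?case by (auto simp: has_type_iff intro: sub_cong)
  next
    case (St \<sigma> t)
    then show ?case by (auto simp: has_type_iff intro: sub_cong)
  next
    case (Forall \<sigma> A)
    show ?case using Forall.IH[of "\<sigma> # \<Gamma>" "up \<theta>" "up \<theta>'"] Forall.prems(1) up[OF Forall.prems(2)] by auto
  next
    case (Exists \<sigma> A)
    show ?case using Exists.IH[of "\<sigma> # \<Gamma>" "up \<theta>" "up \<theta>'"] Exists.prems(1) up[OF Exists.prems(2)] by auto
  next
    case (ForallSt \<sigma> A)
    show ?case using ForallSt.IH[of "\<sigma> # \<Gamma>" "up \<theta>" "up \<theta>'"] ForallSt.prems(1) up[OF ForallSt.prems(2)] by auto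
  next
    case (ExistsSt \<sigma> A)
    show ?case using ExistsSt.IH[of "\<sigma> # \<Gamma>" "up \<theta>" "up \<theta>'"] ExistsSt.prems(1) up[OF ExistsSt.prems(2)] by auto
  next
    case (And A B)
    show ?case using And.IH(1)[of \<Gamma> \<theta> \<theta>'] And.IH(2)[of \<Gamma> \<theta> \<theta>'] And.prems by simp
  next
    case (Or A B)
    show ?case using Or.IH(1)[of \<Gamma> \<theta> \<theta>'] Or.IH(2)[of \<Gamma> \<theta> \<theta>'] Or.prems by simp
  next
    case (Imp A B)
    show ?case using Imp.IH(1)[of \<Gamma> \<theta> \<theta>'] Imp.IH(2)[of \<Gamma> \<theta> \<theta>'] Imp.prems by simp
  qed simp
qed

lemma fsub_closed: "wf_fm [] A \<Longrightarrow> fsub \<theta> A = A"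
  using fsub_cong[of "[]" A \<theta> Var] by simp

section \<open>Derivability from a hypothesis, in the style of Kripke semantics\<close>

text \<open>A world is a context together with a hypothesis. Extending a world appends new variables at the
  end of its context; terms and formulas over the old context then stay literally the same, and no
  shifting is needed.\<close>

datatype world = World (cx: ctx) (hypothesis: fm)

text \<open>Abstracting from language and axioms allows two uses: the internal system, where
  matrices are forced, and a calculus over all formulas whose axioms are the valid ones, needed for
  external induction.\<close>

locale calculus =
  fixes L Ax :: "ctx \<Rightarrow> fm \<Rightarrow> bool"
  assumes L_cases: "L = wf_fm \<or> L = wf_int"
    and Ax_L: "Ax \<Gamma> A \<Longrightarrow> L \<Gamma> A"
    and Ax_append: "Ax \<Gamma> A \<Longrightarrow> Ax (\<Gamma> @ \<Gamma>') A"
begin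

lemma L_simps [simp]:
  "L \<Gamma> Bot" "L \<Gamma> (Eq \<sigma> s t) \<longleftrightarrow> typeof s \<Gamma> = Some \<sigma> \<and> typeof t \<Gamma> = Some \<sigma>"
  "L \<Gamma> (And A B) \<longleftrightarrow> L \<Gamma> A \<and> L \<Gamma> B" "L \<Gamma> (Or A B) \<longleftrightarrow> L \<Gamma> A \<and> L \<Gamma> B"
  "L \<Gamma> (Imp A B) \<longleftrightarrow> L \<Gamma> A \<and> L \<Gamma> B"
  "L \<Gamma> (Forall \<sigma> A) \<longleftrightarrow> L (\<sigma> # \<Gamma>) A" "L \<Gamma> (Exists \<sigma> A) \<longleftrightarrow> L (\<sigma> # \<Gamma>) A"
  "L (\<sigma> # \<Gamma>) (fren Suc A) \<longleftrightarrow> L \<Gamma> A"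
  using L_cases by (auto simp: wf_int_def has_type_iff)

lemma L_fsub:
  "L \<Gamma> A \<Longrightarrow> (\<And>n. n < length \<Gamma> \<Longrightarrow> typeof (\<theta> n) \<Gamma>' = Some (\<Gamma> ! n)) \<Longrightarrow> L \<Gamma>' (fsub \<theta> A)"
  using L_cases wf_fsub[of \<Gamma> A \<theta> \<Gamma>'] by (auto simp: wf_int_def)

lemma L_wf: "L \<Gamma> A \<Longrightarrow> wf_fm \<Gamma> A"
  using L_cases by (auto simp: wf_int_def)

lemma L_inst: "L (\<sigma> # \<Gamma>) A \<Longrightarrow> typeof t \<Gamma> = Some \<sigma> \<Longrightarrow> L \<Gamma> (fsub (inst t) A)"
  by (erule L_fsub) (auto simp: nth_Cons split: nat.split)

lemma L_append: "L \<Gamma> A \<Longrightarrow> L (\<Gamma> @ \<Gamma>') A"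
  using L_fsub[of \<Gamma> A Var "\<Gamma> @ \<Gamma>'"] by (simp add: nth_append)

abbreviation dv :: "ctx \<Rightarrow> fm \<Rightarrow> bool" where
  "dv \<equiv> derives L Ax"

lemma dv_L: "dv \<Gamma> A \<Longrightarrow> L \<Gamma> A"
  by (induction rule: derives.induct) (auto simp: Ax_L has_type_iff L_inst)

lemma dv_append: "dv \<Gamma> A \<Longrightarrow> dv (\<Gamma> @ \<Gamma>') A"
proof (induction rule: derives.induct)
  case (axiom \<Gamma> A)
  then show ?case by (simp add: Ax_append derives.axiom)
next
  case (forall_elim \<Gamma> \<sigma> A t)
  then show ?case using L_append[OF forall_elim(1)]
    by (intro derives.forall_elim) (auto simp: has_type_iff typeof_append)
next
  case (exists_intro \<Gamma> \<sigma> A t)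
  then show ?case using L_append[OF exists_intro(1)]
    by (intro derives.exists_intro) (auto simp: has_type_iff typeof_append)
next
  case (mp \<Gamma> A B)
  then show ?case by (blast intro: derives.mp)
next
  case (syll \<Gamma> A B C)
  then show ?case by (blast intro: derives.syll)
next
  case (forall_rule \<Gamma> B \<sigma> A)
  then show ?case using L_append[of \<Gamma> B] by (auto intro: derives.forall_rule)
next
  case (exists_rule \<Gamma> B \<sigma> A)
  then show ?case using L_append[of \<Gamma> B] by (auto intro: derives.exists_rule)
next
  case (or_expansion \<Gamma> C A B)
  then show ?case using L_append[of \<Gamma> C] by (auto intro: derives.or_expansion)
qed (auto intro: derives.intros L_append)

lemma dv_refl: "L \<Gamma> A \<Longrightarrow> dv \<Gamma> (Imp A A)"
  by (rule derives.syll[OF derives.and_contr derives.and_weak])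

lemma dv_const: "dv \<Gamma> B \<Longrightarrow> L \<Gamma> A \<Longrightarrow> dv \<Gamma> (Imp A B)"
  by (rule derives.mp[OF _ derives.exportation[OF derives.and_weak]]) (auto dest: dv_L)

text \<open>The rule \<open>forall_rule\<close> acts on implications only, so
  \<open>Imp Bot Bot\<close> is put in front as antecedent and removed again by modus
  ponens.\<close>

lemma dv_Forall: "dv (\<sigma> # \<Gamma>) A \<Longrightarrow> dv \<Gamma> (Forall \<sigma> A)"
proof -
  assume A: "dv (\<sigma> # \<Gamma>) A"
  have "dv (\<sigma> # \<Gamma>) (Imp (fren Suc (Imp Bot Bot)) A)"
    by (rule dv_const[OF A]) simp
  then have "dv \<Gamma> (Imp (Imp Bot Bot) (Forall \<sigma> A))"
    by (intro derives.forall_rule) auto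
  then show ?thesis using derives.mp[OF dv_refl[of \<Gamma> Bot]] by simp
qed

text \<open>No induction over derivations is used: closing off the variables one by one with
  \<open>dv_Forall\<close> and instantiating the quantifiers afterwards has the effect of the
  substitution. The induction is therefore on the context.\<close>

lemma dv_fsub:
  "dv \<Gamma> A \<Longrightarrow> (\<And>n. n < length \<Gamma> \<Longrightarrow> typeof (\<theta> n) \<Gamma>' = Some (\<Gamma> ! n)) \<Longrightarrow> dv \<Gamma>' (fsub \<theta> A)"
proof (induction \<Gamma> arbitrary: A \<theta>)
  case Nil
  then show ?case using dv_append[of "[]" A \<Gamma>'] dv_L[THEN L_wf] by (simp add: fsub_closed)
next
  case (Cons \<sigma> \<Gamma>)
  let ?\<eta> = "\<lambda>i. \<theta> (Suc i)"
  have "dv \<Gamma>' (fsub ?\<eta> (Forall \<sigma> A))"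
    by (rule Cons.IH[OF dv_Forall[OF Cons.prems(1)]]) (use Cons.prems(2) in force)
  moreover have "typeof (\<theta> 0) \<Gamma>' = Some \<sigma>"
    using Cons.prems(2)[of 0] by simp
  ultimately have "dv \<Gamma>' (fsub (inst (\<theta> 0)) (fsub (up ?\<eta>) A))"
    by (intro derives.mp[OF _ derives.forall_elim]) (auto dest: dv_L simp: has_type_iff simp del: fsub_fsub)
  moreover have "case_nat (\<theta> 0) ?\<eta> = \<theta>"
    by (rule ext) (simp split: nat.split)
  ultimately show ?case by simp
qed

text \<open>An ill-formed hypothesis is read as \<open>Bot\<close>, so that every world is meaningful.\<close>

definition hy :: "world \<Rightarrow> fm" where
  "hy w = (if L (cx w) (hypothesis w) then hypothesis w else Bot)"

definition pv :: "world \<Rightarrow> fm \<Rightarrow> bool" where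
  "pv w A \<longleftrightarrow> dv (cx w) (Imp (hy w) A)"

definition ext :: "world \<Rightarrow> world \<Rightarrow> bool" where
  "ext w w' \<longleftrightarrow> (\<exists>\<Gamma>. cx w' = cx w @ \<Gamma>) \<and> pv w' (hy w)"

lemma L_hy [simp]: "L (cx w) (hy w)"
  by (simp add: hy_def)

lemma pv_L: "pv w A \<Longrightarrow> L (cx w) A"
  unfolding pv_def by (auto dest: dv_L)

lemma pv_dv: "dv (cx w) A \<Longrightarrow> pv w A"
  unfolding pv_def by (rule dv_const) auto

lemma pv_mono: "pv w A \<Longrightarrow> ext w w' \<Longrightarrow> pv w' A"
  unfolding pv_def ext_def by (metis derives.syll dv_append)

lemma ty_mono: "typeof t (cx w) = Some \<sigma> \<Longrightarrow> ext w w' \<Longrightarrow> typeof t (cx w') = Some \<sigma>"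
  unfolding ext_def by (auto simp: typeof_append)

lemma L_mono: "L (cx w) A \<Longrightarrow> ext w w' \<Longrightarrow> L (cx w') A"
  unfolding ext_def by (auto simp: L_append)

lemma ext_refl [simp]: "ext w w"
  unfolding ext_def pv_def by (auto intro: dv_refl)

lemma ext_trans: "ext w w' \<Longrightarrow> ext w' w'' \<Longrightarrow> ext w w''"
  using pv_mono[of w' "hy w" w''] unfolding ext_def by auto

text \<open>Exporting the identity on \<open>And A B\<close> gives
  \<open>A \<rightarrow> B \<rightarrow> A \<and> B\<close>; composing with both premises leaves the
  hypothesis twice in front, and \<open>and_contr\<close> merges the two copies.\<close>

lemma pv_AndI: "pv w A \<Longrightarrow> pv w B \<Longrightarrow> pv w (And A B)"
proof -
  assume A: "pv w A" and B: "pv w B"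
  note L = A[THEN pv_L] B[THEN pv_L]
  let ?G = "cx w" and ?h = "hy w"
  have "dv ?G (Imp ?h (Imp B (And A B)))"
    using A unfolding pv_def by (rule derives.syll) (rule derives.exportation[OF dv_refl], use L in auto)
  then have "dv ?G (Imp B (Imp ?h (And A B)))"
    by (intro derives.exportation) (rule derives.syll[OF derives.and_perm], use L in \<open>auto dest: derives.importation\<close>)
  then have "dv ?G (Imp ?h (Imp ?h (And A B)))"
    using B unfolding pv_def by (blast intro: derives.syll)
  then show ?thesis
    unfolding pv_def by (blast intro: derives.syll[OF derives.and_contr] derives.importation L_hy)
qed

lemma pv_AndD1: "pv w (And A B) \<Longrightarrow> pv w A"
  using pv_L[of w "And A B"] unfolding pv_def by (auto intro: derives.syll[OF _ derives.and_weak])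

lemma pv_AndD2: "pv w (And A B) \<Longrightarrow> pv w B"
  using pv_L[of w "And A B"] unfolding pv_def
  by (auto intro: derives.syll[OF _ derives.syll[OF derives.and_perm derives.and_weak]])

lemma pv_ImpD: "pv w (Imp A B) \<Longrightarrow> pv w A \<Longrightarrow> pv w B"
proof -
  assume AB: "pv w (Imp A B)" and A: "pv w A"
  have "dv (cx w) (Imp (And (Imp A B) A) B)"
    using pv_L[OF AB] by (intro derives.importation dv_refl) auto
  then show ?thesis using pv_AndI[OF AB A] unfolding pv_def by (blast intro: derives.syll)
qed

lemma ext_hyp: "L (cx w) A \<Longrightarrow> ext w (World (cx w @ \<Gamma>) (And (hy w) A))"
  and hyp_pv: "L (cx w) A \<Longrightarrow> pv (World (cx w @ \<Gamma>) (And (hy w) A)) A"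
proof -
  assume A: "L (cx w) A"
  let ?w = "(World (cx w @ \<Gamma>) (And (hy w) A))"
  have "pv ?w (hy ?w)"
    unfolding pv_def using L_hy[of ?w] by (intro dv_refl)
  moreover have "hy ?w = And (hy w) A"
    using A by (simp add: hy_def L_append)
  ultimately have "pv ?w (And (hy w) A)" by simp
  then show "ext w ?w" "pv ?w A"
    by (auto simp: ext_def dest: pv_AndD1 pv_AndD2)
qed

text \<open>This takes the place of a deduction theorem. Of all the worlds in the premise only one
  is used, the world in which \<open>A\<close> has been added to the hypothesis by conjunction, and
  exportation turns derivability there into the implication.\<close>

lemma pv_ImpI:
  assumes A: "L (cx w) A" and B: "\<And>w'. ext w w' \<Longrightarrow> pv w' A \<Longrightarrow> pv w' B"
  shows "pv w (Imp A B)"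
proof -
  have "pv (World (cx w) (And (hy w) A)) B"
    using B ext_hyp[OF A, of "[]"] hyp_pv[OF A, of "[]"] by simp
  then show ?thesis using A
    unfolding pv_def by (auto simp: hy_def[of "World _ (And _ _)"] intro: derives.exportation)
qed

lemma ext_new: "ext w (World (cx w @ [\<sigma>]) (hy w))"
proof -
  have "hy (World (cx w @ [\<sigma>]) (hy w)) = hy w"
    by (simp add: hy_def[of "World (_ @ _) _"] L_append)
  then show ?thesis
    unfolding ext_def pv_def using L_append[of "cx w" "hy w" "[\<sigma>]"] by (auto intro: dv_refl)
qed

text \<open>The premise is used once, at a world with a fresh variable appended at the end of the
  context. A renaming then rotates that variable to index 0, where \<open>forall_rule\<close>
  expects it.\<close>

lemma pv_ForallI:
  assumes A: "L (\<sigma> # cx w) A"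
    and B: "\<And>w' t. ext w w' \<Longrightarrow> typeof t (cx w') = Some \<sigma> \<Longrightarrow> pv w' (fsub (inst t) A)"
  shows "pv w (Forall \<sigma> A)"
proof -
  let ?n = "length (cx w)" and ?w = "(World (cx w @ [\<sigma>]) (hy w))"
  let ?\<theta> = "\<lambda>i. if i < ?n then Var (Suc i) else Var 0"
  have hy: "hy ?w = hy w"
    by (simp add: hy_def[of "World (_ @ _) _"] L_append)
  have "pv ?w (fsub (inst (Var ?n)) A)"
    using B[OF ext_new, of "Var ?n"] by simp
  then have "dv (cx w @ [\<sigma>]) (Imp (hy w) (fsub (inst (Var ?n)) A))"
    unfolding pv_def hy by simp
  then have "dv (\<sigma> # cx w) (fsub ?\<theta> (Imp (hy w) (fsub (inst (Var ?n)) A)))"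
    by (rule dv_fsub) (auto simp: nth_append less_Suc_eq)
  moreover have "fsub ?\<theta> (hy w) = fren Suc (hy w)"
    unfolding fren_eq_fsub by (rule fsub_cong[of "cx w"]) (auto simp: L_wf)
  moreover have "fsub (\<lambda>i. sub ?\<theta> (inst (Var ?n) i)) A = fsub Var A"
    by (rule fsub_cong[OF L_wf[OF A]]) (auto simp: nth_Cons split: nat.split)
  ultimately show ?thesis
    unfolding pv_def by (intro derives.forall_rule) auto
qed

lemma pv_ForallD: "pv w (Forall \<sigma> A) \<Longrightarrow> typeof t (cx w) = Some \<sigma> \<Longrightarrow> pv w (fsub (inst t) A)"
  using pv_L[of w "Forall \<sigma> A"] unfolding pv_def
  by (auto intro: derives.syll[OF _ derives.forall_elim] simp: has_type_iff)

lemma pv_ExistsI: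
  "L (\<sigma> # cx w) A \<Longrightarrow> typeof t (cx w) = Some \<sigma> \<Longrightarrow> pv w (fsub (inst t) A) \<Longrightarrow> pv w (Exists \<sigma> A)"
  unfolding pv_def by (auto intro: derives.syll[OF _ derives.exists_intro] simp: has_type_iff)

text \<open>The premise about witnesses is first collected in the universal formula
  \<open>Forall \<sigma> (Imp A (fren Suc C))\<close>, since \<open>pv_ForallI\<close> already deals
  with fresh variables. Reading it at \<open>Var 0\<close> in the extended context and exchanging
  the two antecedents produces the premise of \<open>exists_rule\<close>.\<close>

lemma pv_ExistsE:
  assumes E: "pv w (Exists \<sigma> A)" and C: "L (cx w) C"
    and B: "\<And>w' t. ext w w' \<Longrightarrow> typeof t (cx w') = Some \<sigma> \<Longrightarrow> pv w' (fsub (inst t) A) \<Longrightarrow> pv w' C"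
  shows "pv w C"
proof -
  note A = pv_L[OF E, simplified]
  have "pv w (Forall \<sigma> (Imp A (fren Suc C)))"
  proof (rule pv_ForallI)
    fix w' t assume w': "ext w w'" and t: "typeof t (cx w') = Some \<sigma>"
    obtain \<Gamma> where \<Gamma>: "cx w' = cx w @ \<Gamma>" using w' unfolding ext_def by auto
    have "pv w' (Imp (fsub (inst t) A) C)"
    proof (rule pv_ImpI)
      show "L (cx w') (fsub (inst t) A)"
        using L_append[OF A, of \<Gamma>] t \<Gamma> by (intro L_inst) auto
    next
      fix w'' assume w'': "ext w' w''" and "pv w'' (fsub (inst t) A)"
      then show "pv w'' C" using B[of w'' t] ext_trans[OF w' w''] ty_mono[OF t w''] by simp
    qed
    then show "pv w' (fsub (inst t) (Imp A (fren Suc C)))" by simp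
  qed (use A C in auto)
  then have "dv (cx w) (Imp (hy w) (Forall \<sigma> (Imp A (fren Suc C))))"
    by (simp add: pv_def)
  then have "dv (\<sigma> # cx w) (fsub (\<lambda>i. Var (Suc i)) (Imp (hy w) (Forall \<sigma> (Imp A (fren Suc C)))))"
    by (rule dv_fsub) auto
  from this[unfolded fren_eq_fsub[symmetric]]
  have 1: "dv (\<sigma> # cx w) (Imp (fren Suc (hy w)) (fren Suc (Forall \<sigma> (Imp A (fren Suc C)))))"
    by simp
  have "L (\<sigma> # cx w) (fren Suc (Forall \<sigma> (Imp A (fren Suc C))))"
    using A C by (subst L_simps) simp
  then have "dv (\<sigma> # cx w) (Imp (fren Suc (Forall \<sigma> (Imp A (fren Suc C))))
      (fsub (inst (Var 0)) (fren (up_ren Suc) (Imp A (fren Suc C)))))"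
    unfolding fren.simps by (rule derives.forall_elim) (simp add: has_type_iff)
  moreover have "fsub (inst (Var 0)) (fren (up_ren Suc) (Imp A (fren Suc C))) = Imp A (fren Suc C)"
  proof -
    have "(\<lambda>i. inst (Var 0) (up_ren Suc i)) = Var"
      by (rule HOL.ext) (simp add: up_ren_def split: nat.split)
    then show ?thesis by (simp add: fren_eq_fsub)
  qed
  ultimately have "dv (\<sigma> # cx w) (Imp (fren Suc (hy w)) (Imp A (fren Suc C)))"
    using 1 by (metis derives.syll)
  then have "dv (\<sigma> # cx w) (Imp A (fren Suc (Imp (hy w) C)))"
    using A by (auto intro!: derives.exportation intro: derives.syll[OF derives.and_perm] derives.importation)
  then have "dv (cx w) (Imp (Exists \<sigma> A) (Imp (hy w) C))"
    using C by (intro derives.exists_rule) auto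
  then have "pv w (Imp (hy w) C)"
    using E unfolding pv_def by (blast intro: derives.syll)
  moreover have "pv w (hy w)"
    by (simp add: pv_def dv_refl)
  ultimately show ?thesis by (rule pv_ImpD)
qed

lemma pv_OrI1: "pv w A \<Longrightarrow> L (cx w) B \<Longrightarrow> pv w (Or A B)"
  using pv_L[of w A] unfolding pv_def by (auto intro: derives.syll[OF _ derives.or_weak])

lemma pv_OrI2: "pv w B \<Longrightarrow> L (cx w) A \<Longrightarrow> pv w (Or A B)"
  using pv_L[of w B] unfolding pv_def
  by (auto intro: derives.syll[OF _ derives.syll[OF derives.or_weak derives.or_perm]])

text \<open>The calculus offers no elimination rule for disjunction. Both disjuncts are replaced by
  \<open>?D\<close> with \<open>or_expansion\<close>, using \<open>or_perm\<close> in between, and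
  \<open>or_contr\<close> merges them. The hypothesis of the world is built into \<open>?D\<close>
  because \<open>or_expansion\<close> applies only to implications derivable outright.\<close>

lemma pv_OrE:
  assumes AB: "pv w (Or A B)" and C: "L (cx w) C"
    and 1: "\<And>w'. ext w w' \<Longrightarrow> pv w' A \<Longrightarrow> pv w' C"
    and 2: "\<And>w'. ext w w' \<Longrightarrow> pv w' B \<Longrightarrow> pv w' C"
  shows "pv w C"
proof -
  let ?D = "Imp (hy w) C"
  have swap: "dv (cx w) (Imp X ?D)" if "pv w (Imp X C)" for X
    using that pv_L[OF that] unfolding pv_def
    by (auto intro!: derives.exportation intro: derives.syll[OF derives.and_perm] derives.importation)
  have L: "L (cx w) A" "L (cx w) B" "L (cx w) ?D"
    using pv_L[OF AB] C by auto
  have A: "dv (cx w) (Imp A ?D)" and B: "dv (cx w) (Imp B ?D)"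
    by (rule swap, rule pv_ImpI, use L 1 2 in auto)+
  have "dv (cx w) (Imp (Or A B) (Or A ?D))"
    by (rule derives.or_expansion[OF L(1) B])
  moreover have "dv (cx w) (Imp (Or A ?D) (Or ?D A))"
    by (rule derives.or_perm) (use L in auto)
  moreover have "dv (cx w) (Imp (Or ?D A) (Or ?D ?D))"
    by (rule derives.or_expansion[OF L(3) A])
  moreover have "dv (cx w) (Imp (Or ?D ?D) ?D)"
    by (rule derives.or_contr) (fact L(3))
  ultimately have "dv (cx w) (Imp (Or A B) ?D)"
    by (metis derives.syll)
  then have "pv w ?D"
    using AB unfolding pv_def by (blast intro: derives.syll)
  moreover have "pv w (hy w)"
    by (simp add: pv_def dv_refl)
  ultimately show ?thesis by (rule pv_ImpD)
qed

lemma pv_BotE: "pv w Bot \<Longrightarrow> L (cx w) C \<Longrightarrow> pv w C"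
  unfolding pv_def by (blast intro: derives.syll derives.ex_falso)

lemma pv_ax: "Ax (cx w) A \<Longrightarrow> pv w A"
  by (rule pv_dv) (rule derives.axiom)

lemma dv_iff_pv: "dv \<Gamma> A \<longleftrightarrow> pv (World \<Gamma> (Imp Bot Bot)) A"
proof
  assume "pv (World \<Gamma> (Imp Bot Bot)) A"
  then have "dv \<Gamma> (Imp (Imp Bot Bot) A)" by (simp add: pv_def hy_def)
  then show "dv \<Gamma> A" using derives.mp[OF dv_refl[of \<Gamma> Bot]] by simp
qed (simp add: pv_dv)

end

section \<open>Typing and substitution for the defined terms and formulas\<close>

lemma default_simps [simp]:
  "typeof (default_tm \<sigma>) \<Gamma> = Some \<sigma>" "sub \<theta> (default_tm \<sigma>) = default_tm \<sigma>"
proof -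
  show "typeof (default_tm \<sigma>) \<Gamma> = Some \<sigma>" for \<Gamma>
    by (induction \<sigma> arbitrary: \<Gamma>) auto
  then show "sub \<theta> (default_tm \<sigma>) = default_tm \<sigma>"
    by (rule sub_closed)
qed

lemma typeof_consts [simp]:
  "typeof plusC \<Gamma> = Some (TFun TNat (TFun TNat TNat))"
  "typeof (lenC \<sigma>) \<Gamma> = Some (TFun (TSeq \<sigma>) TNat)"
  "typeof (projC \<sigma>) \<Gamma> = Some (TFun (TSeq \<sigma>) (TFun TNat \<sigma>))"
  "typeof (appendC \<sigma>) \<Gamma> = Some (TFun (TSeq \<sigma>) (TFun (TSeq \<sigma>) (TSeq \<sigma>)))"
  by (simp_all add: plusC_def lenC_def projC_def appendC_def)

lemma typeof_sappC [simp]: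
  "typeof (sappC \<sigma> \<tau>) \<Gamma> = Some (TFun (TSeq (TFun \<sigma> (TSeq \<tau>))) (TFun \<sigma> (TSeq \<tau>)))"
  by (simp add: sappC_def Let_def)

lemma sub_consts [simp]:
  "sub \<theta> plusC = plusC" "sub \<theta> (lenC \<sigma>) = lenC \<sigma>" "sub \<theta> (projC \<sigma>) = projC \<sigma>"
  "sub \<theta> (appendC \<sigma>) = appendC \<sigma>" "sub \<theta> (sappC \<sigma> \<tau>) = sappC \<sigma> \<tau>"
  by (rule sub_closed, simp)+

lemma ren_consts [simp]:
  "ren r (default_tm \<sigma>) = default_tm \<sigma>"
  "ren r plusC = plusC" "ren r (lenC \<sigma>) = lenC \<sigma>" "ren r (projC \<sigma>) = projC \<sigma>"
  "ren r (appendC \<sigma>) = appendC \<sigma>" "ren r (sappC \<sigma> \<tau>) = sappC \<sigma> \<tau>"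
  by (simp_all add: ren_eq_sub)

lemma fsub_less_fm [simp]: "fsub \<theta> (less_fm s t) = less_fm (sub \<theta> s) (sub \<theta> t)"
  by (simp add: less_fm_def ren_sub)

lemma fsub_mem_fm [simp]: "fsub \<theta> (mem_fm \<sigma> s t) = mem_fm \<sigma> (sub \<theta> s) (sub \<theta> t)"
  by (simp add: mem_fm_def ren_sub)

lemma fsub_ball_fm [simp]: "fsub \<theta> (ball_fm \<sigma> t A) = ball_fm \<sigma> (sub \<theta> t) (fsub (up \<theta>) A)"
  by (simp add: ball_fm_def ren_sub)

lemma fsub_bex_fm [simp]: "fsub \<theta> (bex_fm \<sigma> t A) = bex_fm \<sigma> (sub \<theta> t) (fsub (up \<theta>) A)"
  by (simp add: bex_fm_def ren_sub)

lemma fsub_balls_fm [simp]: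
  "length ts = length \<sigma>s \<Longrightarrow>
    fsub \<theta> (balls_fm \<sigma>s ts A) = balls_fm \<sigma>s (map (sub \<theta>) ts) (fsub (ups (length \<sigma>s) \<theta>) A)"
proof (induction \<sigma>s arbitrary: ts \<theta>)
  case (Cons \<sigma> \<sigma>s)
  then show ?case by (cases ts) (auto simp: ren_sub comp_def)
qed auto

lemma wf_int_simps:
  "wf_int \<Gamma> Bot" "wf_int \<Gamma> (Eq \<sigma> s t) \<longleftrightarrow> typeof s \<Gamma> = Some \<sigma> \<and> typeof t \<Gamma> = Some \<sigma>"
  "wf_int \<Gamma> (And A B) \<longleftrightarrow> wf_int \<Gamma> A \<and> wf_int \<Gamma> B" "wf_int \<Gamma> (Or A B) \<longleftrightarrow> wf_int \<Gamma> A \<and> wf_int \<Gamma> B"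
  "wf_int \<Gamma> (Imp A B) \<longleftrightarrow> wf_int \<Gamma> A \<and> wf_int \<Gamma> B"
  "wf_int \<Gamma> (Forall \<sigma> A) \<longleftrightarrow> wf_int (\<sigma> # \<Gamma>) A" "wf_int \<Gamma> (Exists \<sigma> A) \<longleftrightarrow> wf_int (\<sigma> # \<Gamma>) A"
  "wf_int (\<sigma> # \<Gamma>) (fren Suc A) \<longleftrightarrow> wf_int \<Gamma> A"
  by (auto simp: wf_int_def has_type_iff)

lemma wf_int_less_fm [simp]:
  "wf_int \<Gamma> (less_fm s t) \<longleftrightarrow> typeof s \<Gamma> = Some TNat \<and> typeof t \<Gamma> = Some TNat"
  by (auto simp: less_fm_def wf_int_simps typeof_App_iff simp del: typeof.simps(3))

lemma wf_int_mem_fm [simp]: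
  "wf_int \<Gamma> (mem_fm \<sigma> s t) \<longleftrightarrow> typeof s \<Gamma> = Some \<sigma> \<and> typeof t \<Gamma> = Some (TSeq \<sigma>)"
  by (auto simp: mem_fm_def wf_int_simps typeof_App_iff simp del: typeof.simps(3))

lemma wf_int_ball_fm [simp]:
  "wf_int \<Gamma> (ball_fm \<sigma> t A) \<longleftrightarrow> typeof t \<Gamma> = Some (TSeq \<sigma>) \<and> wf_int (\<sigma> # \<Gamma>) A"
  by (auto simp: ball_fm_def wf_int_simps)

lemma wf_int_bex_fm [simp]:
  "wf_int \<Gamma> (bex_fm \<sigma> t A) \<longleftrightarrow> typeof t \<Gamma> = Some (TSeq \<sigma>) \<and> wf_int (\<sigma> # \<Gamma>) A"
  by (auto simp: bex_fm_def wf_int_simps)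

lemma wf_int_balls_fm:
  "map (\<lambda>t. typeof t \<Gamma>) ts = map (\<lambda>\<sigma>. Some (TSeq \<sigma>)) \<sigma>s \<Longrightarrow>
    wf_int \<Gamma> (balls_fm \<sigma>s ts A) \<longleftrightarrow> wf_int (rev \<sigma>s @ \<Gamma>) A"
proof (induction \<sigma>s arbitrary: ts \<Gamma>)
  case (Cons \<sigma> \<sigma>s)
  then obtain t ts' where ts: "ts = t # ts'" "typeof t \<Gamma> = Some (TSeq \<sigma>)"
    "map (\<lambda>t. typeof t \<Gamma>) ts' = map (\<lambda>\<sigma>. Some (TSeq \<sigma>)) \<sigma>s"
    by (auto simp: map_eq_Cons_conv)
  then show ?case using Cons.IH[of "\<sigma> # \<Gamma>" "map (shift 1) ts'"] by (simp add: comp_def)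
qed simp

section \<open>Equality in extensional arithmetic\<close>

lemma typeof_Apps:
  "typeof f \<Gamma> = Some (TFuns \<sigma>s \<tau>) \<Longrightarrow> map (\<lambda>t. typeof t \<Gamma>) ts = map Some \<sigma>s \<Longrightarrow>
    typeof (Apps f ts) \<Gamma> = Some \<tau>"
proof (induction ts arbitrary: f \<sigma>s)
  case (Cons t ts)
  then obtain \<sigma> \<sigma>s' where \<sigma>s: "\<sigma>s = \<sigma> # \<sigma>s'" by (cases \<sigma>s) simp_all
  show ?case using Cons.IH[of "f \<cdot> t" \<sigma>s'] Cons.prems by (simp add: \<sigma>s)
qed simp

lemma have_types_nth: "have_types \<Gamma> ts \<sigma>s \<Longrightarrow> i < length \<sigma>s \<Longrightarrow> typeof (ts ! i) \<Gamma> = Some (\<sigma>s ! i)"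
  unfolding have_types_def has_type_iff[symmetric] by (simp add: list_all2_conv_all_nth)

lemma EHA_axiom_wf: "EHA_axiom \<Gamma> A \<Longrightarrow> wf_int \<Gamma> A"
proof (induction rule: EHA_axiom.induct)
  case (rec_zero i \<rho>s \<Gamma> ys zs)
  then have "typeof (ys ! i) \<Gamma> = Some (\<rho>s ! i)"
    by (simp add: have_types_nth)
  moreover have "typeof (Apps (RecC \<rho>s i \<cdot> ZeroC) (ys @ zs)) \<Gamma> = Some (\<rho>s ! i)"
    by (rule typeof_Apps[where \<sigma>s = "\<rho>s @ map (\<lambda>\<rho>. TFuns \<rho>s (TFun TNat \<rho>)) \<rho>s"])
      (use rec_zero in \<open>auto simp: have_types_iff\<close>)
  ultimately show ?case by (simp add: wf_int_simps)
next
  case (rec_suc i \<rho>s \<Gamma> ys zs n)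
  have R: "typeof (Apps (RecC \<rho>s j \<cdot> m) (ys @ zs)) \<Gamma> = Some (\<rho>s ! j)"
    if "typeof m \<Gamma> = Some TNat" "j < length \<rho>s" for j m
    by (rule typeof_Apps[where \<sigma>s = "\<rho>s @ map (\<lambda>\<rho>. TFuns \<rho>s (TFun TNat \<rho>)) \<rho>s"])
      (use that rec_suc in \<open>auto simp: have_types_iff\<close>)
  have "typeof (zs ! i) \<Gamma> = Some (TFuns \<rho>s (TFun TNat (\<rho>s ! i)))"
    using rec_suc(1) have_types_nth[OF rec_suc(3), of i] by simp
  then have "typeof (Apps (zs ! i) (map (\<lambda>j. Apps (RecC \<rho>s j \<cdot> n) (ys @ zs)) [0..<length \<rho>s])) \<Gamma>
      = Some (TFun TNat (\<rho>s ! i))"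
    by (rule typeof_Apps) (use R rec_suc(4) in \<open>auto simp: has_type_iff intro!: nth_equalityI\<close>)
  then show ?case using R[of "SucC \<cdot> n" i] rec_suc(1,4) by (simp add: wf_int_simps has_type_iff)
next
  case (lrec_nil i \<rho>s \<Gamma> ys zs \<sigma>)
  then have "typeof (ys ! i) \<Gamma> = Some (\<rho>s ! i)"
    by (simp add: have_types_nth)
  moreover have "typeof (Apps (LRecC \<sigma> \<rho>s i \<cdot> NilC \<sigma>) (ys @ zs)) \<Gamma> = Some (\<rho>s ! i)"
    by (rule typeof_Apps[where \<sigma>s = "\<rho>s @ map (\<lambda>\<rho>. TFuns \<rho>s (TFun \<sigma> \<rho>)) \<rho>s"])
      (use lrec_nil in \<open>auto simp: have_types_iff\<close>)
  ultimately show ?case by (simp add: wf_int_simps)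
next
  case (lrec_cons i \<rho>s \<Gamma> ys zs \<sigma> a x)
  have R: "typeof (Apps (LRecC \<sigma> \<rho>s j \<cdot> m) (ys @ zs)) \<Gamma> = Some (\<rho>s ! j)"
    if "typeof m \<Gamma> = Some (TSeq \<sigma>)" "j < length \<rho>s" for j m
    by (rule typeof_Apps[where \<sigma>s = "\<rho>s @ map (\<lambda>\<rho>. TFuns \<rho>s (TFun \<sigma> \<rho>)) \<rho>s"])
      (use that lrec_cons in \<open>auto simp: have_types_iff\<close>)
  have "typeof (zs ! i) \<Gamma> = Some (TFuns \<rho>s (TFun \<sigma> (\<rho>s ! i)))"
    using lrec_cons(1) have_types_nth[OF lrec_cons(3), of i] by simp
  then have "typeof (Apps (zs ! i) (map (\<lambda>j. Apps (LRecC \<sigma> \<rho>s j \<cdot> x) (ys @ zs)) [0..<length \<rho>s])) \<Gamma>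
      = Some (TFun \<sigma> (\<rho>s ! i))"
    by (rule typeof_Apps) (use R lrec_cons(5) in \<open>auto simp: has_type_iff intro!: nth_equalityI\<close>)
  then show ?case using R[of "ConsC \<sigma> \<cdot> a \<cdot> x" i] lrec_cons(1,4,5) by (simp add: wf_int_simps has_type_iff)
next
  case (beta \<sigma> \<Gamma> s \<tau> t)
  then have "typeof (sub (inst t) s) \<Gamma> = Some \<tau>"
    by (intro typeof_sub) (auto simp: has_type_iff nth_Cons split: nat.split)
  then show ?case using beta by (simp add: wf_int_simps has_type_iff)
next
  case (induction \<Gamma> A)
  have "wf_int \<Gamma> (fsub (inst ZeroC) A)" "wf_int (TNat # \<Gamma>) (fsub succ_sub A)"
    using induction unfolding wf_int_def
    by (auto intro!: wf_fsub[of "TNat # \<Gamma>" A] simp: nth_Cons split: nat.split)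
  then show ?case using induction by (simp add: wf_int_simps)
qed (auto simp: wf_int_simps has_type_iff)

lemma has_type_append: "has_type \<Gamma> t \<tau> \<Longrightarrow> has_type (\<Gamma> @ \<Gamma>') t \<tau>"
  by (simp add: has_type_iff typeof_append)

lemma have_types_append: "have_types \<Gamma> ts \<sigma>s \<Longrightarrow> have_types (\<Gamma> @ \<Gamma>') ts \<sigma>s"
  unfolding have_types_def by (erule list_all2_mono) (rule has_type_append)

lemma EHA_axiom_append: "EHA_axiom \<Gamma> A \<Longrightarrow> EHA_axiom (\<Gamma> @ \<Gamma>') A"
proof (induction rule: EHA_axiom.induct)
  case (induction \<Gamma> A)
  then show ?case
    using EHA_axiom.induction[of "\<Gamma> @ \<Gamma>'" A] wf_append[of "TNat # \<Gamma>" A \<Gamma>'] by (simp add: wf_int_def)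
next
  case (beta \<sigma> \<Gamma> s \<tau> t)
  then show ?case
    using EHA_axiom.beta[of \<sigma> "\<Gamma> @ \<Gamma>'" s \<tau> t] typeof_append[of s "\<sigma> # \<Gamma>"] by (simp add: has_type_iff typeof_append)
qed (rule EHA_axiom.intros; simp add: has_type_append have_types_append)+

locale eha =
  fixes \<Delta> :: "fm set"
  assumes \<Delta>_int: "\<forall>\<delta>\<in>\<Delta>. internal_sentence \<delta>"

sublocale eha \<subseteq> calculus wf_int "\<lambda>\<Gamma> A. EHA_axiom \<Gamma> A \<or> A \<in> \<Delta>"
proof
  fix \<Gamma> \<Gamma>' A assume A: "EHA_axiom \<Gamma> A \<or> A \<in> \<Delta>"
  then show "wf_int \<Gamma> A"
  proof
    assume "A \<in> \<Delta>"
    then show ?thesis using \<Delta>_int wf_append[of "[]" A \<Gamma>] by (auto simp: internal_sentence_def wf_int_def)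
  qed (rule EHA_axiom_wf)
  show "EHA_axiom (\<Gamma> @ \<Gamma>') A \<or> A \<in> \<Delta>"
    using A by (auto simp: EHA_axiom_append)
qed simp

context eha
begin

definition eqv :: "world \<Rightarrow> ty \<Rightarrow> tm \<Rightarrow> tm \<Rightarrow> bool" where
  "eqv w \<sigma> s t \<longleftrightarrow> pv w (Eq \<sigma> s t)"

lemma pv_EHA: "EHA_axiom (cx w) A \<Longrightarrow> pv w A"
  by (rule pv_ax) simp

lemma eqv_ty: "eqv w \<sigma> s t \<Longrightarrow> typeof s (cx w) = Some \<sigma>" "eqv w \<sigma> s t \<Longrightarrow> typeof t (cx w) = Some \<sigma>"
  unfolding eqv_def by (auto dest: pv_L)

lemma eqv_mono: "eqv w \<sigma> s t \<Longrightarrow> ext w w' \<Longrightarrow> eqv w' \<sigma> s t"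
  unfolding eqv_def by (rule pv_mono)

lemma eqv_refl: "typeof t (cx w) = Some \<sigma> \<Longrightarrow> eqv w \<sigma> t t"
  unfolding eqv_def by (rule pv_EHA) (rule EHA_axiom.eq_refl, simp add: has_type_iff)

lemma eqv_sym: "eqv w \<sigma> s t \<Longrightarrow> eqv w \<sigma> t s"
proof -
  assume st: "eqv w \<sigma> s t"
  have "pv w (Imp (Eq \<sigma> s t) (Eq \<sigma> t s))"
    by (rule pv_EHA, rule EHA_axiom.eq_sym) (use eqv_ty[OF st] in \<open>auto simp: has_type_iff\<close>)
  then show ?thesis using st unfolding eqv_def by (rule pv_ImpD)
qed

lemma eqv_trans [trans]: "eqv w \<sigma> s t \<Longrightarrow> eqv w \<sigma> t u \<Longrightarrow> eqv w \<sigma> s u"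
proof -
  assume st: "eqv w \<sigma> s t" and tu: "eqv w \<sigma> t u"
  have "pv w (Imp (And (Eq \<sigma> s t) (Eq \<sigma> t u)) (Eq \<sigma> s u))"
    by (rule pv_EHA, rule EHA_axiom.eq_trans) (use eqv_ty[OF st] eqv_ty[OF tu] in \<open>auto simp: has_type_iff\<close>)
  then show ?thesis using st tu unfolding eqv_def by (blast intro: pv_ImpD pv_AndI)
qed

lemma eqv_app: "eqv w (TFun \<sigma> \<tau>) f g \<Longrightarrow> eqv w \<sigma> s t \<Longrightarrow> eqv w \<tau> (f \<cdot> s) (g \<cdot> t)"
proof -
  assume fg: "eqv w (TFun \<sigma> \<tau>) f g" and st: "eqv w \<sigma> s t"
  have "pv w (Imp (And (Eq (TFun \<sigma> \<tau>) f g) (Eq \<sigma> s t)) (Eq \<tau> (f \<cdot> s) (g \<cdot> t)))"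
    by (rule pv_EHA, rule EHA_axiom.eq_cong) (use eqv_ty[OF st] eqv_ty[OF fg] in \<open>auto simp: has_type_iff\<close>)
  then show ?thesis using st fg unfolding eqv_def by (blast intro: pv_ImpD pv_AndI)
qed

lemma eqv_fun: "eqv w (TFun \<sigma> \<tau>) f g \<Longrightarrow> typeof t (cx w) = Some \<sigma> \<Longrightarrow> eqv w \<tau> (f \<cdot> t) (g \<cdot> t)"
  by (rule eqv_app[OF _ eqv_refl])

lemma eqv_arg: "eqv w \<sigma> s t \<Longrightarrow> typeof f (cx w) = Some (TFun \<sigma> \<tau>) \<Longrightarrow> eqv w \<tau> (f \<cdot> s) (f \<cdot> t)"
  by (rule eqv_app[OF eqv_refl])

lemma eqv_ext:
  assumes "typeof f (cx w) = Some (TFun \<sigma> \<tau>)" "typeof g (cx w) = Some (TFun \<sigma> \<tau>)"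
    and "\<And>w' t. ext w w' \<Longrightarrow> typeof t (cx w') = Some \<sigma> \<Longrightarrow> eqv w' \<tau> (f \<cdot> t) (g \<cdot> t)"
  shows "eqv w (TFun \<sigma> \<tau>) f g"
proof -
  have "pv w (Forall \<sigma> (Eq \<tau> (shift 1 f \<cdot> Var 0) (shift 1 g \<cdot> Var 0)))"
    by (rule pv_ForallI) (use assms in \<open>auto simp: eqv_def\<close>)
  moreover have "pv w (Iff (Eq (TFun \<sigma> \<tau>) f g) (Forall \<sigma> (Eq \<tau> (shift 1 f \<cdot> Var 0) (shift 1 g \<cdot> Var 0))))"
    by (rule pv_EHA, rule EHA_axiom.extensionality) (use assms in \<open>auto simp: has_type_iff\<close>)
  ultimately show ?thesis unfolding eqv_def by (blast intro: pv_ImpD dest: pv_AndD2)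
qed

lemma eqv_beta:
  "typeof s (\<sigma> # cx w) = Some \<tau> \<Longrightarrow> typeof t (cx w) = Some \<sigma> \<Longrightarrow> eqv w \<tau> (Lam \<sigma> s \<cdot> t) (sub (inst t) s)"
  unfolding eqv_def by (rule pv_EHA, rule EHA_axiom.beta) (auto simp: has_type_iff)

lemma eqv_Apps:
  "eqv w (TFuns \<sigma>s \<tau>) f g \<Longrightarrow> map (\<lambda>t. typeof t (cx w)) ts = map Some \<sigma>s \<Longrightarrow>
    eqv w \<tau> (Apps f ts) (Apps g ts)"
proof (induction \<sigma>s arbitrary: f g ts)
  case (Cons \<sigma> \<sigma>s)
  then show ?case by (cases ts) (auto intro: eqv_fun)
qed simp

text \<open>Keeping a pending substitution \<theta> general lets each \<beta>-step be absorbed into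
  it, so that the induction hypothesis applies directly to the remaining arguments.\<close>

lemma eqv_beta_tuple:
  "typeof (sub \<theta> (foldr Lam \<sigma>s b)) (cx w) = Some (TFuns \<sigma>s \<tau>) \<Longrightarrow>
    map (\<lambda>t. typeof t (cx w)) ts = map Some \<sigma>s \<Longrightarrow>
    eqv w \<tau> (Apps (sub \<theta> (foldr Lam \<sigma>s b)) ts) (sub (envl ts \<theta>) b)"
proof (induction \<sigma>s arbitrary: \<theta> ts)
  case (Cons \<sigma> \<sigma>s)
  then obtain t ts' where ts: "ts = t # ts'" "typeof t (cx w) = Some \<sigma>"
    "map (\<lambda>t. typeof t (cx w)) ts' = map Some \<sigma>s"
    by (auto simp: map_eq_Cons_conv)
  let ?b = "sub (up \<theta>) (foldr Lam \<sigma>s b)"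
  have b: "typeof ?b (\<sigma> # cx w) = Some (TFuns \<sigma>s \<tau>)"
    using Cons.prems(1) by auto
  have 1: "eqv w (TFuns \<sigma>s \<tau>) (Lam \<sigma> ?b \<cdot> t) (sub (inst t) ?b)"
    by (rule eqv_beta[OF b ts(2)])
  have "eqv w \<tau> (Apps (Lam \<sigma> ?b \<cdot> t) ts') (Apps (sub (case_nat t \<theta>) (foldr Lam \<sigma>s b)) ts')"
    using eqv_Apps[OF 1 ts(3)] by simp
  also have "eqv w \<tau> \<dots> (sub (envl ts' (case_nat t \<theta>)) b)"
    by (rule Cons.IH[OF _ ts(3)]) (use eqv_ty(2)[OF 1] in simp)
  finally show ?case by (simp add: ts(1))
qed (simp add: eqv_refl)

lemma eqv_case_nat:
  "(\<And>i. i < length \<Gamma> \<Longrightarrow> eqv w (\<Gamma> ! i) (\<theta> i) (\<theta>' i)) \<Longrightarrow> ext w w' \<Longrightarrow> typeof a (cx w') = Some \<sigma> \<Longrightarrow>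
    i < length (\<sigma> # \<Gamma>) \<Longrightarrow> eqv w' ((\<sigma> # \<Gamma>) ! i) (case_nat a \<theta> i) (case_nat a \<theta>' i)"
  by (cases i) (auto intro: eqv_refl eqv_mono)

text \<open>The congruence axioms cover application only. Under an abstraction extensionality is
  needed: at an arbitrary argument of a later world both sides \<beta>-reduce to instances of the
  induction hypothesis, which is why the world is generalized.\<close>

lemma eqv_sub:
  "typeof t \<Gamma> = Some \<tau> \<Longrightarrow> (\<And>i. i < length \<Gamma> \<Longrightarrow> eqv w (\<Gamma> ! i) (\<theta> i) (\<theta>' i)) \<Longrightarrow>
    eqv w \<tau> (sub \<theta> t) (sub \<theta>' t)"
proof (induction t arbitrary: \<Gamma> \<tau> \<theta> \<theta>' w)
  case (Lam \<sigma> t)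
  then obtain \<tau>' where t: "\<tau> = TFun \<sigma> \<tau>'" "typeof t (\<sigma> # \<Gamma>) = Some \<tau>'" by auto
  have "typeof (sub \<eta> (Lam \<sigma> t)) (cx w) = Some \<tau>"
    if "\<And>i. i < length \<Gamma> \<Longrightarrow> typeof (\<eta> i) (cx w) = Some (\<Gamma> ! i)" for \<eta>
    by (rule typeof_sub[OF Lam.prems(1) that])
  note ty = this[OF eqv_ty(1)[OF Lam.prems(2)]] this[OF eqv_ty(2)[OF Lam.prems(2)]]
  have "eqv w (TFun \<sigma> \<tau>') (sub \<theta> (Lam \<sigma> t)) (sub \<theta>' (Lam \<sigma> t))"
  proof (rule eqv_ext)
    fix w' a assume w': "ext w w'" and a: "typeof a (cx w') = Some \<sigma>"
    note ty' = ty[THEN ty_mono[OF _ w']]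
    have "eqv w' \<tau>' (sub \<theta> (Lam \<sigma> t) \<cdot> a) (sub (inst a) (sub (up \<theta>) t))"
      unfolding sub.simps by (rule eqv_beta) (use ty' a t in auto)
    also have "eqv w' \<tau>' \<dots> (sub (inst a) (sub (up \<theta>') t))"
      unfolding sub_inst_up
      by (rule Lam.IH[OF t(2) eqv_case_nat[OF Lam.prems(2) w' a]])
    also have "eqv w' \<tau>' \<dots> (sub \<theta>' (Lam \<sigma> t) \<cdot> a)"
      unfolding sub.simps by (rule eqv_sym, rule eqv_beta) (use ty' a t in auto)
    finally show "eqv w' \<tau>' (sub \<theta> (Lam \<sigma> t) \<cdot> a) (sub \<theta>' (Lam \<sigma> t) \<cdot> a)" .
  qed (use ty t in auto)
  then show ?case by (simp add: t)
next
  case (App s t)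
  then obtain \<sigma> where st: "typeof s \<Gamma> = Some (TFun \<sigma> \<tau>)" "typeof t \<Gamma> = Some \<sigma>"
    unfolding typeof_App_iff by blast
  show ?case unfolding sub.simps
    by (rule eqv_app[OF App.IH(1)[OF st(1)] App.IH(2)[OF st(2)]]) (use App.prems(2) in auto)
qed (auto intro!: eqv_refl split: if_splits)

text \<open>Leibniz's law, derived by induction on the formula, since the axioms state congruence
  for terms only. The antecedent of an implication is transported backwards, using symmetry, and the
  quantifiers extend both environments by a common value.\<close>

lemma eqv_fsub:
  "wf_int \<Gamma> A \<Longrightarrow> (\<And>i. i < length \<Gamma> \<Longrightarrow> eqv w (\<Gamma> ! i) (\<theta> i) (\<theta>' i)) \<Longrightarrow>
    pv w (fsub \<theta> A) \<Longrightarrow> pv w (fsub \<theta>' A)"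
proof (induction A arbitrary: \<Gamma> \<theta> \<theta>' w)
  case (Eq \<sigma> s t)
  then have "eqv w \<sigma> (sub \<theta>' s) (sub \<theta> s)" "eqv w \<sigma> (sub \<theta> s) (sub \<theta> t)" "eqv w \<sigma> (sub \<theta> t) (sub \<theta>' t)"
    using eqv_sub[of s \<Gamma> \<sigma> w \<theta>' \<theta>] eqv_sub[of t \<Gamma> \<sigma> w \<theta> \<theta>'] by (auto simp: eqv_def intro: eqv_sym[unfolded eqv_def])
  then show ?case unfolding fsub.simps eqv_def[symmetric] by (blast intro: eqv_trans)
next
  case (And A B)
  then show ?case using And.IH(1)[OF _ And.prems(2)] And.IH(2)[OF _ And.prems(2)]
    by (auto intro!: pv_AndI dest: pv_AndD1 pv_AndD2)
next
  case (Or A B)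
  have L: "wf_int (cx w) (fsub \<theta>' (Or A B))"
    by (rule L_fsub[OF Or.prems(1)]) (use Or.prems(2) in \<open>auto dest: eqv_ty\<close>)
  show ?case
  proof (rule pv_OrE[OF Or.prems(3)[unfolded fsub.simps] L])
    fix w' assume w': "ext w w'" and *: "pv w' (fsub \<theta> A)"
    have "pv w' (fsub \<theta>' A)"
      by (rule Or.IH(1)[OF _ _ *]) (use Or.prems in \<open>auto intro: eqv_mono[OF _ w']\<close>)
    then show "pv w' (fsub \<theta>' (Or A B))"
      using L_mono[OF L w'] by (auto intro: pv_OrI1)
  next
    fix w' assume w': "ext w w'" and *: "pv w' (fsub \<theta> B)"
    have "pv w' (fsub \<theta>' B)"
      by (rule Or.IH(2)[OF _ _ *]) (use Or.prems in \<open>auto intro: eqv_mono[OF _ w']\<close>)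
    then show "pv w' (fsub \<theta>' (Or A B))"
      using L_mono[OF L w'] by (auto intro: pv_OrI2)
  qed
next
  case (Imp A B)
  have L: "wf_int (cx w) (fsub \<theta>' (Imp A B))"
    by (rule L_fsub[OF Imp.prems(1)]) (use Imp.prems(2) in \<open>auto dest: eqv_ty\<close>)
  show ?case unfolding fsub.simps
  proof (rule pv_ImpI)
    fix w' assume w': "ext w w'" and *: "pv w' (fsub \<theta>' A)"
    have "pv w' (fsub \<theta> A)"
      by (rule Imp.IH(1)[OF _ _ *]) (use Imp.prems in \<open>auto intro: eqv_sym eqv_mono[OF _ w']\<close>)
    then have *: "pv w' (fsub \<theta> B)"
      using pv_mono[OF Imp.prems(3) w'] by (auto intro: pv_ImpD)
    show "pv w' (fsub \<theta>' B)"
      by (rule Imp.IH(2)[OF _ _ *]) (use Imp.prems in \<open>auto intro: eqv_mono[OF _ w']\<close>)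
  qed (use L in simp)
next
  case (Forall \<sigma> A)
  have L: "wf_int (cx w) (fsub \<theta>' (Forall \<sigma> A))"
    by (rule L_fsub[OF Forall.prems(1)]) (use Forall.prems(2) in \<open>auto dest: eqv_ty\<close>)
  show ?case unfolding fsub.simps
  proof (rule pv_ForallI)
    fix w' a assume w': "ext w w'" and a: "typeof a (cx w') = Some \<sigma>"
    have "pv w' (fsub (inst a) (fsub (up \<theta>) A))"
      using pv_mono[OF Forall.prems(3) w'] a unfolding fsub.simps by (rule pv_ForallD)
    then show "pv w' (fsub (inst a) (fsub (up \<theta>') A))"
      using Forall.prems(1) Forall.IH[of "\<sigma> # \<Gamma>" w' "case_nat a \<theta>" "case_nat a \<theta>'",
        OF _ eqv_case_nat[OF Forall.prems(2) w' a]]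
      unfolding fsub_inst_up wf_int_simps by blast
  qed (use L in simp)
next
  case (Exists \<sigma> A)
  have L: "wf_int (cx w) (fsub \<theta>' (Exists \<sigma> A))"
    by (rule L_fsub[OF Exists.prems(1)]) (use Exists.prems(2) in \<open>auto dest: eqv_ty\<close>)
  show ?case
  proof (rule pv_ExistsE[OF Exists.prems(3)[unfolded fsub.simps] L])
    fix w' a assume w': "ext w w'" and a: "typeof a (cx w') = Some \<sigma>"
      and "pv w' (fsub (inst a) (fsub (up \<theta>) A))"
    then have "pv w' (fsub (inst a) (fsub (up \<theta>') A))"
      using Exists.prems(1) Exists.IH[of "\<sigma> # \<Gamma>" w' "case_nat a \<theta>" "case_nat a \<theta>'",
        OF _ eqv_case_nat[OF Exists.prems(2) w' a]]
      unfolding fsub_inst_up wf_int_simps by blast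
    then show "pv w' (fsub \<theta>' (Exists \<sigma> A))"
      unfolding fsub.simps by (rule pv_ExistsI[rotated 2]) (use a L_mono[OF L w'] in auto)
  qed
qed (auto simp: wf_int_def)

lemma pv_inst_cong:
  "eqv w \<sigma> s t \<Longrightarrow> pv w (fsub (inst s) A) \<Longrightarrow> wf_int (\<sigma> # cx w) A \<Longrightarrow> pv w (fsub (inst t) A)"
  by (rule eqv_fsub[of "\<sigma> # cx w"]) (auto simp: nth_Cons intro: eqv_refl split: nat.split)

text \<open>The step premise speaks about arbitrary later worlds because in the induction axiom the
  step stands under a quantifier and an implication.\<close>

lemma pv_nat_induct:
  assumes A: "wf_int (TNat # cx w) A" and n: "typeof n (cx w) = Some TNat"
    and 0: "pv w (fsub (inst ZeroC) A)"
    and S: "\<And>w' m. ext w w' \<Longrightarrow> typeof m (cx w') = Some TNat \<Longrightarrow> pv w' (fsub (inst m) A) \<Longrightarrow>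
      pv w' (fsub (inst (SucC \<cdot> m)) A)"
  shows "pv w (fsub (inst n) A)"
proof -
  have s: "(\<lambda>i. sub (inst m) (succ_sub i)) = inst (SucC \<cdot> m)" for m
    by (rule HOL.ext) (simp split: nat.split)
  have LS: "wf_int (TNat # cx w) (fsub succ_sub A)"
    by (rule L_fsub[OF A]) (auto simp: nth_Cons split: nat.split)
  have "pv w (Forall TNat (Imp A (fsub succ_sub A)))"
  proof (rule pv_ForallI)
    fix w' m assume w': "ext w w'" and m: "typeof m (cx w') = Some TNat"
    obtain \<Gamma> where \<Gamma>: "cx w' = cx w @ \<Gamma>" using w' unfolding ext_def by auto
    show "pv w' (fsub (inst m) (Imp A (fsub succ_sub A)))"
      unfolding fsub.simps
    proof (rule pv_ImpI)
      show "wf_int (cx w') (fsub (inst m) A)"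
        using L_append[OF A, of \<Gamma>] m \<Gamma> by (intro L_inst) auto
      fix w'' assume w'': "ext w' w''" "pv w'' (fsub (inst m) A)"
      show "pv w'' (fsub (inst m) (fsub succ_sub A))"
        using S[OF ext_trans[OF w' w''(1)] ty_mono[OF m w''(1)] w''(2)] by (simp add: s)
    qed
  qed (use A LS in simp)
  moreover have "pv w (Imp (And (fsub (inst ZeroC) A) (Forall TNat (Imp A (fsub succ_sub A)))) (Forall TNat A))"
    by (rule pv_EHA) (rule EHA_axiom.induction[OF A])
  ultimately have "pv w (Forall TNat A)"
    using 0 by (blast intro: pv_ImpD pv_AndI)
  then show ?thesis using n by (rule pv_ForallD)
qed

end

section \<open>Arithmetic of finite sequences\<close>

lemma up_numeral [simp]: "up \<theta> (numeral k) = ren Suc (\<theta> (pred_numeral k))"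
  by (simp add: numeral_eq_Suc)

lemma up_ren_numeral [simp]: "up_ren r (numeral k) = Suc (r (pred_numeral k))"
  by (simp add: numeral_eq_Suc)

context eha
begin

section \<open>Computation rules for the recursors and for the defined closed terms\<close>

lemma eqv_beta2:
  "typeof b (\<tau> # \<sigma> # cx w) = Some \<rho> \<Longrightarrow> typeof x (cx w) = Some \<sigma> \<Longrightarrow> typeof y (cx w) = Some \<tau> \<Longrightarrow>
    eqv w \<rho> (Lam \<sigma> (Lam \<tau> b) \<cdot> x \<cdot> y) (sub (case_nat y (inst x)) b)"
  using eqv_beta_tuple[of Var "[\<sigma>, \<tau>]" b w \<rho> "[x, y]"] by simp

lemma eqv_beta3:
  "typeof b (\<upsilon> # \<tau> # \<sigma> # cx w) = Some \<rho> \<Longrightarrow> typeof x (cx w) = Some \<sigma> \<Longrightarrow> typeof y (cx w) = Some \<tau> \<Longrightarrow>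
    typeof z (cx w) = Some \<upsilon> \<Longrightarrow>
    eqv w \<rho> (Lam \<sigma> (Lam \<tau> (Lam \<upsilon> b)) \<cdot> x \<cdot> y \<cdot> z) (sub (case_nat z (case_nat y (inst x))) b)"
  using eqv_beta_tuple[of Var "[\<sigma>, \<tau>, \<upsilon>]" b w \<rho> "[x, y, z]"] by simp

lemma rec1_zero:
  "typeof y (cx w) = Some \<tau> \<Longrightarrow> typeof z (cx w) = Some (TFun \<tau> (TFun TNat \<tau>)) \<Longrightarrow>
    eqv w \<tau> (RecC [\<tau>] 0 \<cdot> ZeroC \<cdot> y \<cdot> z) y"
  using pv_EHA[of w, OF EHA_axiom.rec_zero[of 0 "[\<tau>]" "cx w" "[y]" "[z]"]] by (simp add: have_types_iff eqv_def)

lemma rec1_suc: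
  "typeof y (cx w) = Some \<tau> \<Longrightarrow> typeof z (cx w) = Some (TFun \<tau> (TFun TNat \<tau>)) \<Longrightarrow>
    typeof n (cx w) = Some TNat \<Longrightarrow>
    eqv w \<tau> (RecC [\<tau>] 0 \<cdot> (SucC \<cdot> n) \<cdot> y \<cdot> z) (z \<cdot> (RecC [\<tau>] 0 \<cdot> n \<cdot> y \<cdot> z) \<cdot> n)"
  using pv_EHA[of w, OF EHA_axiom.rec_suc[of 0 "[\<tau>]" "cx w" "[y]" "[z]" n]]
  by (simp add: have_types_iff has_type_iff eqv_def)

lemma lrec1_nil:
  "typeof y (cx w) = Some \<tau> \<Longrightarrow> typeof z (cx w) = Some (TFun \<tau> (TFun \<sigma> \<tau>)) \<Longrightarrow>
    eqv w \<tau> (LRecC \<sigma> [\<tau>] 0 \<cdot> NilC \<sigma> \<cdot> y \<cdot> z) y"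
  using pv_EHA[of w, OF EHA_axiom.lrec_nil[of 0 "[\<tau>]" "cx w" "[y]" "[z]" \<sigma>]] by (simp add: have_types_iff eqv_def)

lemma lrec1_cons:
  "typeof y (cx w) = Some \<tau> \<Longrightarrow> typeof z (cx w) = Some (TFun \<tau> (TFun \<sigma> \<tau>)) \<Longrightarrow>
    typeof a (cx w) = Some \<sigma> \<Longrightarrow> typeof x (cx w) = Some (TSeq \<sigma>) \<Longrightarrow>
    eqv w \<tau> (LRecC \<sigma> [\<tau>] 0 \<cdot> (ConsC \<sigma> \<cdot> a \<cdot> x) \<cdot> y \<cdot> z) (z \<cdot> (LRecC \<sigma> [\<tau>] 0 \<cdot> x \<cdot> y \<cdot> z) \<cdot> a)"
  using pv_EHA[of w, OF EHA_axiom.lrec_cons[of 0 "[\<tau>]" "cx w" "[y]" "[z]" \<sigma> a x]]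
  by (simp add: have_types_iff has_type_iff eqv_def)

lemma plus_unfold:
  "typeof s (cx w) = Some TNat \<Longrightarrow> typeof t (cx w) = Some TNat \<Longrightarrow>
    eqv w TNat (plusC \<cdot> s \<cdot> t) (RecC [TNat] 0 \<cdot> t \<cdot> s \<cdot> Lam TNat (Lam TNat (SucC \<cdot> Var 1)))"
  using eqv_beta2[of "RecC [TNat] 0 \<cdot> Var 0 \<cdot> Var 1 \<cdot> Lam TNat (Lam TNat (SucC \<cdot> Var 1))" TNat TNat w TNat s t]
  by (simp add: plusC_def)

lemma plus_zero: "typeof s (cx w) = Some TNat \<Longrightarrow> eqv w TNat (plusC \<cdot> s \<cdot> ZeroC) s"
  by (rule eqv_trans[OF plus_unfold rec1_zero]) simp_all

lemma plus_suc:
  assumes [simp]: "typeof s (cx w) = Some TNat" "typeof t (cx w) = Some TNat"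
  shows "eqv w TNat (plusC \<cdot> s \<cdot> (SucC \<cdot> t)) (SucC \<cdot> (plusC \<cdot> s \<cdot> t))"
proof -
  let ?F = "Lam TNat (Lam TNat (SucC \<cdot> Var 1))"
  let ?R = "RecC [TNat] 0 \<cdot> t \<cdot> s \<cdot> ?F"
  have "eqv w TNat (plusC \<cdot> s \<cdot> (SucC \<cdot> t)) (RecC [TNat] 0 \<cdot> (SucC \<cdot> t) \<cdot> s \<cdot> ?F)"
    by (rule plus_unfold) simp_all
  also have "eqv w TNat \<dots> (?F \<cdot> ?R \<cdot> t)"
    by (rule rec1_suc) simp_all
  also have "eqv w TNat \<dots> (SucC \<cdot> ?R)"
    using eqv_beta2[of "SucC \<cdot> Var 1" TNat TNat w TNat ?R t] by simp
  also have "eqv w TNat \<dots> (SucC \<cdot> (plusC \<cdot> s \<cdot> t))"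
    by (rule eqv_arg[OF eqv_sym[OF plus_unfold]]) simp_all
  finally show ?thesis .
qed

lemma len_unfold:
  "typeof x (cx w) = Some (TSeq \<sigma>) \<Longrightarrow>
    eqv w TNat (lenC \<sigma> \<cdot> x) (LRecC \<sigma> [TNat] 0 \<cdot> x \<cdot> ZeroC \<cdot> Lam TNat (Lam \<sigma> (SucC \<cdot> Var 1)))"
  using eqv_beta[of "LRecC \<sigma> [TNat] 0 \<cdot> Var 0 \<cdot> ZeroC \<cdot> Lam TNat (Lam \<sigma> (SucC \<cdot> Var 1))" "TSeq \<sigma>" w TNat x]
  by (simp add: lenC_def)

lemma len_nil: "eqv w TNat (lenC \<sigma> \<cdot> NilC \<sigma>) ZeroC"
  by (rule eqv_trans[OF len_unfold lrec1_nil]) simp_all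

lemma len_cons:
  assumes [simp]: "typeof a (cx w) = Some \<sigma>" "typeof x (cx w) = Some (TSeq \<sigma>)"
  shows "eqv w TNat (lenC \<sigma> \<cdot> (ConsC \<sigma> \<cdot> a \<cdot> x)) (SucC \<cdot> (lenC \<sigma> \<cdot> x))"
proof -
  let ?F = "Lam TNat (Lam \<sigma> (SucC \<cdot> Var 1))"
  let ?R = "LRecC \<sigma> [TNat] 0 \<cdot> x \<cdot> ZeroC \<cdot> ?F"
  have "eqv w TNat (lenC \<sigma> \<cdot> (ConsC \<sigma> \<cdot> a \<cdot> x)) (LRecC \<sigma> [TNat] 0 \<cdot> (ConsC \<sigma> \<cdot> a \<cdot> x) \<cdot> ZeroC \<cdot> ?F)"
    by (rule len_unfold) simp
  also have "eqv w TNat \<dots> (?F \<cdot> ?R \<cdot> a)"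
    by (rule lrec1_cons) simp_all
  also have "eqv w TNat \<dots> (SucC \<cdot> ?R)"
    using eqv_beta2[of "SucC \<cdot> Var 1" \<sigma> TNat w TNat ?R a] by simp
  also have "eqv w TNat \<dots> (SucC \<cdot> (lenC \<sigma> \<cdot> x))"
    by (rule eqv_arg[OF eqv_sym[OF len_unfold]]) simp_all
  finally show ?thesis .
qed

lemma append_unfold:
  "typeof x (cx w) = Some (TSeq \<sigma>) \<Longrightarrow> typeof y (cx w) = Some (TSeq \<sigma>) \<Longrightarrow>
    eqv w (TSeq \<sigma>) (appendC \<sigma> \<cdot> x \<cdot> y)
      (LRecC \<sigma> [TSeq \<sigma>] 0 \<cdot> x \<cdot> y \<cdot> Lam (TSeq \<sigma>) (Lam \<sigma> (ConsC \<sigma> \<cdot> Var 0 \<cdot> Var 1)))"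
  using eqv_beta2[of "LRecC \<sigma> [TSeq \<sigma>] 0 \<cdot> Var 1 \<cdot> Var 0 \<cdot> Lam (TSeq \<sigma>) (Lam \<sigma> (ConsC \<sigma> \<cdot> Var 0 \<cdot> Var 1))"
      "TSeq \<sigma>" "TSeq \<sigma>" w "TSeq \<sigma>" x y]
  by (simp add: appendC_def)

lemma append_nil: "typeof y (cx w) = Some (TSeq \<sigma>) \<Longrightarrow> eqv w (TSeq \<sigma>) (appendC \<sigma> \<cdot> NilC \<sigma> \<cdot> y) y"
  by (rule eqv_trans[OF append_unfold lrec1_nil]) simp_all

lemma append_cons:
  assumes [simp]: "typeof a (cx w) = Some \<sigma>" "typeof x (cx w) = Some (TSeq \<sigma>)" "typeof y (cx w) = Some (TSeq \<sigma>)"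
  shows "eqv w (TSeq \<sigma>) (appendC \<sigma> \<cdot> (ConsC \<sigma> \<cdot> a \<cdot> x) \<cdot> y) (ConsC \<sigma> \<cdot> a \<cdot> (appendC \<sigma> \<cdot> x \<cdot> y))"
proof -
  let ?F = "Lam (TSeq \<sigma>) (Lam \<sigma> (ConsC \<sigma> \<cdot> Var 0 \<cdot> Var 1))"
  let ?R = "LRecC \<sigma> [TSeq \<sigma>] 0 \<cdot> x \<cdot> y \<cdot> ?F"
  have "eqv w (TSeq \<sigma>) (appendC \<sigma> \<cdot> (ConsC \<sigma> \<cdot> a \<cdot> x) \<cdot> y)
      (LRecC \<sigma> [TSeq \<sigma>] 0 \<cdot> (ConsC \<sigma> \<cdot> a \<cdot> x) \<cdot> y \<cdot> ?F)"
    by (rule append_unfold) simp_all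
  also have "eqv w (TSeq \<sigma>) \<dots> (?F \<cdot> ?R \<cdot> a)"
    by (rule lrec1_cons) simp_all
  also have "eqv w (TSeq \<sigma>) \<dots> (ConsC \<sigma> \<cdot> a \<cdot> ?R)"
    using eqv_beta2[of "ConsC \<sigma> \<cdot> Var 0 \<cdot> Var 1" \<sigma> "TSeq \<sigma>" w "TSeq \<sigma>" ?R a] by simp
  also have "eqv w (TSeq \<sigma>) \<dots> (ConsC \<sigma> \<cdot> a \<cdot> (appendC \<sigma> \<cdot> x \<cdot> y))"
    by (rule eqv_arg[OF eqv_sym[OF append_unfold]]) simp_all
  finally show ?thesis .
qed

text \<open>Unfolding \<open>projC\<close> leaves its list recursor on \<open>x\<close> inside the
  step function of the recursion on the index. Turning it back into \<open>projC\<close> has to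
  happen under two abstractions, hence the two uses of extensionality. The step function ignores the
  previous value, so this recursion is merely a case distinction on \<open>i\<close>.\<close>

lemma proj_cons:
  assumes [simp]: "typeof a (cx w) = Some \<sigma>" "typeof x (cx w) = Some (TSeq \<sigma>)" "typeof i (cx w) = Some TNat"
  shows "eqv w \<sigma> (projC \<sigma> \<cdot> (ConsC \<sigma> \<cdot> a \<cdot> x) \<cdot> i)
    (RecC [\<sigma>] 0 \<cdot> i \<cdot> a \<cdot> Lam \<sigma> (Lam TNat (projC \<sigma> \<cdot> shift 2 x \<cdot> Var 0)))"
proof -
  let ?b = "RecC [\<sigma>] 0 \<cdot> Var 0 \<cdot> Var 1 \<cdot> Lam \<sigma> (Lam TNat (Var 4 \<cdot> Var 0))"
  let ?F = "Lam (TFun TNat \<sigma>) (Lam \<sigma> (Lam TNat ?b))"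
  let ?R = "\<lambda>y. LRecC \<sigma> [TFun TNat \<sigma>] 0 \<cdot> y \<cdot> default_tm (TFun TNat \<sigma>) \<cdot> ?F"
  have unfold: "eqv w (TFun TNat \<sigma>) (projC \<sigma> \<cdot> y) (?R y)" if "typeof y (cx w) = Some (TSeq \<sigma>)" for w y
    using that eqv_beta[of "?R (Var 0)" "TSeq \<sigma>" w "TFun TNat \<sigma>" y] by (simp add: projC_def numeral_eq_Suc)
  have "eqv w \<sigma> (projC \<sigma> \<cdot> (ConsC \<sigma> \<cdot> a \<cdot> x) \<cdot> i) (?R (ConsC \<sigma> \<cdot> a \<cdot> x) \<cdot> i)"
    by (rule eqv_fun[OF unfold]) simp_all
  also have "eqv w \<sigma> \<dots> (?F \<cdot> ?R x \<cdot> a \<cdot> i)"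
    by (rule eqv_fun[OF lrec1_cons]) simp_all
  also have "eqv w \<sigma> \<dots> (RecC [\<sigma>] 0 \<cdot> i \<cdot> a \<cdot> Lam \<sigma> (Lam TNat (shift 2 (?R x) \<cdot> Var 0)))"
    using eqv_beta3[of ?b TNat \<sigma> "TFun TNat \<sigma>" w \<sigma> "?R x" a i] by (simp add: numeral_eq_Suc)
  also have "eqv w \<sigma> \<dots> (RecC [\<sigma>] 0 \<cdot> i \<cdot> a \<cdot> Lam \<sigma> (Lam TNat (projC \<sigma> \<cdot> shift 2 x \<cdot> Var 0)))"
  proof (rule eqv_arg)
    have t: "typeof (Lam \<sigma> (Lam TNat (projC \<sigma> \<cdot> shift 2 x \<cdot> Var 0))) (cx w) = Some (TFun \<sigma> (TFun TNat \<sigma>))"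
      "typeof (Lam \<sigma> (Lam TNat (shift 2 (?R x) \<cdot> Var 0))) (cx w) = Some (TFun \<sigma> (TFun TNat \<sigma>))"
      using typeof_shift[of "[TNat, \<sigma>]" 2 x "cx w"] by simp_all
    show "eqv w (TFun \<sigma> (TFun TNat \<sigma>)) (Lam \<sigma> (Lam TNat (shift 2 (?R x) \<cdot> Var 0)))
        (Lam \<sigma> (Lam TNat (projC \<sigma> \<cdot> shift 2 x \<cdot> Var 0)))"
    proof (rule eqv_ext[OF t(2,1)], rule eqv_ext)
      fix w' b assume w': "ext w w'" and b[simp]: "typeof b (cx w') = Some \<sigma>"
      show "typeof (Lam \<sigma> (Lam TNat (projC \<sigma> \<cdot> shift 2 x \<cdot> Var 0)) \<cdot> b) (cx w') = Some (TFun TNat \<sigma>)"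
        "typeof (Lam \<sigma> (Lam TNat (shift 2 (?R x) \<cdot> Var 0)) \<cdot> b) (cx w') = Some (TFun TNat \<sigma>)"
        using t[THEN ty_mono[OF _ w']] by (simp_all del: typeof.simps(2))
      fix w'' j assume w'': "ext w' w''" and j[simp]: "typeof j (cx w'') = Some TNat"
      have b'[simp]: "typeof b (cx w'') = Some \<sigma>" by (rule ty_mono[OF b w''])
      have [simp]: "typeof x (cx w'') = Some (TSeq \<sigma>)" by (rule ty_mono[OF assms(2) ext_trans[OF w' w'']])
      have "eqv w'' \<sigma> (Lam \<sigma> (Lam TNat (shift 2 (?R x) \<cdot> Var 0)) \<cdot> b \<cdot> j) (?R x \<cdot> j)"
        using eqv_beta2[of "shift 2 (?R x) \<cdot> Var 0" TNat \<sigma> w'' \<sigma> b j] typeof_shift[of "[TNat, \<sigma>]" 2 x "cx w''"]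
        by (simp add: numeral_eq_Suc)
      also have "eqv w'' \<sigma> \<dots> (projC \<sigma> \<cdot> x \<cdot> j)"
        by (rule eqv_fun[OF eqv_sym[OF unfold]]) simp_all
      also have "eqv w'' \<sigma> \<dots> (Lam \<sigma> (Lam TNat (projC \<sigma> \<cdot> shift 2 x \<cdot> Var 0)) \<cdot> b \<cdot> j)"
        using eqv_sym[OF eqv_beta2[of "projC \<sigma> \<cdot> shift 2 x \<cdot> Var 0" TNat \<sigma> w'' \<sigma> b j]] typeof_shift[of "[TNat, \<sigma>]" 2 x "cx w''"] by simp
      finally show "eqv w'' \<sigma> (Lam \<sigma> (Lam TNat (shift 2 (?R x) \<cdot> Var 0)) \<cdot> b \<cdot> j)
        (Lam \<sigma> (Lam TNat (projC \<sigma> \<cdot> shift 2 x \<cdot> Var 0)) \<cdot> b \<cdot> j)" .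
    qed
  qed simp
  finally show ?thesis .
qed

lemma proj_zero:
  assumes [simp]: "typeof a (cx w) = Some \<sigma>" "typeof x (cx w) = Some (TSeq \<sigma>)"
  shows "eqv w \<sigma> (projC \<sigma> \<cdot> (ConsC \<sigma> \<cdot> a \<cdot> x) \<cdot> ZeroC) a"
  by (rule eqv_trans[OF proj_cons rec1_zero]) (use typeof_shift[of "[TNat, \<sigma>]" 2 x "cx w"] in simp_all)

lemma proj_suc:
  assumes [simp]: "typeof a (cx w) = Some \<sigma>" "typeof x (cx w) = Some (TSeq \<sigma>)" "typeof i (cx w) = Some TNat"
  shows "eqv w \<sigma> (projC \<sigma> \<cdot> (ConsC \<sigma> \<cdot> a \<cdot> x) \<cdot> (SucC \<cdot> i)) (projC \<sigma> \<cdot> x \<cdot> i)"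
proof -
  have [simp]: "typeof (ren (\<lambda>n. Suc (Suc n)) x) (TNat # \<sigma> # cx w) = Some (TSeq \<sigma>)"
    using typeof_shift[of "[TNat, \<sigma>]" 2 x "cx w"] by simp
  let ?F = "Lam \<sigma> (Lam TNat (projC \<sigma> \<cdot> shift 2 x \<cdot> Var 0))"
  have "eqv w \<sigma> (projC \<sigma> \<cdot> (ConsC \<sigma> \<cdot> a \<cdot> x) \<cdot> (SucC \<cdot> i)) (RecC [\<sigma>] 0 \<cdot> (SucC \<cdot> i) \<cdot> a \<cdot> ?F)"
    by (rule proj_cons) simp_all
  also have "eqv w \<sigma> \<dots> (?F \<cdot> (RecC [\<sigma>] 0 \<cdot> i \<cdot> a \<cdot> ?F) \<cdot> i)"
    by (rule rec1_suc) simp_all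
  also have "eqv w \<sigma> \<dots> (projC \<sigma> \<cdot> x \<cdot> i)"
    using eqv_beta2[of "projC \<sigma> \<cdot> shift 2 x \<cdot> Var 0" TNat \<sigma> w \<sigma> "RecC [\<sigma>] 0 \<cdot> i \<cdot> a \<cdot> ?F" i] by simp
  finally show ?thesis .
qed

subsection \<open>The order on numbers\<close>

abbreviation less :: "world \<Rightarrow> tm \<Rightarrow> tm \<Rightarrow> bool" where
  "less w s t \<equiv> pv w (less_fm s t)"

lemma less_ty: "less w s t \<Longrightarrow> typeof s (cx w) = Some TNat" "less w s t \<Longrightarrow> typeof t (cx w) = Some TNat"
  by (auto dest: pv_L)

lemma less_cong: "less w s t \<Longrightarrow> eqv w TNat s s' \<Longrightarrow> eqv w TNat t t' \<Longrightarrow> less w s' t'"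
  using eqv_fsub[of "[TNat, TNat]" "less_fm (Var 0) (Var 1)" w "case_nat s (inst t)" "case_nat s' (inst t')"]
  by (auto simp: nth_Cons split: nat.splits)

lemma less_I: "eqv w TNat (plusC \<cdot> k \<cdot> (SucC \<cdot> s)) t \<Longrightarrow> less w s t"
proof -
  assume e: "eqv w TNat (plusC \<cdot> k \<cdot> (SucC \<cdot> s)) t"
  from eqv_ty(1)[OF e] have "typeof k (cx w) = Some TNat" "typeof s (cx w) = Some TNat"
    by (auto simp: typeof_App_iff simp del: typeof.simps(3))
  then show ?thesis unfolding less_fm_def
    using e eqv_ty(2)[OF e] by (intro pv_ExistsI[of TNat w _ k]) (auto simp: eqv_def)
qed

lemma less_E:
  assumes "less w s t" "wf_int (cx w) C"
    and "\<And>w' k. ext w w' \<Longrightarrow> typeof k (cx w') = Some TNat \<Longrightarrow> eqv w' TNat (plusC \<cdot> k \<cdot> (SucC \<cdot> s)) t \<Longrightarrow> pv w' C"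
  shows "pv w C"
  by (rule pv_ExistsE[OF assms(1)[unfolded less_fm_def] assms(2)]) (use assms(3) in \<open>auto simp: eqv_def\<close>)

lemma suc_ne_zero: "eqv w TNat (SucC \<cdot> t) ZeroC \<Longrightarrow> wf_int (cx w) C \<Longrightarrow> pv w C"
proof -
  assume e: "eqv w TNat (SucC \<cdot> t) ZeroC" and C: "wf_int (cx w) C"
  have "pv w (Neg (Eq TNat (SucC \<cdot> t) ZeroC))"
    using eqv_ty(1)[OF e]
    by (intro pv_EHA EHA_axiom.suc_not_zero) (auto simp: has_type_iff typeof_App_iff simp del: typeof.simps(3))
  then show ?thesis using e C unfolding eqv_def by (blast intro: pv_ImpD pv_BotE)
qed

lemma suc_inj: "eqv w TNat (SucC \<cdot> s) (SucC \<cdot> t) \<Longrightarrow> eqv w TNat s t"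
proof -
  assume e: "eqv w TNat (SucC \<cdot> s) (SucC \<cdot> t)"
  have "pv w (Imp (Eq TNat (SucC \<cdot> s) (SucC \<cdot> t)) (Eq TNat s t))"
    using eqv_ty[OF e]
    by (intro pv_EHA EHA_axiom.suc_inj) (auto simp: has_type_iff typeof_App_iff simp del: typeof.simps(3))
  then show ?thesis using e unfolding eqv_def by (blast intro: pv_ImpD)
qed

lemma suc_cong: "eqv w TNat s t \<Longrightarrow> eqv w TNat (SucC \<cdot> s) (SucC \<cdot> t)"
  by (rule eqv_arg) simp_all

lemma not_less_zero: "less w s ZeroC \<Longrightarrow> wf_int (cx w) C \<Longrightarrow> pv w C"
proof -
  assume s: "less w s ZeroC" and C: "wf_int (cx w) C"
  show ?thesis
  proof (rule less_E[OF s C])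
    fix w' k assume w': "ext w w'" and [simp]: "typeof k (cx w') = Some TNat"
      and e: "eqv w' TNat (plusC \<cdot> k \<cdot> (SucC \<cdot> s)) ZeroC"
    have "eqv w' TNat (SucC \<cdot> (plusC \<cdot> k \<cdot> s)) ZeroC"
      by (rule eqv_trans[OF eqv_sym[OF plus_suc] e]) (use less_ty(1)[OF pv_mono[OF s w']] in simp_all)
    then show "pv w' C" by (rule suc_ne_zero) (rule L_mono[OF C w'])
  qed
qed

lemma zero_less_suc: "typeof n (cx w) = Some TNat \<Longrightarrow> less w ZeroC (SucC \<cdot> n)"
  by (rule less_I[of w n]) (rule eqv_trans[OF plus_suc suc_cong[OF plus_zero]], simp_all)

lemma suc_less_suc: "less w s t \<Longrightarrow> less w (SucC \<cdot> s) (SucC \<cdot> t)"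
proof -
  assume s: "less w s t"
  show ?thesis
  proof (rule less_E[OF s])
    fix w' k assume w': "ext w w'" and k: "typeof k (cx w') = Some TNat"
      and e: "eqv w' TNat (plusC \<cdot> k \<cdot> (SucC \<cdot> s)) t"
    show "less w' (SucC \<cdot> s) (SucC \<cdot> t)"
      by (rule less_I[of w' k], rule eqv_trans[OF plus_suc suc_cong[OF e]])
        (use k less_ty(1)[OF pv_mono[OF s w']] in simp_all)
  qed (use less_ty[OF s] in simp)
qed

lemma suc_less_sucD: "less w (SucC \<cdot> s) (SucC \<cdot> t) \<Longrightarrow> less w s t"
proof -
  assume s: "less w (SucC \<cdot> s) (SucC \<cdot> t)"
  then have ty: "typeof s (cx w) = Some TNat" "typeof t (cx w) = Some TNat"
    using less_ty[OF s] by (auto simp: typeof_App_iff simp del: typeof.simps(3))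
  show ?thesis
  proof (rule less_E[OF s])
    fix w' k assume w': "ext w w'" and k: "typeof k (cx w') = Some TNat"
      and e: "eqv w' TNat (plusC \<cdot> k \<cdot> (SucC \<cdot> (SucC \<cdot> s))) (SucC \<cdot> t)"
    show "less w' s t"
      by (rule less_I[of w' k], rule suc_inj, rule eqv_trans[OF eqv_sym[OF plus_suc] e])
        (use k ty_mono[OF ty(1) w'] in simp_all)
  qed (use ty in simp)
qed

lemma nat_cases:
  assumes n: "typeof n (cx w) = Some TNat" and C: "wf_int (cx w) C"
    and 0: "\<And>w'. ext w w' \<Longrightarrow> eqv w' TNat n ZeroC \<Longrightarrow> pv w' C"
    and S: "\<And>w' m. ext w w' \<Longrightarrow> typeof m (cx w') = Some TNat \<Longrightarrow> eqv w' TNat n (SucC \<cdot> m) \<Longrightarrow> pv w' C"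
  shows "pv w C"
proof -
  let ?E = "Exists TNat (Eq TNat (Var 1) (SucC \<cdot> Var 0))"
  have "pv w (fsub (inst n) (Or (Eq TNat (Var 0) ZeroC) ?E))"
  proof (rule pv_nat_induct[OF _ n])
    show "pv w (fsub (inst ZeroC) (Or (Eq TNat (Var 0) ZeroC) ?E))"
      using eqv_refl[of ZeroC w TNat] by (auto simp: eqv_def intro: pv_OrI1)
    fix w' m assume m: "typeof m (cx w') = Some TNat"
    have "pv w' (Exists TNat (Eq TNat (ren Suc (SucC \<cdot> m)) (SucC \<cdot> Var 0)))"
      by (rule pv_ExistsI[of _ _ _ m]) (use m eqv_refl[of "SucC \<cdot> m" w'] in \<open>auto simp: eqv_def\<close>)
    then show "pv w' (fsub (inst (SucC \<cdot> m)) (Or (Eq TNat (Var 0) ZeroC) ?E))"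
      using m by (auto intro: pv_OrI2)
  qed simp
  then have "pv w (Or (Eq TNat n ZeroC) (Exists TNat (Eq TNat (ren Suc n) (SucC \<cdot> Var 0))))" by simp
  then show ?thesis
  proof (rule pv_OrE[OF _ C])
    fix w' assume w': "ext w w'" and "pv w' (Exists TNat (Eq TNat (ren Suc n) (SucC \<cdot> Var 0)))"
    then show "pv w' C"
      by (rule_tac pv_ExistsE[OF _ L_mono[OF C w']])
        (auto simp: eqv_def intro: S[OF ext_trans[OF w']])
  qed (auto simp: eqv_def intro: 0)
qed

text \<open>Addition recurs on its second argument, so facts about the first one, here and in
  \<open>suc_plus\<close>, need induction. They are wanted because the order is defined by a summand
  on the left.\<close>

lemma zero_plus:
  assumes n: "typeof n (cx w) = Some TNat"
  shows "eqv w TNat (plusC \<cdot> ZeroC \<cdot> n) n"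
proof -
  have "pv w (fsub (inst n) (Eq TNat (plusC \<cdot> ZeroC \<cdot> Var 0) (Var 0)))"
  proof (rule pv_nat_induct[OF _ n])
    fix w' m assume m: "typeof m (cx w') = Some TNat"
      and "pv w' (fsub (inst m) (Eq TNat (plusC \<cdot> ZeroC \<cdot> Var 0) (Var 0)))"
    then have "eqv w' TNat (plusC \<cdot> ZeroC \<cdot> (SucC \<cdot> m)) (SucC \<cdot> m)"
      by (intro eqv_trans[OF plus_suc suc_cong]) (auto simp: eqv_def)
    then show "pv w' (fsub (inst (SucC \<cdot> m)) (Eq TNat (plusC \<cdot> ZeroC \<cdot> Var 0) (Var 0)))"
      by (simp add: eqv_def)
  qed (use plus_zero[of ZeroC w] in \<open>auto simp: eqv_def\<close>)
  then show ?thesis by (simp add: eqv_def)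
qed

lemma suc_plus:
  assumes k: "typeof k (cx w) = Some TNat" and n: "typeof n (cx w) = Some TNat"
  shows "eqv w TNat (plusC \<cdot> (SucC \<cdot> k) \<cdot> n) (SucC \<cdot> (plusC \<cdot> k \<cdot> n))"
proof -
  let ?A = "Eq TNat (plusC \<cdot> (SucC \<cdot> ren Suc k) \<cdot> Var 0) (SucC \<cdot> (plusC \<cdot> ren Suc k \<cdot> Var 0))"
  have "pv w (fsub (inst n) ?A)"
  proof (rule pv_nat_induct[OF _ n])
    have "eqv w TNat (plusC \<cdot> (SucC \<cdot> k) \<cdot> ZeroC) (SucC \<cdot> (plusC \<cdot> k \<cdot> ZeroC))"
      by (rule eqv_trans[OF plus_zero suc_cong[OF eqv_sym[OF plus_zero]]]) (use k in simp_all)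
    then show "pv w (fsub (inst ZeroC) ?A)"
      by (simp add: eqv_def)
    fix w' m assume w': "ext w w'" and m[simp]: "typeof m (cx w') = Some TNat" and "pv w' (fsub (inst m) ?A)"
    then have IH: "eqv w' TNat (plusC \<cdot> (SucC \<cdot> k) \<cdot> m) (SucC \<cdot> (plusC \<cdot> k \<cdot> m))"
      by (simp add: eqv_def)
    have [simp]: "typeof k (cx w') = Some TNat" by (rule ty_mono[OF k w'])
    have "eqv w' TNat (plusC \<cdot> (SucC \<cdot> k) \<cdot> (SucC \<cdot> m)) (SucC \<cdot> (plusC \<cdot> (SucC \<cdot> k) \<cdot> m))"
      by (rule plus_suc) simp_all
    also have "eqv w' TNat \<dots> (SucC \<cdot> (SucC \<cdot> (plusC \<cdot> k \<cdot> m)))"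
      by (rule suc_cong[OF IH])
    also have "eqv w' TNat \<dots> (SucC \<cdot> (plusC \<cdot> k \<cdot> (SucC \<cdot> m)))"
      by (rule suc_cong[OF eqv_sym[OF plus_suc]]) simp_all
    finally show "pv w' (fsub (inst (SucC \<cdot> m)) ?A)"
      by (simp add: eqv_def)
  qed (use k in simp)
  then show ?thesis by (simp add: eqv_def)
qed

lemma less_suc_self: "typeof n (cx w) = Some TNat \<Longrightarrow> less w n (SucC \<cdot> n)"
  by (rule less_I[of w ZeroC]) (rule zero_plus, simp)

lemma less_suc: "less w s t \<Longrightarrow> less w s (SucC \<cdot> t)"
proof -
  assume s: "less w s t"
  show ?thesis
  proof (rule less_E[OF s])
    fix w' k assume w': "ext w w'" and k: "typeof k (cx w') = Some TNat"
      and e: "eqv w' TNat (plusC \<cdot> k \<cdot> (SucC \<cdot> s)) t"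
    show "less w' s (SucC \<cdot> t)"
      by (rule less_I[of w' "SucC \<cdot> k"], rule eqv_trans[OF suc_plus suc_cong[OF e]])
        (use k less_ty(1)[OF pv_mono[OF s w']] in simp_all)
  qed (use less_ty[OF s] in simp)
qed

text \<open>Case distinction on the summand \<open>k\<close> in \<open>k + Ss = St\<close>: for zero
  it gives \<open>s = t\<close>, and for a successor its predecessor witnesses
  \<open>s < t\<close>.\<close>

lemma less_suc_E:
  assumes s: "less w s (SucC \<cdot> t)" and C: "wf_int (cx w) C"
    and 1: "\<And>w'. ext w w' \<Longrightarrow> less w' s t \<Longrightarrow> pv w' C"
    and 2: "\<And>w'. ext w w' \<Longrightarrow> eqv w' TNat s t \<Longrightarrow> pv w' C"
  shows "pv w C"
proof (rule less_E[OF s C])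
  fix w' k assume w': "ext w w'" and k: "typeof k (cx w') = Some TNat"
    and e: "eqv w' TNat (plusC \<cdot> k \<cdot> (SucC \<cdot> s)) (SucC \<cdot> t)"
  note s' = less_ty(1)[OF pv_mono[OF s w']]
  have e': "eqv w' TNat (plusC \<cdot> k \<cdot> s) t"
    by (rule suc_inj, rule eqv_trans[OF eqv_sym[OF plus_suc] e]) (use k s' in simp_all)
  show "pv w' C"
  proof (rule nat_cases[OF k L_mono[OF C w']])
    fix w'' assume w'': "ext w' w''" and z: "eqv w'' TNat k ZeroC"
    note s'' = ty_mono[OF s' w'']
    have "eqv w'' TNat s (plusC \<cdot> ZeroC \<cdot> s)"
      by (rule eqv_sym[OF zero_plus[OF s'']])
    also have "eqv w'' TNat \<dots> (plusC \<cdot> k \<cdot> s)"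
      by (rule eqv_fun[OF eqv_arg[OF eqv_sym[OF z]]]) (use s'' in simp_all)
    also have "eqv w'' TNat \<dots> t"
      by (rule eqv_mono[OF e' w''])
    finally show "pv w'' C" by (rule 2[OF ext_trans[OF w' w'']])
  next
    fix w'' m assume w'': "ext w' w''" and m: "typeof m (cx w'') = Some TNat" and z: "eqv w'' TNat k (SucC \<cdot> m)"
    note s'' = ty_mono[OF s' w'']
    have "eqv w'' TNat (plusC \<cdot> m \<cdot> (SucC \<cdot> s)) (SucC \<cdot> (plusC \<cdot> m \<cdot> s))"
      by (rule plus_suc[OF m s''])
    also have "eqv w'' TNat \<dots> (plusC \<cdot> (SucC \<cdot> m) \<cdot> s)"
      by (rule eqv_sym[OF suc_plus[OF m s'']])
    also have "eqv w'' TNat \<dots> (plusC \<cdot> k \<cdot> s)"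
      by (rule eqv_fun[OF eqv_arg[OF eqv_sym[OF z]]]) (use s'' in simp_all)
    also have "eqv w'' TNat \<dots> t"
      by (rule eqv_mono[OF e' w''])
    finally have "less w'' s t" by (rule less_I)
    then show "pv w'' C" by (rule 1[OF ext_trans[OF w' w'']])
  qed
qed

end

lemma sub_Var_ren [simp]: "sub (\<lambda>i. Var (r i)) t = ren r t"
  by (simp add: ren_eq_sub)

lemma fsub_Var_ren [simp]: "fsub (\<lambda>i. Var (r i)) A = fren r A"
  by (simp add: fren_eq_fsub)

text \<open>Union of the values \<open>s[a]\<close> over all members \<open>a\<close> of a sequence.\<close>

definition sappLC :: "ty \<Rightarrow> ty \<Rightarrow> tm" where
  "sappLC \<sigma> \<tau> = Lam (TSeq (TFun \<sigma> (TSeq \<tau>))) (Lam (TSeq \<sigma>)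
     (LRecC \<sigma> [TSeq \<tau>] 0 \<cdot> Var 0 \<cdot> NilC \<tau>
       \<cdot> Lam (TSeq \<tau>) (Lam \<sigma> (appendC \<tau> \<cdot> (sappC \<sigma> \<tau> \<cdot> Var 3 \<cdot> Var 0) \<cdot> Var 1))))"

lemma typeof_sappLC [simp]:
  "typeof (sappLC \<sigma> \<tau>) \<Gamma> = Some (TFun (TSeq (TFun \<sigma> (TSeq \<tau>))) (TFun (TSeq \<sigma>) (TSeq \<tau>)))"
  by (simp add: sappLC_def)

lemma sub_sappLC [simp]: "sub \<theta> (sappLC \<sigma> \<tau>) = sappLC \<sigma> \<tau>" "ren r (sappLC \<sigma> \<tau>) = sappLC \<sigma> \<tau>"
  by (rule sub_closed ren_closed, simp)+

fun sappsL :: "ty list \<Rightarrow> ty \<Rightarrow> tm \<Rightarrow> tm list \<Rightarrow> tm" where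
  "sappsL (\<sigma> # \<sigma>s) \<tau> s (t # ts) = sappsL \<sigma>s \<tau> (sappLC \<sigma> (sapp_elem \<sigma>s \<tau>) \<cdot> s \<cdot> t) ts"
| "sappsL _ \<tau> s _ = s"

lemma sub_sapps [simp]: "sub \<theta> (sapps \<sigma>s \<tau> s ts) = sapps \<sigma>s \<tau> (sub \<theta> s) (map (sub \<theta>) ts)"
  by (induction \<sigma>s \<tau> s ts rule: sapps.induct) auto

lemma sub_sappsL [simp]: "sub \<theta> (sappsL \<sigma>s \<tau> s ts) = sappsL \<sigma>s \<tau> (sub \<theta> s) (map (sub \<theta>) ts)"
  by (induction \<sigma>s \<tau> s ts rule: sappsL.induct) auto

lemma typeof_sapps:
  "typeof s \<Gamma> = Some (TSeq (sapp_elem \<sigma>s \<tau>)) \<Longrightarrow> map (\<lambda>t. typeof t \<Gamma>) ts = map Some \<sigma>s \<Longrightarrow>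
    typeof (sapps \<sigma>s \<tau> s ts) \<Gamma> = Some (TSeq \<tau>)"
  by (induction \<sigma>s \<tau> s ts rule: sapps.induct) auto

lemma typeof_sappsL:
  "typeof s \<Gamma> = Some (TSeq (sapp_elem \<sigma>s \<tau>)) \<Longrightarrow> map (\<lambda>t. typeof t \<Gamma>) ts = map (\<lambda>\<sigma>. Some (TSeq \<sigma>)) \<sigma>s \<Longrightarrow>
    typeof (sappsL \<sigma>s \<tau> s ts) \<Gamma> = Some (TSeq \<tau>)"
  by (induction \<sigma>s \<tau> s ts rule: sappsL.induct) auto

lemma sapp_elem_append: "sapp_elem (\<sigma>s @ \<sigma>s') \<tau> = sapp_elem \<sigma>s (sapp_elem \<sigma>s' \<tau>)"
  by (induction \<sigma>s) auto

lemma sapps_append: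
  "length ts = length \<sigma>s \<Longrightarrow>
    sapps (\<sigma>s @ \<sigma>s') \<tau> s (ts @ ts') = sapps \<sigma>s' \<tau> (sapps \<sigma>s (sapp_elem \<sigma>s' \<tau>) s ts) ts'"
proof (induction \<sigma>s arbitrary: s ts)
  case (Cons \<sigma> \<sigma>s)
  then show ?case by (cases ts) (auto simp: sapp_elem_append)
qed simp

text \<open>Iterated \<open>\<Lambda>\<close>-abstraction.\<close>

primrec slam :: "ty list \<Rightarrow> ty \<Rightarrow> tm \<Rightarrow> tm" where
  "slam [] \<tau> b = b"
| "slam (\<sigma> # \<sigma>s) \<tau> b = (let \<phi> = TFun \<sigma> (TSeq (sapp_elem \<sigma>s \<tau>)) in
     ConsC \<phi> \<cdot> Lam \<sigma> (slam \<sigma>s \<tau> b) \<cdot> NilC \<phi>)"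

lemma typeof_slam:
  "typeof b (rev \<sigma>s @ \<Gamma>) = Some (TSeq \<tau>) \<Longrightarrow> typeof (slam \<sigma>s \<tau> b) \<Gamma> = Some (TSeq (sapp_elem \<sigma>s \<tau>))"
  by (induction \<sigma>s arbitrary: \<Gamma>) (auto simp: Let_def)

abbreviation single :: "ty \<Rightarrow> tm \<Rightarrow> tm" where
  "single \<sigma> a \<equiv> ConsC \<sigma> \<cdot> a \<cdot> NilC \<sigma>"

context eha
begin

section \<open>Membership in finite sequences, and induction on sequences\<close>

abbreviation mem :: "world \<Rightarrow> ty \<Rightarrow> tm \<Rightarrow> tm \<Rightarrow> bool" where
  "mem w \<sigma> s t \<equiv> pv w (mem_fm \<sigma> s t)"

lemma wf_mono1: "wf_int (\<sigma> # cx w) A \<Longrightarrow> ext w w' \<Longrightarrow> wf_int (\<sigma> # cx w') A"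
  using L_append[of "\<sigma> # cx w" A] unfolding ext_def by auto

lemma mem_ty: "mem w \<sigma> s t \<Longrightarrow> typeof s (cx w) = Some \<sigma>" "mem w \<sigma> s t \<Longrightarrow> typeof t (cx w) = Some (TSeq \<sigma>)"
  by (auto dest: pv_L)

lemma mem_cong: "mem w \<sigma> s t \<Longrightarrow> eqv w \<sigma> s s' \<Longrightarrow> eqv w (TSeq \<sigma>) t t' \<Longrightarrow> mem w \<sigma> s' t'"
  using eqv_fsub[of "[\<sigma>, TSeq \<sigma>]" "mem_fm \<sigma> (Var 0) (Var 1)" w "case_nat s (inst t)" "case_nat s' (inst t')"]
  by (auto simp: nth_Cons split: nat.splits)

lemma mem_cong2: "mem w \<sigma> s t \<Longrightarrow> eqv w (TSeq \<sigma>) t t' \<Longrightarrow> mem w \<sigma> s t'"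
  by (rule mem_cong) (auto intro: eqv_refl dest: mem_ty)

lemma mem_I: "less w i (lenC \<sigma> \<cdot> t) \<Longrightarrow> eqv w \<sigma> s (projC \<sigma> \<cdot> t \<cdot> i) \<Longrightarrow> mem w \<sigma> s t"
proof -
  assume i: "less w i (lenC \<sigma> \<cdot> t)" and s: "eqv w \<sigma> s (projC \<sigma> \<cdot> t \<cdot> i)"
  have t: "typeof t (cx w) = Some (TSeq \<sigma>)"
    using less_ty(2)[OF i] by (auto simp: typeof_App_iff simp del: typeof.simps(3))
  show ?thesis unfolding mem_fm_def
    by (rule pv_ExistsI[of TNat w _ i])
      (use i s t eqv_ty(1)[OF s] less_ty(1)[OF i] in \<open>auto simp: eqv_def intro: pv_AndI\<close>)
qed

lemma mem_E:
  assumes m: "mem w \<sigma> s t" and C: "wf_int (cx w) C"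
    and "\<And>w' i. ext w w' \<Longrightarrow> less w' i (lenC \<sigma> \<cdot> t) \<Longrightarrow> eqv w' \<sigma> s (projC \<sigma> \<cdot> t \<cdot> i) \<Longrightarrow> pv w' C"
  shows "pv w C"
proof (rule pv_ExistsE[OF m[unfolded mem_fm_def] C])
  fix w' i assume "ext w w'" and "pv w' (fsub (inst i) (And (less_fm (Var 0) (lenC \<sigma> \<cdot> shift 1 t))
    (Eq \<sigma> (shift 1 s) (projC \<sigma> \<cdot> shift 1 t \<cdot> Var 0))))"
  then show "pv w' C"
    by (intro assms(3)) (auto simp: eqv_def dest: pv_AndD1 pv_AndD2)
qed

lemma mem_nil: "mem w \<sigma> s (NilC \<sigma>) \<Longrightarrow> wf_int (cx w) C \<Longrightarrow> pv w C"
proof -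
  assume m: "mem w \<sigma> s (NilC \<sigma>)" and C: "wf_int (cx w) C"
  show ?thesis
  proof (rule mem_E[OF m C])
    fix w' i assume w': "ext w w'" and i: "less w' i (lenC \<sigma> \<cdot> NilC \<sigma>)"
    have "less w' i ZeroC"
      by (rule less_cong[OF i eqv_refl[OF less_ty(1)[OF i]] len_nil])
    then show "pv w' C" by (rule not_less_zero[OF _ L_mono[OF C w']])
  qed
qed

text \<open>Membership is given by an index, so the two cases are those of the index being zero or a
  successor.\<close>

lemma mem_cons_E:
  assumes m: "mem w \<sigma> s (ConsC \<sigma> \<cdot> a \<cdot> x)" and C: "wf_int (cx w) C"
    and 1: "\<And>w'. ext w w' \<Longrightarrow> eqv w' \<sigma> s a \<Longrightarrow> pv w' C"
    and 2: "\<And>w'. ext w w' \<Longrightarrow> mem w' \<sigma> s x \<Longrightarrow> pv w' C"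
  shows "pv w C"
proof (rule mem_E[OF m C])
  have ty: "typeof a (cx w) = Some \<sigma>" "typeof x (cx w) = Some (TSeq \<sigma>)"
    using mem_ty(2)[OF m] by (auto simp: typeof_App_iff simp del: typeof.simps(3))
  fix w' i assume w': "ext w w'" and i: "less w' i (lenC \<sigma> \<cdot> (ConsC \<sigma> \<cdot> a \<cdot> x))"
    and s: "eqv w' \<sigma> s (projC \<sigma> \<cdot> (ConsC \<sigma> \<cdot> a \<cdot> x) \<cdot> i)"
  show "pv w' C"
  proof (rule nat_cases[OF less_ty(1)[OF i] L_mono[OF C w']])
    fix w'' assume w'': "ext w' w''" and z: "eqv w'' TNat i ZeroC"
    note ty' = ty[THEN ty_mono[OF _ ext_trans[OF w' w'']]]
    note eqv_mono[OF s w'']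
    also have "eqv w'' \<sigma> (projC \<sigma> \<cdot> (ConsC \<sigma> \<cdot> a \<cdot> x) \<cdot> i) (projC \<sigma> \<cdot> (ConsC \<sigma> \<cdot> a \<cdot> x) \<cdot> ZeroC)"
      by (rule eqv_arg[OF z]) (use ty' in simp)
    also have "eqv w'' \<sigma> \<dots> a" by (rule proj_zero[OF ty'])
    finally show "pv w'' C" by (rule 1[OF ext_trans[OF w' w'']])
  next
    fix w'' j assume w'': "ext w' w''" and j: "typeof j (cx w'') = Some TNat" and z: "eqv w'' TNat i (SucC \<cdot> j)"
    note ty' = ty[THEN ty_mono[OF _ ext_trans[OF w' w'']]]
    note eqv_mono[OF s w'']
    also have "eqv w'' \<sigma> (projC \<sigma> \<cdot> (ConsC \<sigma> \<cdot> a \<cdot> x) \<cdot> i) (projC \<sigma> \<cdot> (ConsC \<sigma> \<cdot> a \<cdot> x) \<cdot> (SucC \<cdot> j))"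
      by (rule eqv_arg[OF z]) (use ty' in simp)
    also have "eqv w'' \<sigma> \<dots> (projC \<sigma> \<cdot> x \<cdot> j)" by (rule proj_suc[OF ty' j])
    finally have "mem w'' \<sigma> s x"
      by (rule mem_I[rotated]) (rule suc_less_sucD[OF less_cong[OF pv_mono[OF i w''] z len_cons[OF ty']]])
    then show "pv w'' C" by (rule 2[OF ext_trans[OF w' w'']])
  qed
qed

lemma mem_cons_I1:
  assumes s: "eqv w \<sigma> s a" and x: "typeof x (cx w) = Some (TSeq \<sigma>)"
  shows "mem w \<sigma> s (ConsC \<sigma> \<cdot> a \<cdot> x)"
proof (rule mem_I)
  note a = eqv_ty(2)[OF s]
  show "less w ZeroC (lenC \<sigma> \<cdot> (ConsC \<sigma> \<cdot> a \<cdot> x))"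
    by (rule less_cong[OF zero_less_suc eqv_refl eqv_sym[OF len_cons[OF a x]]]) (use x in simp_all)
  show "eqv w \<sigma> s (projC \<sigma> \<cdot> (ConsC \<sigma> \<cdot> a \<cdot> x) \<cdot> ZeroC)"
    by (rule eqv_trans[OF s eqv_sym[OF proj_zero[OF a x]]])
qed

lemma mem_cons_I2:
  assumes s: "mem w \<sigma> s x" and a: "typeof a (cx w) = Some \<sigma>"
  shows "mem w \<sigma> s (ConsC \<sigma> \<cdot> a \<cdot> x)"
proof (rule mem_E[OF s])
  fix w' i assume w': "ext w w'" and i: "less w' i (lenC \<sigma> \<cdot> x)" and e: "eqv w' \<sigma> s (projC \<sigma> \<cdot> x \<cdot> i)"
  note ty = ty_mono[OF a w'] ty_mono[OF mem_ty(2)[OF s] w'] and i' = less_ty(1)[OF i]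
  show "mem w' \<sigma> s (ConsC \<sigma> \<cdot> a \<cdot> x)"
  proof (rule mem_I)
    show "less w' (SucC \<cdot> i) (lenC \<sigma> \<cdot> (ConsC \<sigma> \<cdot> a \<cdot> x))"
      by (rule less_cong[OF suc_less_suc[OF i] eqv_refl eqv_sym[OF len_cons[OF ty]]]) (use i' in simp)
    show "eqv w' \<sigma> s (projC \<sigma> \<cdot> (ConsC \<sigma> \<cdot> a \<cdot> x) \<cdot> (SucC \<cdot> i))"
      by (rule eqv_trans[OF e eqv_sym[OF proj_suc[OF ty i']]])
  qed
qed (use mem_ty[OF s] a in simp)

lemma mem_single: "typeof a (cx w) = Some \<sigma> \<Longrightarrow> mem w \<sigma> a (single \<sigma> a)"
  by (rule mem_cons_I1) (auto intro: eqv_refl)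

lemma list_cases:
  assumes x: "typeof x (cx w) = Some (TSeq \<sigma>)" and C: "wf_int (cx w) C"
    and 0: "\<And>w'. ext w w' \<Longrightarrow> eqv w' (TSeq \<sigma>) x (NilC \<sigma>) \<Longrightarrow> pv w' C"
    and S: "\<And>w' a y. ext w w' \<Longrightarrow> typeof a (cx w') = Some \<sigma> \<Longrightarrow> typeof y (cx w') = Some (TSeq \<sigma>) \<Longrightarrow>
      eqv w' (TSeq \<sigma>) x (ConsC \<sigma> \<cdot> a \<cdot> y) \<Longrightarrow> pv w' C"
  shows "pv w C"
proof -
  have "pv w (Or (Eq (TSeq \<sigma>) x (NilC \<sigma>))
    (Exists \<sigma> (Exists (TSeq \<sigma>) (Eq (TSeq \<sigma>) (ren (\<lambda>i. Suc (Suc i)) x) (ConsC \<sigma> \<cdot> Var 1 \<cdot> Var 0)))))"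
    using pv_ForallD[OF pv_EHA[OF EHA_axiom.seq_cases] x] by simp
  then show ?thesis
  proof (rule pv_OrE[OF _ C])
    fix w1 assume w1: "ext w w1"
      and e: "pv w1 (Exists \<sigma> (Exists (TSeq \<sigma>) (Eq (TSeq \<sigma>) (ren (\<lambda>i. Suc (Suc i)) x) (ConsC \<sigma> \<cdot> Var 1 \<cdot> Var 0))))"
    show "pv w1 C"
    proof (rule pv_ExistsE[OF e L_mono[OF C w1]])
      fix w2 a assume w2: "ext w1 w2" and a: "typeof a (cx w2) = Some \<sigma>"
        and "pv w2 (fsub (inst a) (Exists (TSeq \<sigma>) (Eq (TSeq \<sigma>) (ren (\<lambda>i. Suc (Suc i)) x) (ConsC \<sigma> \<cdot> Var 1 \<cdot> Var 0))))"
      then have e: "pv w2 (Exists (TSeq \<sigma>) (Eq (TSeq \<sigma>) (ren Suc x) (ConsC \<sigma> \<cdot> ren Suc a \<cdot> Var 0)))"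
        by simp
      note w2' = ext_trans[OF w1 w2]
      show "pv w2 C"
      proof (rule pv_ExistsE[OF e L_mono[OF C w2']])
        fix w3 y assume w3: "ext w2 w3" and y: "typeof y (cx w3) = Some (TSeq \<sigma>)"
          and "pv w3 (fsub (inst y) (Eq (TSeq \<sigma>) (ren Suc x) (ConsC \<sigma> \<cdot> ren Suc a \<cdot> Var 0)))"
        then show "pv w3 C"
          by (intro S[OF ext_trans[OF w2' w3] ty_mono[OF a w3] y]) (simp add: eqv_def)
      qed
    qed
  qed (auto intro: 0 simp: eqv_def)
qed

text \<open>Induction on sequences is not an axiom. It is reduced to induction on a number n for the
  formula that all sequences of length n satisfy \<open>A\<close>, with \<open>list_cases\<close>
  splitting the sequence; lengths that do not fit are refuted by \<open>suc_ne_zero\<close>.\<close>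

lemma pv_list_induct:
  assumes A: "wf_int (TSeq \<sigma> # cx w) A" and x: "typeof x (cx w) = Some (TSeq \<sigma>)"
    and 0: "pv w (fsub (inst (NilC \<sigma>)) A)"
    and S: "\<And>w' a y. ext w w' \<Longrightarrow> typeof a (cx w') = Some \<sigma> \<Longrightarrow> typeof y (cx w') = Some (TSeq \<sigma>) \<Longrightarrow>
      pv w' (fsub (inst y) A) \<Longrightarrow> pv w' (fsub (inst (ConsC \<sigma> \<cdot> a \<cdot> y)) A)"
  shows "pv w (fsub (inst x) A)"
proof -
  let ?E = "\<lambda>n. Eq TNat (lenC \<sigma> \<cdot> Var 0) n"
  let ?A = "Forall (TSeq \<sigma>) (Imp (?E (Var 1)) (fren (skip 1) A))"
  have sk: "(\<lambda>i. up (inst n) (skip 1 i)) = Var" for n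
    by (rule HOL.ext) (simp add: skip_def up_def split: nat.split)
  have subst: "fsub (inst n) ?A = Forall (TSeq \<sigma>) (Imp (?E (ren Suc n)) A)" for n
    using sk[of n] by simp
  have wfA: "wf_int (cx w') (fsub (inst y) A)" if "ext w w'" "typeof y (cx w') = Some (TSeq \<sigma>)" for w' y
    by (rule L_inst[OF wf_mono1[OF A that(1)] that(2)])
  have wf: "wf_int (TSeq \<sigma> # cx w') (Imp (?E (ren Suc n)) A)" if "ext w w'" "typeof n (cx w') = Some TNat" for w' n
    using that wf_mono1[OF A] by auto
  have len: "typeof (lenC \<sigma> \<cdot> x) (cx w) = Some TNat" using x by simp
  have "pv w (fsub (inst (lenC \<sigma> \<cdot> x)) ?A)"
  proof (rule pv_nat_induct[OF _ len])
    have "wf_int (TSeq \<sigma> # TNat # cx w) (fren (skip 1) A)"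
      using A wf_fren[of "TSeq \<sigma> # cx w" "skip 1" "TSeq \<sigma> # TNat # cx w" A]
      by (auto simp: wf_int_def skip_def nth_Cons split: nat.splits)
    then show "wf_int (TNat # cx w) ?A" by simp
    show "pv w (fsub (inst ZeroC) ?A)" unfolding subst
    proof (rule pv_ForallI)
      fix w1 y assume w1: "ext w w1" and y: "typeof y (cx w1) = Some (TSeq \<sigma>)"
      have "pv w1 (Imp (Eq TNat (lenC \<sigma> \<cdot> y) ZeroC) (fsub (inst y) A))"
      proof (rule pv_ImpI)
        fix w2 assume w2: "ext w1 w2" and "pv w2 (Eq TNat (lenC \<sigma> \<cdot> y) ZeroC)"
        then have e: "eqv w2 TNat (lenC \<sigma> \<cdot> y) ZeroC" by (simp add: eqv_def)
        note w2' = ext_trans[OF w1 w2] and y2 = ty_mono[OF y w2]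
        show "pv w2 (fsub (inst y) A)"
        proof (rule list_cases[OF y2 wfA[OF w2' y2]])
          fix w3 assume w3: "ext w2 w3" and e: "eqv w3 (TSeq \<sigma>) y (NilC \<sigma>)"
          note w3' = ext_trans[OF w2' w3]
          show "pv w3 (fsub (inst y) A)"
            by (rule pv_inst_cong[OF eqv_sym[OF e] pv_mono[OF 0 w3'] wf_mono1[OF A w3']])
        next
          fix w3 a z assume w3: "ext w2 w3" and az: "typeof a (cx w3) = Some \<sigma>" "typeof z (cx w3) = Some (TSeq \<sigma>)"
            and ey: "eqv w3 (TSeq \<sigma>) y (ConsC \<sigma> \<cdot> a \<cdot> z)"
          have "eqv w3 TNat (SucC \<cdot> (lenC \<sigma> \<cdot> z)) (lenC \<sigma> \<cdot> (ConsC \<sigma> \<cdot> a \<cdot> z))"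
            by (rule eqv_sym[OF len_cons[OF az]])
          also have "eqv w3 TNat \<dots> (lenC \<sigma> \<cdot> y)"
            by (rule eqv_arg[OF eqv_sym[OF ey]]) simp
          also note eqv_mono[OF e w3]
          finally show "pv w3 (fsub (inst y) A)"
            by (rule suc_ne_zero) (rule wfA[OF ext_trans[OF w2' w3] ty_mono[OF y2 w3]])
        qed
      qed (use y wfA[OF w1 y] in simp_all)
      then show "pv w1 (fsub (inst y) (Imp (?E (ren Suc ZeroC)) A))" by simp
    qed (rule wf, simp_all)
    fix w' n assume w': "ext w w'" and n: "typeof n (cx w') = Some TNat" and IH: "pv w' (fsub (inst n) ?A)"
    show "pv w' (fsub (inst (SucC \<cdot> n)) ?A)" unfolding subst
    proof (rule pv_ForallI)
      fix w1 y assume w1: "ext w' w1" and y: "typeof y (cx w1) = Some (TSeq \<sigma>)"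
      note w1' = ext_trans[OF w' w1]
      have "pv w1 (Imp (Eq TNat (lenC \<sigma> \<cdot> y) (SucC \<cdot> n)) (fsub (inst y) A))"
      proof (rule pv_ImpI)
        fix w2 assume w2: "ext w1 w2" and "pv w2 (Eq TNat (lenC \<sigma> \<cdot> y) (SucC \<cdot> n))"
        then have e: "eqv w2 TNat (lenC \<sigma> \<cdot> y) (SucC \<cdot> n)" by (simp add: eqv_def)
        note w2' = ext_trans[OF w1' w2] and y2 = ty_mono[OF y w2]
        show "pv w2 (fsub (inst y) A)"
        proof (rule list_cases[OF y2 wfA[OF w2' y2]])
          fix w3 assume w3: "ext w2 w3" and ey: "eqv w3 (TSeq \<sigma>) y (NilC \<sigma>)"
          have "eqv w3 TNat (SucC \<cdot> n) (lenC \<sigma> \<cdot> y)"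
            by (rule eqv_sym[OF eqv_mono[OF e w3]])
          also have "eqv w3 TNat \<dots> (lenC \<sigma> \<cdot> NilC \<sigma>)"
            by (rule eqv_arg[OF ey]) simp
          also have "eqv w3 TNat \<dots> ZeroC" by (rule len_nil)
          finally show "pv w3 (fsub (inst y) A)"
            by (rule suc_ne_zero) (rule wfA[OF ext_trans[OF w2' w3] ty_mono[OF y2 w3]])
        next
          fix w3 a z assume w3: "ext w2 w3" and az: "typeof a (cx w3) = Some \<sigma>" "typeof z (cx w3) = Some (TSeq \<sigma>)"
            and ey: "eqv w3 (TSeq \<sigma>) y (ConsC \<sigma> \<cdot> a \<cdot> z)"
          note w3' = ext_trans[OF w2' w3]
          have "eqv w3 TNat (SucC \<cdot> (lenC \<sigma> \<cdot> z)) (lenC \<sigma> \<cdot> (ConsC \<sigma> \<cdot> a \<cdot> z))"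
            by (rule eqv_sym[OF len_cons[OF az]])
          also have "eqv w3 TNat \<dots> (lenC \<sigma> \<cdot> y)"
            by (rule eqv_arg[OF eqv_sym[OF ey]]) simp
          also note eqv_mono[OF e w3]
          finally have l: "eqv w3 TNat (lenC \<sigma> \<cdot> z) n" by (rule suc_inj)
          have "pv w3 (Forall (TSeq \<sigma>) (Imp (?E (ren Suc n)) A))"
            using pv_mono[OF IH ext_trans[OF w1 ext_trans[OF w2 w3]]] unfolding subst .
          from pv_ForallD[OF this az(2)] have "pv w3 (Imp (Eq TNat (lenC \<sigma> \<cdot> z) n) (fsub (inst z) A))"
            by simp
          then have "pv w3 (fsub (inst z) A)"
            by (rule pv_ImpD) (use l in \<open>simp add: eqv_def\<close>)
          then have "pv w3 (fsub (inst (ConsC \<sigma> \<cdot> a \<cdot> z)) A)" by (rule S[OF w3' az])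
          then show "pv w3 (fsub (inst y) A)"
            by (rule pv_inst_cong[OF eqv_sym[OF ey] _ wf_mono1[OF A w3']])
        qed
      qed (use y ty_mono[OF n w1] wfA[OF w1' y] in simp_all)
      then show "pv w1 (fsub (inst y) (Imp (?E (ren Suc (SucC \<cdot> n))) A))" by simp
    qed (rule wf[OF w'], use n in simp)
  qed
  then have "pv w (Forall (TSeq \<sigma>) (Imp (?E (ren Suc (lenC \<sigma> \<cdot> x))) A))" unfolding subst .
  from pv_ForallD[OF this x] have "pv w (Imp (Eq TNat (lenC \<sigma> \<cdot> x) (lenC \<sigma> \<cdot> x)) (fsub (inst x) A))"
    by simp
  then show ?thesis
    by (rule pv_ImpD) (use eqv_refl[OF len] in \<open>simp add: eqv_def\<close>)
qed

text \<open>Induction is available for formulas of the system, not for the rule itself. So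
  membership in one of the two parts is first proved as a disjunction, by induction on
  \<open>x\<close>, and \<open>C\<close> is drawn from it afterwards.\<close>

lemma mem_append_E:
  assumes m: "mem w \<sigma> z (appendC \<sigma> \<cdot> x \<cdot> y)" and C: "wf_int (cx w) C"
    and 1: "\<And>w'. ext w w' \<Longrightarrow> mem w' \<sigma> z x \<Longrightarrow> pv w' C"
    and 2: "\<And>w'. ext w w' \<Longrightarrow> mem w' \<sigma> z y \<Longrightarrow> pv w' C"
  shows "pv w C"
proof -
  have ty: "typeof x (cx w) = Some (TSeq \<sigma>)" "typeof y (cx w) = Some (TSeq \<sigma>)" "typeof z (cx w) = Some \<sigma>"
    using mem_ty[OF m] by (auto simp: typeof_App_iff simp del: typeof.simps(3))
  let ?A = "Imp (mem_fm \<sigma> (ren Suc z) (appendC \<sigma> \<cdot> Var 0 \<cdot> ren Suc y))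
    (Or (mem_fm \<sigma> (ren Suc z) (Var 0)) (mem_fm \<sigma> (ren Suc z) (ren Suc y)))"
  have "pv w (fsub (inst x) ?A)"
  proof (rule pv_list_induct[OF _ ty(1)])
    have "pv w (Imp (mem_fm \<sigma> z (appendC \<sigma> \<cdot> NilC \<sigma> \<cdot> y)) (Or (mem_fm \<sigma> z (NilC \<sigma>)) (mem_fm \<sigma> z y)))"
    proof (rule pv_ImpI)
      fix w' assume w': "ext w w'" and m: "mem w' \<sigma> z (appendC \<sigma> \<cdot> NilC \<sigma> \<cdot> y)"
      show "pv w' (Or (mem_fm \<sigma> z (NilC \<sigma>)) (mem_fm \<sigma> z y))"
        by (rule pv_OrI2[OF mem_cong2[OF m append_nil]]) (use ty[THEN ty_mono[OF _ w']] in simp_all)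
    qed (use ty in simp)
    then show "pv w (fsub (inst (NilC \<sigma>)) ?A)" by simp
    fix w' a v assume w': "ext w w'" and av: "typeof a (cx w') = Some \<sigma>" "typeof v (cx w') = Some (TSeq \<sigma>)"
      and "pv w' (fsub (inst v) ?A)"
    then have IH: "pv w' (Imp (mem_fm \<sigma> z (appendC \<sigma> \<cdot> v \<cdot> y)) (Or (mem_fm \<sigma> z v) (mem_fm \<sigma> z y)))"
      by simp
    note ty' = ty[THEN ty_mono[OF _ w']]
    let ?C = "Or (mem_fm \<sigma> z (ConsC \<sigma> \<cdot> a \<cdot> v)) (mem_fm \<sigma> z y)"
    have "pv w' (Imp (mem_fm \<sigma> z (appendC \<sigma> \<cdot> (ConsC \<sigma> \<cdot> a \<cdot> v) \<cdot> y)) ?C)"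
    proof (rule pv_ImpI)
      fix w2 assume w2: "ext w' w2" and m: "mem w2 \<sigma> z (appendC \<sigma> \<cdot> (ConsC \<sigma> \<cdot> a \<cdot> v) \<cdot> y)"
      note ty2 = ty'[THEN ty_mono[OF _ w2]] and av2 = av[THEN ty_mono[OF _ w2]]
      have m': "mem w2 \<sigma> z (ConsC \<sigma> \<cdot> a \<cdot> (appendC \<sigma> \<cdot> v \<cdot> y))"
        by (rule mem_cong2[OF m append_cons[OF av2 ty2(2)]])
      have C: "wf_int (cx w2) ?C" using ty2 av2 by simp
      show "pv w2 ?C"
      proof (rule mem_cons_E[OF m' C])
        fix w3 assume w3: "ext w2 w3" and e: "eqv w3 \<sigma> z a"
        show "pv w3 ?C"
          by (rule pv_OrI1[OF mem_cons_I1[OF e]]) (use av2 ty2 in \<open>auto intro: ty_mono[OF _ w3]\<close>)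
      next
        fix w3 assume w3: "ext w2 w3" and e: "mem w3 \<sigma> z (appendC \<sigma> \<cdot> v \<cdot> y)"
        from pv_ImpD[OF pv_mono[OF IH ext_trans[OF w2 w3]] e]
        show "pv w3 ?C"
        proof (rule pv_OrE[OF _ L_mono[OF C w3]])
          fix w4 assume w4: "ext w3 w4" and e: "mem w4 \<sigma> z v"
          note w4' = ext_trans[OF w3 w4]
          show "pv w4 ?C"
            by (rule pv_OrI1[OF mem_cons_I2[OF e]]) (use av2 ty2 in \<open>auto intro: ty_mono[OF _ w4']\<close>)
        next
          fix w4 assume w4: "ext w3 w4" and e: "mem w4 \<sigma> z y"
          note w4' = ext_trans[OF w3 w4]
          show "pv w4 ?C"
            by (rule pv_OrI2[OF e]) (use av2 ty2 in \<open>auto intro: ty_mono[OF _ w4']\<close>)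
        qed
      qed
    qed (use ty' av in simp)
    then show "pv w' (fsub (inst (ConsC \<sigma> \<cdot> a \<cdot> v)) ?A)" by simp
  qed (use ty in simp)
  then have "pv w (Imp (mem_fm \<sigma> z (appendC \<sigma> \<cdot> x \<cdot> y)) (Or (mem_fm \<sigma> z x) (mem_fm \<sigma> z y)))" by simp
  from pv_ImpD[OF this m] show ?thesis by (rule pv_OrE[OF _ C 1 2])
qed

lemma mem_append_I2:
  assumes m: "mem w \<sigma> z y" and x: "typeof x (cx w) = Some (TSeq \<sigma>)"
  shows "mem w \<sigma> z (appendC \<sigma> \<cdot> x \<cdot> y)"
proof -
  note ty = mem_ty[OF m]
  have "pv w (fsub (inst x) (mem_fm \<sigma> (ren Suc z) (appendC \<sigma> \<cdot> Var 0 \<cdot> ren Suc y)))"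
  proof (rule pv_list_induct[OF _ x])
    show "pv w (fsub (inst (NilC \<sigma>)) (mem_fm \<sigma> (ren Suc z) (appendC \<sigma> \<cdot> Var 0 \<cdot> ren Suc y)))"
      using mem_cong2[OF m eqv_sym[OF append_nil[OF ty(2)]]] by simp
    fix w' a v assume w': "ext w w'" and av: "typeof a (cx w') = Some \<sigma>" "typeof v (cx w') = Some (TSeq \<sigma>)"
      and "pv w' (fsub (inst v) (mem_fm \<sigma> (ren Suc z) (appendC \<sigma> \<cdot> Var 0 \<cdot> ren Suc y)))"
    then have IH: "mem w' \<sigma> z (appendC \<sigma> \<cdot> v \<cdot> y)" by simp
    show "pv w' (fsub (inst (ConsC \<sigma> \<cdot> a \<cdot> v)) (mem_fm \<sigma> (ren Suc z) (appendC \<sigma> \<cdot> Var 0 \<cdot> ren Suc y)))"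
      using mem_cong2[OF mem_cons_I2[OF IH av(1)] eqv_sym[OF append_cons[OF av ty_mono[OF ty(2) w']]]] by simp
  qed (use ty in simp)
  then show ?thesis by simp
qed

lemma mem_append_I1:
  assumes m: "mem w \<sigma> z x" and y: "typeof y (cx w) = Some (TSeq \<sigma>)"
  shows "mem w \<sigma> z (appendC \<sigma> \<cdot> x \<cdot> y)"
proof -
  note ty = mem_ty[OF m]
  let ?A = "Imp (mem_fm \<sigma> (ren Suc z) (Var 0)) (mem_fm \<sigma> (ren Suc z) (appendC \<sigma> \<cdot> Var 0 \<cdot> ren Suc y))"
  have "pv w (fsub (inst x) ?A)"
  proof (rule pv_list_induct[OF _ ty(2)])
    have "pv w (Imp (mem_fm \<sigma> z (NilC \<sigma>)) (mem_fm \<sigma> z (appendC \<sigma> \<cdot> NilC \<sigma> \<cdot> y)))"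
      by (rule pv_ImpI, use ty y in simp, rule mem_nil)
        (use ty y in \<open>auto intro: ty_mono\<close>)
    then show "pv w (fsub (inst (NilC \<sigma>)) ?A)" by simp
    fix w' a v assume w': "ext w w'" and av: "typeof a (cx w') = Some \<sigma>" "typeof v (cx w') = Some (TSeq \<sigma>)"
      and "pv w' (fsub (inst v) ?A)"
    then have IH: "pv w' (Imp (mem_fm \<sigma> z v) (mem_fm \<sigma> z (appendC \<sigma> \<cdot> v \<cdot> y)))" by simp
    note z' = ty_mono[OF ty(1) w'] and y' = ty_mono[OF y w']
    let ?C = "mem_fm \<sigma> z (appendC \<sigma> \<cdot> (ConsC \<sigma> \<cdot> a \<cdot> v) \<cdot> y)"
    have "pv w' (Imp (mem_fm \<sigma> z (ConsC \<sigma> \<cdot> a \<cdot> v)) ?C)"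
    proof (rule pv_ImpI)
      fix w2 assume w2: "ext w' w2" and m: "mem w2 \<sigma> z (ConsC \<sigma> \<cdot> a \<cdot> v)"
      note y2 = ty_mono[OF y' w2] and av2 = av[THEN ty_mono[OF _ w2]] and z2 = ty_mono[OF z' w2]
      have "mem w2 \<sigma> z (ConsC \<sigma> \<cdot> a \<cdot> (appendC \<sigma> \<cdot> v \<cdot> y))" (is "pv w2 ?C'")
      proof (rule mem_cons_E[OF m])
        fix w3 assume w3: "ext w2 w3" and e: "eqv w3 \<sigma> z a"
        show "pv w3 ?C'"
          by (rule mem_cons_I1[OF e]) (use av2 y2 in \<open>auto intro: ty_mono[OF _ w3]\<close>)
      next
        fix w3 assume w3: "ext w2 w3" and e: "mem w3 \<sigma> z v"
        show "pv w3 ?C'"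
          by (rule mem_cons_I2[OF pv_ImpD[OF pv_mono[OF IH ext_trans[OF w2 w3]] e]])
            (rule ty_mono[OF av2(1) w3])
      qed (use y2 av2 z2 in simp)
      then show "pv w2 ?C"
        by (rule mem_cong2) (rule eqv_sym[OF append_cons[OF av2 y2]])
    qed (use z' av in simp)
    then show "pv w' (fsub (inst (ConsC \<sigma> \<cdot> a \<cdot> v)) ?A)" by simp
  qed (use ty y in simp)
  then have "pv w (Imp (mem_fm \<sigma> z x) (mem_fm \<sigma> z (appendC \<sigma> \<cdot> x \<cdot> y)))" by simp
  then show ?thesis using m by (rule pv_ImpD)
qed

end

lemma typeof_ren_Suc_Suc [simp]: "typeof (ren (\<lambda>i. Suc (Suc i)) t) (\<sigma> # \<tau> # \<Gamma>) = typeof t \<Gamma>"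
  by (rule typeof_ren) auto

abbreviation tys :: "world \<Rightarrow> tm list \<Rightarrow> ty list \<Rightarrow> bool" where
  "tys w ts \<sigma>s \<equiv> map (\<lambda>t. typeof t (cx w)) ts = map Some \<sigma>s"

context eha
begin

lemma tys_mono: "tys w ts \<sigma>s \<Longrightarrow> ext w w' \<Longrightarrow> tys w' ts \<sigma>s"
proof (induction ts arbitrary: \<sigma>s)
  case (Cons t ts)
  then show ?case by (cases \<sigma>s) (auto intro: ty_mono)
qed simp

subsection \<open>Bounded quantifiers\<close>

lemma ballI:
  assumes "wf_int (\<sigma> # cx w) A" "typeof t (cx w) = Some (TSeq \<sigma>)"
    and "\<And>w' a. ext w w' \<Longrightarrow> mem w' \<sigma> a t \<Longrightarrow> pv w' (fsub (inst a) A)"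
  shows "pv w (ball_fm \<sigma> t A)"
  unfolding ball_fm_def
proof (rule pv_ForallI)
  fix w' a assume w': "ext w w'" and a: "typeof a (cx w') = Some \<sigma>"
  have "pv w' (Imp (mem_fm \<sigma> a t) (fsub (inst a) A))"
    by (rule pv_ImpI) (use a ty_mono[OF assms(2) w'] assms(3)[OF ext_trans[OF w']] in auto)
  then show "pv w' (fsub (inst a) (Imp (mem_fm \<sigma> (Var 0) (shift 1 t)) A))" by simp
qed (use assms in simp)

lemma ballD: "pv w (ball_fm \<sigma> t A) \<Longrightarrow> mem w \<sigma> a t \<Longrightarrow> pv w (fsub (inst a) A)"
  unfolding ball_fm_def using pv_ForallD[of w \<sigma> _ a] mem_ty(1)[of w \<sigma> a t] by (force intro: pv_ImpD)

lemma bexI: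
  assumes "wf_int (\<sigma> # cx w) A" "mem w \<sigma> a t" "pv w (fsub (inst a) A)"
  shows "pv w (bex_fm \<sigma> t A)"
  unfolding bex_fm_def
  by (rule pv_ExistsI[of _ _ _ a]) (use assms mem_ty[OF assms(2)] in \<open>auto intro: pv_AndI\<close>)

lemma bexE:
  assumes b: "pv w (bex_fm \<sigma> t A)" and C: "wf_int (cx w) C"
    and "\<And>w' a. ext w w' \<Longrightarrow> mem w' \<sigma> a t \<Longrightarrow> pv w' (fsub (inst a) A) \<Longrightarrow> pv w' C"
  shows "pv w C"
proof (rule pv_ExistsE[OF b[unfolded bex_fm_def] C])
  fix w' a assume "ext w w'" "pv w' (fsub (inst a) (And (mem_fm \<sigma> (Var 0) (shift 1 t)) A))"
  then show "pv w' C"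
    by (intro assms(3)) (auto dest: pv_AndD1 pv_AndD2)
qed

fun mems :: "world \<Rightarrow> ty list \<Rightarrow> tm list \<Rightarrow> tm list \<Rightarrow> bool" where
  "mems w (\<sigma> # \<sigma>s) (y # ys) (t # ts) \<longleftrightarrow> mem w \<sigma> y t \<and> mems w \<sigma>s ys ts"
| "mems w [] [] [] \<longleftrightarrow> True"
| "mems w _ _ _ \<longleftrightarrow> False"

lemma mems_length: "mems w \<sigma>s ys ts \<Longrightarrow> length ys = length \<sigma>s \<and> length ts = length \<sigma>s"
  by (induction w \<sigma>s ys ts rule: mems.induct) auto

lemma mems_tys: "mems w \<sigma>s ys ts \<Longrightarrow> tys w ys \<sigma>s"
  by (induction w \<sigma>s ys ts rule: mems.induct) (auto dest: mem_ty)

lemma mems_mono: "mems w \<sigma>s ys ts \<Longrightarrow> ext w w' \<Longrightarrow> mems w' \<sigma>s ys ts"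
  by (induction w \<sigma>s ys ts rule: mems.induct) (auto intro: pv_mono)

lemma mems_append:
  "length ys = length \<sigma>s \<Longrightarrow> length ts = length \<sigma>s \<Longrightarrow>
    mems w (\<sigma>s @ \<sigma>s') (ys @ ys') (ts @ ts') \<longleftrightarrow> mems w \<sigma>s ys ts \<and> mems w \<sigma>s' ys' ts'"
proof (induction \<sigma>s arbitrary: ys ts)
  case (Cons \<sigma> \<sigma>s)
  then show ?case by (cases ys; cases ts) auto
qed simp

lemma mems_single: "tys w ys \<sigma>s \<Longrightarrow> mems w \<sigma>s ys (map2 single \<sigma>s ys)"
proof (induction \<sigma>s arbitrary: ys)
  case (Cons \<sigma> \<sigma>s)
  then show ?case by (cases ys) (auto intro: mem_single)
qed simp

text \<open>The relation \<open>\<preceq>\<close> in semantic form. Quantifying over extensions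
  makes it persistent, and inclusions between realizers can be handled without writing them as
  formulas.\<close>

definition incl :: "world \<Rightarrow> ty \<Rightarrow> tm \<Rightarrow> tm \<Rightarrow> bool" where
  "incl w \<sigma> s t \<longleftrightarrow> (\<forall>w' a. ext w w' \<longrightarrow> mem w' \<sigma> a s \<longrightarrow> mem w' \<sigma> a t)"

lemma inclI: "(\<And>w' a. ext w w' \<Longrightarrow> mem w' \<sigma> a s \<Longrightarrow> mem w' \<sigma> a t) \<Longrightarrow> incl w \<sigma> s t"
  by (simp add: incl_def)

lemma inclD: "incl w \<sigma> s t \<Longrightarrow> mem w \<sigma> a s \<Longrightarrow> mem w \<sigma> a t"
  unfolding incl_def using ext_refl by blast

lemma incl_mono: "incl w \<sigma> s t \<Longrightarrow> ext w w' \<Longrightarrow> incl w' \<sigma> s t"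
  unfolding incl_def by (blast intro: ext_trans)

fun incls :: "world \<Rightarrow> ty list \<Rightarrow> tm list \<Rightarrow> tm list \<Rightarrow> bool" where
  "incls w (\<sigma> # \<sigma>s) (s # ss) (t # ts) \<longleftrightarrow> incl w \<sigma> s t \<and> incls w \<sigma>s ss ts"
| "incls w [] [] [] \<longleftrightarrow> True"
| "incls w _ _ _ \<longleftrightarrow> False"

lemma incls_mono: "incls w \<sigma>s ss ts \<Longrightarrow> ext w w' \<Longrightarrow> incls w' \<sigma>s ss ts"
  by (induction w \<sigma>s ss ts rule: incls.induct) (auto intro: incl_mono)

lemma incls_append:
  "length ys = length \<sigma>s \<Longrightarrow> length ts = length \<sigma>s \<Longrightarrow>
    incls w (\<sigma>s @ \<sigma>s') (ys @ ys') (ts @ ts') \<longleftrightarrow> incls w \<sigma>s ys ts \<and> incls w \<sigma>s' ys' ts'"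
proof (induction \<sigma>s arbitrary: ys ts)
  case (Cons \<sigma> \<sigma>s)
  then show ?case by (cases ys; cases ts) auto
qed simp

lemma mems_incls: "mems w \<sigma>s ys ss \<Longrightarrow> incls w \<sigma>s ss ts \<Longrightarrow> mems w \<sigma>s ys ts"
proof (induction \<sigma>s arbitrary: ys ss ts)
  case Nil
  then show ?case by (cases ys; cases ss; cases ts) auto
next
  case (Cons \<sigma> \<sigma>s)
  then show ?case by (cases ys; cases ss; cases ts) (auto intro: inclD)
qed

text \<open>The member chosen for the outermost quantifier is substituted under the remaining
  binders through \<open>ups\<close>, and \<open>envl_ups\<close> merges it with the members chosen
  later into one environment.\<close>

lemma ballsI:
  "wf_int (rev \<sigma>s @ cx w) A \<Longrightarrow> map (\<lambda>t. typeof t (cx w)) ts = map (\<lambda>\<sigma>. Some (TSeq \<sigma>)) \<sigma>s \<Longrightarrow>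
    (\<And>w' ys. ext w w' \<Longrightarrow> mems w' \<sigma>s ys ts \<Longrightarrow> pv w' (fsub (envl ys Var) A)) \<Longrightarrow>
    pv w (balls_fm \<sigma>s ts A)"
proof (induction \<sigma>s arbitrary: w ts A)
  case Nil
  then show ?case using Nil(3)[of w "[]"] by auto
next
  case (Cons \<sigma> \<sigma>s)
  then obtain t ts' where ts: "ts = t # ts'" "typeof t (cx w) = Some (TSeq \<sigma>)"
    "map (\<lambda>t. typeof t (cx w)) ts' = map (\<lambda>\<sigma>. Some (TSeq \<sigma>)) \<sigma>s"
    by (auto simp: map_eq_Cons_conv)
  then have len: "length ts' = length \<sigma>s" by (metis length_map)
  show ?case unfolding ts(1) balls_fm.simps
  proof (rule ballI)
    show "wf_int (\<sigma> # cx w) (balls_fm \<sigma>s (map (shift 1) ts') A)"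
      by (subst wf_int_balls_fm) (use Cons.prems(1) ts(3) in \<open>auto simp: comp_def\<close>)
    fix w' a assume w': "ext w w'" and a: "mem w' \<sigma> a t"
    then obtain \<Gamma> where \<Gamma>: "cx w' = cx w @ \<Gamma>" unfolding ext_def by auto
    have "pv w' (balls_fm \<sigma>s ts' (fsub (ups (length \<sigma>s) (inst a)) A))"
    proof (rule Cons.IH)
      have 1: "wf_int (rev \<sigma>s @ \<sigma> # cx w') A"
        using L_append[OF Cons.prems(1), of \<Gamma>] \<Gamma> by simp
      have a': "typeof a (cx w') = Some \<sigma>" by (rule mem_ty(1)[OF a])
      show "wf_int (rev \<sigma>s @ cx w') (fsub (ups (length \<sigma>s) (inst a)) A)"
      proof (rule L_fsub[OF 1])
        fix n assume n: "n < length (rev \<sigma>s @ \<sigma> # cx w')"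
        show "typeof (ups (length \<sigma>s) (inst a) n) (rev \<sigma>s @ cx w') = Some ((rev \<sigma>s @ \<sigma> # cx w') ! n)"
        proof (cases "n < length \<sigma>s")
          case True
          then show ?thesis by (simp add: ups_less nth_append)
        next
          case False
          then obtain m where m: "n = m + length \<sigma>s" by (metis add.commute le_Suc_ex not_less)
          have "typeof (inst a m) (cx w') = Some ((\<sigma> # cx w') ! m)"
            using n m a' by (cases m) auto
          then show ?thesis
            unfolding m ups_add using typeof_shift[of "rev \<sigma>s" "length \<sigma>s" "inst a m" "cx w'"]
            by (simp add: nth_append)
        qed
      qed
      show "map (\<lambda>t. typeof t (cx w')) ts' = map (\<lambda>\<sigma>. Some (TSeq \<sigma>)) \<sigma>s"
        using tys_mono[of w ts' "map TSeq \<sigma>s" w', OF _ w'] ts(3) by (simp add: comp_def)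
      fix w'' ys assume w'': "ext w' w''" and ys: "mems w'' \<sigma>s ys ts'"
      have "mems w'' (\<sigma> # \<sigma>s) (a # ys) ts"
        using ys pv_mono[OF a w''] ts(1) by simp
      from Cons.prems(3)[OF ext_trans[OF w' w''] this]
      show "pv w'' (fsub (envl ys Var) (fsub (ups (length \<sigma>s) (inst a)) A))"
        using mems_length[OF ys] by (simp add: envl_ups)
    qed
    then show "pv w' (fsub (inst a) (balls_fm \<sigma>s (map (shift 1) ts') A))"
      using len by (simp add: comp_def)
  qed (rule ts(2))
qed

lemma ballsD:
  "pv w (balls_fm \<sigma>s ts A) \<Longrightarrow> mems w \<sigma>s ys ts \<Longrightarrow> pv w (fsub (envl ys Var) A)"
proof (induction \<sigma>s arbitrary: ts ys A)
  case Nil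
  then show ?case by (cases ts; cases ys) auto
next
  case (Cons \<sigma> \<sigma>s)
  then obtain t ts' a ys' where *: "ts = t # ts'" "ys = a # ys'" "mem w \<sigma> a t" "mems w \<sigma>s ys' ts'"
    by (cases ts; cases ys) auto
  have len: "length ts' = length \<sigma>s" "length ys' = length \<sigma>s" using mems_length[OF *(4)] by auto
  have "pv w (balls_fm \<sigma>s ts' (fsub (ups (length \<sigma>s) (inst a)) A))"
    using ballD[OF Cons.prems(1)[unfolded *(1) balls_fm.simps] *(3)] len by (simp add: comp_def)
  from Cons.IH[OF this *(4)] show ?case using len by (simp add: * envl_ups)
qed

text \<open>Over an arbitrary domain this law is not intuitionistically valid; it holds here because
  \<open>t\<close> is a finite sequence. In the induction on \<open>t\<close> the tail and the new
  head are decided one after the other, and \<open>P\<close> is kept as soon as one of them yields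
  it.\<close>

lemma ball_or:
  assumes b: "pv w (ball_fm \<sigma> t (Or (fren Suc P) Q))"
  shows "pv w (Or P (ball_fm \<sigma> t Q))"
proof -
  have t: "typeof t (cx w) = Some (TSeq \<sigma>)" and P: "wf_int (cx w) P" and Q: "wf_int (\<sigma> # cx w) Q"
    using pv_L[OF b] by auto
  have inst: "fsub (case_nat y (case_nat x Var)) (fren (skip 1) Q) = fsub (inst y) Q" for x y
  proof -
    have "(\<lambda>i. case_nat y (case_nat x Var) (skip 1 i)) = inst y"
      by (rule HOL.ext) (simp add: skip_def split: nat.split)
    then show ?thesis by simp
  qed
  have up: "fsub (up (inst x)) (fren (skip 1) Q) = Q" "fsub (up (inst x)) (fren Suc P') = fren Suc (fsub (inst x) P')" for x P'
  proof -
    have "(\<lambda>i. up (inst x) (skip 1 i)) = Var"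
      by (rule HOL.ext) (simp add: skip_def up_def split: nat.split)
    then show "fsub (up (inst x)) (fren (skip 1) Q) = Q" by simp
    show "fsub (up (inst x)) (fren Suc P') = fren Suc (fsub (inst x) P')"
      by (simp add: fren_fsub)
  qed
  let ?A = "Imp (ball_fm \<sigma> (Var 0) (Or (fren Suc (fren Suc P)) (fren (skip 1) Q)))
     (Or (fren Suc P) (ball_fm \<sigma> (Var 0) (fren (skip 1) Q)))"
  have A: "fsub (inst x) ?A = Imp (ball_fm \<sigma> x (Or (fren Suc P) Q)) (Or P (ball_fm \<sigma> x Q))" for x
    unfolding fsub.simps fsub_ball_fm up by simp
  have "pv w (fsub (inst t) ?A)"
  proof (rule pv_list_induct[OF _ t])
    have "wf_int (\<sigma> # TSeq \<sigma> # cx w) (fren (skip 1) Q)"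
      using Q wf_fren[of "\<sigma> # cx w" "skip 1" "\<sigma> # TSeq \<sigma> # cx w" Q]
      by (auto simp: wf_int_def skip_def nth_Cons split: nat.splits)
    moreover have "wf_int (\<sigma> # TSeq \<sigma> # cx w) (fren Suc (fren Suc P))"
      using P by (simp only: wf_int_simps)
    ultimately show "wf_int (TSeq \<sigma> # cx w) ?A" using P by simp
    show "pv w (fsub (inst (NilC \<sigma>)) ?A)"
      unfolding A
    proof (rule pv_ImpI)
      fix w' assume w': "ext w w'"
      have "pv w' (ball_fm \<sigma> (NilC \<sigma>) Q)"
      proof (rule ballI)
        show Q': "wf_int (\<sigma> # cx w') Q" by (rule wf_mono1[OF Q w'])
        fix w'' a assume w'': "ext w' w''" and a: "mem w'' \<sigma> a (NilC \<sigma>)"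
        show "pv w'' (fsub (inst a) Q)"
          by (rule mem_nil[OF a L_inst[OF wf_mono1[OF Q' w''] mem_ty(1)[OF a]]])
      qed simp
      then show "pv w' (Or P (ball_fm \<sigma> (NilC \<sigma>) Q))"
        by (rule pv_OrI2) (rule L_mono[OF P w'])
    qed (use P Q in simp)
    fix w' a y assume w': "ext w w'" and ay: "typeof a (cx w') = Some \<sigma>" "typeof y (cx w') = Some (TSeq \<sigma>)"
      and IH: "pv w' (fsub (inst y) ?A)"
    note P' = L_mono[OF P w'] and Q' = wf_mono1[OF Q w']
    let ?l = "ConsC \<sigma> \<cdot> a \<cdot> y"
    show "pv w' (fsub (inst ?l) ?A)" unfolding A
    proof (rule pv_ImpI)
      fix w2 assume w2: "ext w' w2" and b: "pv w2 (ball_fm \<sigma> ?l (Or (fren Suc P) Q))"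
      note ay2 = ay[THEN ty_mono[OF _ w2]] and P2 = L_mono[OF P' w2] and Q2 = wf_mono1[OF Q' w2]
      have "pv w2 (ball_fm \<sigma> y (Or (fren Suc P) Q))"
      proof (rule ballI)
        fix w3 z assume w3: "ext w2 w3" and z: "mem w3 \<sigma> z y"
        show "pv w3 (fsub (inst z) (Or (fren Suc P) Q))"
          by (rule ballD[OF pv_mono[OF b w3] mem_cons_I2[OF z ty_mono[OF ay2(1) w3]]])
      qed (use P2 Q2 ay2 in simp_all)
      with pv_mono[OF IH w2] have y: "pv w2 (Or P (ball_fm \<sigma> y Q))"
        unfolding A by (rule pv_ImpD)
      have "pv w2 (fsub (inst a) (Or (fren Suc P) Q))"
        by (rule ballD[OF b mem_cons_I1[OF eqv_refl[OF ay2(1)] ay2(2)]])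
      then have a: "pv w2 (Or P (fsub (inst a) Q))" by simp
      let ?C = "Or P (ball_fm \<sigma> ?l Q)"
      have C: "wf_int (cx w2) ?C" using P2 Q2 ay2 by simp
      show "pv w2 ?C"
      proof (rule pv_OrE[OF y C])
        fix w3 assume w3: "ext w2 w3" and yQ: "pv w3 (ball_fm \<sigma> y Q)"
        note C3 = L_mono[OF C w3]
        show "pv w3 ?C"
        proof (rule pv_OrE[OF pv_mono[OF a w3] C3])
          fix w4 assume w4: "ext w3 w4" and aQ: "pv w4 (fsub (inst a) Q)"
          note w4' = ext_trans[OF w3 w4]
          note ay4 = ay2[THEN ty_mono[OF _ w4']] and Q4 = wf_mono1[OF Q2 w4']
          have "pv w4 (ball_fm \<sigma> ?l Q)"
          proof (rule ballI[OF Q4])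
            fix w5 z assume w5: "ext w4 w5" and z: "mem w5 \<sigma> z ?l"
            note Q5 = wf_mono1[OF Q4 w5]
            show "pv w5 (fsub (inst z) Q)"
            proof (rule mem_cons_E[OF z L_inst[OF Q5 mem_ty(1)[OF z]]])
              fix w6 assume w6: "ext w5 w6" and e: "eqv w6 \<sigma> z a"
              show "pv w6 (fsub (inst z) Q)"
                by (rule pv_inst_cong[OF eqv_sym[OF e] pv_mono[OF aQ ext_trans[OF w5 w6]] wf_mono1[OF Q5 w6]])
            next
              fix w6 assume w6: "ext w5 w6" and e: "mem w6 \<sigma> z y"
              show "pv w6 (fsub (inst z) Q)"
                by (rule ballD[OF pv_mono[OF yQ ext_trans[OF w4 ext_trans[OF w5 w6]]] e])
            qed
          qed (use ay4 in simp)
          then show "pv w4 ?C" by (rule pv_OrI2) (rule L_mono[OF P2 w4'])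
        next
          fix w4 assume w4: "ext w3 w4" and "pv w4 P"
          then show "pv w4 ?C" by (rule_tac pv_OrI1) (use L_mono[OF C3 w4] in simp_all)
        qed
      next
        fix w3 assume w3: "ext w2 w3" and "pv w3 P"
        then show "pv w3 ?C" by (rule_tac pv_OrI1) (use L_mono[OF C w3] in simp_all)
      qed
    qed (use P' Q' ay in simp)
  qed
  then have "pv w (Imp (ball_fm \<sigma> t (Or (fren Suc P) Q)) (Or P (ball_fm \<sigma> t Q)))"
    unfolding A .
  then show ?thesis using b by (rule pv_ImpD)
qed

lemma pv_Or_mono:
  assumes "pv w (Or A B)" "wf_int (cx w) B'" "\<And>w'. ext w w' \<Longrightarrow> pv w' B \<Longrightarrow> pv w' B'"
  shows "pv w (Or A B')"
  by (rule pv_OrE[OF assms(1)])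
    (use assms pv_L[OF assms(1)] in \<open>auto intro: pv_OrI1 pv_OrI2 L_mono\<close>)

subsection \<open>Application of sequences of functions\<close>

text \<open>The step function of the recursion contains shifted copies of \<open>s\<close> and
  \<open>t\<close>. It is hidden behind an existential, because the arguments below use only its
  type and its recursion equation at later worlds.\<close>

lemma sapp_rec:
  assumes s: "typeof s (cx w) = Some (TSeq (TFun \<sigma> (TSeq \<tau>)))" and t: "typeof t (cx w) = Some \<sigma>"
  shows "\<exists>G. typeof G (cx w) = Some (TFun (TSeq \<tau>) (TFun TNat (TSeq \<tau>))) \<and>
    eqv w (TSeq \<tau>) (sappC \<sigma> \<tau> \<cdot> s \<cdot> t)
      (RecC [TSeq \<tau>] 0 \<cdot> (lenC (TFun \<sigma> (TSeq \<tau>)) \<cdot> s) \<cdot> NilC \<tau> \<cdot> G) \<and>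
    (\<forall>w' n. ext w w' \<longrightarrow> typeof n (cx w') = Some TNat \<longrightarrow>
      eqv w' (TSeq \<tau>) (RecC [TSeq \<tau>] 0 \<cdot> (SucC \<cdot> n) \<cdot> NilC \<tau> \<cdot> G)
        (appendC \<tau> \<cdot> (RecC [TSeq \<tau>] 0 \<cdot> n \<cdot> NilC \<tau> \<cdot> G) \<cdot> (projC (TFun \<sigma> (TSeq \<tau>)) \<cdot> s \<cdot> n \<cdot> t)))"
proof -
  let ?\<phi> = "TFun \<sigma> (TSeq \<tau>)"
  let ?b = "\<lambda>s t. appendC \<tau> \<cdot> Var 1 \<cdot> (projC ?\<phi> \<cdot> s \<cdot> Var 0 \<cdot> t)"
  let ?G = "Lam (TSeq \<tau>) (Lam TNat (?b (shift 2 s) (shift 2 t)))"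
  have sh: "typeof (ren (\<lambda>n. Suc (Suc n)) s) (TNat # TSeq \<tau> # cx w') = Some (TSeq ?\<phi>)"
    "typeof (ren (\<lambda>n. Suc (Suc n)) t) (TNat # TSeq \<tau> # cx w') = Some \<sigma>" if "ext w w'" for w'
    using typeof_shift[of "[TNat, TSeq \<tau>]" 2 s "cx w'"] typeof_shift[of "[TNat, TSeq \<tau>]" 2 t "cx w'"]
      ty_mono[OF s that] ty_mono[OF t that] by simp_all
  show ?thesis
  proof (intro exI conjI allI impI)
    show "typeof ?G (cx w) = Some (TFun (TSeq \<tau>) (TFun TNat (TSeq \<tau>)))"
      using sh[OF ext_refl] by simp
    show "eqv w (TSeq \<tau>) (sappC \<sigma> \<tau> \<cdot> s \<cdot> t) (RecC [TSeq \<tau>] 0 \<cdot> (lenC ?\<phi> \<cdot> s) \<cdot> NilC \<tau> \<cdot> ?G)"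
      using eqv_beta2[of "RecC [TSeq \<tau>] 0 \<cdot> (lenC ?\<phi> \<cdot> Var 1) \<cdot> NilC \<tau> \<cdot> Lam (TSeq \<tau>) (Lam TNat (?b (Var 3) (Var 2)))"
          \<sigma> "TSeq ?\<phi>" w "TSeq \<tau>" s t] s t
      by (simp add: sappC_def Let_def numeral_eq_Suc)
    fix w' n assume w': "ext w w'" and n: "typeof n (cx w') = Some TNat"
    note st = ty_mono[OF s w'] ty_mono[OF t w']
    let ?R = "RecC [TSeq \<tau>] 0 \<cdot> n \<cdot> NilC \<tau> \<cdot> ?G"
    have "eqv w' (TSeq \<tau>) (RecC [TSeq \<tau>] 0 \<cdot> (SucC \<cdot> n) \<cdot> NilC \<tau> \<cdot> ?G) (?G \<cdot> ?R \<cdot> n)"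
      by (rule rec1_suc) (use n sh[OF w'] in simp_all)
    also have "eqv w' (TSeq \<tau>) \<dots> (appendC \<tau> \<cdot> ?R \<cdot> (projC ?\<phi> \<cdot> s \<cdot> n \<cdot> t))"
      using eqv_beta2[of "?b (shift 2 s) (shift 2 t)" TNat "TSeq \<tau>" w' "TSeq \<tau>" ?R n] n st sh[OF w'] by simp
    finally show "eqv w' (TSeq \<tau>) (RecC [TSeq \<tau>] 0 \<cdot> (SucC \<cdot> n) \<cdot> NilC \<tau> \<cdot> ?G)
        (appendC \<tau> \<cdot> ?R \<cdot> (projC ?\<phi> \<cdot> s \<cdot> n \<cdot> t))" .
  qed
qed

text \<open>Since the sequence has length one, a single step of the recursion remains, and it
  appends \<open>f \<cdot> t\<close> to the empty sequence. This is the computation rule for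
  \<open>\<Lambda>\<close>.\<close>

lemma sapp_single:
  assumes f: "typeof f (cx w) = Some (TFun \<sigma> (TSeq \<tau>))" and t: "typeof t (cx w) = Some \<sigma>"
  shows "eqv w (TSeq \<tau>) (sappC \<sigma> \<tau> \<cdot> single (TFun \<sigma> (TSeq \<tau>)) f \<cdot> t) (f \<cdot> t)"
proof -
  let ?\<phi> = "TFun \<sigma> (TSeq \<tau>)"
  let ?s = "single ?\<phi> f"
  have s: "typeof ?s (cx w) = Some (TSeq ?\<phi>)" using f by simp
  obtain G where G: "typeof G (cx w) = Some (TFun (TSeq \<tau>) (TFun TNat (TSeq \<tau>)))"
    and 1: "eqv w (TSeq \<tau>) (sappC \<sigma> \<tau> \<cdot> ?s \<cdot> t) (RecC [TSeq \<tau>] 0 \<cdot> (lenC ?\<phi> \<cdot> ?s) \<cdot> NilC \<tau> \<cdot> G)"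
    and 2: "\<forall>w' n. ext w w' \<longrightarrow> typeof n (cx w') = Some TNat \<longrightarrow>
      eqv w' (TSeq \<tau>) (RecC [TSeq \<tau>] 0 \<cdot> (SucC \<cdot> n) \<cdot> NilC \<tau> \<cdot> G)
        (appendC \<tau> \<cdot> (RecC [TSeq \<tau>] 0 \<cdot> n \<cdot> NilC \<tau> \<cdot> G) \<cdot> (projC ?\<phi> \<cdot> ?s \<cdot> n \<cdot> t))"
    using sapp_rec[OF s t] by blast
  note 1
  also have "eqv w (TSeq \<tau>) (RecC [TSeq \<tau>] 0 \<cdot> (lenC ?\<phi> \<cdot> ?s) \<cdot> NilC \<tau> \<cdot> G)
      (RecC [TSeq \<tau>] 0 \<cdot> (SucC \<cdot> ZeroC) \<cdot> NilC \<tau> \<cdot> G)"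
    by (rule eqv_fun[OF eqv_fun[OF eqv_arg[OF eqv_trans[OF len_cons suc_cong[OF len_nil]]]]])
      (use f G in simp_all)
  also have "eqv w (TSeq \<tau>) \<dots>
      (appendC \<tau> \<cdot> (RecC [TSeq \<tau>] 0 \<cdot> ZeroC \<cdot> NilC \<tau> \<cdot> G) \<cdot> (projC ?\<phi> \<cdot> ?s \<cdot> ZeroC \<cdot> t))"
    by (rule 2[rule_format]) simp_all
  also have "eqv w (TSeq \<tau>) \<dots> (appendC \<tau> \<cdot> NilC \<tau> \<cdot> (f \<cdot> t))"
    by (rule eqv_app[OF eqv_arg[OF rec1_zero] eqv_fun[OF proj_zero t]]) (use f G in simp_all)
  also have "eqv w (TSeq \<tau>) \<dots> (f \<cdot> t)"
    by (rule append_nil) (use f t in simp)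
  finally show ?thesis .
qed

text \<open>An induction on n shows that a member of the first n concatenated pieces lies in the
  piece of some index below n; at the end n is the length of \<open>s\<close>. The projection of
  \<open>s\<close> at that index is the function sought.\<close>

lemma mem_sapp_E:
  assumes m: "mem w \<tau> z (sappC \<sigma> \<tau> \<cdot> s \<cdot> t)" and C: "wf_int (cx w) C"
    and 1: "\<And>w' f. ext w w' \<Longrightarrow> mem w' (TFun \<sigma> (TSeq \<tau>)) f s \<Longrightarrow> mem w' \<tau> z (f \<cdot> t) \<Longrightarrow> pv w' C"
  shows "pv w C"
proof -
  let ?\<phi> = "TFun \<sigma> (TSeq \<tau>)"
  have ty: "typeof s (cx w) = Some (TSeq ?\<phi>)" "typeof t (cx w) = Some \<sigma>" "typeof z (cx w) = Some \<tau>"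
    using mem_ty[OF m] by (auto simp: typeof_App_iff simp del: typeof.simps(3))
  obtain G where G: "typeof G (cx w) = Some (TFun (TSeq \<tau>) (TFun TNat (TSeq \<tau>)))"
    and e1: "eqv w (TSeq \<tau>) (sappC \<sigma> \<tau> \<cdot> s \<cdot> t) (RecC [TSeq \<tau>] 0 \<cdot> (lenC ?\<phi> \<cdot> s) \<cdot> NilC \<tau> \<cdot> G)"
    and e2: "\<forall>w' n. ext w w' \<longrightarrow> typeof n (cx w') = Some TNat \<longrightarrow>
      eqv w' (TSeq \<tau>) (RecC [TSeq \<tau>] 0 \<cdot> (SucC \<cdot> n) \<cdot> NilC \<tau> \<cdot> G)
        (appendC \<tau> \<cdot> (RecC [TSeq \<tau>] 0 \<cdot> n \<cdot> NilC \<tau> \<cdot> G) \<cdot> (projC ?\<phi> \<cdot> s \<cdot> n \<cdot> t))"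
    using sapp_rec[OF ty(1,2)] by blast
  let ?R = "\<lambda>n. RecC [TSeq \<tau>] 0 \<cdot> n \<cdot> NilC \<tau> \<cdot> G"
  let ?E = "\<lambda>n. Exists TNat (And (less_fm (Var 0) (ren Suc n)) (mem_fm \<tau> (ren Suc z) (projC ?\<phi> \<cdot> ren Suc s \<cdot> Var 0 \<cdot> ren Suc t)))"
  let ?A = "Imp (mem_fm \<tau> (ren Suc z) (RecC [TSeq \<tau>] 0 \<cdot> Var 0 \<cdot> NilC \<tau> \<cdot> ren Suc G))
    (Exists TNat (And (less_fm (Var 0) (Var 1)) (mem_fm \<tau> (ren Suc (ren Suc z))
       (projC ?\<phi> \<cdot> ren Suc (ren Suc s) \<cdot> Var 0 \<cdot> ren Suc (ren Suc t)))))"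
  have A: "fsub (inst n) ?A = Imp (mem_fm \<tau> z (?R n)) (?E n)" for n
    by simp
  have EI: "pv w' (?E n)" if "less w' i n" "mem w' \<tau> z (projC ?\<phi> \<cdot> s \<cdot> i \<cdot> t)" for w' n i
  proof (rule pv_ExistsI[of _ _ _ i])
    have "typeof s (cx w') = Some (TSeq ?\<phi>)" "typeof t (cx w') = Some \<sigma>" "typeof z (cx w') = Some \<tau>"
      using mem_ty[OF that(2)] by (auto simp: typeof_App_iff simp del: typeof.simps(3))
    then show "wf_int (TNat # cx w') (And (less_fm (Var 0) (ren Suc n))
        (mem_fm \<tau> (ren Suc z) (projC ?\<phi> \<cdot> ren Suc s \<cdot> Var 0 \<cdot> ren Suc t)))"
      using less_ty[OF that(1)] by simp
  qed (use that less_ty[OF that(1)] in \<open>auto intro: pv_AndI\<close>)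
  have EE: "pv w' C'" if "pv w' (?E n)" "wf_int (cx w') C'"
    "\<And>w'' i. ext w' w'' \<Longrightarrow> less w'' i n \<Longrightarrow> mem w'' \<tau> z (projC ?\<phi> \<cdot> s \<cdot> i \<cdot> t) \<Longrightarrow> pv w'' C'" for w' n C'
  proof (rule pv_ExistsE[OF that(1,2)])
    fix w'' i assume w'': "ext w' w''" and "pv w'' (fsub (inst i) (And (less_fm (Var 0) (ren Suc n))
      (mem_fm \<tau> (ren Suc z) (projC ?\<phi> \<cdot> ren Suc s \<cdot> Var 0 \<cdot> ren Suc t))))"
    then have "pv w'' (And (less_fm i n) (mem_fm \<tau> z (projC ?\<phi> \<cdot> s \<cdot> i \<cdot> t)))" by simp
    then show "pv w'' C'" using that(3)[OF w''] pv_AndD1 pv_AndD2 by blast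
  qed
  have len: "typeof (lenC ?\<phi> \<cdot> s) (cx w) = Some TNat" using ty by simp
  have "pv w (fsub (inst (lenC ?\<phi> \<cdot> s)) ?A)"
  proof (rule pv_nat_induct[OF _ len])
    show "pv w (fsub (inst ZeroC) ?A)" unfolding A
    proof (rule pv_ImpI)
      show wf: "wf_int (cx w) (mem_fm \<tau> z (?R ZeroC))" using ty G by simp
      fix w' assume w': "ext w w'" and m: "mem w' \<tau> z (?R ZeroC)"
      have "mem w' \<tau> z (NilC \<tau>)"
        by (rule mem_cong2[OF m rec1_zero]) (use ty_mono[OF G w'] in simp_all)
      then show "pv w' (?E ZeroC)"
        by (rule mem_nil) (use ty[THEN ty_mono[OF _ w']] in simp)
    qed
    fix w' n assume w': "ext w w'" and n: "typeof n (cx w') = Some TNat" and IH: "pv w' (fsub (inst n) ?A)"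
    show "pv w' (fsub (inst (SucC \<cdot> n)) ?A)" unfolding A
    proof (rule pv_ImpI)
      show "wf_int (cx w') (mem_fm \<tau> z (?R (SucC \<cdot> n)))"
        using ty_mono[OF ty(3) w'] ty_mono[OF G w'] n by simp
      fix w2 assume w2: "ext w' w2" and m: "mem w2 \<tau> z (?R (SucC \<cdot> n))"
      note w2' = ext_trans[OF w' w2]
      note n2 = ty_mono[OF n w2] and ty2 = ty[THEN ty_mono[OF _ w2']]
      have C2: "wf_int (cx w2) (?E (SucC \<cdot> n))" using n2 ty2 by simp
      show "pv w2 (?E (SucC \<cdot> n))"
      proof (rule mem_append_E[OF mem_cong2[OF m e2[rule_format, OF w2' n2]] C2])
        fix w3 assume w3: "ext w2 w3" and m3: "mem w3 \<tau> z (?R n)"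
        have "pv w3 (?E n)"
          using pv_mono[OF IH ext_trans[OF w2 w3]] m3 unfolding A by (rule pv_ImpD)
        then show "pv w3 (?E (SucC \<cdot> n))"
          by (rule EE[OF _ L_mono[OF C2 w3]]) (rule EI[OF less_suc])
      next
        fix w3 assume w3: "ext w2 w3" and m3: "mem w3 \<tau> z (projC ?\<phi> \<cdot> s \<cdot> n \<cdot> t)"
        show "pv w3 (?E (SucC \<cdot> n))"
          by (rule EI[OF less_suc_self m3]) (rule ty_mono[OF n2 w3])
      qed
    qed
  qed (use ty G in simp)
  then have "pv w (Imp (mem_fm \<tau> z (?R (lenC ?\<phi> \<cdot> s))) (?E (lenC ?\<phi> \<cdot> s)))" unfolding A .
  from pv_ImpD[OF this mem_cong2[OF m e1]] show ?thesis
  proof (rule EE[OF _ C])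
    fix w' i assume w': "ext w w'" and i: "less w' i (lenC ?\<phi> \<cdot> s)" and m: "mem w' \<tau> z (projC ?\<phi> \<cdot> s \<cdot> i \<cdot> t)"
    have "mem w' ?\<phi> (projC ?\<phi> \<cdot> s \<cdot> i) s"
      by (rule mem_I[OF i eqv_refl]) (use less_ty(1)[OF i] ty_mono[OF ty(1) w'] in simp)
    then show "pv w' C" by (rule 1[OF w' _ m])
  qed
qed

text \<open>The index \<open>i\<close> of \<open>f\<close> in \<open>s\<close> is fixed first; then
  induction on n shows that \<open>z\<close> lies in the concatenation of the first n pieces as soon
  as \<open>i < n\<close>.\<close>

lemma mem_sapp_I:
  assumes f: "mem w (TFun \<sigma> (TSeq \<tau>)) f s" and m: "mem w \<tau> z (f \<cdot> t)"
  shows "mem w \<tau> z (sappC \<sigma> \<tau> \<cdot> s \<cdot> t)"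
proof -
  let ?\<phi> = "TFun \<sigma> (TSeq \<tau>)"
  have ty: "typeof s (cx w) = Some (TSeq ?\<phi>)" "typeof z (cx w) = Some \<tau>" "typeof t (cx w) = Some \<sigma>"
    using mem_ty[OF f] mem_ty[OF m] by (auto simp: typeof_App_iff simp del: typeof.simps(3))
  obtain G where G: "typeof G (cx w) = Some (TFun (TSeq \<tau>) (TFun TNat (TSeq \<tau>)))"
    and e1: "eqv w (TSeq \<tau>) (sappC \<sigma> \<tau> \<cdot> s \<cdot> t) (RecC [TSeq \<tau>] 0 \<cdot> (lenC ?\<phi> \<cdot> s) \<cdot> NilC \<tau> \<cdot> G)"
    and e2: "\<forall>w' n. ext w w' \<longrightarrow> typeof n (cx w') = Some TNat \<longrightarrow>
      eqv w' (TSeq \<tau>) (RecC [TSeq \<tau>] 0 \<cdot> (SucC \<cdot> n) \<cdot> NilC \<tau> \<cdot> G)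
        (appendC \<tau> \<cdot> (RecC [TSeq \<tau>] 0 \<cdot> n \<cdot> NilC \<tau> \<cdot> G) \<cdot> (projC ?\<phi> \<cdot> s \<cdot> n \<cdot> t))"
    using sapp_rec[OF ty(1,3)] by blast
  let ?R = "\<lambda>n. RecC [TSeq \<tau>] 0 \<cdot> n \<cdot> NilC \<tau> \<cdot> G"
  have wfC: "wf_int (cx w) (mem_fm \<tau> z (sappC \<sigma> \<tau> \<cdot> s \<cdot> t))" using ty by simp
  show ?thesis
  proof (rule mem_E[OF f wfC])
    fix w' i assume w': "ext w w'" and i: "less w' i (lenC ?\<phi> \<cdot> s)" and fi: "eqv w' ?\<phi> f (projC ?\<phi> \<cdot> s \<cdot> i)"
    note ty' = ty[THEN ty_mono[OF _ w']] and i' = less_ty(1)[OF i] and G' = ty_mono[OF G w']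
    have m': "mem w' \<tau> z (projC ?\<phi> \<cdot> s \<cdot> i \<cdot> t)"
      by (rule mem_cong2[OF pv_mono[OF m w'] eqv_fun[OF fi ty'(3)]])
    let ?A = "Imp (less_fm (ren Suc i) (Var 0)) (mem_fm \<tau> (ren Suc z) (RecC [TSeq \<tau>] 0 \<cdot> Var 0 \<cdot> NilC \<tau> \<cdot> ren Suc G))"
    have A: "fsub (inst n) ?A = Imp (less_fm i n) (mem_fm \<tau> z (?R n))" for n
      by simp
    have "pv w' (fsub (inst (lenC ?\<phi> \<cdot> s)) ?A)"
    proof (rule pv_nat_induct[OF _ less_ty(2)[OF i]])
      show "pv w' (fsub (inst ZeroC) ?A)" unfolding A
        by (rule pv_ImpI, use i' in simp, rule not_less_zero)
          (use ty' G' in \<open>auto intro: ty_mono\<close>)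
      fix w1 n assume w1: "ext w' w1" and n: "typeof n (cx w1) = Some TNat" and IH: "pv w1 (fsub (inst n) ?A)"
      note w1' = ext_trans[OF w' w1]
      show "pv w1 (fsub (inst (SucC \<cdot> n)) ?A)" unfolding A
      proof (rule pv_ImpI)
        show "wf_int (cx w1) (less_fm i (SucC \<cdot> n))" using n ty_mono[OF i' w1] by simp
        fix w2 assume w2: "ext w1 w2" and l: "less w2 i (SucC \<cdot> n)"
        note w2' = ext_trans[OF w1' w2]
        note n2 = ty_mono[OF n w2] and ty2 = ty[THEN ty_mono[OF _ w2']] and G2 = ty_mono[OF G w2']
          and i2 = less_ty(1)[OF l]
        have p: "typeof (projC ?\<phi> \<cdot> s \<cdot> n \<cdot> t) (cx w2) = Some (TSeq \<tau>)" "typeof (?R n) (cx w2) = Some (TSeq \<tau>)"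
          using ty2 G2 n2 by simp_all
        have "mem w2 \<tau> z (appendC \<tau> \<cdot> ?R n \<cdot> (projC ?\<phi> \<cdot> s \<cdot> n \<cdot> t))" (is "pv w2 ?C")
        proof (rule less_suc_E[OF l])
          show C: "wf_int (cx w2) ?C" using p ty2(2) by simp
          fix w3 assume w3: "ext w2 w3" and l: "less w3 i n"
          have "mem w3 \<tau> z (?R n)"
            using pv_mono[OF IH ext_trans[OF w2 w3]] l unfolding A by (rule pv_ImpD)
          then show "pv w3 ?C" by (rule mem_append_I1) (rule ty_mono[OF p(1) w3])
        next
          fix w3 assume w3: "ext w2 w3" and e: "eqv w3 TNat i n"
          have "eqv w3 (TSeq \<tau>) (projC ?\<phi> \<cdot> s \<cdot> i \<cdot> t) (projC ?\<phi> \<cdot> s \<cdot> n \<cdot> t)"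
            by (rule eqv_fun[OF eqv_arg[OF e]]) (use ty2[THEN ty_mono[OF _ w3]] in simp_all)
          from mem_cong2[OF pv_mono[OF m' ext_trans[OF w1 ext_trans[OF w2 w3]]] this]
          show "pv w3 ?C" by (rule mem_append_I2) (rule ty_mono[OF p(2) w3])
        qed
        then show "mem w2 \<tau> z (?R (SucC \<cdot> n))"
          by (rule mem_cong2) (rule eqv_sym[OF e2[rule_format, OF w2' n2]])
      qed
    qed (use i' ty' G' in simp)
    then have "pv w' (Imp (less_fm i (lenC ?\<phi> \<cdot> s)) (mem_fm \<tau> z (?R (lenC ?\<phi> \<cdot> s))))" unfolding A .
    from pv_ImpD[OF this i] show "mem w' \<tau> z (sappC \<sigma> \<tau> \<cdot> s \<cdot> t)"
      by (rule mem_cong2) (rule eqv_sym[OF eqv_mono[OF e1 w']])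
  qed
qed

text \<open>Enlarging the sequence of functions only adds pieces to the concatenation. This is the
  source of the monotonicity of the whole interpretation in its realizers.\<close>

lemma incl_sapp:
  assumes i: "incl w (TFun \<sigma> (TSeq \<tau>)) s s'" and s': "typeof s' (cx w) = Some (TSeq (TFun \<sigma> (TSeq \<tau>)))"
  shows "incl w \<tau> (sappC \<sigma> \<tau> \<cdot> s \<cdot> t) (sappC \<sigma> \<tau> \<cdot> s' \<cdot> t)"
proof (rule inclI)
  fix w' z assume w': "ext w w'" and m: "mem w' \<tau> z (sappC \<sigma> \<tau> \<cdot> s \<cdot> t)"
  have t: "typeof z (cx w') = Some \<tau>" "typeof t (cx w') = Some \<sigma>"
    using mem_ty[OF m] by (auto simp: typeof_App_iff simp del: typeof.simps(3))
  show "mem w' \<tau> z (sappC \<sigma> \<tau> \<cdot> s' \<cdot> t)"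
  proof (rule mem_sapp_E[OF m])
    fix w'' f assume w'': "ext w' w''" and f: "mem w'' (TFun \<sigma> (TSeq \<tau>)) f s" and z: "mem w'' \<tau> z (f \<cdot> t)"
    show "mem w'' \<tau> z (sappC \<sigma> \<tau> \<cdot> s' \<cdot> t)"
      by (rule mem_sapp_I[OF inclD[OF incl_mono[OF i ext_trans[OF w' w'']] f] z])
  qed (use t ty_mono[OF s' w'] in simp)
qed

lemma incl_sapps:
  "incl w (sapp_elem \<sigma>s \<tau>) s s' \<Longrightarrow> typeof s' (cx w) = Some (TSeq (sapp_elem \<sigma>s \<tau>)) \<Longrightarrow> tys w ts \<sigma>s \<Longrightarrow>
    incl w \<tau> (sapps \<sigma>s \<tau> s ts) (sapps \<sigma>s \<tau> s' ts)"
proof (induction \<sigma>s arbitrary: s s' ts)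
  case (Cons \<sigma> \<sigma>s)
  then obtain t ts' where t: "ts = t # ts'" "typeof t (cx w) = Some \<sigma>" "tys w ts' \<sigma>s" by (cases ts) auto
  show ?case unfolding t(1) sapps.simps
    by (rule Cons.IH[OF incl_sapp _ t(3)]) (use Cons.prems t(2) in auto)
qed simp

lemma eqv_sapps:
  "eqv w (TSeq (sapp_elem \<sigma>s \<tau>)) s s' \<Longrightarrow> tys w ts \<sigma>s \<Longrightarrow> eqv w (TSeq \<tau>) (sapps \<sigma>s \<tau> s ts) (sapps \<sigma>s \<tau> s' ts)"
proof (induction \<sigma>s arbitrary: s s' ts)
  case (Cons \<sigma> \<sigma>s)
  then obtain t ts' where t: "ts = t # ts'" "typeof t (cx w) = Some \<sigma>" "tys w ts' \<sigma>s" by (cases ts) auto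
  show ?case unfolding t(1) sapps.simps
    by (rule Cons.IH[OF eqv_fun[OF eqv_arg] t(3)]) (use Cons.prems t(2) in auto)
qed simp

text \<open>The \<beta>-law for iterated \<open>\<Lambda>\<close>, with a pending substitution as in
  \<open>eqv_beta_tuple\<close>: each singleton layer is removed by \<open>sapp_single\<close>, and
  the argument is absorbed into \<theta>.\<close>

lemma sapps_slam:
  "typeof (sub \<theta> (slam \<sigma>s \<tau> b)) (cx w) = Some (TSeq (sapp_elem \<sigma>s \<tau>)) \<Longrightarrow> tys w ts \<sigma>s \<Longrightarrow>
    eqv w (TSeq \<tau>) (sapps \<sigma>s \<tau> (sub \<theta> (slam \<sigma>s \<tau> b)) ts) (sub (envl ts \<theta>) b)"
proof (induction \<sigma>s arbitrary: \<theta> ts)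
  case Nil
  then show ?case by (auto intro: eqv_refl)
next
  case (Cons \<sigma> \<sigma>s)
  then obtain t ts' where t: "ts = t # ts'" "typeof t (cx w) = Some \<sigma>" "tys w ts' \<sigma>s" by (cases ts) auto
  let ?\<phi> = "TFun \<sigma> (TSeq (sapp_elem \<sigma>s \<tau>))"
  let ?b = "sub (up \<theta>) (slam \<sigma>s \<tau> b)"
  have b: "typeof ?b (\<sigma> # cx w) = Some (TSeq (sapp_elem \<sigma>s \<tau>))"
    using Cons.prems(1) by (auto simp: Let_def typeof_App_iff simp del: typeof.simps(3))
  have "eqv w (TSeq (sapp_elem \<sigma>s \<tau>)) (sappC \<sigma> (sapp_elem \<sigma>s \<tau>) \<cdot> single ?\<phi> (Lam \<sigma> ?b) \<cdot> t) (Lam \<sigma> ?b \<cdot> t)"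
    by (rule sapp_single[OF _ t(2)]) (simp add: b)
  also have "eqv w (TSeq (sapp_elem \<sigma>s \<tau>)) \<dots> (sub (inst t) ?b)"
    by (rule eqv_beta[OF b t(2)])
  finally have e: "eqv w (TSeq (sapp_elem \<sigma>s \<tau>)) (sappC \<sigma> (sapp_elem \<sigma>s \<tau>) \<cdot> single ?\<phi> (Lam \<sigma> ?b) \<cdot> t)
    (sub (case_nat t \<theta>) (slam \<sigma>s \<tau> b))" by simp
  have "eqv w (TSeq \<tau>) (sapps (\<sigma> # \<sigma>s) \<tau> (sub \<theta> (slam (\<sigma> # \<sigma>s) \<tau> b)) ts)
      (sapps \<sigma>s \<tau> (sub (case_nat t \<theta>) (slam \<sigma>s \<tau> b)) ts')"
    using eqv_sapps[OF e t(3)] by (simp add: t(1) Let_def)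
  also have "eqv w (TSeq \<tau>) \<dots> (sub (envl ts' (case_nat t \<theta>)) b)"
    by (rule Cons.IH[OF eqv_ty(2)[OF e] t(3)])
  finally show ?case by (simp add: t(1))
qed

lemma sappL_eqs:
  assumes s: "typeof s (cx w) = Some (TSeq (TFun \<sigma> (TSeq \<tau>)))"
  shows "typeof a (cx w) = Some \<sigma> \<Longrightarrow> typeof x (cx w) = Some (TSeq \<sigma>) \<Longrightarrow>
      eqv w (TSeq \<tau>) (sappLC \<sigma> \<tau> \<cdot> s \<cdot> (ConsC \<sigma> \<cdot> a \<cdot> x))
        (appendC \<tau> \<cdot> (sappC \<sigma> \<tau> \<cdot> s \<cdot> a) \<cdot> (sappLC \<sigma> \<tau> \<cdot> s \<cdot> x))"
proof -
  let ?\<phi> = "TFun \<sigma> (TSeq \<tau>)"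
  let ?b = "\<lambda>s. appendC \<tau> \<cdot> (sappC \<sigma> \<tau> \<cdot> s \<cdot> Var 0) \<cdot> Var 1"
  let ?F = "Lam (TSeq \<tau>) (Lam \<sigma> (?b (shift 2 s)))"
  let ?R = "\<lambda>x. LRecC \<sigma> [TSeq \<tau>] 0 \<cdot> x \<cdot> NilC \<tau> \<cdot> ?F"
  have sh: "typeof (ren (\<lambda>n. Suc (Suc n)) s) (\<sigma> # TSeq \<tau> # cx w) = Some (TSeq ?\<phi>)"
    using typeof_shift[of "[\<sigma>, TSeq \<tau>]" 2 s "cx w"] s by simp
  have unfold: "eqv w (TSeq \<tau>) (sappLC \<sigma> \<tau> \<cdot> s \<cdot> x) (?R x)" if "typeof x (cx w) = Some (TSeq \<sigma>)" for x
    using eqv_beta2[of "LRecC \<sigma> [TSeq \<tau>] 0 \<cdot> Var 0 \<cdot> NilC \<tau> \<cdot> Lam (TSeq \<tau>) (Lam \<sigma> (?b (Var 3)))"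
      "TSeq \<sigma>" "TSeq ?\<phi>" w "TSeq \<tau>" s x] s that
    by (simp add: sappLC_def numeral_eq_Suc)
  show "eqv w (TSeq \<tau>) (sappLC \<sigma> \<tau> \<cdot> s \<cdot> (ConsC \<sigma> \<cdot> a \<cdot> x))
        (appendC \<tau> \<cdot> (sappC \<sigma> \<tau> \<cdot> s \<cdot> a) \<cdot> (sappLC \<sigma> \<tau> \<cdot> s \<cdot> x))"
    if ax: "typeof a (cx w) = Some \<sigma>" "typeof x (cx w) = Some (TSeq \<sigma>)"
  proof -
    have "eqv w (TSeq \<tau>) (sappLC \<sigma> \<tau> \<cdot> s \<cdot> (ConsC \<sigma> \<cdot> a \<cdot> x)) (?R (ConsC \<sigma> \<cdot> a \<cdot> x))"
      by (rule unfold) (use ax in simp)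
    also have "eqv w (TSeq \<tau>) \<dots> (?F \<cdot> ?R x \<cdot> a)"
      by (rule lrec1_cons) (use ax sh in simp_all)
    also have "eqv w (TSeq \<tau>) \<dots> (appendC \<tau> \<cdot> (sappC \<sigma> \<tau> \<cdot> s \<cdot> a) \<cdot> ?R x)"
      using eqv_beta2[of "?b (shift 2 s)" \<sigma> "TSeq \<tau>" w "TSeq \<tau>" "?R x" a] ax s sh by simp
    also have "eqv w (TSeq \<tau>) \<dots> (appendC \<tau> \<cdot> (sappC \<sigma> \<tau> \<cdot> s \<cdot> a) \<cdot> (sappLC \<sigma> \<tau> \<cdot> s \<cdot> x))"
      by (rule eqv_arg[OF eqv_sym[OF unfold]]) (use ax s in simp_all)
    finally show ?thesis .
  qed
qed

lemma mem_sappL_I: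
  assumes a: "mem w \<sigma> a l" and z: "mem w \<tau> z (sappC \<sigma> \<tau> \<cdot> s \<cdot> a)"
  shows "mem w \<tau> z (sappLC \<sigma> \<tau> \<cdot> s \<cdot> l)"
proof -
  have ty: "typeof s (cx w) = Some (TSeq (TFun \<sigma> (TSeq \<tau>)))" "typeof z (cx w) = Some \<tau>"
    "typeof a (cx w) = Some \<sigma>" "typeof l (cx w) = Some (TSeq \<sigma>)"
    using mem_ty[OF z] mem_ty[OF a] by (auto simp: typeof_App_iff simp del: typeof.simps(3))
  let ?A = "Imp (mem_fm \<sigma> (ren Suc a) (Var 0)) (mem_fm \<tau> (ren Suc z) (sappLC \<sigma> \<tau> \<cdot> ren Suc s \<cdot> Var 0))"
  have A: "fsub (inst l) ?A = Imp (mem_fm \<sigma> a l) (mem_fm \<tau> z (sappLC \<sigma> \<tau> \<cdot> s \<cdot> l))" for l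
    by simp
  have "pv w (fsub (inst l) ?A)"
  proof (rule pv_list_induct[OF _ ty(4)])
    show "pv w (fsub (inst (NilC \<sigma>)) ?A)" unfolding A
      by (rule pv_ImpI, use ty in simp, rule mem_nil) (use ty in \<open>auto intro: ty_mono\<close>)
    fix w' b y assume w': "ext w w'" and bt: "typeof b (cx w') = Some \<sigma>" "typeof y (cx w') = Some (TSeq \<sigma>)"
      and IH: "pv w' (fsub (inst y) ?A)"
    note ty' = ty[THEN ty_mono[OF _ w']]
    show "pv w' (fsub (inst (ConsC \<sigma> \<cdot> b \<cdot> y)) ?A)" unfolding A
    proof (rule pv_ImpI)
      show "wf_int (cx w') (mem_fm \<sigma> a (ConsC \<sigma> \<cdot> b \<cdot> y))" using ty' bt by simp
      fix w2 assume w2: "ext w' w2" and m: "mem w2 \<sigma> a (ConsC \<sigma> \<cdot> b \<cdot> y)"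
      note ty2 = ty'[THEN ty_mono[OF _ w2]] and bt2 = bt[THEN ty_mono[OF _ w2]]
      have "mem w2 \<tau> z (appendC \<tau> \<cdot> (sappC \<sigma> \<tau> \<cdot> s \<cdot> b) \<cdot> (sappLC \<sigma> \<tau> \<cdot> s \<cdot> y))" (is "pv w2 ?C")
      proof (rule mem_cons_E[OF m])
        show "wf_int (cx w2) ?C" using ty2 bt2 by simp
        fix w3 assume w3: "ext w2 w3" and e: "eqv w3 \<sigma> a b"
        note ty3 = ty2[THEN ty_mono[OF _ w3]] and bt3 = bt2[THEN ty_mono[OF _ w3]]
        have "mem w3 \<tau> z (sappC \<sigma> \<tau> \<cdot> s \<cdot> b)"
          by (rule mem_cong2[OF pv_mono[OF z ext_trans[OF w' ext_trans[OF w2 w3]]] eqv_arg[OF e]])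
            (use ty3 in simp)
        then show "pv w3 ?C" by (rule mem_append_I1) (use ty3 bt3 in simp)
      next
        fix w3 assume w3: "ext w2 w3" and e: "mem w3 \<sigma> a y"
        note ty3 = ty2[THEN ty_mono[OF _ w3]] and bt3 = bt2[THEN ty_mono[OF _ w3]]
        have "mem w3 \<tau> z (sappLC \<sigma> \<tau> \<cdot> s \<cdot> y)"
          using pv_mono[OF IH ext_trans[OF w2 w3]] e unfolding A by (rule pv_ImpD)
        then show "pv w3 ?C" by (rule mem_append_I2) (use ty3 bt3 in simp)
      qed
      then show "mem w2 \<tau> z (sappLC \<sigma> \<tau> \<cdot> s \<cdot> (ConsC \<sigma> \<cdot> b \<cdot> y))"
        by (rule mem_cong2) (rule eqv_sym[OF sappL_eqs[OF ty2(1) bt2]])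
    qed
  qed (use ty in simp)
  then have "pv w (Imp (mem_fm \<sigma> a l) (mem_fm \<tau> z (sappLC \<sigma> \<tau> \<cdot> s \<cdot> l)))" unfolding A .
  then show ?thesis using a by (rule pv_ImpD)
qed

text \<open>When only sequences \<open>ls\<close> containing the arguments \<open>vs\<close> are
  known, the union over all members of \<open>ls\<close> bounds \<open>s[vs]\<close>. The first
  application is enlarged to a union by \<open>mem_sappL_I\<close>, the later ones are monotone by
  \<open>incl_sapps\<close>, and the induction goes on with the remaining arguments.\<close>

lemma mem_sappsL:
  "mems w \<sigma>s vs ls \<Longrightarrow> mem w \<tau> z (sapps \<sigma>s \<tau> s vs) \<Longrightarrow> typeof s (cx w) = Some (TSeq (sapp_elem \<sigma>s \<tau>)) \<Longrightarrow>
    mem w \<tau> z (sappsL \<sigma>s \<tau> s ls)"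
proof (induction \<sigma>s arbitrary: s vs ls)
  case Nil
  then show ?case by (cases vs; cases ls) auto
next
  case (Cons \<sigma> \<sigma>s)
  then obtain v vs' l ls' where *: "vs = v # vs'" "ls = l # ls'" "mem w \<sigma> v l" "mems w \<sigma>s vs' ls'"
    by (cases vs; cases ls) auto
  let ?\<tau> = "sapp_elem \<sigma>s \<tau>"
  have L: "typeof (sappLC \<sigma> ?\<tau> \<cdot> s \<cdot> l) (cx w) = Some (TSeq ?\<tau>)"
    using Cons.prems(3) mem_ty(2)[OF *(3)] by simp
  have "incl w ?\<tau> (sappC \<sigma> ?\<tau> \<cdot> s \<cdot> v) (sappLC \<sigma> ?\<tau> \<cdot> s \<cdot> l)"
    by (rule inclI) (blast intro: mem_sappL_I pv_mono[OF *(3)])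
  from incl_sapps[OF this L mems_tys[OF *(4)]]
  have "mem w \<tau> z (sapps \<sigma>s \<tau> (sappLC \<sigma> ?\<tau> \<cdot> s \<cdot> l) vs')"
    using Cons.prems(2) by (auto simp: *(1) dest: inclD)
  from Cons.IH[OF *(4) this L] show ?case by (simp add: *)
qed

end

section \<open>The matrix of the interpretation\<close>

lemma D_fsub [simp]: "D_elems (fsub \<theta> A) = D_elems A" "D_univ (fsub \<theta> A) = D_univ A"
  by (induction A arbitrary: \<theta>) simp_all

lemma D_fren [simp]: "D_elems (fren r A) = D_elems A" "D_univ (fren r A) = D_univ A"
  by (simp_all add: fren_eq_fsub del: fsub_Var_ren)

lemma map_sub_Var [simp]: "map (sub Var) ts = ts"
  by (induction ts) auto

lemma length_D_exist [simp]: "length (D_exist A) = length (D_elems A)"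
  by (simp add: D_exist_def)

lemma D_internal: "internal A \<Longrightarrow> D_elems A = []" "internal A \<Longrightarrow> D_univ A = []"
  by (induction A) auto

text \<open>Internal formulas have empty tuples on both sides, so every block of bounded quantifiers
  is empty and the clauses reproduce the formula.\<close>

lemma D_matrix_internal: "internal A \<Longrightarrow> D_matrix A \<rho> xs ys = fsub \<rho> A"
  by (induction A arbitrary: \<rho> xs ys) (auto simp: D_internal D_exist_def Let_def)

text \<open>The reason for giving \<open>D_matrix\<close> an environment argument: substitution in
  the formula composes with the environment and leaves the realizers alone.\<close>

lemma D_matrix_fsub: "D_matrix (fsub \<theta> A) \<rho> xs ys = D_matrix A (\<lambda>i. sub \<rho> (\<theta> i)) xs ys"
proof (induction A arbitrary: \<theta> \<rho> xs ys)
  case (Imp A B)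
  then show ?case by (simp add: D_exist_def Let_def ren_sub)
next
  case (Forall \<sigma> A)
  then show ?case by (simp add: sub_up_up)
next
  case (Exists \<sigma> A)
  have "(\<lambda>i. sub (\<lambda>i. shift n (up \<rho> i)) (up \<theta> i)) = (\<lambda>i. shift n (up (\<lambda>i. sub \<rho> (\<theta> i)) i))" for n
    by (simp add: sub_up_up[symmetric] ren_sub)
  then show ?case using Exists by (simp add: Let_def)
next
  case (ForallSt \<sigma> A)
  then show ?case by simp
next
  case (ExistsSt \<sigma> A)
  have "(\<lambda>i. sub (\<lambda>i. shift n (up \<rho> i)) (up \<theta> i)) = (\<lambda>i. shift n (up (\<lambda>i. sub \<rho> (\<theta> i)) i))" for n
    by (simp add: sub_up_up[symmetric] ren_sub)
  then show ?case using ExistsSt by (simp add: Let_def)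
qed (auto simp: D_exist_def Let_def)

lemma D_matrix_fren: "D_matrix (fren r A) \<rho> xs ys = D_matrix A (\<lambda>i. \<rho> (r i)) xs ys"
  by (simp add: fren_eq_fsub D_matrix_fsub del: fsub_Var_ren)

abbreviation map_sapps :: "ty list \<Rightarrow> ty list \<Rightarrow> tm list \<Rightarrow> tm list \<Rightarrow> tm list" where
  "map_sapps \<sigma>s \<tau>s ss ts \<equiv> map2 (\<lambda>\<tau> s. sapps \<sigma>s \<tau> s ts) \<tau>s ss"

lemma map_sub_map_sapps [simp]:
  "map (sub \<theta>) (map_sapps \<sigma>s \<tau>s ss ts) = map_sapps \<sigma>s \<tau>s (map (sub \<theta>) ss) (map (sub \<theta>) ts)"
proof (induction \<tau>s arbitrary: ss)
  case (Cons \<tau> \<tau>s)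
  then show ?case by (cases ss) auto
qed simp

lemma D_matrix_And:
  "length xs = length (D_elems A) \<Longrightarrow> length ys = length (D_univ A) \<Longrightarrow>
    D_matrix (And A B) \<rho> (xs @ xs') (ys @ ys') = And (D_matrix A \<rho> xs ys) (D_matrix B \<rho> xs' ys')"
  by simp

lemma D_matrix_Or:
  "length xs = length (D_elems A) \<Longrightarrow> length ys = length (D_univ A) \<Longrightarrow>
    D_matrix (Or A B) \<rho> (xs @ xs') (ys @ ys') = Or (D_matrix A \<rho> xs ys) (D_matrix B \<rho> xs' ys')"
  by simp

lemma D_matrix_Imp:
  "length Us = length (D_elems B) \<Longrightarrow> length xs = length (D_elems A) \<Longrightarrow> n = length (D_univ A) \<Longrightarrow>
    D_matrix (Imp A B) \<rho> (Us @ Ys) (xs @ vs) =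
      Imp (balls_fm (D_univ A) (map_sapps (D_exist A @ D_univ B) (D_univ A) Ys (xs @ vs))
          (D_matrix A (\<lambda>i. shift n (\<rho> i)) (map (shift n) xs) (vars n)))
        (D_matrix B \<rho> (map_sapps (D_exist A) (D_elems B) Us xs) vs)"
  by (simp add: Let_def)

lemma length_appendE:
  assumes "length xs = m + n"
  obtains ys zs where "xs = ys @ zs" "length ys = m" "length zs = n"
  using assms that[of "take m xs" "drop m xs"] by simp

text \<open>The length premises matter because \<open>hd\<close> and \<open>last\<close> of an empty
  list do not commute with substitution. Under a block of bounded quantifiers the substitution is
  lifted by \<open>ups\<close>, which commutes with the shifts and fixes
  \<open>vars\<close>.\<close>

lemma fsub_D_matrix:
  "length xs = length (D_elems A) \<Longrightarrow> length ys = length (D_univ A) \<Longrightarrow>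
    fsub \<theta> (D_matrix A \<rho> xs ys) = D_matrix A (\<lambda>i. sub \<theta> (\<rho> i)) (map (sub \<theta>) xs) (map (sub \<theta>) ys)"
proof (induction A arbitrary: \<theta> \<rho> xs ys)
  case (St \<sigma> t)
  then show ?case by (cases xs) auto
next
  case (And A B)
  then show ?case by (simp add: Let_def take_map drop_map)
next
  case (Or A B)
  then show ?case by (simp add: Let_def take_map drop_map)
next
  case (Imp A B)
  let ?n = "length (D_univ A)"
  obtain Us Ys where xs: "xs = Us @ Ys" "length Us = length (D_elems B)" "length Ys = ?n"
    using Imp.prems(1) by (auto elim: length_appendE)
  obtain x v where ys: "ys = x @ v" "length x = length (D_elems A)" "length v = length (D_univ B)"
    using Imp.prems(2) by (auto elim: length_appendE)
  have A: "fsub (ups ?n \<theta>) (D_matrix A (\<lambda>i. shift ?n (\<rho> i)) (map (shift ?n) x) (vars ?n))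
      = D_matrix A (\<lambda>i. shift ?n (sub \<theta> (\<rho> i))) (map (shift ?n) (map (sub \<theta>) x)) (vars ?n)"
    by (simp add: Imp.IH ys comp_def ren_sub)
  show ?case using xs ys A
    by (simp add: D_matrix_Imp[where n = ?n] Imp.IH del: D_matrix.simps map_map)
next
  case (Forall \<sigma> A)
  then show ?case by (simp add: sub_up_up comp_def ren_sub)
next
  case (Exists \<sigma> A)
  let ?n = "length (D_univ A)"
  have 1: "(\<lambda>i. sub (ups ?n (up \<theta>)) (shift ?n (up \<rho> i))) = (\<lambda>i. shift ?n (up (\<lambda>i. sub \<theta> (\<rho> i)) i))"
    unfolding sub_ups_shift by (simp add: sub_up_up[symmetric])
  have 2: "sub (ups ?n (up \<theta>)) (shift (Suc ?n) x) = shift (Suc ?n) (sub \<theta> x)" for x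
    using sub_ups_shift[of "Suc ?n" \<theta> x] by simp
  have 3: "sub (up \<theta>) (shift (Suc 0) x) = shift (Suc 0) (sub \<theta> x)" for x
    by (simp add: ren_sub)
  show ?case using Exists.prems
    by (simp add: Let_def Exists.IH comp_def 1 2 3 del: sub_ren add_Suc_right sub_ups_shift)
next
  case (ForallSt \<sigma> A)
  then obtain z zs where ys: "ys = z # zs" by (cases ys) auto
  show ?case using ForallSt by (simp add: ys sub_case_nat del: map_map sapps.simps)
next
  case (ExistsSt \<sigma> A)
  let ?n = "length (D_univ A)"
  have 1: "(\<lambda>i. sub (ups ?n (up \<theta>)) (shift ?n (up \<rho> i))) = (\<lambda>i. shift ?n (up (\<lambda>i. sub \<theta> (\<rho> i)) i))"
    unfolding sub_ups_shift by (simp add: sub_up_up[symmetric])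
  have 2: "sub (ups ?n (up \<theta>)) (shift (Suc ?n) x) = shift (Suc ?n) (sub \<theta> x)" for x
    using sub_ups_shift[of "Suc ?n" \<theta> x] by simp
  have 3: "sub (up \<theta>) (shift (Suc 0) x) = shift (Suc 0) (sub \<theta> x)" for x
    by (simp add: ren_sub)
  have "xs \<noteq> []" using ExistsSt.prems by auto
  then show ?case using ExistsSt.prems
    by (simp add: Let_def ExistsSt.IH comp_def 1 2 3 last_map map_butlast[symmetric]
        del: sub_ren add_Suc_right sub_ups_shift)
qed (auto)

lemma inst_D_matrix:
  "length xs = length (D_elems A) \<Longrightarrow> length ys = n \<Longrightarrow> n = length (D_univ A) \<Longrightarrow>
    fsub (envl ys \<theta>) (D_matrix A (\<lambda>i. shift n (\<rho> i)) (map (shift n) xs) (vars n))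
      = D_matrix A (\<lambda>i. sub \<theta> (\<rho> i)) (map (sub \<theta>) xs) ys"
  by (simp add: fsub_D_matrix comp_def del: sub_ren)

abbreviation tyl :: "ctx \<Rightarrow> tm list \<Rightarrow> ty list \<Rightarrow> bool" where
  "tyl \<Gamma> ts \<sigma>s \<equiv> map (\<lambda>t. typeof t \<Gamma>) ts = map Some \<sigma>s"

abbreviation env :: "ctx \<Rightarrow> ctx \<Rightarrow> (nat \<Rightarrow> tm) \<Rightarrow> bool" where
  "env G \<Gamma> \<rho> \<equiv> (\<forall>i<length \<Gamma>. typeof (\<rho> i) G = Some (\<Gamma> ! i))"

lemma tyl_length: "tyl \<Gamma> ts \<sigma>s \<Longrightarrow> length ts = length \<sigma>s"
  by (metis length_map)

lemma tyl_appendD: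
  "tyl \<Gamma> ts (\<sigma>s @ \<tau>s) \<Longrightarrow> n = length \<sigma>s \<Longrightarrow> tyl \<Gamma> (take n ts) \<sigma>s \<and> tyl \<Gamma> (drop n ts) \<tau>s"
  by (metis append_eq_conv_conj length_map map_append take_map drop_map)

lemma tyl_appendE:
  assumes "tyl \<Gamma> ts (\<sigma>s @ \<tau>s)"
  obtains ts1 ts2 where "ts = ts1 @ ts2" "tyl \<Gamma> ts1 \<sigma>s" "tyl \<Gamma> ts2 \<tau>s"
  using tyl_appendD[OF assms refl] by (metis append_take_drop_id)

lemma tyl_snocE:
  assumes "tyl \<Gamma> ts (\<sigma>s @ [\<sigma>])"
  obtains ts' t where "ts = ts' @ [t]" "tyl \<Gamma> ts' \<sigma>s" "typeof t \<Gamma> = Some \<sigma>"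
proof -
  from assms obtain ts1 ts2 where "ts = ts1 @ ts2" "tyl \<Gamma> ts1 \<sigma>s" "tyl \<Gamma> ts2 [\<sigma>]"
    by (rule tyl_appendE)
  then show thesis using that by (cases ts2) auto
qed

lemma tyl_map_sapps:
  "tyl \<Gamma> ss (map (\<lambda>\<tau>. TSeq (sapp_elem \<sigma>s \<tau>)) \<tau>s) \<Longrightarrow> tyl \<Gamma> ts \<sigma>s \<Longrightarrow>
    tyl \<Gamma> (map_sapps \<sigma>s \<tau>s ss ts) (map TSeq \<tau>s)"
proof (induction \<tau>s arbitrary: ss)
  case (Cons \<tau> \<tau>s)
  then show ?case by (cases ss) (auto simp: typeof_sapps)
qed simp

lemma tyl_shift: "tyl \<Gamma> ts \<sigma>s \<Longrightarrow> length \<Delta> = n \<Longrightarrow> tyl (\<Delta> @ \<Gamma>) (map (shift n) ts) \<sigma>s"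
  by (simp add: typeof_shift comp_def)

lemma tyl_vars: "length \<sigma>s = n \<Longrightarrow> tyl (rev \<sigma>s @ \<Gamma>) (vars n) \<sigma>s"
  by (rule nth_equalityI) (auto simp: vars_def nth_append rev_nth)

lemma env_shift: "env G \<Gamma> \<rho> \<Longrightarrow> length \<Delta> = n \<Longrightarrow> env (\<Delta> @ G) \<Gamma> (\<lambda>i. shift n (\<rho> i))"
  by (simp add: typeof_shift)

lemma env_up: "env G \<Gamma> \<rho> \<Longrightarrow> env (\<sigma> # G) (\<sigma> # \<Gamma>) (up \<rho>)"
  by (auto simp: up_def nth_Cons split: nat.splits)

lemma env_case_nat: "env G \<Gamma> \<rho> \<Longrightarrow> typeof z G = Some \<sigma> \<Longrightarrow> env G (\<sigma> # \<Gamma>) (case_nat z \<rho>)"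
  by (auto simp: nth_Cons split: nat.splits)

text \<open>The conclusion is \<open>wf_int\<close> even when \<open>A\<close> is external: the
  clause for \<open>St\<close> is membership in a sequence, \<open>ExistsSt\<close> becomes a
  bounded quantifier, and \<open>ForallSt\<close> moves its variable into the environment.\<close>

lemma wf_D_matrix:
  "wf_fm \<Gamma> A \<Longrightarrow> env G \<Gamma> \<rho> \<Longrightarrow> tyl G xs (D_exist A) \<Longrightarrow> tyl G ys (D_univ A) \<Longrightarrow>
    wf_int G (D_matrix A \<rho> xs ys)"
proof (induction A arbitrary: \<Gamma> G \<rho> xs ys)
  case (Eq \<sigma> s t)
  then show ?case by (auto simp: wf_int_simps has_type_iff intro: typeof_sub)
next
  case (St \<sigma> t)
  then show ?case by (auto simp: D_exist_def has_type_iff intro: typeof_sub)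
next
  case (And A B)
  obtain x1 x2 where x: "xs = x1 @ x2" "tyl G x1 (D_exist A)" "tyl G x2 (D_exist B)"
    using tyl_appendE[of G xs "D_exist A" "D_exist B"] And.prems(3) by (auto simp: D_exist_def)
  obtain y1 y2 where y: "ys = y1 @ y2" "tyl G y1 (D_univ A)" "tyl G y2 (D_univ B)"
    using tyl_appendE[of G ys "D_univ A" "D_univ B"] And.prems(4) by auto
  have "wf_int G (D_matrix A \<rho> x1 y1)" "wf_int G (D_matrix B \<rho> x2 y2)"
    using And.IH(1)[OF _ And.prems(2) x(2) y(2)] And.IH(2)[OF _ And.prems(2) x(3) y(3)] And.prems(1) by auto
  then show ?case
    using tyl_length[OF x(2)] tyl_length[OF y(2)] unfolding x y
    by (simp add: D_matrix_And wf_int_simps del: D_matrix.simps)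
next
  case (Or A B)
  obtain x1 x2 where x: "xs = x1 @ x2" "tyl G x1 (D_exist A)" "tyl G x2 (D_exist B)"
    using tyl_appendE[of G xs "D_exist A" "D_exist B"] Or.prems(3) by (auto simp: D_exist_def)
  obtain y1 y2 where y: "ys = y1 @ y2" "tyl G y1 (D_univ A)" "tyl G y2 (D_univ B)"
    using tyl_appendE[of G ys "D_univ A" "D_univ B"] Or.prems(4) by auto
  have "wf_int G (D_matrix A \<rho> x1 y1)" "wf_int G (D_matrix B \<rho> x2 y2)"
    using Or.IH(1)[OF _ Or.prems(2) x(2) y(2)] Or.IH(2)[OF _ Or.prems(2) x(3) y(3)] Or.prems(1) by auto
  then show ?case
    using tyl_length[OF x(2)] tyl_length[OF y(2)] unfolding x y
    by (simp add: D_matrix_Or wf_int_simps del: D_matrix.simps)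
next
  case (Imp A B)
  let ?n = "length (D_univ A)"
  let ?Us = "take (length (D_elems B)) xs" and ?Ys = "drop (length (D_elems B)) xs"
  let ?xs = "take (length (D_elems A)) ys" and ?vs = "drop (length (D_elems A)) ys"
  have X: "tyl G ?Us (map (\<lambda>\<tau>. TSeq (sapp_elem (D_exist A) \<tau>)) (D_elems B))"
    "tyl G ?Ys (map (\<lambda>\<tau>. TSeq (sapp_elem (D_exist A @ D_univ B) \<tau>)) (D_univ A))"
    using tyl_appendD[of G xs "map (\<lambda>\<tau>. TSeq (sapp_elem (D_exist A) \<tau>)) (D_elems B)"
        "map (\<lambda>\<tau>. TSeq (sapp_elem (D_exist A @ D_univ B) \<tau>)) (D_univ A)" "length (D_elems B)"] Imp.prems(3)
    by (simp_all add: D_exist_def comp_def)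
  have Y: "tyl G ?xs (D_exist A)" "tyl G ?vs (D_univ B)"
    using tyl_appendD[of G ys "D_exist A" "D_univ B" "length (D_elems A)"] Imp.prems(4)
    by (simp_all add: D_exist_def)
  have 1: "tyl G (map_sapps (D_exist A) (D_elems B) ?Us ?xs) (D_exist B)"
    using tyl_map_sapps[OF X(1) Y(1)] by (simp add: D_exist_def)
  have 2: "tyl G (map_sapps (D_exist A @ D_univ B) (D_univ A) ?Ys (?xs @ ?vs)) (map TSeq (D_univ A))"
    by (rule tyl_map_sapps[OF X(2)]) (simp only: map_append Y)
  have A: "wf_int (rev (D_univ A) @ G) (D_matrix A (\<lambda>i. shift ?n (\<rho> i)) (map (shift ?n) ?xs) (vars ?n))"
    by (rule Imp.IH(1)[of \<Gamma>]) (use Imp.prems(1,2) Y(1) in \<open>auto simp: typeof_shift tyl_vars comp_def\<close>)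
  have B: "wf_int G (D_matrix B \<rho> (map_sapps (D_exist A) (D_elems B) ?Us ?xs) ?vs)"
    by (rule Imp.IH(2)[of \<Gamma>]) (use Imp.prems(1,2) Y(2) 1 in auto)
  show ?case
    using A B wf_int_balls_fm[of G "map_sapps (D_exist A @ D_univ B) (D_univ A) ?Ys (?xs @ ?vs)" "D_univ A"] 2
    by (simp add: Let_def wf_int_simps comp_def)
next
  case (Forall \<sigma> A)
  show ?case using Forall.IH[of "\<sigma> # \<Gamma>" "up \<rho>" "\<sigma> # G" "map (shift 1) xs" "map (shift 1) ys"] Forall.prems env_up[OF Forall.prems(2), of \<sigma>]
    by (simp add: wf_int_simps D_exist_def comp_def)
next
  case (Exists \<sigma> A)
  let ?n = "length (D_univ A)"
  have "wf_int (rev (D_univ A) @ \<sigma> # G) (D_matrix A (\<lambda>i. shift ?n (up \<rho> i)) (map (shift (Suc ?n)) xs) (vars ?n))"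
  proof (rule Exists.IH[of "\<sigma> # \<Gamma>"])
    show "env (rev (D_univ A) @ \<sigma> # G) (\<sigma> # \<Gamma>) (\<lambda>i. shift ?n (up \<rho> i))"
      by (rule env_shift[OF env_up[OF Exists.prems(2)]]) simp
    show "tyl (rev (D_univ A) @ \<sigma> # G) (map (shift (Suc ?n)) xs) (D_exist A)"
      using tyl_shift[of G xs "D_exist A" "rev (D_univ A) @ [\<sigma>]" "Suc ?n"] Exists.prems(3) by (simp add: D_exist_def)
  qed (use Exists.prems in \<open>auto simp: tyl_vars\<close>)
  then show ?case
    using wf_int_balls_fm[of "\<sigma> # G" "map (shift 1) ys" "D_univ A"] Exists.prems(4)
    by (simp add: Let_def wf_int_simps comp_def)
next
  case (ForallSt \<sigma> A)
  then obtain z zs where ys: "ys = z # zs" "typeof z G = Some \<sigma>" "tyl G zs (D_univ A)" by (cases ys) auto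
  have "tyl G (map_sapps [\<sigma>] (D_elems A) xs [z]) (D_exist A)"
    using tyl_map_sapps[of G xs "[\<sigma>]" "D_elems A" "[z]"] ForallSt.prems(3) ys(2) by (simp add: D_exist_def comp_def)
  then show ?case
    using ForallSt.IH[of "\<sigma> # \<Gamma>" "case_nat z \<rho>" G _ zs] ForallSt.prems(1) env_case_nat[OF ForallSt.prems(2) ys(2)] ys
    by simp
next
  case (ExistsSt \<sigma> A)
  let ?n = "length (D_univ A)"
  from ExistsSt.prems(3) have "tyl G xs (D_exist A @ [TSeq \<sigma>])" by (simp add: D_exist_def)
  then obtain xs' z where xs: "xs = xs' @ [z]" "tyl G xs' (D_exist A)" "typeof z G = Some (TSeq \<sigma>)"
    by (rule tyl_snocE)
  have "wf_int (rev (D_univ A) @ \<sigma> # G) (D_matrix A (\<lambda>i. shift ?n (up \<rho> i)) (map (shift (Suc ?n)) xs') (vars ?n))"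
  proof (rule ExistsSt.IH[of "\<sigma> # \<Gamma>"])
    show "env (rev (D_univ A) @ \<sigma> # G) (\<sigma> # \<Gamma>) (\<lambda>i. shift ?n (up \<rho> i))"
      by (rule env_shift[OF env_up[OF ExistsSt.prems(2)]]) simp
    show "tyl (rev (D_univ A) @ \<sigma> # G) (map (shift (Suc ?n)) xs') (D_exist A)"
      using tyl_shift[of G xs' "D_exist A" "rev (D_univ A) @ [\<sigma>]" "Suc ?n"] xs(2) by simp
  qed (use ExistsSt.prems in \<open>auto simp: tyl_vars\<close>)
  then show ?case
    using wf_int_balls_fm[of "\<sigma> # G" "map (shift 1) ys" "D_univ A"] ExistsSt.prems(4) xs
    by (simp add: Let_def comp_def)
qed (simp add: wf_int_simps)

context eha
begin

section \<open>Forcing clauses of the matrix: introduction and elimination for each kind of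
  connective\<close>

abbreviation MD :: "world \<Rightarrow> fm \<Rightarrow> (nat \<Rightarrow> tm) \<Rightarrow> tm list \<Rightarrow> tm list \<Rightarrow> bool" where
  "MD w A \<rho> xs ys \<equiv> pv w (D_matrix A \<rho> xs ys)"

lemma env_mono: "env (cx w) \<Gamma> \<rho> \<Longrightarrow> ext w w' \<Longrightarrow> env (cx w') \<Gamma> \<rho>"
  by (blast intro: ty_mono)

lemma balls_MD_I:
  assumes "wf_fm \<Gamma> A" "env (cx w) \<Gamma> \<rho>" "tys w xs (D_exist A)" "tys w ts (map TSeq (D_univ A))"
    and n: "n = length (D_univ A)"
    and "\<And>w' ys. ext w w' \<Longrightarrow> mems w' (D_univ A) ys ts \<Longrightarrow> MD w' A \<rho> xs ys"
  shows "pv w (balls_fm (D_univ A) ts (D_matrix A (\<lambda>i. shift n (\<rho> i)) (map (shift n) xs) (vars n)))"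
proof (rule ballsI)
  show "wf_int (rev (D_univ A) @ cx w) (D_matrix A (\<lambda>i. shift n (\<rho> i)) (map (shift n) xs) (vars n))"
    by (rule wf_D_matrix[OF assms(1)]) (use assms in \<open>auto simp: typeof_shift tyl_vars comp_def\<close>)
  fix w' ys assume w': "ext w w'" and ys: "mems w' (D_univ A) ys ts"
  show "pv w' (fsub (envl ys Var) (D_matrix A (\<lambda>i. shift n (\<rho> i)) (map (shift n) xs) (vars n)))"
    by (subst inst_D_matrix)
      (use mems_length[OF ys] n tyl_length[OF assms(3)] assms(6)[OF w' ys] in \<open>simp_all\<close>)
qed (use assms(4) in \<open>simp add: comp_def\<close>)

lemma balls_MD_D:
  assumes "pv w (balls_fm (D_univ A) ts (D_matrix A (\<lambda>i. shift n (\<rho> i)) (map (shift n) xs) (vars n)))"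
    and n: "n = length (D_univ A)" and ys: "mems w (D_univ A) ys ts" and xs: "length xs = length (D_elems A)"
  shows "MD w A \<rho> xs ys"
proof -
  have "pv w (fsub (envl ys Var) (D_matrix A (\<lambda>i. shift n (\<rho> i)) (map (shift n) xs) (vars n)))"
    by (rule ballsD[OF assms(1) ys])
  then show ?thesis
    by (subst (asm) inst_D_matrix) (use mems_length[OF ys] n xs in simp_all)
qed

text \<open>With this clause and \<open>MD_ImpD\<close> the bounded quantifiers of an implication
  are read as statements about members at later worlds, so that most soundness proofs can avoid the
  shifted form inside \<open>D_matrix\<close>.\<close>

lemma MD_ImpI:
  assumes wf: "wf_fm \<Gamma> (Imp A B)" and env: "env (cx w) \<Gamma> \<rho>"
    and Us: "tys w Us (map (\<lambda>\<tau>. TSeq (sapp_elem (D_exist A) \<tau>)) (D_elems B))"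
    and Ys: "tys w Ys (map (\<lambda>\<tau>. TSeq (sapp_elem (D_exist A @ D_univ B) \<tau>)) (D_univ A))"
    and xs: "tys w xs (D_exist A)" and vs: "tys w vs (D_univ B)"
    and main: "\<And>w'. ext w w' \<Longrightarrow>
      (\<And>w'' ys. ext w' w'' \<Longrightarrow> mems w'' (D_univ A) ys (map_sapps (D_exist A @ D_univ B) (D_univ A) Ys (xs @ vs)) \<Longrightarrow>
        MD w'' A \<rho> xs ys) \<Longrightarrow>
      MD w' B \<rho> (map_sapps (D_exist A) (D_elems B) Us xs) vs"
  shows "MD w (Imp A B) \<rho> (Us @ Ys) (xs @ vs)"
proof -
  note len = tyl_length[OF Us] tyl_length[OF Ys] tyl_length[OF xs] tyl_length[OF vs]
  let ?n = "length (D_univ A)" and ?ts = "map_sapps (D_exist A @ D_univ B) (D_univ A) Ys (xs @ vs)"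
  let ?P = "balls_fm (D_univ A) ?ts (D_matrix A (\<lambda>i. shift ?n (\<rho> i)) (map (shift ?n) xs) (vars ?n))"
  let ?Q = "D_matrix B \<rho> (map_sapps (D_exist A) (D_elems B) Us xs) vs"
  have M: "D_matrix (Imp A B) \<rho> (Us @ Ys) (xs @ vs) = Imp ?P ?Q"
    using len by (simp add: Let_def)
  have "tyl (cx w) (Us @ Ys) (D_exist (Imp A B))" "tyl (cx w) (xs @ vs) (D_univ (Imp A B))"
    using Us Ys xs vs by (simp_all add: D_exist_def comp_def)
  from wf_D_matrix[OF wf env this] have wf': "wf_int (cx w) ?P"
    unfolding M by (simp add: wf_int_simps)
  show ?thesis unfolding M
  proof (rule pv_ImpI[OF wf'])
    fix w' assume w': "ext w w'" and P: "pv w' ?P"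
    show "pv w' ?Q"
    proof (rule main[OF w'])
      fix w'' ys assume w'': "ext w' w''" and ys: "mems w'' (D_univ A) ys ?ts"
      show "MD w'' A \<rho> xs ys"
        by (rule balls_MD_D[OF pv_mono[OF P w''] refl ys]) (use len in simp)
    qed
  qed
qed

lemma MD_ImpD:
  assumes M: "MD w (Imp A B) \<rho> (Us @ Ys) (xs @ vs)"
    and wf: "wf_fm \<Gamma> (Imp A B)" and env: "env (cx w) \<Gamma> \<rho>"
    and Us: "tys w Us (map (\<lambda>\<tau>. TSeq (sapp_elem (D_exist A) \<tau>)) (D_elems B))"
    and Ys: "tys w Ys (map (\<lambda>\<tau>. TSeq (sapp_elem (D_exist A @ D_univ B) \<tau>)) (D_univ A))"
    and xs: "tys w xs (D_exist A)" and vs: "tys w vs (D_univ B)"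
    and main: "\<And>w' ys. ext w w' \<Longrightarrow>
      mems w' (D_univ A) ys (map_sapps (D_exist A @ D_univ B) (D_univ A) Ys (xs @ vs)) \<Longrightarrow> MD w' A \<rho> xs ys"
  shows "MD w B \<rho> (map_sapps (D_exist A) (D_elems B) Us xs) vs"
proof -
  note len = tyl_length[OF Us] tyl_length[OF Ys] tyl_length[OF xs] tyl_length[OF vs]
  let ?n = "length (D_univ A)" and ?ts = "map_sapps (D_exist A @ D_univ B) (D_univ A) Ys (xs @ vs)"
  let ?P = "balls_fm (D_univ A) ?ts (D_matrix A (\<lambda>i. shift ?n (\<rho> i)) (map (shift ?n) xs) (vars ?n))"
  let ?Q = "D_matrix B \<rho> (map_sapps (D_exist A) (D_elems B) Us xs) vs"
  have eq: "D_matrix (Imp A B) \<rho> (Us @ Ys) (xs @ vs) = Imp ?P ?Q"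
    using len by (simp add: Let_def)
  have "pv w ?P"
    by (rule balls_MD_I[OF _ env xs tyl_map_sapps[OF Ys]])
      (use wf xs vs main in auto)
  then show ?thesis using M unfolding eq by (blast intro: pv_ImpD)
qed

lemma MD_ForallI:
  assumes wf: "wf_fm (\<sigma> # \<Gamma>) A" and env: "env (cx w) \<Gamma> \<rho>"
    and xs: "tys w xs (D_exist A)" and ys: "tys w ys (D_univ A)"
    and main: "\<And>w' z. ext w w' \<Longrightarrow> typeof z (cx w') = Some \<sigma> \<Longrightarrow> MD w' A (case_nat z \<rho>) xs ys"
  shows "MD w (Forall \<sigma> A) \<rho> xs ys"
  unfolding D_matrix.simps
proof (rule pv_ForallI)
  show "wf_int (\<sigma> # cx w) (D_matrix A (up \<rho>) (map (shift 1) xs) (map (shift 1) ys))"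
    by (rule wf_D_matrix[OF wf env_up[OF env]]) (use xs ys in \<open>auto simp: comp_def\<close>)
  fix w' z assume w': "ext w w'" and z: "typeof z (cx w') = Some \<sigma>"
  show "pv w' (fsub (inst z) (D_matrix A (up \<rho>) (map (shift 1) xs) (map (shift 1) ys)))"
    using main[OF w' z] tyl_length[OF xs] tyl_length[OF ys] by (simp add: fsub_D_matrix comp_def)
qed

lemma MD_ForallD:
  assumes M: "MD w (Forall \<sigma> A) \<rho> xs ys" and z: "typeof z (cx w) = Some \<sigma>"
    and len: "length xs = length (D_elems A)" "length ys = length (D_univ A)"
  shows "MD w A (case_nat z \<rho>) xs ys"
  using pv_ForallD[OF M[unfolded D_matrix.simps] z] len by (simp add: fsub_D_matrix comp_def)

lemma inst_Exists_matrix: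
  assumes "length ts = length (D_univ A)" "length xs = length (D_elems A)" "n = length (D_univ A)"
  shows "fsub (inst z) (balls_fm (D_univ A) (map (shift 1) ts)
      (D_matrix A (\<lambda>i. shift n (up \<rho> i)) (map (shift (Suc n)) xs) (vars n)))
    = balls_fm (D_univ A) ts (D_matrix A (\<lambda>i. shift n (case_nat z \<rho> i)) (map (shift n) xs) (vars n))"
proof -
  have 1: "(\<lambda>i. sub (ups n (inst z)) (shift n (up \<rho> i))) = (\<lambda>i. shift n (case_nat z \<rho> i))"
    unfolding sub_ups_shift by (rule HOL.ext) (simp add: up_def split: nat.split)
  have 2: "sub (ups n (inst z)) (shift (Suc n) x) = shift n x" for x
    using sub_ups_shift[of n "inst z" "ren Suc x"] by (simp del: sub_ups_shift)
  have 3: "sub (inst z) (shift (Suc 0) x) = x" for x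
    by simp
  show ?thesis using assms
    by (simp add: fsub_D_matrix comp_def 1[unfolded assms(3)] 2[unfolded assms(3)] 3
        del: sub_ren add_Suc_right sub_ups_shift)
qed

lemma wf_Exists_matrix:
  assumes wf: "wf_fm (\<sigma> # \<Gamma>) A" and env: "env (cx w) \<Gamma> \<rho>"
    and xs: "tys w xs (D_exist A)" and ts: "tys w ts (map TSeq (D_univ A))" and n: "n = length (D_univ A)"
  shows "wf_int (\<sigma> # cx w) (balls_fm (D_univ A) (map (shift 1) ts)
      (D_matrix A (\<lambda>i. shift n (up \<rho> i)) (map (shift (Suc n)) xs) (vars n)))"
  using wf_D_matrix[of \<Gamma> "Exists \<sigma> A" \<rho> "cx w" xs ts] assms
  by (simp add: D_exist_def Let_def wf_int_simps)

lemma MD_ExistsI: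
  assumes wf: "wf_fm (\<sigma> # \<Gamma>) A" and env: "env (cx w) \<Gamma> \<rho>"
    and xs: "tys w xs (D_exist A)" and ts: "tys w ts (map TSeq (D_univ A))"
    and z: "typeof z (cx w) = Some \<sigma>"
    and main: "\<And>w' ys. ext w w' \<Longrightarrow> mems w' (D_univ A) ys ts \<Longrightarrow> MD w' A (case_nat z \<rho>) xs ys"
  shows "MD w (Exists \<sigma> A) \<rho> xs ts"
  unfolding D_matrix.simps Let_def
proof (rule pv_ExistsI[OF wf_Exists_matrix[OF wf env xs ts refl] z], subst inst_Exists_matrix)
  show "pv w (balls_fm (D_univ A) ts (D_matrix A (\<lambda>i. shift (length (D_univ A)) (case_nat z \<rho> i))
      (map (shift (length (D_univ A))) xs) (vars (length (D_univ A)))))"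
    by (rule balls_MD_I[OF wf env_case_nat[OF env z] xs ts refl main])
qed (use tyl_length[OF xs] tyl_length[OF ts] in simp_all)

lemma MD_ExistsE:
  assumes M: "MD w (Exists \<sigma> A) \<rho> xs ts"
    and len: "length xs = length (D_elems A)" "length ts = length (D_univ A)"
    and C: "wf_int (cx w) C"
    and main: "\<And>w' z. ext w w' \<Longrightarrow> typeof z (cx w') = Some \<sigma> \<Longrightarrow>
      (\<And>w'' ys. ext w' w'' \<Longrightarrow> mems w'' (D_univ A) ys ts \<Longrightarrow> MD w'' A (case_nat z \<rho>) xs ys) \<Longrightarrow> pv w' C"
  shows "pv w C"
proof (rule pv_ExistsE[OF M[unfolded D_matrix.simps Let_def] C])
  fix w' z
  let ?n = "length (D_univ A)"
  assume w': "ext w w'" and z: "typeof z (cx w') = Some \<sigma>"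
    and "pv w' (fsub (inst z) (balls_fm (D_univ A) (map (shift 1) ts)
      (D_matrix A (\<lambda>i. shift ?n (up \<rho> i)) (map (shift (Suc ?n)) xs) (vars ?n))))"
  then have P: "pv w' (balls_fm (D_univ A) ts (D_matrix A (\<lambda>i. shift ?n (case_nat z \<rho> i)) (map (shift ?n) xs) (vars ?n)))"
    by (subst (asm) inst_Exists_matrix) (use len in simp_all)
  show "pv w' C"
  proof (rule main[OF w' z])
    fix w'' ys assume w'': "ext w' w''" and ys: "mems w'' (D_univ A) ys ts"
    show "MD w'' A (case_nat z \<rho>) xs ys"
      by (rule balls_MD_D[OF pv_mono[OF P w''] refl ys len(1)])
  qed
qed

lemma MD_ExistsStI:
  assumes wf: "wf_fm (\<sigma> # \<Gamma>) A" and env: "env (cx w) \<Gamma> \<rho>"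
    and xs: "tys w xs (D_exist A)" and ts: "tys w ts (map TSeq (D_univ A))"
    and z: "mem w \<sigma> z l"
    and main: "\<And>w' ys. ext w w' \<Longrightarrow> mems w' (D_univ A) ys ts \<Longrightarrow> MD w' A (case_nat z \<rho>) xs ys"
  shows "MD w (ExistsSt \<sigma> A) \<rho> (xs @ [l]) ts"
  unfolding D_matrix.simps Let_def last_snoc butlast_snoc
proof (rule bexI[OF wf_Exists_matrix[OF wf env xs ts refl] z], subst inst_Exists_matrix)
  show "pv w (balls_fm (D_univ A) ts (D_matrix A (\<lambda>i. shift (length (D_univ A)) (case_nat z \<rho> i))
      (map (shift (length (D_univ A))) xs) (vars (length (D_univ A)))))"
    by (rule balls_MD_I[OF wf env_case_nat[OF env mem_ty(1)[OF z]] xs ts refl main])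
qed (use tyl_length[OF xs] tyl_length[OF ts] in simp_all)

lemma MD_ExistsStE:
  assumes M: "MD w (ExistsSt \<sigma> A) \<rho> (xs @ [l]) ts"
    and len: "length xs = length (D_elems A)" "length ts = length (D_univ A)"
    and C: "wf_int (cx w) C"
    and main: "\<And>w' z. ext w w' \<Longrightarrow> mem w' \<sigma> z l \<Longrightarrow>
      (\<And>w'' ys. ext w' w'' \<Longrightarrow> mems w'' (D_univ A) ys ts \<Longrightarrow> MD w'' A (case_nat z \<rho>) xs ys) \<Longrightarrow> pv w' C"
  shows "pv w C"
proof (rule bexE[OF M[unfolded D_matrix.simps Let_def last_snoc butlast_snoc] C])
  fix w' z
  let ?n = "length (D_univ A)"
  assume w': "ext w w'" and z: "mem w' \<sigma> z l"
    and "pv w' (fsub (inst z) (balls_fm (D_univ A) (map (shift 1) ts)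
      (D_matrix A (\<lambda>i. shift ?n (up \<rho> i)) (map (shift (Suc ?n)) xs) (vars ?n))))"
  then have P: "pv w' (balls_fm (D_univ A) ts (D_matrix A (\<lambda>i. shift ?n (case_nat z \<rho> i)) (map (shift ?n) xs) (vars ?n)))"
    by (subst (asm) inst_Exists_matrix) (use len in simp_all)
  show "pv w' C"
  proof (rule main[OF w' z])
    fix w'' ys assume w'': "ext w' w''" and ys: "mems w'' (D_univ A) ys ts"
    show "MD w'' A (case_nat z \<rho>) xs ys"
      by (rule balls_MD_D[OF pv_mono[OF P w''] refl ys len(1)])
  qed
qed

lemma MD_wf: "wf_fm \<Gamma> A \<Longrightarrow> env (cx w) \<Gamma> \<rho> \<Longrightarrow> tys w xs (D_exist A) \<Longrightarrow> tys w ys (D_univ A) \<Longrightarrow>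
    wf_int (cx w) (D_matrix A \<rho> xs ys)"
  by (rule wf_D_matrix)

subsection \<open>Replacement of equals\<close>

definition eqvs :: "world \<Rightarrow> ty list \<Rightarrow> tm list \<Rightarrow> tm list \<Rightarrow> bool" where
  "eqvs w \<sigma>s ss ts \<longleftrightarrow> length ss = length \<sigma>s \<and> length ts = length \<sigma>s \<and> (\<forall>i<length \<sigma>s. eqv w (\<sigma>s ! i) (ss ! i) (ts ! i))"

lemma eqvs_Cons [simp]: "eqvs w (\<sigma> # \<sigma>s) (s # ss) (t # ts) \<longleftrightarrow> eqv w \<sigma> s t \<and> eqvs w \<sigma>s ss ts"
  by (auto simp: eqvs_def nth_Cons split: nat.splits)

lemma eqvs_Nil [simp]: "eqvs w [] [] []"
  by (simp add: eqvs_def)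

lemma eqvs_refl: "tys w ts \<sigma>s \<Longrightarrow> eqvs w \<sigma>s ts ts"
proof (induction \<sigma>s arbitrary: ts)
  case (Cons \<sigma> \<sigma>s)
  then show ?case by (cases ts) (auto intro: eqv_refl)
qed simp

lemma eqvs_sym: "eqvs w \<sigma>s ss ts \<Longrightarrow> eqvs w \<sigma>s ts ss"
  by (auto simp: eqvs_def intro: eqv_sym)

lemma mems_cong: "mems w \<sigma>s ys ss \<Longrightarrow> eqvs w (map TSeq \<sigma>s) ss ts \<Longrightarrow> mems w \<sigma>s ys ts"
proof (induction \<sigma>s arbitrary: ys ss ts)
  case Nil
  then show ?case by (cases ys; cases ss; cases ts) (auto simp: eqvs_def)
next
  case (Cons \<sigma> \<sigma>s)
  then have "ts \<noteq> []" by (auto simp: eqvs_def)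
  with Cons show ?case by (cases ys; cases ss; cases ts) (auto intro: mem_cong2)
qed

text \<open>Instead of another induction on \<open>A\<close>, the matrix is written as a
  substitution instance of a generic matrix whose arguments and parameters are distinct variables.
  That generic matrix is an internal formula, and \<open>eqv_fsub\<close> applies to it.\<close>

lemma MD_cong:
  assumes wf: "wf_fm \<Gamma> A" and M: "MD w A \<rho> xs ys"
    and \<rho>: "\<And>i. i < length \<Gamma> \<Longrightarrow> eqv w (\<Gamma> ! i) (\<rho> i) (\<rho>' i)"
    and xs: "eqvs w (D_exist A) xs xs'" and ys: "eqvs w (D_univ A) ys ys'"
  shows "MD w A \<rho>' xs' ys'"
proof -
  let ?m = "length (D_elems A)" and ?n = "length (D_univ A)"
  define \<rho>0 where "\<rho>0 = (\<lambda>i. Var (?m + ?n + i))"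
  define xs0 ys0 where "xs0 = map Var [0..<?m]" and "ys0 = map Var [?m..<?m + ?n]"
  \<comment> \<open>The variables are laid out as existential arguments, then universal ones, then
    parameters, in the order of the context \<open>?\<Gamma>\<close>.\<close>
  define \<theta> where "\<theta> = (\<lambda>xs ys (\<rho> :: nat \<Rightarrow> tm) i. if i < ?m then xs ! i else if i < ?m + ?n then ys ! (i - ?m) else \<rho> (i - ?m - ?n))"
  let ?\<Gamma> = "D_exist A @ D_univ A @ \<Gamma>"
  have len: "length xs = ?m" "length xs' = ?m" "length ys = ?n" "length ys' = ?n"
    using xs ys by (auto simp: eqvs_def)
  have D: "D_matrix A \<rho> xs ys = fsub (\<theta> xs ys \<rho>) (D_matrix A \<rho>0 xs0 ys0)"
    if "length xs = ?m" "length ys = ?n" for xs ys \<rho>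
  proof -
    have "map (sub (\<theta> xs ys \<rho>)) xs0 = xs" "map (sub (\<theta> xs ys \<rho>)) ys0 = ys"
      using that by (auto simp: xs0_def ys0_def \<theta>_def intro!: nth_equalityI)
    then show ?thesis by (subst fsub_D_matrix) (auto simp: xs0_def ys0_def \<rho>0_def \<theta>_def)
  qed
  have "wf_int ?\<Gamma> (D_matrix A \<rho>0 xs0 ys0)"
    by (rule wf_D_matrix[OF wf]) (auto simp: xs0_def ys0_def \<rho>0_def nth_append intro!: nth_equalityI)
  moreover have "eqv w (?\<Gamma> ! i) (\<theta> xs ys \<rho> i) (\<theta> xs' ys' \<rho>' i)" if "i < length ?\<Gamma>" for i
    using that xs ys \<rho>[of "i - ?m - ?n"] by (auto simp: \<theta>_def nth_append eqvs_def)
  ultimately show ?thesis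
    using M unfolding D[OF len(1,3)] D[OF len(2,4)] by (rule eqv_fsub)
qed

lemma MD_cong_x:
  "wf_fm \<Gamma> A \<Longrightarrow> env (cx w) \<Gamma> \<rho> \<Longrightarrow> MD w A \<rho> xs ys \<Longrightarrow> eqvs w (D_exist A) xs xs' \<Longrightarrow> tys w ys (D_univ A) \<Longrightarrow>
    MD w A \<rho> xs' ys"
  by (rule MD_cong) (auto intro: eqv_refl eqvs_refl)

subsection \<open>Monotonicity\<close>

lemma incls_map_sapps:
  "incls w (map (sapp_elem \<sigma>s) \<tau>s) ss ss' \<Longrightarrow> tys w ss' (map (\<lambda>\<tau>. TSeq (sapp_elem \<sigma>s \<tau>)) \<tau>s) \<Longrightarrow> tys w ts \<sigma>s \<Longrightarrow>
    incls w \<tau>s (map_sapps \<sigma>s \<tau>s ss ts) (map_sapps \<sigma>s \<tau>s ss' ts)"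
proof (induction \<tau>s arbitrary: ss ss')
  case (Cons \<tau> \<tau>s)
  then show ?case by (cases ss; cases ss') (auto intro: incl_sapps)
qed simp

text \<open>This is what lets realizers be merged by concatenation. In an implication larger
  functions \<open>Y'\<close> bound more counterexamples and so strengthen the assumption on the
  antecedent, whose own realizers stay fixed, while larger \<open>U'\<close> enlarge the realizers
  of the consequent, to which the induction hypothesis applies.\<close>

lemma MD_mono:
  "wf_fm \<Gamma> A \<Longrightarrow> env (cx w) \<Gamma> \<rho> \<Longrightarrow> MD w A \<rho> xs ys \<Longrightarrow> incls w (D_elems A) xs xs' \<Longrightarrow>
    tys w xs (D_exist A) \<Longrightarrow> tys w xs' (D_exist A) \<Longrightarrow> tys w ys (D_univ A) \<Longrightarrow> MD w A \<rho> xs' ys"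
proof (induction A arbitrary: \<Gamma> \<rho> xs xs' ys w)
  case (Eq \<sigma> s t)
  then show ?case by simp
next
  case (St \<sigma> t)
  then show ?case by (cases xs; cases xs') (auto simp: D_exist_def intro: inclD)
next
  case (And A B)
  obtain x1 x2 where x: "xs = x1 @ x2" "tys w x1 (D_exist A)" "tys w x2 (D_exist B)"
    using tyl_appendE[of "cx w" xs "D_exist A" "D_exist B"] And.prems(5) by (auto simp: D_exist_def)
  obtain x1' x2' where x': "xs' = x1' @ x2'" "tys w x1' (D_exist A)" "tys w x2' (D_exist B)"
    using tyl_appendE[of "cx w" xs' "D_exist A" "D_exist B"] And.prems(6) by (auto simp: D_exist_def)
  obtain y1 y2 where y: "ys = y1 @ y2" "tys w y1 (D_univ A)" "tys w y2 (D_univ B)"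
    using tyl_appendE[of "cx w" ys "D_univ A" "D_univ B"] And.prems(7) by auto
  have i: "incls w (D_elems A) x1 x1'" "incls w (D_elems B) x2 x2'"
    using And.prems(4) tyl_length[OF x(2)] tyl_length[OF x'(2)] by (auto simp: x x' incls_append)
  have "MD w A \<rho> x1 y1" "MD w B \<rho> x2 y2"
    using And.prems(3) tyl_length[OF x(2)] tyl_length[OF y(2)] unfolding x y
    by (auto simp: D_matrix_And simp del: D_matrix.simps dest: pv_AndD1 pv_AndD2)
  then have "MD w A \<rho> x1' y1" "MD w B \<rho> x2' y2"
    using And.IH(1)[OF _ And.prems(2) _ i(1) x(2) x'(2) y(2)] And.IH(2)[OF _ And.prems(2) _ i(2) x(3) x'(3) y(3)] And.prems(1)
    by auto
  then show ?case
    using tyl_length[OF x'(2)] tyl_length[OF y(2)] unfolding x' y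
    by (simp add: D_matrix_And pv_AndI del: D_matrix.simps)
next
  case (Or A B)
  obtain x1 x2 where x: "xs = x1 @ x2" "tys w x1 (D_exist A)" "tys w x2 (D_exist B)"
    using tyl_appendE[of "cx w" xs "D_exist A" "D_exist B"] Or.prems(5) by (auto simp: D_exist_def)
  obtain x1' x2' where x': "xs' = x1' @ x2'" "tys w x1' (D_exist A)" "tys w x2' (D_exist B)"
    using tyl_appendE[of "cx w" xs' "D_exist A" "D_exist B"] Or.prems(6) by (auto simp: D_exist_def)
  obtain y1 y2 where y: "ys = y1 @ y2" "tys w y1 (D_univ A)" "tys w y2 (D_univ B)"
    using tyl_appendE[of "cx w" ys "D_univ A" "D_univ B"] Or.prems(7) by auto
  have i: "incls w (D_elems A) x1 x1'" "incls w (D_elems B) x2 x2'"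
    using Or.prems(4) tyl_length[OF x(2)] tyl_length[OF x'(2)] by (auto simp: x x' incls_append)
  have or: "D_matrix (Or A B) \<rho> xs ys = Or (D_matrix A \<rho> x1 y1) (D_matrix B \<rho> x2 y2)"
    "D_matrix (Or A B) \<rho> xs' ys = Or (D_matrix A \<rho> x1' y1) (D_matrix B \<rho> x2' y2)"
    using tyl_length[OF x(2)] tyl_length[OF x'(2)] tyl_length[OF y(2)] unfolding x x' y
    by (simp_all add: D_matrix_Or del: D_matrix.simps)
  have L: "wf_int (cx w) (Or (D_matrix A \<rho> x1' y1) (D_matrix B \<rho> x2' y2))"
    using MD_wf[OF Or.prems(1,2,6,7)] unfolding or .
  show ?case unfolding or
  proof (rule pv_OrE[OF Or.prems(3)[unfolded or] L])
    fix w' assume w': "ext w w'" and "MD w' A \<rho> x1 y1"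
    then have "MD w' A \<rho> x1' y1"
      by (intro Or.IH(1)[OF _ env_mono[OF Or.prems(2) w'] _ incls_mono[OF i(1) w'] tys_mono[OF x(2) w'] tys_mono[OF x'(2) w'] tys_mono[OF y(2) w']])
        (use Or.prems(1) in auto)
    then show "pv w' (Or (D_matrix A \<rho> x1' y1) (D_matrix B \<rho> x2' y2))"
      using L_mono[OF L w'] by (simp add: pv_OrI1)
  next
    fix w' assume w': "ext w w'" and "MD w' B \<rho> x2 y2"
    then have "MD w' B \<rho> x2' y2"
      by (intro Or.IH(2)[OF _ env_mono[OF Or.prems(2) w'] _ incls_mono[OF i(2) w'] tys_mono[OF x(3) w'] tys_mono[OF x'(3) w'] tys_mono[OF y(3) w']])
        (use Or.prems(1) in auto)
    then show "pv w' (Or (D_matrix A \<rho> x1' y1) (D_matrix B \<rho> x2' y2))"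
      using L_mono[OF L w'] by (simp add: pv_OrI2)
  qed
next
  case (Imp A B)
  let ?tU = "map (\<lambda>\<tau>. TSeq (sapp_elem (D_exist A) \<tau>)) (D_elems B)"
  let ?tY = "map (\<lambda>\<tau>. TSeq (sapp_elem (D_exist A @ D_univ B) \<tau>)) (D_univ A)"
  obtain U Y where U: "xs = U @ Y" "tys w U ?tU" "tys w Y ?tY"
    using tyl_appendE[of "cx w" xs ?tU ?tY] Imp.prems(5) by (auto simp: D_exist_def comp_def)
  obtain U' Y' where U': "xs' = U' @ Y'" "tys w U' ?tU" "tys w Y' ?tY"
    using tyl_appendE[of "cx w" xs' ?tU ?tY] Imp.prems(6) by (auto simp: D_exist_def comp_def)
  obtain x v where x: "ys = x @ v" "tys w x (D_exist A)" "tys w v (D_univ B)"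
    using tyl_appendE[of "cx w" ys "D_exist A" "D_univ B"] Imp.prems(7) by (auto simp: D_exist_def)
  have xv: "tys w (x @ v) (D_exist A @ D_univ B)" using x by simp
  have i: "incls w (map (sapp_elem (D_exist A)) (D_elems B)) U U'"
    "incls w (map (sapp_elem (D_exist A @ D_univ B)) (D_univ A)) Y Y'"
    using Imp.prems(4) tyl_length[OF U(2)] tyl_length[OF U'(2)] by (auto simp: U U' incls_append D_exist_def)
  note iU = incls_map_sapps[OF i(1) U'(2) x(2)] and iY = incls_map_sapps[OF i(2) U'(3) xv]
  have wf: "wf_fm \<Gamma> A" "wf_fm \<Gamma> B" using Imp.prems(1) by auto
  have tU: "tys w (map_sapps (D_exist A) (D_elems B) U x) (D_exist B)"
    "tys w (map_sapps (D_exist A) (D_elems B) U' x) (D_exist B)"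
    using tyl_map_sapps[OF U(2) x(2)] tyl_map_sapps[OF U'(2) x(2)] by (simp_all add: D_exist_def)
  show ?case unfolding U'(1) x(1)
  proof (rule MD_ImpI[OF Imp.prems(1,2) U'(2,3) x(2,3)])
    fix w' assume w': "ext w w'" and A: "\<And>w'' ys. ext w' w'' \<Longrightarrow>
      mems w'' (D_univ A) ys (map_sapps (D_exist A @ D_univ B) (D_univ A) Y' (x @ v)) \<Longrightarrow> MD w'' A \<rho> x ys"
    note env' = env_mono[OF Imp.prems(2) w']
    have "MD w' B \<rho> (map_sapps (D_exist A) (D_elems B) U x) v"
    proof (rule MD_ImpD[OF _ Imp.prems(1) env' U(2,3)[THEN tys_mono[OF _ w']] x(2,3)[THEN tys_mono[OF _ w']]])
      show "MD w' (Imp A B) \<rho> (U @ Y) (x @ v)"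
        using pv_mono[OF Imp.prems(3) w'] unfolding U x .
      fix w'' ys assume w'': "ext w' w''"
        and ys: "mems w'' (D_univ A) ys (map_sapps (D_exist A @ D_univ B) (D_univ A) Y (x @ v))"
      show "MD w'' A \<rho> x ys"
        by (rule A[OF w'' mems_incls[OF ys incls_mono[OF iY ext_trans[OF w' w'']]]])
    qed
    then show "MD w' B \<rho> (map_sapps (D_exist A) (D_elems B) U' x) v"
      by (rule Imp.IH(2)[OF wf(2) env' _ incls_mono[OF iU w'] tys_mono[OF tU(1) w'] tys_mono[OF tU(2) w'] tys_mono[OF x(3) w']])
  qed
next
  case (Forall \<sigma> A)
  have ty: "tys w xs (D_exist A)" "tys w xs' (D_exist A)" "tys w ys (D_univ A)" and i: "incls w (D_elems A) xs xs'"
    and wf: "wf_fm (\<sigma> # \<Gamma>) A"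
    using Forall.prems by (auto simp: D_exist_def)
  show ?case
  proof (rule MD_ForallI[OF wf Forall.prems(2) ty(2,3)])
    fix w' z assume w': "ext w w'" and z: "typeof z (cx w') = Some \<sigma>"
    have "MD w' A (case_nat z \<rho>) xs ys"
      by (rule MD_ForallD[OF pv_mono[OF Forall.prems(3) w'] z]) (use tyl_length[OF ty(1)] tyl_length[OF ty(3)] in auto)
    then show "MD w' A (case_nat z \<rho>) xs' ys"
      by (rule Forall.IH[OF wf env_case_nat[OF env_mono[OF Forall.prems(2) w'] z] _ incls_mono[OF i w'] ty[THEN tys_mono[OF _ w']]])
  qed
next
  case (Exists \<sigma> A)
  have ty: "tys w xs (D_exist A)" "tys w xs' (D_exist A)" "tys w ys (map TSeq (D_univ A))" and i: "incls w (D_elems A) xs xs'"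
    and wf: "wf_fm (\<sigma> # \<Gamma>) A"
    using Exists.prems by (auto simp: D_exist_def)
  show ?case
  proof (rule MD_ExistsE[OF Exists.prems(3) _ _ MD_wf[OF Exists.prems(1,2,6,7)]])
    fix w' z assume w': "ext w w'" and z: "typeof z (cx w') = Some \<sigma>"
      and A: "\<And>w'' ys'. ext w' w'' \<Longrightarrow> mems w'' (D_univ A) ys' ys \<Longrightarrow> MD w'' A (case_nat z \<rho>) xs ys'"
    note ty' = ty[THEN tys_mono[OF _ w']] and env' = env_mono[OF Exists.prems(2) w']
    show "MD w' (Exists \<sigma> A) \<rho> xs' ys"
    proof (rule MD_ExistsI[OF wf env' ty'(2,3) z])
      fix w'' ys' assume w'': "ext w' w''" and m: "mems w'' (D_univ A) ys' ys"
      show "MD w'' A (case_nat z \<rho>) xs' ys'"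
        by (rule Exists.IH[OF wf env_mono[OF env_case_nat[OF env' z] w''] A[OF w'' m] incls_mono[OF i ext_trans[OF w' w'']]
            ty'(1,2)[THEN tys_mono[OF _ w'']] mems_tys[OF m]])
    qed
  qed (use tyl_length[OF ty(1)] tyl_length[OF ty(3)] in auto)
next
  case (ForallSt \<sigma> A)
  obtain z y where y: "ys = z # y" "typeof z (cx w) = Some \<sigma>" "tys w y (D_univ A)"
    using ForallSt.prems(7) by (cases ys) auto
  let ?t = "map (\<lambda>\<tau>. TSeq (sapp_elem [\<sigma>] \<tau>)) (D_elems A)"
  have ty: "tys w xs ?t" "tys w xs' ?t" and i: "incls w (map (sapp_elem [\<sigma>]) (D_elems A)) xs xs'" and z: "tys w [z] [\<sigma>]"
    using ForallSt.prems y by (auto simp: D_exist_def comp_def)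
  have ty': "tys w (map_sapps [\<sigma>] (D_elems A) xs [z]) (D_exist A)" "tys w (map_sapps [\<sigma>] (D_elems A) xs' [z]) (D_exist A)"
    using tyl_map_sapps[OF ty(1) z] tyl_map_sapps[OF ty(2) z] by (simp_all add: D_exist_def)
  have "MD w A (case_nat z \<rho>) (map_sapps [\<sigma>] (D_elems A) xs' [z]) y"
    by (rule ForallSt.IH[OF _ env_case_nat[OF ForallSt.prems(2) y(2)] _ incls_map_sapps[OF i ty(2) z] ty' y(3)])
      (use ForallSt.prems(1,3) y(1) in auto)
  then show ?case by (simp add: y)
next
  case (ExistsSt \<sigma> A)
  obtain x l where x: "xs = x @ [l]" "tys w x (D_exist A)" "typeof l (cx w) = Some (TSeq \<sigma>)"
    using tyl_snocE[of "cx w" xs "D_exist A" "TSeq \<sigma>"] ExistsSt.prems(5) by (auto simp: D_exist_def)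
  obtain x' l' where x': "xs' = x' @ [l']" "tys w x' (D_exist A)" "typeof l' (cx w) = Some (TSeq \<sigma>)"
    using tyl_snocE[of "cx w" xs' "D_exist A" "TSeq \<sigma>"] ExistsSt.prems(6) by (auto simp: D_exist_def)
  have ty: "tys w ys (map TSeq (D_univ A))" and wf: "wf_fm (\<sigma> # \<Gamma>) A"
    using ExistsSt.prems by auto
  have i: "incls w (D_elems A) x x'" "incl w \<sigma> l l'"
    using ExistsSt.prems(4) tyl_length[OF x(2)] tyl_length[OF x'(2)] by (auto simp: x x' incls_append)
  show ?case
  proof (rule MD_ExistsStE[OF ExistsSt.prems(3)[unfolded x(1)] _ _ MD_wf[OF ExistsSt.prems(1,2,6,7)]])
    fix w' z assume w': "ext w w'" and z: "mem w' \<sigma> z l"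
      and A: "\<And>w'' ys'. ext w' w'' \<Longrightarrow> mems w'' (D_univ A) ys' ys \<Longrightarrow> MD w'' A (case_nat z \<rho>) x ys'"
    note ty' = ty[THEN tys_mono[OF _ w']] x(2)[THEN tys_mono[OF _ w']] x'(2)[THEN tys_mono[OF _ w']]
      and env' = env_mono[OF ExistsSt.prems(2) w']
    show "MD w' (ExistsSt \<sigma> A) \<rho> xs' ys" unfolding x'(1)
    proof (rule MD_ExistsStI[OF wf env' ty'(3,1) inclD[OF incl_mono[OF i(2) w'] z]])
      fix w'' ys' assume w'': "ext w' w''" and m: "mems w'' (D_univ A) ys' ys"
      show "MD w'' A (case_nat z \<rho>) x' ys'"
        by (rule ExistsSt.IH[OF wf env_mono[OF env_case_nat[OF env' mem_ty(1)[OF z]] w''] A[OF w'' m] incls_mono[OF i(1) ext_trans[OF w' w'']]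
            ty'(2,3)[THEN tys_mono[OF _ w'']] mems_tys[OF m]])
    qed
  qed (use tyl_length[OF x(2)] tyl_length[OF ty] in auto)
qed simp

end

section \<open>Soundness of the logical rules\<close>

lemma D_exist_simps [simp]:
  "D_exist Bot = []" "D_exist (Eq \<sigma> s t) = []" "D_exist (St \<sigma> t) = [TSeq \<sigma>]"
  "D_exist (And A B) = D_exist A @ D_exist B" "D_exist (Or A B) = D_exist A @ D_exist B"
  "D_exist (Imp A B) = map (\<lambda>\<tau>. TSeq (sapp_elem (D_exist A) \<tau>)) (D_elems B) @
     map (\<lambda>\<tau>. TSeq (sapp_elem (D_exist A @ D_univ B) \<tau>)) (D_univ A)"
  "D_exist (Forall \<sigma> A) = D_exist A" "D_exist (Exists \<sigma> A) = D_exist A"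
  "D_exist (ForallSt \<sigma> A) = map (\<lambda>\<tau>. TSeq (sapp_elem [\<sigma>] \<tau>)) (D_elems A)"
  "D_exist (ExistsSt \<sigma> A) = D_exist A @ [TSeq \<sigma>]"
  "D_exist (fsub \<theta> A) = D_exist A" "D_exist (fren r A) = D_exist A"
  by (simp_all add: D_exist_def comp_def)

abbreviation singles :: "ty list \<Rightarrow> tm list \<Rightarrow> tm list" where
  "singles \<sigma>s vs \<equiv> map2 single \<sigma>s vs"

abbreviation defaults :: "ty list \<Rightarrow> tm list" where
  "defaults \<sigma>s \<equiv> map default_tm \<sigma>s"

fun appends :: "ty list \<Rightarrow> tm list \<Rightarrow> tm list \<Rightarrow> tm list" where
  "appends (\<sigma> # \<sigma>s) (x # xs) (y # ys) = (appendC \<sigma> \<cdot> x \<cdot> y) # appends \<sigma>s xs ys"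
| "appends _ _ _ = []"

text \<open>The arguments for \<sigma>s are given exactly, those for \<sigma>s' only up to
  membership in the sequences \<open>ls\<close>. In a syllogism the former are realizers and the
  latter are counterexamples to the middle formula.\<close>

abbreviation map_sappsL :: "ty list \<Rightarrow> ty list \<Rightarrow> ty list \<Rightarrow> tm list \<Rightarrow> tm list \<Rightarrow> tm list \<Rightarrow> tm list" where
  "map_sappsL \<sigma>s \<sigma>s' \<tau>s ss ts ls \<equiv>
    map2 (\<lambda>\<tau> s. sappsL \<sigma>s' \<tau> (sapps \<sigma>s (sapp_elem \<sigma>s' \<tau>) s ts) ls) \<tau>s ss"

lemma tyl_singles: "tyl \<Gamma> vs \<sigma>s \<Longrightarrow> tyl \<Gamma> (singles \<sigma>s vs) (map TSeq \<sigma>s)"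
proof (induction \<sigma>s arbitrary: vs)
  case (Cons \<sigma> \<sigma>s)
  then show ?case by (cases vs) auto
qed simp

lemma sub_singles [simp]: "map (sub \<theta>) (singles \<sigma>s vs) = singles \<sigma>s (map (sub \<theta>) vs)"
proof (induction \<sigma>s arbitrary: vs)
  case (Cons \<sigma> \<sigma>s)
  then show ?case by (cases vs) auto
qed simp

lemma sub_defaults [simp]: "map (sub \<theta>) (defaults \<sigma>s) = defaults \<sigma>s"
  by simp

lemma tyl_appends:
  "tyl \<Gamma> xs (map TSeq \<sigma>s) \<Longrightarrow> tyl \<Gamma> ys (map TSeq \<sigma>s) \<Longrightarrow> tyl \<Gamma> (appends \<sigma>s xs ys) (map TSeq \<sigma>s)"
  by (induction \<sigma>s xs ys rule: appends.induct) auto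

lemma sub_appends [simp]:
  "map (sub \<theta>) (appends \<sigma>s xs ys) = appends \<sigma>s (map (sub \<theta>) xs) (map (sub \<theta>) ys)"
  by (induction \<sigma>s xs ys rule: appends.induct) auto

lemma tyl_map_sappsL:
  "tyl \<Gamma> ss (map (\<lambda>\<tau>. TSeq (sapp_elem (\<sigma>s @ \<sigma>s') \<tau>)) \<tau>s) \<Longrightarrow> tyl \<Gamma> ts \<sigma>s \<Longrightarrow> tyl \<Gamma> ls (map TSeq \<sigma>s') \<Longrightarrow>
    tyl \<Gamma> (map_sappsL \<sigma>s \<sigma>s' \<tau>s ss ts ls) (map TSeq \<tau>s)"
proof (induction \<tau>s arbitrary: ss)
  case (Cons \<tau> \<tau>s)
  then show ?case by (cases ss) (auto simp: sapp_elem_append comp_def intro!: typeof_sappsL typeof_sapps)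
qed simp

lemma sub_map_sappsL [simp]:
  "map (sub \<theta>) (map_sappsL \<sigma>s \<sigma>s' \<tau>s ss ts ls) =
    map_sappsL \<sigma>s \<sigma>s' \<tau>s (map (sub \<theta>) ss) (map (sub \<theta>) ts) (map (sub \<theta>) ls)"
proof (induction \<tau>s arbitrary: ss)
  case (Cons \<tau> \<tau>s)
  then show ?case by (cases ss) auto
qed simp

lemma map_sapps_append:
  "length ts = length \<sigma>s \<Longrightarrow> map_sapps (\<sigma>s @ \<sigma>s') \<tau>s ss (ts @ ts') =
    map_sapps \<sigma>s' \<tau>s (map_sapps \<sigma>s (map (sapp_elem \<sigma>s') \<tau>s) ss ts) ts'"
proof (induction \<tau>s arbitrary: ss)
  case (Cons \<tau> \<tau>s)
  then show ?case by (cases ss) (auto simp: sapps_append)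
qed simp

lemma tyl_closed: "tyl [] ts \<sigma>s \<Longrightarrow> tyl \<Gamma> ts \<sigma>s"
proof (induction \<sigma>s arbitrary: ts)
  case (Cons \<sigma> \<sigma>s)
  then show ?case by (cases ts) (auto intro: typeof_closed)
qed simp

lemma sub_tyl_closed: "tyl [] ts \<sigma>s \<Longrightarrow> map (sub \<theta>) ts = ts"
proof (induction \<sigma>s arbitrary: ts)
  case (Cons \<sigma> \<sigma>s)
  then show ?case by (cases ts) (auto intro: sub_closed)
qed simp

text \<open>Functions on tuples of terms that are given by a term with free variables; \<open>clos\<close> turns such a
  function into a tuple of closed terms.\<close>

definition nat_fn :: "ty list \<Rightarrow> ty list \<Rightarrow> (tm list \<Rightarrow> tm list) \<Rightarrow> bool" where
  "nat_fn \<sigma>s \<tau>s F \<longleftrightarrow> (\<forall>\<Gamma> xs. tyl \<Gamma> xs \<sigma>s \<longrightarrow> tyl \<Gamma> (F xs) \<tau>s \<and> (\<forall>\<theta>. map (sub \<theta>) (F xs) = F (map (sub \<theta>) xs)))"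

definition nat_fn2 :: "ty list \<Rightarrow> ty list \<Rightarrow> ty list \<Rightarrow> (tm list \<Rightarrow> tm list \<Rightarrow> tm list) \<Rightarrow> bool" where
  "nat_fn2 \<sigma>s \<sigma>s' \<tau>s F \<longleftrightarrow> (\<forall>\<Gamma> xs ys. tyl \<Gamma> xs \<sigma>s \<longrightarrow> tyl \<Gamma> ys \<sigma>s' \<longrightarrow>
    tyl \<Gamma> (F xs ys) \<tau>s \<and> (\<forall>\<theta>. map (sub \<theta>) (F xs ys) = F (map (sub \<theta>) xs) (map (sub \<theta>) ys)))"

lemma nat_fnI:
  "(\<And>\<Gamma> xs. tyl \<Gamma> xs \<sigma>s \<Longrightarrow> tyl \<Gamma> (F xs) \<tau>s) \<Longrightarrow>
    (\<And>\<Gamma> \<theta> xs. tyl \<Gamma> xs \<sigma>s \<Longrightarrow> map (sub \<theta>) (F xs) = F (map (sub \<theta>) xs)) \<Longrightarrow> nat_fn \<sigma>s \<tau>s F"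
  unfolding nat_fn_def by blast

lemma nat_fn2I:
  "(\<And>\<Gamma> xs ys. tyl \<Gamma> xs \<sigma>s \<Longrightarrow> tyl \<Gamma> ys \<sigma>s' \<Longrightarrow> tyl \<Gamma> (F xs ys) \<tau>s) \<Longrightarrow>
    (\<And>\<Gamma> \<theta> xs ys. tyl \<Gamma> xs \<sigma>s \<Longrightarrow> tyl \<Gamma> ys \<sigma>s' \<Longrightarrow> map (sub \<theta>) (F xs ys) = F (map (sub \<theta>) xs) (map (sub \<theta>) ys)) \<Longrightarrow>
    nat_fn2 \<sigma>s \<sigma>s' \<tau>s F"
  unfolding nat_fn2_def by blast

lemma nat_fn_of2:
  assumes "nat_fn2 \<sigma>s \<sigma>s' \<tau>s F"
  shows "nat_fn (\<sigma>s @ \<sigma>s') \<tau>s (\<lambda>zs. F (take (length \<sigma>s) zs) (drop (length \<sigma>s) zs))"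
proof (rule nat_fnI)
  fix \<Gamma> zs assume "tyl \<Gamma> zs (\<sigma>s @ \<sigma>s')"
  from tyl_appendD[OF this refl] show "tyl \<Gamma> (F (take (length \<sigma>s) zs) (drop (length \<sigma>s) zs)) \<tau>s"
    using assms unfolding nat_fn2_def by blast
next
  fix \<Gamma> \<theta> zs assume "tyl \<Gamma> zs (\<sigma>s @ \<sigma>s')"
  from tyl_appendD[OF this refl]
  show "map (sub \<theta>) (F (take (length \<sigma>s) zs) (drop (length \<sigma>s) zs)) =
      F (take (length \<sigma>s) (map (sub \<theta>) zs)) (drop (length \<sigma>s) (map (sub \<theta>) zs))"
    using assms unfolding nat_fn2_def take_map drop_map by blast
qed

definition clos :: "ty list \<Rightarrow> ty list \<Rightarrow> (tm list \<Rightarrow> tm list) \<Rightarrow> tm list" where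
  "clos \<sigma>s \<tau>s F = map2 (slam \<sigma>s) \<tau>s (F (vars (length \<sigma>s)))"

lemma tyl_slam:
  "tyl (rev \<sigma>s @ \<Gamma>) bs (map TSeq \<tau>s) \<Longrightarrow> tyl \<Gamma> (map2 (slam \<sigma>s) \<tau>s bs) (map (\<lambda>\<tau>. TSeq (sapp_elem \<sigma>s \<tau>)) \<tau>s)"
proof (induction \<tau>s arbitrary: bs)
  case (Cons \<tau> \<tau>s)
  then show ?case by (cases bs) (auto intro: typeof_slam)
qed simp

lemma tyl_clos:
  assumes "nat_fn \<sigma>s (map TSeq \<tau>s) F"
  shows "tyl \<Gamma> (clos \<sigma>s \<tau>s F) (map (\<lambda>\<tau>. TSeq (sapp_elem \<sigma>s \<tau>)) \<tau>s)"
  unfolding clos_def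
  by (rule tyl_slam) (use assms tyl_vars[of \<sigma>s "length \<sigma>s" \<Gamma>] in \<open>unfold nat_fn_def, blast\<close>)

context eha
begin

lemma eqvs_slam:
  "tyl (rev \<sigma>s @ cx w) bs (map TSeq \<tau>s) \<Longrightarrow> tys w xs \<sigma>s \<Longrightarrow>
    eqvs w (map TSeq \<tau>s) (map_sapps \<sigma>s \<tau>s (map2 (slam \<sigma>s) \<tau>s bs) xs) (map (sub (envl xs Var)) bs)"
proof (induction \<tau>s arbitrary: bs)
  case (Cons \<tau> \<tau>s)
  then show ?case using sapps_slam[of Var] by (cases bs) (auto simp: typeof_slam)
qed simp

text \<open>Naturality is used at the generic tuple \<open>vars\<close>: substituting
  \<open>xs\<close> there commutes with \<open>F\<close>, so \<beta>-reduction of the closed terms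
  yields \<open>F xs\<close>.\<close>

lemma eqvs_clos:
  assumes F: "nat_fn \<sigma>s (map TSeq \<tau>s) F" and xs: "tys w xs \<sigma>s"
  shows "eqvs w (map TSeq \<tau>s) (map_sapps \<sigma>s \<tau>s (clos \<sigma>s \<tau>s F) xs) (F xs)"
proof -
  let ?n = "length \<sigma>s"
  have "tyl (rev \<sigma>s @ cx w) (F (vars ?n)) (map TSeq \<tau>s)"
    and "map (sub (envl xs Var)) (F (vars ?n)) = F (map (sub (envl xs Var)) (vars ?n))"
    using F tyl_vars[of \<sigma>s ?n "cx w"] unfolding nat_fn_def by blast+
  then show ?thesis
    using eqvs_slam[of \<sigma>s w "F (vars ?n)" \<tau>s xs] xs tyl_length[OF xs] by (simp add: clos_def)
qed

lemma mems_appends1: "mems w \<sigma>s zs xs \<Longrightarrow> tys w ys (map TSeq \<sigma>s) \<Longrightarrow> mems w \<sigma>s zs (appends \<sigma>s xs ys)"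
proof (induction w \<sigma>s zs xs arbitrary: ys rule: mems.induct)
  case (1 w \<sigma> \<sigma>s z zs x xs)
  then show ?case by (cases ys) (auto intro: mem_append_I1)
qed auto

lemma mems_appends2: "mems w \<sigma>s zs ys \<Longrightarrow> tys w xs (map TSeq \<sigma>s) \<Longrightarrow> mems w \<sigma>s zs (appends \<sigma>s xs ys)"
proof (induction w \<sigma>s zs ys arbitrary: xs rule: mems.induct)
  case (1 w \<sigma> \<sigma>s z zs x xs ys)
  then show ?case by (cases ys) (auto intro: mem_append_I2)
qed auto

lemma incls_appends:
  "tys w xs (map TSeq \<sigma>s) \<Longrightarrow> tys w ys (map TSeq \<sigma>s) \<Longrightarrow>
    incls w \<sigma>s xs (appends \<sigma>s xs ys) \<and> incls w \<sigma>s ys (appends \<sigma>s xs ys)"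
proof (induction \<sigma>s xs ys rule: appends.induct)
  case (1 \<sigma> \<sigma>s x xs y ys)
  then have "typeof x (cx w) = Some (TSeq \<sigma>)" "typeof y (cx w) = Some (TSeq \<sigma>)" by auto
  then have "incl w \<sigma> x (appendC \<sigma> \<cdot> x \<cdot> y)" "incl w \<sigma> y (appendC \<sigma> \<cdot> x \<cdot> y)"
    by (blast intro: inclI mem_append_I1 mem_append_I2 ty_mono)+
  with 1 show ?case by simp
next
  case ("2_1" xs ys)
  then show ?case by (cases xs; cases ys) auto
qed auto

lemma mems_defaults: "mems w \<sigma>s (defaults \<sigma>s) (singles \<sigma>s (defaults \<sigma>s))"
  by (rule mems_single) simp

lemma mems_sappsL:
  "mems w \<tau>s zs (map_sapps (\<sigma>s @ \<sigma>s') \<tau>s ss (xs @ ys)) \<Longrightarrow> mems w \<sigma>s' ys ls \<Longrightarrow>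
    tys w ss (map (\<lambda>\<tau>. TSeq (sapp_elem (\<sigma>s @ \<sigma>s') \<tau>)) \<tau>s) \<Longrightarrow> tys w xs \<sigma>s \<Longrightarrow>
    mems w \<tau>s zs (map_sappsL \<sigma>s \<sigma>s' \<tau>s ss xs ls)"
proof (induction \<tau>s arbitrary: zs ss)
  case (Cons \<tau> \<tau>s)
  note len = tyl_length[OF Cons.prems(4)]
  from Cons.prems obtain s ss' where s: "ss = s # ss'" by (cases ss) auto
  with Cons.prems obtain z zs' where z: "zs = z # zs'" by (cases zs) auto
  have "mem w \<tau> z (sappsL \<sigma>s' \<tau> (sapps \<sigma>s (sapp_elem \<sigma>s' \<tau>) s xs) ls)"
    by (rule mem_sappsL[OF Cons.prems(2)])
      (use Cons.prems len in \<open>auto simp: s z sapps_append sapp_elem_append typeof_sapps\<close>)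
  then show ?case using Cons by (simp add: s z)
qed simp

definition valid :: "ctx \<Rightarrow> fm \<Rightarrow> bool" where
  "valid \<Gamma> A \<longleftrightarrow> (\<exists>ts. tyl [] ts (D_exist A) \<and>
    (\<forall>w \<rho> ys. env (cx w) \<Gamma> \<rho> \<longrightarrow> tys w ys (D_univ A) \<longrightarrow> MD w A \<rho> ts ys))"

lemma validI:
  "tyl [] ts (D_exist A) \<Longrightarrow> (\<And>w \<rho> ys. env (cx w) \<Gamma> \<rho> \<Longrightarrow> tys w ys (D_univ A) \<Longrightarrow> MD w A \<rho> ts ys) \<Longrightarrow> valid \<Gamma> A"
  unfolding valid_def by blast

text \<open>An implication is realized by two transformations: \<open>U\<close> sends realizers of
  \<open>A\<close> to realizers of \<open>B\<close>, and \<open>Y\<close> computes sequences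
  containing the instances of \<open>A\<close> that the argument will use. \<open>clos\<close> makes
  both closed, and \<open>MD_cong_x\<close> and \<open>mems_cong\<close> absorb the \<beta>-steps
  this costs.\<close>

lemma valid_ImpI:
  assumes wf: "wf_fm \<Gamma> (Imp A B)"
    and U: "nat_fn (D_exist A) (D_exist B) U"
    and Y: "nat_fn2 (D_exist A) (D_univ B) (map TSeq (D_univ A)) Y"
    and main: "\<And>w \<rho> xs vs. env (cx w) \<Gamma> \<rho> \<Longrightarrow> tys w xs (D_exist A) \<Longrightarrow> tys w vs (D_univ B) \<Longrightarrow>
      (\<And>w' ys. ext w w' \<Longrightarrow> mems w' (D_univ A) ys (Y xs vs) \<Longrightarrow> MD w' A \<rho> xs ys) \<Longrightarrow> MD w B \<rho> (U xs) vs"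
  shows "valid \<Gamma> (Imp A B)"
proof -
  let ?Y = "\<lambda>zs. Y (take (length (D_exist A)) zs) (drop (length (D_exist A)) zs)"
  let ?Us = "clos (D_exist A) (D_elems B) U" and ?Ys = "clos (D_exist A @ D_univ B) (D_univ A) ?Y"
  note Y' = nat_fn_of2[OF Y] and U' = U[unfolded D_exist_def[of B]]
  show ?thesis
  proof (rule validI)
    show "tyl [] (?Us @ ?Ys) (D_exist (Imp A B))"
      using tyl_clos[OF U', of "[]"] tyl_clos[OF Y', of "[]"] by simp
    fix w \<rho> ys assume env: "env (cx w) \<Gamma> \<rho>" and "tys w ys (D_univ (Imp A B))"
    then have "tys w ys (D_exist A @ D_univ B)" by (simp add: D_exist_def)
    then obtain xs vs where ys: "ys = xs @ vs" and xs: "tys w xs (D_exist A)" and vs: "tys w vs (D_univ B)"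
      by (rule tyl_appendE)
    show "MD w (Imp A B) \<rho> (?Us @ ?Ys) ys" unfolding ys
    proof (rule MD_ImpI[OF wf env tyl_clos[OF U'] tyl_clos[OF Y'] xs vs])
      fix w' assume w': "ext w w'" and A: "\<And>w'' ys. ext w' w'' \<Longrightarrow>
        mems w'' (D_univ A) ys (map_sapps (D_exist A @ D_univ B) (D_univ A) ?Ys (xs @ vs)) \<Longrightarrow> MD w'' A \<rho> xs ys"
      note xs' = tys_mono[OF xs w'] and vs' = tys_mono[OF vs w'] and env' = env_mono[OF env w']
      have U: "MD w' B \<rho> (U xs) vs"
      proof (rule main[OF env' xs' vs'])
        fix w'' ys assume w'': "ext w' w''" and m: "mems w'' (D_univ A) ys (Y xs vs)"
        have "tys w'' (xs @ vs) (D_exist A @ D_univ B)"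
          using tys_mono[OF xs' w''] tys_mono[OF vs' w''] by simp
        from eqvs_clos[OF Y' this]
        have "eqvs w'' (map TSeq (D_univ A)) (Y xs vs) (map_sapps (D_exist A @ D_univ B) (D_univ A) ?Ys (xs @ vs))"
          using tyl_length[OF xs] by (simp add: eqvs_sym)
        from A[OF w'' mems_cong[OF m this]] show "MD w'' A \<rho> xs ys" .
      qed
      have "wf_fm \<Gamma> B" and "eqvs w' (D_exist B) (U xs) (map_sapps (D_exist A) (D_elems B) ?Us xs)"
        using wf eqvs_sym[OF eqvs_clos[OF U' xs']] by (simp_all add: D_exist_def)
      then show "MD w' B \<rho> (map_sapps (D_exist A) (D_elems B) ?Us xs) vs"
        by (rule MD_cong_x[OF _ env' U _ vs'])
    qed
  qed
qed

text \<open>Validity of an implication with its realizers kept visible and split into the part for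
  the conclusion and the part that bounds counterexamples. Rules with an implication as premise need
  access to both.\<close>

definition impl :: "ctx \<Rightarrow> fm \<Rightarrow> fm \<Rightarrow> tm list \<Rightarrow> tm list \<Rightarrow> bool" where
  "impl \<Gamma> A B Us Ys \<longleftrightarrow>
    tyl [] Us (map (\<lambda>\<tau>. TSeq (sapp_elem (D_exist A) \<tau>)) (D_elems B)) \<and>
    tyl [] Ys (map (\<lambda>\<tau>. TSeq (sapp_elem (D_exist A @ D_univ B) \<tau>)) (D_univ A)) \<and>
    (\<forall>w \<rho> xs vs. env (cx w) \<Gamma> \<rho> \<longrightarrow> tys w xs (D_exist A) \<longrightarrow> tys w vs (D_univ B) \<longrightarrow>
      MD w (Imp A B) \<rho> (Us @ Ys) (xs @ vs))"

lemma impl_tyU: "impl \<Gamma> A B Us Ys \<Longrightarrow> tyl [] Us (map (\<lambda>\<tau>. TSeq (sapp_elem (D_exist A) \<tau>)) (D_elems B))"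
  and impl_tyY: "impl \<Gamma> A B Us Ys \<Longrightarrow> tyl [] Ys (map (\<lambda>\<tau>. TSeq (sapp_elem (D_exist A @ D_univ B) \<tau>)) (D_univ A))"
  and impl_MD: "impl \<Gamma> A B Us Ys \<Longrightarrow> env (cx w) \<Gamma> \<rho> \<Longrightarrow> tys w xs (D_exist A) \<Longrightarrow> tys w vs (D_univ B) \<Longrightarrow>
      MD w (Imp A B) \<rho> (Us @ Ys) (xs @ vs)"
  unfolding impl_def by blast+

lemma implD:
  assumes I: "impl \<Gamma> A B Us Ys" and wf: "wf_fm \<Gamma> (Imp A B)"
    and env: "env (cx w) \<Gamma> \<rho>" and xs: "tys w xs (D_exist A)" and vs: "tys w vs (D_univ B)"
    and A: "\<And>w' ys. ext w w' \<Longrightarrow>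
      mems w' (D_univ A) ys (map_sapps (D_exist A @ D_univ B) (D_univ A) Ys (xs @ vs)) \<Longrightarrow> MD w' A \<rho> xs ys"
  shows "MD w B \<rho> (map_sapps (D_exist A) (D_elems B) Us xs) vs"
  by (rule MD_ImpD[OF impl_MD[OF I env xs vs] wf env tyl_closed[OF impl_tyU[OF I]] tyl_closed[OF impl_tyY[OF I]] xs vs A])

lemma valid_ImpE:
  assumes "valid \<Gamma> (Imp A B)" obtains Us Ys where "impl \<Gamma> A B Us Ys"
proof -
  from assms obtain ts where ts: "tyl [] ts (D_exist (Imp A B))"
    and M: "\<And>w \<rho> ys. env (cx w) \<Gamma> \<rho> \<Longrightarrow> tys w ys (D_univ (Imp A B)) \<Longrightarrow> MD w (Imp A B) \<rho> ts ys"
    unfolding valid_def by blast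
  from ts[unfolded D_exist_simps] obtain Us Ys where eq: "ts = Us @ Ys"
    and ty: "tyl [] Us (map (\<lambda>\<tau>. TSeq (sapp_elem (D_exist A) \<tau>)) (D_elems B))"
      "tyl [] Ys (map (\<lambda>\<tau>. TSeq (sapp_elem (D_exist A @ D_univ B) \<tau>)) (D_univ A))"
    by (rule tyl_appendE)
  have "MD w (Imp A B) \<rho> (Us @ Ys) (xs @ vs)"
    if "env (cx w) \<Gamma> \<rho>" "tys w xs (D_exist A)" "tys w vs (D_univ B)" for w \<rho> xs vs
    using M[of \<rho> w "xs @ vs"] that unfolding eq by (simp add: D_exist_def)
  with ty have "impl \<Gamma> A B Us Ys" unfolding impl_def by blast
  then show thesis by (rule that)
qed

lemma impl_valid:
  assumes "impl \<Gamma> A B Us Ys" shows "valid \<Gamma> (Imp A B)"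
proof (rule validI)
  show "tyl [] (Us @ Ys) (D_exist (Imp A B))"
    using impl_tyU[OF assms] impl_tyY[OF assms] by simp
  fix w \<rho> ys assume env: "env (cx w) \<Gamma> \<rho>" and "tys w ys (D_univ (Imp A B))"
  then have "tys w ys (D_exist A @ D_univ B)" by (simp add: D_exist_def)
  then obtain xs vs where ys: "ys = xs @ vs" and xv: "tys w xs (D_exist A)" "tys w vs (D_univ B)"
    by (rule tyl_appendE)
  show "MD w (Imp A B) \<rho> (Us @ Ys) ys" unfolding ys by (rule impl_MD[OF assms env xv])
qed

text \<open>Derivability in the target system is closed under substitution and persists to every
  world, and the matrix of an internal formula is the formula itself, so the empty tuple is a
  realizer.\<close>

lemma valid_internal: "EHA_derives \<Delta> \<Gamma> A \<Longrightarrow> valid \<Gamma> A"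
proof -
  assume d: "EHA_derives \<Delta> \<Gamma> A"
  then have "wf_int \<Gamma> A" unfolding EHA_derives_def by (rule dv_L)
  then have A: "internal A" by (simp add: wf_int_def)
  show ?thesis
  proof (rule validI[of "[]"])
    fix w \<rho> ys assume "env (cx w) \<Gamma> \<rho>"
    then have "dv (cx w) (fsub \<rho> A)"
      using d unfolding EHA_derives_def by (intro dv_fsub) auto
    then show "MD w A \<rho> [] ys" by (simp add: D_matrix_internal[OF A] pv_dv)
  qed (simp add: D_internal[OF A] D_exist_def)
qed

section \<open>Axioms of intuitionistic predicate logic\<close>

lemma nat_fn_id: "nat_fn \<sigma>s \<sigma>s (\<lambda>xs. xs)"
  by (rule nat_fnI) auto

lemma nat_fn2_singles: "nat_fn2 \<sigma>s \<tau>s (map TSeq \<tau>s) (\<lambda>_. singles \<tau>s)"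
  by (rule nat_fn2I) (simp_all only: tyl_singles sub_singles)

text \<open>Which disjunct holds may vary with the world, whereas the realizer has to be fixed in
  advance. The concatenation of the two candidates contains each of them, and \<open>MD_mono\<close>
  serves both cases.\<close>

lemma valid_or_contr:
  assumes "wf_fm \<Gamma> A" shows "valid \<Gamma> (Imp (Or A A) A)"
proof (rule valid_ImpI)
  let ?m = "length (D_elems A)" and ?V = "D_univ A"
  show "nat_fn (D_exist (Or A A)) (D_exist A) (\<lambda>xs. appends (D_elems A) (take ?m xs) (drop ?m xs))"
  proof (rule nat_fnI)
    fix G xs assume "tyl G xs (D_exist (Or A A))"
    from tyl_appendD[OF this[unfolded D_exist_simps], of ?m]
    show "tyl G (appends (D_elems A) (take ?m xs) (drop ?m xs)) (D_exist A)"
      unfolding D_exist_def by (intro tyl_appends) (simp_all add: D_exist_def)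
  qed (simp add: take_map drop_map)
  show "nat_fn2 (D_exist (Or A A)) (D_univ A) (map TSeq (D_univ (Or A A))) (\<lambda>_ vs. singles ?V vs @ singles ?V vs)"
    by (rule nat_fn2I) (simp_all only: D_univ.simps map_append tyl_singles sub_singles)
  fix w \<rho> xs vs
  assume env: "env (cx w) \<Gamma> \<rho>" and xs: "tys w xs (D_exist (Or A A))" and vs: "tys w vs (D_univ A)"
    and A: "\<And>w' ys. ext w w' \<Longrightarrow> mems w' (D_univ (Or A A)) ys (singles ?V vs @ singles ?V vs) \<Longrightarrow> MD w' (Or A A) \<rho> xs ys"
  from xs[unfolded D_exist_simps] obtain x1 x2 where x: "xs = x1 @ x2" "tys w x1 (D_exist A)" "tys w x2 (D_exist A)"
    by (rule tyl_appendE)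
  note len = tyl_length[OF x(2)] tyl_length[OF vs]
  let ?x = "appends (D_elems A) x1 x2"
  have i: "incls w (D_elems A) x1 ?x" "incls w (D_elems A) x2 ?x" and t: "tys w ?x (D_exist A)"
    using incls_appends[of w x1 "D_elems A" x2] tyl_appends[of "cx w" x1 "D_elems A" x2] x(2,3) by (auto simp: D_exist_def)
  have wf: "wf_int (cx w) (D_matrix A \<rho> ?x vs)" by (rule MD_wf[OF assms env t vs])
  have "mems w (D_univ (Or A A)) (vs @ vs) (singles ?V vs @ singles ?V vs)"
    using mems_single[OF vs] len by (simp add: mems_append)
  from A[OF ext_refl this] have "pv w (Or (D_matrix A \<rho> x1 vs) (D_matrix A \<rho> x2 vs))"
    using len unfolding x(1) by (simp only: D_matrix_Or length_D_exist)
  then have "MD w A \<rho> ?x vs"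
  proof (rule pv_OrE[OF _ wf])
    fix w' assume w': "ext w w'" and "MD w' A \<rho> x1 vs"
    then show "MD w' A \<rho> ?x vs"
      using MD_mono[OF assms env_mono[OF env w'] _ incls_mono[OF i(1) w'] tys_mono[OF x(2) w'] tys_mono[OF t w'] tys_mono[OF vs w']]
      by blast
  next
    fix w' assume w': "ext w w'" and "MD w' A \<rho> x2 vs"
    then show "MD w' A \<rho> ?x vs"
      using MD_mono[OF assms env_mono[OF env w'] _ incls_mono[OF i(2) w'] tys_mono[OF x(3) w'] tys_mono[OF t w'] tys_mono[OF vs w']]
      by blast
  qed
  then show "MD w A \<rho> (appends (D_elems A) (take ?m xs) (drop ?m xs)) vs"
    using len by (simp add: x(1))
qed (use assms in simp)

text \<open>In the Dialectica interpretation this axiom forces a decision of the matrix to choose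
  between the two counterexamples \<open>v1\<close> and \<open>v2\<close>. Here the assumption may
  be used at every member of a finite sequence, so both are put into it and no decidability is
  required.\<close>

lemma valid_and_contr:
  assumes "wf_fm \<Gamma> A" shows "valid \<Gamma> (Imp A (And A A))"
proof (rule valid_ImpI)
  let ?n = "length (D_univ A)" and ?V = "D_univ A"
  let ?Y = "\<lambda>vs. appends ?V (singles ?V (take ?n vs)) (singles ?V (drop ?n vs))"
  show "nat_fn (D_exist A) (D_exist (And A A)) (\<lambda>xs. xs @ xs)"
    by (rule nat_fnI) auto
  show "nat_fn2 (D_exist A) (D_univ (And A A)) (map TSeq (D_univ A)) (\<lambda>_. ?Y)"
  proof (rule nat_fn2I)
    fix G ys assume "tyl G ys (D_univ (And A A))"
    from tyl_appendD[OF this[unfolded D_univ.simps] refl]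
    show "tyl G (?Y ys) (map TSeq (D_univ A))" by (intro tyl_appends tyl_singles) auto
  qed (simp only: sub_appends sub_singles take_map drop_map)
  fix w \<rho> xs vs
  assume env: "env (cx w) \<Gamma> \<rho>" and xs: "tys w xs (D_exist A)" and vs: "tys w vs (D_univ (And A A))"
    and A: "\<And>w' ys. ext w w' \<Longrightarrow> mems w' (D_univ A) ys (?Y vs) \<Longrightarrow> MD w' A \<rho> xs ys"
  from vs[unfolded D_univ.simps] obtain v1 v2 where v: "vs = v1 @ v2" "tys w v1 (D_univ A)" "tys w v2 (D_univ A)"
    by (rule tyl_appendE)
  note len = tyl_length[OF v(2)] tyl_length[OF xs]
  have "MD w A \<rho> xs v1" "MD w A \<rho> xs v2"
    by (rule A[OF ext_refl], rule mems_appends1 mems_appends2,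
        use len v mems_single[OF v(2)] mems_single[OF v(3)] tyl_singles[OF v(2)] tyl_singles[OF v(3)] in simp_all)+
  then show "MD w (And A A) \<rho> (xs @ xs) vs"
    using len unfolding v(1) by (simp only: D_matrix_And length_D_exist pv_AndI)
qed (use assms in simp)

lemma valid_or_weak:
  assumes "wf_fm \<Gamma> A" "wf_fm \<Gamma> B" shows "valid \<Gamma> (Imp A (Or A B))"
proof (rule valid_ImpI)
  let ?n = "length (D_univ A)"
  \<comment> \<open>The second disjunct is never claimed to hold, so any well-typed realizers will
    do for it.\<close>
  show "nat_fn (D_exist A) (D_exist (Or A B)) (\<lambda>xs. xs @ defaults (D_exist B))"
    by (rule nat_fnI) (auto simp: comp_def)
  show "nat_fn2 (D_exist A) (D_univ (Or A B)) (map TSeq (D_univ A)) (\<lambda>_ vs. singles (D_univ A) (take ?n vs))"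
  proof (rule nat_fn2I)
    fix G ys assume "tyl G ys (D_univ (Or A B))"
    from tyl_appendD[OF this[unfolded D_univ.simps] refl]
    show "tyl G (singles (D_univ A) (take ?n ys)) (map TSeq (D_univ A))" by (intro tyl_singles) auto
  qed (simp only: sub_singles take_map)
  fix w \<rho> xs vs
  assume env: "env (cx w) \<Gamma> \<rho>" and xs: "tys w xs (D_exist A)" and vs: "tys w vs (D_univ (Or A B))"
    and A: "\<And>w' ys. ext w w' \<Longrightarrow> mems w' (D_univ A) ys (singles (D_univ A) (take ?n vs)) \<Longrightarrow> MD w' A \<rho> xs ys"
  from vs[unfolded D_univ.simps] obtain v1 v2 where v: "vs = v1 @ v2" "tys w v1 (D_univ A)" "tys w v2 (D_univ B)"
    by (rule tyl_appendE)
  note len = tyl_length[OF v(2)] tyl_length[OF xs]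
  have "MD w A \<rho> xs v1"
    by (rule A[OF ext_refl]) (use len mems_single[OF v(2)] in \<open>simp add: v(1)\<close>)
  moreover have "wf_int (cx w) (D_matrix B \<rho> (defaults (D_exist B)) v2)"
    by (rule MD_wf[OF assms(2) env _ v(3)]) simp
  ultimately show "MD w (Or A B) \<rho> (xs @ defaults (D_exist B)) vs"
    using len unfolding v(1) by (simp only: D_matrix_Or length_D_exist pv_OrI1)
qed (use assms in simp)

lemma valid_and_weak:
  assumes "wf_fm \<Gamma> A" "wf_fm \<Gamma> B" shows "valid \<Gamma> (Imp (And A B) A)"
proof (rule valid_ImpI)
  let ?m = "length (D_elems A)"
  \<comment> \<open>For the second conjunct any object will do, but its sequences must not be empty:
    the assumption ranges over all components jointly and would otherwise be vacuous.\<close>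
  let ?Y = "\<lambda>vs. singles (D_univ A) vs @ singles (D_univ B) (defaults (D_univ B))"
  show "nat_fn (D_exist (And A B)) (D_exist A) (take ?m)"
    by (rule nat_fnI, use tyl_appendD in force) (simp add: take_map)
  show "nat_fn2 (D_exist (And A B)) (D_univ A) (map TSeq (D_univ (And A B))) (\<lambda>_. ?Y)"
    by (rule nat_fn2I)
      (use tyl_singles[of _ "defaults (D_univ B)" "D_univ B"] in
        \<open>simp_all only: D_univ.simps map_append tyl_singles sub_singles sub_defaults, simp\<close>)
  fix w \<rho> xs vs
  assume env: "env (cx w) \<Gamma> \<rho>" and xs: "tys w xs (D_exist (And A B))" and vs: "tys w vs (D_univ A)"
    and A: "\<And>w' ys. ext w w' \<Longrightarrow> mems w' (D_univ (And A B)) ys (?Y vs) \<Longrightarrow> MD w' (And A B) \<rho> xs ys"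
  from xs[unfolded D_exist_simps] obtain x1 x2 where x: "xs = x1 @ x2" "tys w x1 (D_exist A)" "tys w x2 (D_exist B)"
    by (rule tyl_appendE)
  note len = tyl_length[OF x(2)] tyl_length[OF vs]
  have "MD w (And A B) \<rho> xs (vs @ defaults (D_univ B))"
    by (rule A[OF ext_refl]) (use len mems_single[OF vs] mems_defaults[of w "D_univ B"] in \<open>simp add: mems_append\<close>)
  then have "MD w A \<rho> x1 vs"
    using len unfolding x(1) by (simp only: D_matrix_And length_D_exist) (rule pv_AndD1)
  then show "MD w A \<rho> (take ?m xs) vs" using len by (simp add: x(1))
qed (use assms in simp)

lemma nat_fn_swap:
  "m = length \<sigma>s \<Longrightarrow> nat_fn (\<sigma>s @ \<tau>s) (\<tau>s @ \<sigma>s) (\<lambda>xs. drop m xs @ take m xs)"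
  by (rule nat_fnI, use tyl_appendD in force) (simp add: take_map drop_map)

lemma nat_fn2_swap:
  assumes n: "n = length \<tau>s"
  shows "nat_fn2 \<upsilon>s (\<tau>s @ \<sigma>s) (map TSeq (\<sigma>s @ \<tau>s)) (\<lambda>_ vs. singles \<sigma>s (drop n vs) @ singles \<tau>s (take n vs))"
proof (rule nat_fn2I)
  fix G vs assume "tyl G vs (\<tau>s @ \<sigma>s)"
  from tyl_appendD[OF this n] show "tyl G (singles \<sigma>s (drop n vs) @ singles \<tau>s (take n vs)) (map TSeq (\<sigma>s @ \<tau>s))"
    by (simp only: map_append tyl_singles)
qed (simp only: map_append sub_singles take_map drop_map)

lemma valid_or_perm:
  assumes "wf_fm \<Gamma> A" "wf_fm \<Gamma> B" shows "valid \<Gamma> (Imp (Or A B) (Or B A))"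
proof (rule valid_ImpI)
  let ?m = "length (D_elems A)" and ?n = "length (D_univ B)"
  let ?Y = "\<lambda>vs. singles (D_univ A) (drop ?n vs) @ singles (D_univ B) (take ?n vs)"
  show "nat_fn (D_exist (Or A B)) (D_exist (Or B A)) (\<lambda>xs. drop ?m xs @ take ?m xs)"
    unfolding D_exist_simps by (rule nat_fn_swap) simp
  show "nat_fn2 (D_exist (Or A B)) (D_univ (Or B A)) (map TSeq (D_univ (Or A B))) (\<lambda>_. ?Y)"
    unfolding D_univ.simps by (rule nat_fn2_swap) simp
  fix w \<rho> xs vs
  assume env: "env (cx w) \<Gamma> \<rho>" and xs: "tys w xs (D_exist (Or A B))" and vs: "tys w vs (D_univ (Or B A))"
    and A: "\<And>w' ys. ext w w' \<Longrightarrow> mems w' (D_univ (Or A B)) ys (?Y vs) \<Longrightarrow> MD w' (Or A B) \<rho> xs ys"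
  from xs[unfolded D_exist_simps] obtain x1 x2 where x: "xs = x1 @ x2" "tys w x1 (D_exist A)" "tys w x2 (D_exist B)"
    by (rule tyl_appendE)
  from vs[unfolded D_univ.simps] obtain v1 v2 where v: "vs = v2 @ v1" "tys w v2 (D_univ B)" "tys w v1 (D_univ A)"
    by (rule tyl_appendE)
  note len = tyl_length[OF x(2)] tyl_length[OF x(3)] tyl_length[OF v(2)] tyl_length[OF v(3)]
  have "MD w (Or A B) \<rho> xs (v1 @ v2)"
    by (rule A[OF ext_refl]) (use len mems_single[OF v(2)] mems_single[OF v(3)] in \<open>simp add: v(1) mems_append\<close>)
  then have o: "pv w (Or (D_matrix A \<rho> x1 v1) (D_matrix B \<rho> x2 v2))"
    using len unfolding x(1) by (simp only: D_matrix_Or length_D_exist)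
  then have "pv w (Or (D_matrix B \<rho> x2 v2) (D_matrix A \<rho> x1 v1))"
    by (rule pv_OrE) (use pv_L[OF o] in \<open>auto intro: pv_OrI1 pv_OrI2 L_mono\<close>)
  then show "MD w (Or B A) \<rho> (drop ?m xs @ take ?m xs) vs"
    using len by (simp add: x(1) v(1) D_matrix_Or del: D_matrix.simps)
qed (use assms in simp)

lemma valid_and_perm:
  assumes "wf_fm \<Gamma> A" "wf_fm \<Gamma> B" shows "valid \<Gamma> (Imp (And A B) (And B A))"
proof (rule valid_ImpI)
  let ?m = "length (D_elems A)" and ?n = "length (D_univ B)"
  let ?Y = "\<lambda>vs. singles (D_univ A) (drop ?n vs) @ singles (D_univ B) (take ?n vs)"
  show "nat_fn (D_exist (And A B)) (D_exist (And B A)) (\<lambda>xs. drop ?m xs @ take ?m xs)"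
    unfolding D_exist_simps by (rule nat_fn_swap) simp
  show "nat_fn2 (D_exist (And A B)) (D_univ (And B A)) (map TSeq (D_univ (And A B))) (\<lambda>_. ?Y)"
    unfolding D_univ.simps by (rule nat_fn2_swap) simp
  fix w \<rho> xs vs
  assume env: "env (cx w) \<Gamma> \<rho>" and xs: "tys w xs (D_exist (And A B))" and vs: "tys w vs (D_univ (And B A))"
    and A: "\<And>w' ys. ext w w' \<Longrightarrow> mems w' (D_univ (And A B)) ys (?Y vs) \<Longrightarrow> MD w' (And A B) \<rho> xs ys"
  from xs[unfolded D_exist_simps] obtain x1 x2 where x: "xs = x1 @ x2" "tys w x1 (D_exist A)" "tys w x2 (D_exist B)"
    by (rule tyl_appendE)
  from vs[unfolded D_univ.simps] obtain v1 v2 where v: "vs = v2 @ v1" "tys w v2 (D_univ B)" "tys w v1 (D_univ A)"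
    by (rule tyl_appendE)
  note len = tyl_length[OF x(2)] tyl_length[OF x(3)] tyl_length[OF v(2)] tyl_length[OF v(3)]
  have "MD w (And A B) \<rho> xs (v1 @ v2)"
    by (rule A[OF ext_refl]) (use len mems_single[OF v(2)] mems_single[OF v(3)] in \<open>simp add: v(1) mems_append\<close>)
  then have "pv w (And (D_matrix A \<rho> x1 v1) (D_matrix B \<rho> x2 v2))"
    using len unfolding x(1) by (simp only: D_matrix_And length_D_exist)
  then have "pv w (And (D_matrix B \<rho> x2 v2) (D_matrix A \<rho> x1 v1))"
    by (blast intro: pv_AndI dest: pv_AndD1 pv_AndD2)
  then show "MD w (And B A) \<rho> (drop ?m xs @ take ?m xs) vs"
    using len by (simp add: x(1) v(1) D_matrix_And del: D_matrix.simps)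
qed (use assms in simp)

lemma valid_ex_falso:
  assumes "wf_fm \<Gamma> A" shows "valid \<Gamma> (Imp Bot A)"
proof (rule valid_ImpI)
  show "nat_fn (D_exist Bot) (D_exist A) (\<lambda>_. defaults (D_exist A))"
    by (rule nat_fnI) (auto simp: comp_def)
  show "nat_fn2 (D_exist Bot) (D_univ A) (map TSeq (D_univ Bot)) (\<lambda>_ _. [])"
    by (rule nat_fn2I) auto
  fix w \<rho> xs vs
  assume env: "env (cx w) \<Gamma> \<rho>" and vs: "tys w vs (D_univ A)"
    and A: "\<And>w' ys. ext w w' \<Longrightarrow> mems w' (D_univ Bot) ys [] \<Longrightarrow> MD w' Bot \<rho> xs ys"
  have "pv w Bot" using A[of w "[]"] by simp
  then show "MD w A \<rho> (defaults (D_exist A)) vs"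
    by (rule pv_BotE) (rule MD_wf[OF assms env _ vs], simp)
qed (use assms in simp)

lemma sub_inst_env: "(\<lambda>i. sub \<rho> (inst t i)) = case_nat (sub \<rho> t) \<rho>"
  by (rule HOL.ext) (simp split: nat.split)

text \<open>The clause for \<open>Forall\<close> is uniform in the bound variable, so realizers pass
  unchanged to an instance; the term enters only through the environment.\<close>

lemma valid_forall_elim:
  assumes "wf_fm \<Gamma> (Forall \<sigma> A)" "typeof t \<Gamma> = Some \<sigma>"
  shows "valid \<Gamma> (Imp (Forall \<sigma> A) (fsub (inst t) A))"
proof (rule valid_ImpI)
  show "wf_fm \<Gamma> (Imp (Forall \<sigma> A) (fsub (inst t) A))"
    using assms by (auto simp: nth_Cons intro!: wf_fsub[of "\<sigma> # \<Gamma>"] split: nat.split)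
  show "nat_fn (D_exist (Forall \<sigma> A)) (D_exist (fsub (inst t) A)) (\<lambda>xs. xs)"
    using nat_fn_id by simp
  show "nat_fn2 (D_exist (Forall \<sigma> A)) (D_univ (fsub (inst t) A)) (map TSeq (D_univ (Forall \<sigma> A))) (\<lambda>_. singles (D_univ A))"
    using nat_fn2_singles by simp
  fix w \<rho> xs vs
  assume env: "env (cx w) \<Gamma> \<rho>" and xs: "tys w xs (D_exist (Forall \<sigma> A))" and vs: "tys w vs (D_univ (fsub (inst t) A))"
    and A: "\<And>w' ys. ext w w' \<Longrightarrow> mems w' (D_univ (Forall \<sigma> A)) ys (singles (D_univ A) vs) \<Longrightarrow> MD w' (Forall \<sigma> A) \<rho> xs ys"
  have vs': "tys w vs (D_univ A)" using vs by simp
  have "typeof (sub \<rho> t) (cx w) = Some \<sigma>" by (rule typeof_sub[OF assms(2)]) (use env in auto)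
  moreover have "MD w (Forall \<sigma> A) \<rho> xs vs" by (rule A) (use mems_single[OF vs'] in simp_all)
  ultimately have "MD w A (case_nat (sub \<rho> t) \<rho>) xs vs"
    using tyl_length[OF xs] tyl_length[OF vs'] by (intro MD_ForallD) auto
  then show "MD w (fsub (inst t) A) \<rho> xs vs" by (simp add: D_matrix_fsub sub_inst_env)
qed

text \<open>The universal arguments of an existential formula already are sequences of candidates,
  so they serve directly as bounds, while the realizers record nothing about the witness.\<close>

lemma valid_exists_intro:
  assumes "wf_fm \<Gamma> (Exists \<sigma> A)" "typeof t \<Gamma> = Some \<sigma>"
  shows "valid \<Gamma> (Imp (fsub (inst t) A) (Exists \<sigma> A))"
proof (rule valid_ImpI)
  show "wf_fm \<Gamma> (Imp (fsub (inst t) A) (Exists \<sigma> A))"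
    using assms by (auto simp: nth_Cons intro!: wf_fsub[of "\<sigma> # \<Gamma>"] split: nat.split)
  show "nat_fn (D_exist (fsub (inst t) A)) (D_exist (Exists \<sigma> A)) (\<lambda>xs. xs)"
    using nat_fn_id by simp
  show "nat_fn2 (D_exist (fsub (inst t) A)) (D_univ (Exists \<sigma> A)) (map TSeq (D_univ (fsub (inst t) A))) (\<lambda>_ ts. ts)"
    by (rule nat_fn2I) simp_all
  fix w \<rho> xs vs
  assume env: "env (cx w) \<Gamma> \<rho>" and xs: "tys w xs (D_exist (fsub (inst t) A))" and vs: "tys w vs (D_univ (Exists \<sigma> A))"
    and A: "\<And>w' ys. ext w w' \<Longrightarrow> mems w' (D_univ (fsub (inst t) A)) ys vs \<Longrightarrow> MD w' (fsub (inst t) A) \<rho> xs ys"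
  have "typeof (sub \<rho> t) (cx w) = Some \<sigma>" by (rule typeof_sub[OF assms(2)]) (use env in auto)
  then show "MD w (Exists \<sigma> A) \<rho> xs vs"
    using A assms(1) xs vs by (intro MD_ExistsI[OF _ env]) (simp_all add: D_matrix_fsub sub_inst_env)
qed

section \<open>Rules of inference\<close>

lemma valid_mp:
  assumes "valid \<Gamma> A" "valid \<Gamma> (Imp A B)" "wf_fm \<Gamma> (Imp A B)" shows "valid \<Gamma> B"
proof -
  from assms(1) obtain ts where ts: "tyl [] ts (D_exist A)"
    and A: "\<And>w \<rho> ys. env (cx w) \<Gamma> \<rho> \<Longrightarrow> tys w ys (D_univ A) \<Longrightarrow> MD w A \<rho> ts ys"
    unfolding valid_def by blast
  from assms(2) obtain Us Ys where I: "impl \<Gamma> A B Us Ys" by (rule valid_ImpE)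
  note Us = impl_tyU[OF I]
  show ?thesis
  proof (rule validI)
    show "tyl [] (map_sapps (D_exist A) (D_elems B) Us ts) (D_exist B)"
      using tyl_map_sapps[OF Us ts] by (simp add: D_exist_def)
    fix w \<rho> ys assume env: "env (cx w) \<Gamma> \<rho>" and ys: "tys w ys (D_univ B)"
    show "MD w B \<rho> (map_sapps (D_exist A) (D_elems B) Us ts) ys"
      by (rule implD[OF I assms(3) env tyl_closed[OF ts] ys]) (rule A[OF env_mono[OF env] mems_tys])
  qed
qed

text \<open>Realizers compose. Going backwards, the second implication asks for \<open>B\<close> at
  members \<open>ys\<close> of the sequences \<open>?g2\<close>, and for each of these the first one
  asks for \<open>A\<close> at the members of \<open>Y1\<close> applied to \<open>xs\<close> and
  \<open>ys\<close>. Since \<open>ys\<close> is known only up to membership, the bound handed to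
  \<open>A\<close> is the union over all of \<open>?g2\<close>, which is the purpose of
  \<open>map_sappsL\<close>.\<close>

lemma valid_syll:
  assumes "valid \<Gamma> (Imp A B)" "valid \<Gamma> (Imp B C)" "wf_fm \<Gamma> (Imp A B)" "wf_fm \<Gamma> (Imp B C)"
  shows "valid \<Gamma> (Imp A C)"
proof -
  from assms(1) obtain U1 Y1 where I1: "impl \<Gamma> A B U1 Y1" by (rule valid_ImpE)
  from assms(2) obtain U2 Y2 where I2: "impl \<Gamma> B C U2 Y2" by (rule valid_ImpE)
  note U1 = impl_tyU[OF I1] and Y1 = impl_tyY[OF I1] and U2 = impl_tyU[OF I2] and Y2 = impl_tyY[OF I2]
  let ?f1 = "map_sapps (D_exist A) (D_elems B) U1"
  let ?f2 = "map_sapps (D_exist B) (D_elems C) U2"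
  let ?g2 = "map_sapps (D_exist B @ D_univ C) (D_univ B) Y2"
  let ?Y = "\<lambda>xs vs. map_sappsL (D_exist A) (D_univ B) (D_univ A) Y1 xs (?g2 (?f1 xs @ vs))"
  have f1: "tyl G (?f1 xs) (D_exist B)" if "tyl G xs (D_exist A)" for G xs
    using tyl_map_sapps[OF tyl_closed[OF U1] that] by (simp add: D_exist_def)
  have f2: "tyl G (?f2 xs) (D_exist C)" if "tyl G xs (D_exist B)" for G xs
    using tyl_map_sapps[OF tyl_closed[OF U2] that] by (simp add: D_exist_def)
  have g2: "tyl G (?g2 (?f1 xs @ vs)) (map TSeq (D_univ B))" if "tyl G xs (D_exist A)" "tyl G vs (D_univ C)" for G xs vs
    by (rule tyl_map_sapps[OF tyl_closed[OF Y2]]) (simp only: map_append f1[OF that(1)] that(2))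
  show ?thesis
  proof (rule valid_ImpI)
    show "nat_fn (D_exist A) (D_exist C) (\<lambda>xs. ?f2 (?f1 xs))"
      by (rule nat_fnI) (simp_all only: f1 f2 map_sub_map_sapps sub_tyl_closed[OF U1] sub_tyl_closed[OF U2])
    show "nat_fn2 (D_exist A) (D_univ C) (map TSeq (D_univ A)) ?Y"
    proof (rule nat_fn2I)
      fix G xs ys assume "tyl G xs (D_exist A)" "tyl G ys (D_univ C)"
      then show "tyl G (?Y xs ys) (map TSeq (D_univ A))"
        by (intro tyl_map_sappsL[OF tyl_closed[OF Y1]] g2)
    qed (simp only: sub_map_sappsL map_sub_map_sapps map_append sub_tyl_closed[OF U1] sub_tyl_closed[OF Y1] sub_tyl_closed[OF Y2])
    fix w \<rho> xs vs
    assume env: "env (cx w) \<Gamma> \<rho>" and xs: "tys w xs (D_exist A)" and vs: "tys w vs (D_univ C)"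
      and A: "\<And>w' ys. ext w w' \<Longrightarrow> mems w' (D_univ A) ys (?Y xs vs) \<Longrightarrow> MD w' A \<rho> xs ys"
    show "MD w C \<rho> (?f2 (?f1 xs)) vs"
    proof (rule implD[OF I2 assms(4) env f1[OF xs] vs])
      fix w1 ys assume w1: "ext w w1" and ys: "mems w1 (D_univ B) ys (?g2 (?f1 xs @ vs))"
      show "MD w1 B \<rho> (?f1 xs) ys"
      proof (rule implD[OF I1 assms(3) env_mono[OF env w1] tys_mono[OF xs w1] mems_tys[OF ys]])
        fix w2 zs assume w2: "ext w1 w2"
          and zs: "mems w2 (D_univ A) zs (map_sapps (D_exist A @ D_univ B) (D_univ A) Y1 (xs @ ys))"
        show "MD w2 A \<rho> xs zs"
          by (rule A[OF ext_trans[OF w1 w2] mems_sappsL[OF zs mems_mono[OF ys w2] tyl_closed[OF Y1] tys_mono[OF xs ext_trans[OF w1 w2]]]])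
      qed
    qed
  qed (use assms in simp)
qed

end

lemma map_sapps_append2:
  "length ss = length \<tau>s \<Longrightarrow> map_sapps \<sigma>s (\<tau>s @ \<tau>s') (ss @ ss') ts = map_sapps \<sigma>s \<tau>s ss ts @ map_sapps \<sigma>s \<tau>s' ss' ts"
  by simp

context eha
begin

lemma mems_appendE:
  assumes "mems w (\<sigma>s @ \<tau>s) ys (ts @ us)" "length ts = length \<sigma>s"
  obtains ys1 ys2 where "ys = ys1 @ ys2" "mems w \<sigma>s ys1 ts" "mems w \<tau>s ys2 us"
proof -
  have "length ys = length \<sigma>s + length \<tau>s" using mems_length[OF assms(1)] by simp
  then obtain ys1 ys2 where ys: "ys = ys1 @ ys2" "length ys1 = length \<sigma>s" by (rule length_appendE)
  with assms that show thesis by (auto simp: mems_append)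
qed

text \<open>Currying only regroups realizers: application to \<open>xA @ xB\<close> is application
  to \<open>xA\<close> and then to \<open>xB\<close>, and by \<open>sapp_elem_append\<close> even
  the types agree. The bounds for \<open>B\<close> become part of the realizers of the new
  conclusion.\<close>

lemma valid_exportation:
  assumes v: "valid \<Gamma> (Imp (And A B) C)" and wf: "wf_fm \<Gamma> (Imp (And A B) C)"
  shows "valid \<Gamma> (Imp A (Imp B C))"
proof -
  from v obtain Us Ys where I: "impl \<Gamma> (And A B) C Us Ys" by (rule valid_ImpE)
  let ?EA = "D_exist A" and ?EB = "D_exist B"
  have wf': "wf_fm \<Gamma> (Imp A (Imp B C))" "wf_fm \<Gamma> (Imp B C)" using wf by auto
  have Us: "tyl [] Us (map (\<lambda>\<tau>. TSeq (sapp_elem (?EA @ ?EB) \<tau>)) (D_elems C))"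
    using impl_tyU[OF I] by simp
  have "tyl [] Ys (map (\<lambda>\<tau>. TSeq (sapp_elem ((?EA @ ?EB) @ D_univ C) \<tau>)) (D_univ A) @
      map (\<lambda>\<tau>. TSeq (sapp_elem ((?EA @ ?EB) @ D_univ C) \<tau>)) (D_univ B))"
    using impl_tyY[OF I] by simp
  then obtain YA YB where Ys: "Ys = YA @ YB"
    and YA: "tyl [] YA (map (\<lambda>\<tau>. TSeq (sapp_elem ((?EA @ ?EB) @ D_univ C) \<tau>)) (D_univ A))"
    and YB: "tyl [] YB (map (\<lambda>\<tau>. TSeq (sapp_elem ((?EA @ ?EB) @ D_univ C) \<tau>)) (D_univ B))"
    by (rule tyl_appendE)
  have U: "tyl [] (Us @ YB) (map (\<lambda>\<tau>. TSeq (sapp_elem ?EA \<tau>)) (D_elems (Imp B C)))"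
    using Us YB by (simp add: comp_def sapp_elem_append D_exist_def[symmetric])
  have Y: "tyl [] YA (map (\<lambda>\<tau>. TSeq (sapp_elem (?EA @ D_univ (Imp B C)) \<tau>)) (D_univ A))"
    using YA by (simp add: D_exist_def)
  have "impl \<Gamma> A (Imp B C) (Us @ YB) YA"
    unfolding impl_def
  proof (intro conjI U Y allI, intro impI)
    fix w \<rho> xA zs
    assume env: "env (cx w) \<Gamma> \<rho>" and xA: "tys w xA ?EA" and zs: "tys w zs (D_univ (Imp B C))"
    from zs have "tys w zs (?EB @ D_univ C)" by (simp add: D_exist_def)
    then obtain xB v where z: "zs = xB @ v" and xB: "tys w xB ?EB" and v: "tys w v (D_univ C)"
      by (rule tyl_appendE)
    note len = tyl_length[OF xA] tyl_length[OF xB] tyl_length[OF Us] tyl_length[OF YB] tyl_length[OF YA]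
    let ?Us = "map_sapps ?EA (map (sapp_elem ?EB) (D_elems C)) Us xA"
    let ?YB = "map_sapps ?EA (map (sapp_elem (?EB @ D_univ C)) (D_univ B)) YB xA"
    have eq: "map_sapps ?EA (D_elems (Imp B C)) (Us @ YB) xA = ?Us @ ?YB"
      using len by (simp add: D_exist_def)
    have tU: "tys w ?Us (map (\<lambda>\<tau>. TSeq (sapp_elem ?EB \<tau>)) (D_elems C))"
      and tY: "tys w ?YB (map (\<lambda>\<tau>. TSeq (sapp_elem (?EB @ D_univ C) \<tau>)) (D_univ B))"
      using tyl_map_sapps[OF tyl_closed xA, of Us "map (sapp_elem ?EB) (D_elems C)"]
        tyl_map_sapps[OF tyl_closed xA, of YB "map (sapp_elem (?EB @ D_univ C)) (D_univ B)"] Us YB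
      by (simp_all add: comp_def sapp_elem_append)
    show "MD w (Imp A (Imp B C)) \<rho> ((Us @ YB) @ YA) (xA @ zs)"
    proof (rule MD_ImpI[OF wf'(1) env tyl_closed[OF U] tyl_closed[OF Y] xA zs])
      fix w1 assume w1: "ext w w1" and A: "\<And>w' ys. ext w1 w' \<Longrightarrow>
        mems w' (D_univ A) ys (map_sapps (?EA @ D_univ (Imp B C)) (D_univ A) YA (xA @ zs)) \<Longrightarrow> MD w' A \<rho> xA ys"
      show "MD w1 (Imp B C) \<rho> (map_sapps ?EA (D_elems (Imp B C)) (Us @ YB) xA) zs"
        unfolding eq z
      proof (rule MD_ImpI[OF wf'(2) env_mono[OF env w1] tys_mono[OF tU w1] tys_mono[OF tY w1] tys_mono[OF xB w1] tys_mono[OF v w1]])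
        fix w2 assume w2: "ext w1 w2" and B: "\<And>w' ys. ext w2 w' \<Longrightarrow>
          mems w' (D_univ B) ys (map_sapps (?EB @ D_univ C) (D_univ B) ?YB (xB @ v)) \<Longrightarrow> MD w' B \<rho> xB ys"
        note w2' = ext_trans[OF w1 w2]
        have "MD w2 C \<rho> (map_sapps (D_exist (And A B)) (D_elems C) Us (xA @ xB)) v"
        proof (rule implD[OF I wf env_mono[OF env w2'] _ tys_mono[OF v w2']])
          show "tys w2 (xA @ xB) (D_exist (And A B))"
            using tys_mono[OF xA w2'] tys_mono[OF xB w2'] by simp
          fix w3 ys assume w3: "ext w2 w3"
            and m: "mems w3 (D_univ (And A B)) ys (map_sapps (D_exist (And A B) @ D_univ C) (D_univ (And A B)) Ys ((xA @ xB) @ v))"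
          have "mems w3 (D_univ A @ D_univ B) ys
             (map_sapps (?EA @ ?EB @ D_univ C) (D_univ A) YA (xA @ xB @ v) @ map_sapps (?EA @ ?EB @ D_univ C) (D_univ B) YB (xA @ xB @ v))"
            using m len by (simp add: Ys)
          then obtain ya yb where y: "ys = ya @ yb"
            and ya: "mems w3 (D_univ A) ya (map_sapps (?EA @ ?EB @ D_univ C) (D_univ A) YA (xA @ xB @ v))"
            and yb: "mems w3 (D_univ B) yb (map_sapps (?EA @ ?EB @ D_univ C) (D_univ B) YB (xA @ xB @ v))"
            by (rule mems_appendE) (use len in simp)
          have "MD w3 A \<rho> xA ya"
            by (rule A[OF ext_trans[OF w2 w3]]) (use ya in \<open>simp add: z D_exist_def\<close>)
          moreover have "MD w3 B \<rho> xB yb"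
            by (rule B[OF w3]) (use yb map_sapps_append[of xA ?EA "?EB @ D_univ C" "xB @ v" "D_univ B" YB] len in simp)
          ultimately show "MD w3 (And A B) \<rho> (xA @ xB) ys"
            using len mems_length[OF ya] unfolding y
            by (simp add: D_matrix_And pv_AndI del: D_matrix.simps)
        qed
        then show "MD w2 C \<rho> (map_sapps ?EB (D_elems C) ?Us xB) v"
          using map_sapps_append[of xA ?EA ?EB xB "D_elems C" Us] len by simp
      qed
    qed
  qed
  then show ?thesis by (rule impl_valid)
qed

text \<open>This is not a mere regrouping, because the assumption for \<open>And A B\<close> ranges
  over the counterexamples for \<open>A\<close> and for \<open>B\<close> jointly. To use it for one
  conjunct alone, the sequences of the other must have a member, so default objects are appended to
  all bounds.\<close>

lemma valid_importation:
  assumes v: "valid \<Gamma> (Imp A (Imp B C))" and wf: "wf_fm \<Gamma> (Imp A (Imp B C))"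
  shows "valid \<Gamma> (Imp (And A B) C)"
proof -
  from v obtain Us' YA where I: "impl \<Gamma> A (Imp B C) Us' YA" by (rule valid_ImpE)
  let ?EA = "D_exist A" and ?EB = "D_exist B"
  let ?m = "length ?EA"
  have wf': "wf_fm \<Gamma> (Imp B C)" using wf by auto
  from impl_tyU[OF I] have "tyl [] Us' (map (\<lambda>\<tau>. TSeq (sapp_elem ?EA (sapp_elem ?EB \<tau>))) (D_elems C) @
      map (\<lambda>\<tau>. TSeq (sapp_elem ?EA (sapp_elem (?EB @ D_univ C) \<tau>))) (D_univ B))"
    by (simp add: D_exist_def comp_def)
  then obtain Us YB where U': "Us' = Us @ YB"
    and Us: "tyl [] Us (map (\<lambda>\<tau>. TSeq (sapp_elem ?EA \<tau>)) (map (sapp_elem ?EB) (D_elems C)))"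
    and YB: "tyl [] YB (map (\<lambda>\<tau>. TSeq (sapp_elem ?EA \<tau>)) (map (sapp_elem (?EB @ D_univ C)) (D_univ B)))"
    by (rule tyl_appendE) (simp add: comp_def)
  have YA: "tyl [] YA (map (\<lambda>\<tau>. TSeq (sapp_elem (?EA @ ?EB @ D_univ C) \<tau>)) (D_univ A))"
    using impl_tyY[OF I] by (simp add: D_exist_def)
  let ?U = "\<lambda>x. map_sapps ?EA (map (sapp_elem ?EB) (D_elems C)) Us x"
  let ?V = "\<lambda>x. map_sapps ?EA (map (sapp_elem (?EB @ D_univ C)) (D_univ B)) YB x"
  have tU: "tyl G (?U x) (map (\<lambda>\<tau>. TSeq (sapp_elem ?EB \<tau>)) (D_elems C))"
    and tV: "tyl G (?V x) (map (\<lambda>\<tau>. TSeq (sapp_elem (?EB @ D_univ C) \<tau>)) (D_univ B))" if "tyl G x ?EA" for G x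
    using tyl_map_sapps[OF tyl_closed[OF Us] that] tyl_map_sapps[OF tyl_closed[OF YB] that] by (simp_all add: comp_def)
  let ?d = "\<lambda>A. singles (D_univ A) (defaults (D_univ A))"
  let ?YA = "\<lambda>xA xB v. map_sapps (?EA @ ?EB @ D_univ C) (D_univ A) YA (xA @ xB @ v)"
  let ?YB = "\<lambda>xA xB v. map_sapps (?EB @ D_univ C) (D_univ B) (?V xA) (xB @ v)"
  have tYA: "tyl G (?YA xA xB v) (map TSeq (D_univ A))" and tYB: "tyl G (?YB xA xB v) (map TSeq (D_univ B))"
    if "tyl G xA ?EA" "tyl G xB ?EB" "tyl G v (D_univ C)" for G xA xB v
    by (rule tyl_map_sapps[OF tyl_closed[OF YA]], simp only: map_append that,
        rule tyl_map_sapps[OF tV[OF that(1)]], simp only: map_append that)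
  have td: "tyl G (?d A) (map TSeq (D_univ A))" for G A
    by (rule tyl_singles) simp
  let ?Y = "\<lambda>x v. appends (D_univ A) (?YA (take ?m x) (drop ?m x) v) (?d A) @ appends (D_univ B) (?YB (take ?m x) (drop ?m x) v) (?d B)"
  show ?thesis
  proof (rule valid_ImpI)
    show "nat_fn (D_exist (And A B)) (D_exist C) (\<lambda>x. map_sapps ?EB (D_elems C) (?U (take ?m x)) (drop ?m x))"
    proof (rule nat_fnI)
      fix G x assume "tyl G x (D_exist (And A B))"
      from tyl_appendD[OF this[unfolded D_exist_simps] refl]
      have x: "tyl G (take ?m x) ?EA" "tyl G (drop ?m x) ?EB" by auto
      show "tyl G (map_sapps ?EB (D_elems C) (?U (take ?m x)) (drop ?m x)) (D_exist C)"
        unfolding D_exist_def[of C] by (rule tyl_map_sapps[OF tU[OF x(1)] x(2)])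
    qed (simp only: map_sub_map_sapps sub_tyl_closed[OF Us] take_map drop_map)
    show "nat_fn2 (D_exist (And A B)) (D_univ C) (map TSeq (D_univ (And A B))) ?Y"
    proof (rule nat_fn2I)
      fix G x v assume "tyl G x (D_exist (And A B))" and v: "tyl G v (D_univ C)"
      from tyl_appendD[OF this(1)[unfolded D_exist_simps] refl]
      have x: "tyl G (take ?m x) ?EA" "tyl G (drop ?m x) ?EB" by auto
      show "tyl G (?Y x v) (map TSeq (D_univ (And A B)))"
        unfolding D_univ.simps map_append using tYA[OF x v] tYB[OF x v] td by (simp only: tyl_appends)
    qed (simp only: map_append sub_appends sub_singles sub_defaults map_sub_map_sapps sub_tyl_closed[OF YA] sub_tyl_closed[OF YB] take_map drop_map)
    fix w \<rho> xs v
    assume env: "env (cx w) \<Gamma> \<rho>" and xs: "tys w xs (D_exist (And A B))" and v: "tys w v (D_univ C)"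
      and h: "\<And>w' ys. ext w w' \<Longrightarrow> mems w' (D_univ (And A B)) ys (?Y xs v) \<Longrightarrow> MD w' (And A B) \<rho> xs ys"
    from xs[unfolded D_exist_simps] obtain xA xB where x: "xs = xA @ xB" and xA: "tys w xA ?EA" and xB: "tys w xB ?EB"
      by (rule tyl_appendE)
    note len = tyl_length[OF xA]
    have ttd: "x = xA" "y = xB" if "x = take ?m xs" "y = drop ?m xs" for x y using that len by (auto simp: x)
    have Y: "?Y xs v = appends (D_univ A) (?YA xA xB v) (?d A) @ appends (D_univ B) (?YB xA xB v) (?d B)"
      unfolding ttd[OF refl refl] ..
    have h': "MD w' A \<rho> xA ya \<and> MD w' B \<rho> xB yb"
      if "ext w w'" "mems w' (D_univ A) ya (appends (D_univ A) (?YA xA xB v) (?d A))"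
        "mems w' (D_univ B) yb (appends (D_univ B) (?YB xA xB v) (?d B))" for w' ya yb
    proof -
      note l = mems_length[OF that(2)]
      have "mems w' (D_univ (And A B)) (ya @ yb) (?Y xs v)"
        unfolding Y using that(2,3) l by (simp only: D_univ.simps mems_append)
      from h[OF that(1) this] have "pv w' (And (D_matrix A \<rho> xA ya) (D_matrix B \<rho> xB yb))"
        unfolding x using l len by (simp only: D_matrix_And length_D_exist)
      then show ?thesis by (blast dest: pv_AndD1 pv_AndD2)
    qed
    have dA: "mems w' (D_univ A) (defaults (D_univ A)) (appends (D_univ A) (?YA xA xB v) (?d A))"
      and dB: "mems w' (D_univ B) (defaults (D_univ B)) (appends (D_univ B) (?YB xA xB v) (?d B))" if "ext w w'" for w'
      using tYA[OF xA xB v] tYB[OF xA xB v]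
      by (auto intro!: mems_appends2 mems_defaults intro: tys_mono[OF _ that])
    have zs: "tys w (xB @ v) (D_univ (Imp B C))" using xB v by (simp add: D_exist_def)
    have eq: "map_sapps ?EA (D_elems (Imp B C)) Us' xA = ?U xA @ ?V xA"
      using tyl_length[OF Us] by (simp add: U' D_exist_def)
    have M: "MD w (Imp B C) \<rho> (map_sapps ?EA (D_elems (Imp B C)) Us' xA) (xB @ v)"
    proof (rule implD[OF I wf env xA zs])
      fix w' ya assume w': "ext w w'"
        and "mems w' (D_univ A) ya (map_sapps (?EA @ D_univ (Imp B C)) (D_univ A) YA (xA @ xB @ v))"
      then have "mems w' (D_univ A) ya (?YA xA xB v)" by (simp add: D_exist_def)
      from h'[OF w' mems_appends1[OF this td] dB[OF w']] show "MD w' A \<rho> xA ya" ..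
    qed
    have "MD w C \<rho> (map_sapps ?EB (D_elems C) (?U xA) xB) v"
    proof (rule MD_ImpD[OF M[unfolded eq] wf' env tU[OF xA] tV[OF xA] xB v])
      fix w' yb assume w': "ext w w'" and m: "mems w' (D_univ B) yb (?YB xA xB v)"
      from h'[OF w' dA[OF w'] mems_appends1[OF m td]] show "MD w' B \<rho> xB yb" ..
    qed
    then show "MD w C \<rho> (map_sapps ?EB (D_elems C) (?U (take ?m xs)) (drop ?m xs)) v"
      unfolding ttd[OF refl refl] .
  qed (use wf in simp)
qed

text \<open>The inner block is handled by the induction hypothesis at each member of the outermost
  sequence, and \<open>ball_or\<close> then moves \<open>P\<close> past the outermost
  quantifier.\<close>

lemma balls_or:
  "length ts = length \<sigma>s \<Longrightarrow> pv w (balls_fm \<sigma>s ts (Or (fren (\<lambda>i. i + length \<sigma>s) P) Q)) \<Longrightarrow> pv w (Or P (balls_fm \<sigma>s ts Q))"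
proof (induction \<sigma>s arbitrary: w ts P Q)
  case (Cons \<sigma> \<sigma>s)
  then obtain t ts' where ts: "ts = t # ts'" "length ts' = length \<sigma>s" by (cases ts) auto
  let ?B = "balls_fm \<sigma>s (map (shift 1) ts') (Or (fren (\<lambda>i. i + length \<sigma>s) (fren Suc P)) Q)"
  let ?C = "balls_fm \<sigma>s (map (shift 1) ts') Q"
  from Cons.prems(2) have b: "pv w (ball_fm \<sigma> t ?B)" by (simp add: ts)
  then have "wf_int (\<sigma> # cx w) ?B" "typeof t (cx w) = Some (TSeq \<sigma>)"
    by (auto dest: pv_L)
  note ty = this
  have inner: "pv w' (Or P' (balls_fm \<sigma>s us Q'))"
    if "pv w' (balls_fm \<sigma>s us (Or (fren (\<lambda>i. i + length \<sigma>s) P') Q'))" "length us = length \<sigma>s" for w' us P' Q'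
    by (rule Cons.IH[OF that(2,1)])
  \<comment> \<open>The world with hypothesis \<open>?B\<close> serves only to read off from the
    induction hypothesis that \<open>?C\<close> is well formed.\<close>
  have "pv (World (\<sigma> # cx w) ?B) (Or (fren Suc P) ?C)"
  proof (rule inner)
    have "hy (World (\<sigma> # cx w) ?B) = ?B" using ty(1) by (simp add: hy_def)
    then show "pv (World (\<sigma> # cx w) ?B) ?B" using dv_refl[OF ty(1)] by (simp add: pv_def)
  qed (use ts in simp)
  then have wfC: "wf_int (\<sigma> # cx w) (Or (fren Suc P) ?C)" using pv_L by fastforce
  have "pv w (ball_fm \<sigma> t (Or (fren Suc P) ?C))"
  proof (rule ballI[OF wfC ty(2)])
    fix w' a assume w': "ext w w'" and a: "mem w' \<sigma> a t"
    have up: "fsub (ups (length \<sigma>s) (inst a)) (fren (\<lambda>i. i + length \<sigma>s) (fren Suc P)) = fren (\<lambda>i. i + length \<sigma>s) P"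
    proof -
      have "(\<lambda>i. ups (length \<sigma>s) (inst a) (Suc i + length \<sigma>s)) = (\<lambda>i. Var (i + length \<sigma>s))"
        unfolding ups_add by simp
      then show ?thesis by (simp del: add_Suc)
    qed
    have "pv w' (fsub (inst a) ?B)" by (rule ballD[OF pv_mono[OF b w'] a])
    then have "pv w' (balls_fm \<sigma>s ts' (Or (fren (\<lambda>i. i + length \<sigma>s) P) (fsub (ups (length \<sigma>s) (inst a)) Q)))"
      using ts up by (simp add: comp_def del: fren_fren fsub_fren)
    from inner[OF this ts(2)] show "pv w' (fsub (inst a) (Or (fren Suc P) ?C))"
      using ts by (simp add: comp_def)
  qed
  from ball_or[OF this] show ?case by (simp add: ts)
qed simp

text \<open>For each counterexample to \<open>A\<close> the assumption yields the disjunct for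
  \<open>C\<close> or the one for \<open>A\<close>, possibly a different one each time. With
  \<open>vC\<close> fixed, \<open>balls_or\<close> turns this into one decision: either
  \<open>C\<close> holds at \<open>vC\<close>, or \<open>A\<close> holds at all members of the
  bounds and the realized implication gives \<open>B\<close>.\<close>

lemma valid_or_expansion:
  assumes v: "valid \<Gamma> (Imp A B)" and wf: "wf_fm \<Gamma> (Imp A B)" "wf_fm \<Gamma> C"
  shows "valid \<Gamma> (Imp (Or C A) (Or C B))"
proof -
  from v obtain Us Ys where I: "impl \<Gamma> A B Us Ys" by (rule valid_ImpE)
  let ?m = "length (D_exist C)" and ?n = "length (D_univ C)" and ?k = "length (D_univ A)"
  note Us = impl_tyU[OF I] and Ys = impl_tyY[OF I]
  let ?f = "map_sapps (D_exist A) (D_elems B) Us"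
  let ?g = "map_sapps (D_exist A @ D_univ B) (D_univ A) Ys"
  have f: "tyl G (?f x) (D_exist B)" if "tyl G x (D_exist A)" for G x
    using tyl_map_sapps[OF tyl_closed[OF Us] that] by (simp add: D_exist_def)
  have g: "tyl G (?g (x @ v)) (map TSeq (D_univ A))" if "tyl G x (D_exist A)" "tyl G v (D_univ B)" for G x v
    by (rule tyl_map_sapps[OF tyl_closed[OF Ys]]) (simp only: map_append that)
  let ?Y = "\<lambda>x v. singles (D_univ C) (take ?n v) @ ?g (drop ?m x @ drop ?n v)"
  show ?thesis
  proof (rule valid_ImpI)
    show "nat_fn (D_exist (Or C A)) (D_exist (Or C B)) (\<lambda>x. take ?m x @ ?f (drop ?m x))"
    proof (rule nat_fnI)
      fix G x assume "tyl G x (D_exist (Or C A))"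
      from tyl_appendD[OF this[unfolded D_exist_simps] refl]
      show "tyl G (take ?m x @ ?f (drop ?m x)) (D_exist (Or C B))"
        unfolding D_exist_simps by (simp only: map_append f)
    qed (simp only: map_append map_sub_map_sapps sub_tyl_closed[OF Us] take_map drop_map)
    show "nat_fn2 (D_exist (Or C A)) (D_univ (Or C B)) (map TSeq (D_univ (Or C A))) ?Y"
    proof (rule nat_fn2I)
      fix G x v assume "tyl G x (D_exist (Or C A))" "tyl G v (D_univ (Or C B))"
      from tyl_appendD[OF this(1)[unfolded D_exist_simps] refl] tyl_appendD[OF this(2)[unfolded D_univ.simps] refl]
      show "tyl G (?Y x v) (map TSeq (D_univ (Or C A)))"
        unfolding D_univ.simps map_append by (simp only: tyl_singles g[unfolded map_append])
    qed (simp only: map_append map_sub_map_sapps sub_singles sub_tyl_closed[OF Ys] take_map drop_map)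
    fix w \<rho> xs vs
    assume env: "env (cx w) \<Gamma> \<rho>" and xs: "tys w xs (D_exist (Or C A))" and vs: "tys w vs (D_univ (Or C B))"
      and h: "\<And>w' ys. ext w w' \<Longrightarrow> mems w' (D_univ (Or C A)) ys (?Y xs vs) \<Longrightarrow> MD w' (Or C A) \<rho> xs ys"
    from xs[unfolded D_exist_simps] obtain xC xA where x: "xs = xC @ xA" and xC: "tys w xC (D_exist C)" and xA: "tys w xA (D_exist A)"
      by (rule tyl_appendE)
    from vs[unfolded D_univ.simps] obtain vC vB where v: "vs = vC @ vB" and vC: "tys w vC (D_univ C)" and vB: "tys w vB (D_univ B)"
      by (rule tyl_appendE)
    note len = tyl_length[OF xC] tyl_length[OF vC] tyl_length[OF xA]
    let ?P = "D_matrix C \<rho> xC vC"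
    let ?Q = "D_matrix A (\<lambda>i. shift ?k (\<rho> i)) (map (shift ?k) xA) (vars ?k)"
    let ?ts = "?g (xA @ vB)"
    have ts: "tys w ?ts (map TSeq (D_univ A))" by (rule g[OF xA vB])
    have wfP: "wf_int (cx w) ?P" by (rule MD_wf[OF wf(2) env xC vC])
    have wfA: "wf_fm \<Gamma> A" and wfB: "wf_fm \<Gamma> B" using wf(1) by auto
    have wfQ: "wf_int (rev (D_univ A) @ cx w) ?Q"
      by (rule wf_D_matrix[OF wfA]) (use env xA in \<open>auto simp: typeof_shift tyl_vars comp_def\<close>)
    have "pv w (balls_fm (D_univ A) ?ts (Or (fren (\<lambda>i. i + ?k) ?P) ?Q))"
    proof (rule ballsI)
      have "wf_int (rev (D_univ A) @ cx w) (fren (\<lambda>i. i + ?k) ?P)"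
        unfolding fren_eq_fsub by (rule L_fsub[OF wfP]) (simp add: nth_append)
      then show "wf_int (rev (D_univ A) @ cx w) (Or (fren (\<lambda>i. i + ?k) ?P) ?Q)"
        using wfQ by (simp add: wf_int_simps)
      show "map (\<lambda>t. typeof t (cx w)) ?ts = map (\<lambda>\<sigma>. Some (TSeq \<sigma>)) (D_univ A)"
        using ts by (simp only: map_map comp_def)
      fix w' ys assume w': "ext w w'" and ys: "mems w' (D_univ A) ys ?ts"
      have "mems w' (D_univ (Or C A)) (vC @ ys) (?Y xs vs)"
        using len mems_single[OF tys_mono[OF vC w']] ys by (simp add: x v mems_append)
      from h[OF w' this] have "pv w' (Or ?P (D_matrix A \<rho> xA ys))"
        unfolding x using len by (simp only: D_matrix_Or length_D_exist)
      moreover have "fsub (envl ys Var) (fren (\<lambda>i. i + ?k) ?P) = ?P"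
        using envl_add[of ys Var] mems_length[OF ys] by simp
      moreover have "fsub (envl ys Var) ?Q = D_matrix A \<rho> xA ys"
        by (subst inst_D_matrix) (use len mems_length[OF ys] in simp_all)
      ultimately show "pv w' (fsub (envl ys Var) (Or (fren (\<lambda>i. i + ?k) ?P) ?Q))"
        by (simp only: fsub.simps)
    qed
    then have o: "pv w (Or ?P (balls_fm (D_univ A) ?ts ?Q))"
      by (rule balls_or[rotated]) (use tyl_length[OF ts] in simp)
    have "pv w (Or ?P (D_matrix B \<rho> (?f xA) vB))"
    proof (rule pv_Or_mono[OF o MD_wf[OF wfB env f[OF xA] vB]])
      fix w' assume w': "ext w w'" and b: "pv w' (balls_fm (D_univ A) ?ts ?Q)"
      show "MD w' B \<rho> (?f xA) vB"
      proof (rule implD[OF I wf(1) env_mono[OF env w'] tys_mono[OF xA w'] tys_mono[OF vB w']])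
        fix w'' ys assume w'': "ext w' w''" and ys: "mems w'' (D_univ A) ys ?ts"
        show "MD w'' A \<rho> xA ys"
          by (rule balls_MD_D[OF pv_mono[OF b w''] refl ys]) (use len in simp)
      qed
    qed
    then show "MD w (Or C B) \<rho> (take ?m xs @ ?f (drop ?m xs)) vs"
      using len by (simp add: x v D_matrix_Or del: D_matrix.simps)
  qed (use wf in simp)
qed

text \<open>The clause for \<open>Forall\<close> allows no dependence of the realizers on the bound
  variable, and the realizers of the premise are closed, so the same terms work for the
  conclusion.\<close>

lemma valid_forall_rule:
  assumes v: "valid (\<sigma> # \<Gamma>) (Imp (fren Suc B) A)" and wf: "wf_fm \<Gamma> (Imp B (Forall \<sigma> A))"
  shows "valid \<Gamma> (Imp B (Forall \<sigma> A))"
proof -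
  from v obtain Us Ys where I: "impl (\<sigma> # \<Gamma>) (fren Suc B) A Us Ys" by (rule valid_ImpE)
  note Us = impl_tyU[OF I, simplified] and Ys = impl_tyY[OF I, simplified]
  have wf': "wf_fm (\<sigma> # \<Gamma>) (Imp (fren Suc B) A)" and wfA: "wf_fm (\<sigma> # \<Gamma>) A" using wf by auto
  have U: "tyl [] Us (map (\<lambda>\<tau>. TSeq (sapp_elem (D_exist B) \<tau>)) (D_elems (Forall \<sigma> A)))"
    and Y: "tyl [] Ys (map (\<lambda>\<tau>. TSeq (sapp_elem (D_exist B @ D_univ (Forall \<sigma> A)) \<tau>)) (D_univ B))"
    using Us Ys by simp_all
  have "impl \<Gamma> B (Forall \<sigma> A) Us Ys"
    unfolding impl_def
  proof (intro conjI U Y allI, intro impI)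
    fix w \<rho> xs vs
    assume env: "env (cx w) \<Gamma> \<rho>" and xs: "tys w xs (D_exist B)" and vs: "tys w vs (D_univ (Forall \<sigma> A))"
    show "MD w (Imp B (Forall \<sigma> A)) \<rho> (Us @ Ys) (xs @ vs)"
    proof (rule MD_ImpI[OF wf env tyl_closed[OF U] tyl_closed[OF Y] xs vs])
      fix w1 assume w1: "ext w w1" and B: "\<And>w' ys. ext w1 w' \<Longrightarrow>
        mems w' (D_univ B) ys (map_sapps (D_exist B @ D_univ (Forall \<sigma> A)) (D_univ B) Ys (xs @ vs)) \<Longrightarrow> MD w' B \<rho> xs ys"
      note env1 = env_mono[OF env w1] and xs1 = tys_mono[OF xs w1]
      have vs1: "tys w1 vs (D_univ A)" using tys_mono[OF vs w1] by simp
      have t: "tys w1 (map_sapps (D_exist B) (D_elems A) Us xs) (D_exist A)"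
        unfolding D_exist_def[of A] by (rule tyl_map_sapps[OF tyl_closed xs1]) (use Us in simp)
      have "MD w1 (Forall \<sigma> A) \<rho> (map_sapps (D_exist B) (D_elems A) Us xs) vs"
      proof (rule MD_ForallI[OF wfA env1 t vs1])
        fix w2 z assume w2: "ext w1 w2" and z: "typeof z (cx w2) = Some \<sigma>"
        have "MD w2 A (case_nat z \<rho>) (map_sapps (D_exist (fren Suc B)) (D_elems A) Us xs) vs"
        proof (rule implD[OF I wf' env_case_nat[OF env_mono[OF env1 w2] z] _ tys_mono[OF vs1 w2]])
          fix w3 ys assume w3: "ext w2 w3"
            and "mems w3 (D_univ (fren Suc B)) ys (map_sapps (D_exist (fren Suc B) @ D_univ A) (D_univ (fren Suc B)) Ys (xs @ vs))"
          then have "MD w3 B \<rho> xs ys" by (intro B[OF ext_trans[OF w2 w3]]) simp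
          then show "MD w3 (fren Suc B) (case_nat z \<rho>) xs ys" by (simp add: D_matrix_fren)
        qed (use tys_mono[OF xs1 w2] in simp)
        then show "MD w2 A (case_nat z \<rho>) (map_sapps (D_exist B) (D_elems A) Us xs) vs" by simp
      qed
      then show "MD w1 (Forall \<sigma> A) \<rho> (map_sapps (D_exist B) (D_elems (Forall \<sigma> A)) Us xs) vs" by simp
    qed
  qed
  then show ?thesis by (rule impl_valid)
qed

text \<open>An existential assumption takes sequences as universal arguments and supplies one
  witness good for all their members. The bounds \<open>?g\<close> computed from the premise are
  such sequences, so it suffices to assume the existential formula at the singletons containing
  them.\<close>

lemma valid_exists_rule:
  assumes v: "valid (\<sigma> # \<Gamma>) (Imp A (fren Suc B))" and wf: "wf_fm \<Gamma> (Imp (Exists \<sigma> A) B)"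
  shows "valid \<Gamma> (Imp (Exists \<sigma> A) B)"
proof -
  from v obtain Us Ys where I: "impl (\<sigma> # \<Gamma>) A (fren Suc B) Us Ys" by (rule valid_ImpE)
  note Us = impl_tyU[OF I, simplified] and Ys = impl_tyY[OF I, simplified]
  have wf': "wf_fm (\<sigma> # \<Gamma>) (Imp A (fren Suc B))" and wfA: "wf_fm (\<sigma> # \<Gamma>) A" and wfB: "wf_fm \<Gamma> B" using wf by auto
  let ?f = "map_sapps (D_exist A) (D_elems B) Us"
  let ?g = "map_sapps (D_exist A @ D_univ B) (D_univ A) Ys"
  have f: "tyl G (?f x) (D_exist B)" if "tyl G x (D_exist A)" for G x
    using tyl_map_sapps[OF tyl_closed that, of Us "D_elems B"] Us by (simp add: D_exist_def)
  have g: "tyl G (?g (x @ v)) (map TSeq (D_univ A))" if "tyl G x (D_exist A)" "tyl G v (D_univ B)" for G x v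
    by (rule tyl_map_sapps[OF tyl_closed]) (use Ys that in simp_all)
  have sU: "map (sub \<theta>) Us = Us" and sY: "map (sub \<theta>) Ys = Ys" for \<theta>
    by (rule sub_tyl_closed[OF impl_tyU[OF I]], rule sub_tyl_closed[OF impl_tyY[OF I]])
  show ?thesis
  proof (rule valid_ImpI[OF wf])
    show "nat_fn (D_exist (Exists \<sigma> A)) (D_exist B) ?f"
      by (rule nat_fnI) (simp_all only: D_exist_simps f map_sub_map_sapps sU)
    show "nat_fn2 (D_exist (Exists \<sigma> A)) (D_univ B) (map TSeq (D_univ (Exists \<sigma> A))) (\<lambda>x v. singles (map TSeq (D_univ A)) (?g (x @ v)))"
    proof (rule nat_fn2I)
      fix G x v assume "tyl G x (D_exist (Exists \<sigma> A))" "tyl G v (D_univ B)"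
      then show "tyl G (singles (map TSeq (D_univ A)) (?g (x @ v))) (map TSeq (D_univ (Exists \<sigma> A)))"
        unfolding D_univ.simps D_exist_simps by (intro tyl_singles g)
    qed (simp only: sub_singles map_sub_map_sapps map_append sY)
    fix w \<rho> xs vs
    assume env: "env (cx w) \<Gamma> \<rho>" and xs: "tys w xs (D_exist (Exists \<sigma> A))" and vs: "tys w vs (D_univ B)"
      and h: "\<And>w' ys. ext w w' \<Longrightarrow> mems w' (D_univ (Exists \<sigma> A)) ys (singles (map TSeq (D_univ A)) (?g (xs @ vs))) \<Longrightarrow>
        MD w' (Exists \<sigma> A) \<rho> xs ys"
    have x: "tys w xs (D_exist A)" using xs by simp
    have ts: "tys w (?g (xs @ vs)) (map TSeq (D_univ A))" by (rule g[OF x vs])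
    have E: "MD w (Exists \<sigma> A) \<rho> xs (?g (xs @ vs))"
      by (rule h[OF ext_refl]) (use mems_single[OF ts] in simp)
    show "MD w B \<rho> (?f xs) vs"
    proof (rule MD_ExistsE[OF E _ _ MD_wf[OF wfB env f[OF x] vs]])
      fix w1 z assume w1: "ext w w1" and z: "typeof z (cx w1) = Some \<sigma>"
        and A: "\<And>w' ys. ext w1 w' \<Longrightarrow> mems w' (D_univ A) ys (?g (xs @ vs)) \<Longrightarrow> MD w' A (case_nat z \<rho>) xs ys"
      have "MD w1 (fren Suc B) (case_nat z \<rho>) (map_sapps (D_exist A) (D_elems (fren Suc B)) Us xs) vs"
        by (rule implD[OF I wf' env_case_nat[OF env_mono[OF env w1] z] tys_mono[OF x w1]])
          (use tys_mono[OF vs w1] A in simp_all)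
      then show "MD w1 B \<rho> (?f xs) vs" by (simp add: D_matrix_fren)
    qed (use tyl_length[OF x] tyl_length[OF ts] in auto)
  qed
qed

lemma valid_AndI:
  assumes "valid \<Gamma> A" "valid \<Gamma> B" shows "valid \<Gamma> (And A B)"
proof -
  from assms(1) obtain ts where ts: "tyl [] ts (D_exist A)"
    and A: "\<And>w \<rho> ys. env (cx w) \<Gamma> \<rho> \<Longrightarrow> tys w ys (D_univ A) \<Longrightarrow> MD w A \<rho> ts ys"
    unfolding valid_def by blast
  from assms(2) obtain us where us: "tyl [] us (D_exist B)"
    and B: "\<And>w \<rho> ys. env (cx w) \<Gamma> \<rho> \<Longrightarrow> tys w ys (D_univ B) \<Longrightarrow> MD w B \<rho> us ys"
    unfolding valid_def by blast
  show ?thesis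
  proof (rule validI[of "ts @ us"])
    show "tyl [] (ts @ us) (D_exist (And A B))" using ts us by simp
    fix w \<rho> ys assume env: "env (cx w) \<Gamma> \<rho>" and "tys w ys (D_univ (And A B))"
    from this(2)[unfolded D_univ.simps] obtain y1 y2 where y: "ys = y1 @ y2" "tys w y1 (D_univ A)" "tys w y2 (D_univ B)"
      by (rule tyl_appendE)
    show "MD w (And A B) \<rho> (ts @ us) ys"
      using A[OF env y(2)] B[OF env y(3)] tyl_length[OF ts] tyl_length[OF y(2)]
      by (simp add: y(1) D_matrix_And pv_AndI del: D_matrix.simps)
  qed
qed

end

section \<open>Soundness of the axioms for standardness\<close>

lemma internal_less_fm [simp]: "internal (less_fm s t)"
  by (simp add: less_fm_def)

lemma internal_mem_fm [simp]: "internal (mem_fm \<sigma> s t)"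
  by (simp add: mem_fm_def)

lemma internal_bounded [simp]: "internal (ball_fm \<sigma> t A) = internal A" "internal (bex_fm \<sigma> t A) = internal A"
  by (simp_all add: ball_fm_def bex_fm_def)

lemma wf_fm_mem_fm [simp]: "wf_fm \<Gamma> (mem_fm \<sigma> s t) \<longleftrightarrow> typeof s \<Gamma> = Some \<sigma> \<and> typeof t \<Gamma> = Some (TSeq \<sigma>)"
  using wf_int_mem_fm[of \<Gamma> \<sigma> s t] unfolding wf_int_def by simp

lemma wf_fm_bex_fm [simp]: "wf_fm \<Gamma> (bex_fm \<sigma> t A) \<longleftrightarrow> typeof t \<Gamma> = Some (TSeq \<sigma>) \<and> wf_fm (\<sigma> # \<Gamma>) A"
  by (auto simp: bex_fm_def)

lemma wf_fm_ball_fm [simp]: "wf_fm \<Gamma> (ball_fm \<sigma> t A) \<longleftrightarrow> typeof t \<Gamma> = Some (TSeq \<sigma>) \<and> wf_fm (\<sigma> # \<Gamma>) A"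
  by (auto simp: ball_fm_def)

lemma D_mem_fm [simp]: "D_elems (mem_fm \<sigma> s t) = []" "D_univ (mem_fm \<sigma> s t) = []"
  by (simp_all add: D_internal)

lemma D_bex_fm [simp]: "D_elems (bex_fm \<sigma> t A) = D_elems A" "D_univ (bex_fm \<sigma> t A) = map TSeq (D_univ A)"
  "D_exist (bex_fm \<sigma> t A) = D_exist A"
  by (simp_all add: bex_fm_def D_exist_def)

lemma D_matrix_ForallSt:
  "D_matrix (ForallSt \<sigma> A) \<rho> X (z # ys) = D_matrix A (case_nat z \<rho>) (map_sapps [\<sigma>] (D_elems A) X [z]) ys"
  by simp

lemma wf_fren_skip1 [simp]: "wf_fm (\<sigma> # \<tau> # \<Gamma>) (fren (skip (Suc 0)) A) = wf_fm (\<sigma> # \<Gamma>) A"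
  by (rule wf_fren) (auto simp: skip_def nth_Cons split: nat.splits)

lemma wf_fren_skip2 [simp]: "wf_fm (\<sigma> # \<tau> # \<upsilon> # \<Gamma>) (fren (skip 2) A) = wf_fm (\<sigma> # \<tau> # \<Gamma>) A"
  by (rule wf_fren) (auto simp: skip_def nth_Cons split: nat.splits)

lemma env_skip1: "(\<lambda>i. case_nat z (case_nat y \<rho>) (skip (Suc 0) i)) = case_nat z \<rho>"
  by (rule HOL.ext) (simp add: skip_def split: nat.split)

lemma env_skip2: "(\<lambda>i. case_nat z (case_nat y (case_nat x \<rho>)) (skip 2 i)) = case_nat z (case_nat y \<rho>)"
  by (rule HOL.ext) (auto simp: skip_def split: nat.split)

context eha
begin

lemma MD_bexI:
  assumes wf: "wf_fm \<Gamma> (bex_fm \<sigma> t A)" and env: "env (cx w) \<Gamma> \<rho>"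
    and xs: "tys w xs (D_exist A)" and ts: "tys w ts (map TSeq (D_univ A))"
    and z: "mem w \<sigma> z (sub \<rho> t)"
    and main: "\<And>w' ys. ext w w' \<Longrightarrow> mems w' (D_univ A) ys ts \<Longrightarrow> MD w' A (case_nat z \<rho>) xs ys"
  shows "MD w (bex_fm \<sigma> t A) \<rho> xs ts"
  unfolding bex_fm_def
proof (rule MD_ExistsI[OF _ env _ _ mem_ty(1)[OF z]])
  fix w' ys assume w': "ext w w'" and ys: "mems w' (D_univ (And (mem_fm \<sigma> (Var 0) (shift 1 t)) A)) ys ts"
  have "MD w' A (case_nat z \<rho>) xs ys" by (rule main[OF w']) (use ys in simp)
  moreover have "MD w' (mem_fm \<sigma> (Var 0) (shift 1 t)) (case_nat z \<rho>) [] []"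
    using pv_mono[OF z w'] by (simp add: D_matrix_internal)
  ultimately show "MD w' (And (mem_fm \<sigma> (Var 0) (shift 1 t)) A) (case_nat z \<rho>) xs ys"
    by (simp add: D_exist_def pv_AndI)
qed (use wf xs ts in \<open>auto simp: D_exist_def\<close>)

text \<open>A realizer of \<open>St\<close> is a sequence \<open>l\<close> that contains the
  parameter \<open>\<rho> 0\<close> without telling at which place. The realizer for
  \<open>A\<close> is therefore the union of \<open>X[z]\<close> over all \<open>z\<close> in
  \<open>l\<close>, and monotonicity passes from \<open>X[\<rho> 0]\<close> to this union.\<close>

lemma valid_st_Imp:
  assumes wf: "wf_fm (\<sigma> # \<Gamma>) A"
  shows "valid (\<sigma> # \<Gamma>) (Imp (And (fren Suc (ForallSt \<sigma> A)) (St \<sigma> (Var 0))) A)"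
proof (rule valid_ImpI)
  let ?P = "And (fren Suc (ForallSt \<sigma> A)) (St \<sigma> (Var 0))"
  let ?U = "\<lambda>x. map_sappsL [] [\<sigma>] (D_elems A) (butlast x) [] [last x]"
  \<comment> \<open>The bound may not mention the parameter, so every member of \<open>l\<close> is
    offered as an instance of the standard quantifier. The default keeps the sequence nonempty
    before \<open>l\<close> is known to have a member.\<close>
  let ?Y = "\<lambda>x v. (appendC \<sigma> \<cdot> last x \<cdot> single \<sigma> (default_tm \<sigma>)) # singles (D_univ A) v"
  have el: "D_elems (fren Suc (ForallSt \<sigma> A)) = map (sapp_elem [\<sigma>]) (D_elems A)"
    "D_univ (fren Suc (ForallSt \<sigma> A)) = \<sigma> # D_univ A" by (simp_all only: D_fren D_elems.simps D_univ.simps)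
  have ex: "D_exist ?P = map (\<lambda>\<tau>. TSeq (sapp_elem [\<sigma>] \<tau>)) (D_elems A) @ [TSeq \<sigma>]" "D_univ ?P = \<sigma> # D_univ A"
    unfolding D_exist_def D_elems.simps D_univ.simps el by simp_all
  show "wf_fm (\<sigma> # \<Gamma>) (Imp ?P A)" using wf wf_fren_Suc[of \<sigma> \<Gamma> "ForallSt \<sigma> A"] by (simp add: has_type_iff del: fren.simps)
  show "nat_fn (D_exist ?P) (D_exist A) ?U" unfolding ex D_exist_def[of A]
  proof (rule nat_fnI)
    fix G x assume "tyl G x (map (\<lambda>\<tau>. TSeq (sapp_elem [\<sigma>] \<tau>)) (D_elems A) @ [TSeq \<sigma>])"
    then obtain X l where x: "x = X @ [l]" "tyl G X (map (\<lambda>\<tau>. TSeq (sapp_elem [\<sigma>] \<tau>)) (D_elems A))" "typeof l G = Some (TSeq \<sigma>)"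
      by (rule tyl_snocE)
    show "tyl G (?U x) (map TSeq (D_elems A))"
      by (rule tyl_map_sappsL) (use x in simp_all)
  next
    fix G \<theta> x assume "tyl G x (map (\<lambda>\<tau>. TSeq (sapp_elem [\<sigma>] \<tau>)) (D_elems A) @ [TSeq \<sigma>])"
    then obtain X l where "x = X @ [l]" by (rule tyl_snocE)
    then show "map (sub \<theta>) (?U x) = ?U (map (sub \<theta>) x)" unfolding sub_map_sappsL by simp
  qed
  show "nat_fn2 (D_exist ?P) (D_univ A) (map TSeq (D_univ ?P)) ?Y" unfolding ex
  proof (rule nat_fn2I)
    fix G x v assume "tyl G x (map (\<lambda>\<tau>. TSeq (sapp_elem [\<sigma>] \<tau>)) (D_elems A) @ [TSeq \<sigma>])" and v: "tyl G v (D_univ A)"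
    from this(1) obtain X l where x: "x = X @ [l]" "typeof l G = Some (TSeq \<sigma>)" by (rule tyl_snocE)
    then show "tyl G (?Y x v) (map TSeq (\<sigma> # D_univ A))" using tyl_singles[OF v] by simp
  next
    fix G \<theta> x v assume "tyl G x (map (\<lambda>\<tau>. TSeq (sapp_elem [\<sigma>] \<tau>)) (D_elems A) @ [TSeq \<sigma>])"
    then obtain X l where x: "x = X @ [l]" by (rule tyl_snocE)
    then show "map (sub \<theta>) (?Y x v) = ?Y (map (sub \<theta>) x) (map (sub \<theta>) v)" unfolding list.map sub_singles by simp
  qed
  fix w \<rho> x v
  assume env: "env (cx w) (\<sigma> # \<Gamma>) \<rho>" and "tys w x (D_exist ?P)" and v: "tys w v (D_univ A)"
    and h: "\<And>w' ys. ext w w' \<Longrightarrow> mems w' (D_univ ?P) ys (?Y x v) \<Longrightarrow> MD w' ?P \<rho> x ys"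
  from this(2)[unfolded ex] obtain X l where x: "x = X @ [l]" and X: "tys w X (map (\<lambda>\<tau>. TSeq (sapp_elem [\<sigma>] \<tau>)) (D_elems A))"
    and l: "typeof l (cx w) = Some (TSeq \<sigma>)" by (rule tyl_snocE)
  have \<rho>: "case_nat (\<rho> 0) (\<lambda>i. \<rho> (Suc i)) = \<rho>" by (rule HOL.ext) (simp split: nat.split)
  have h': "pv w (And (D_matrix A (case_nat z (\<lambda>i. \<rho> (Suc i))) (map_sapps [\<sigma>] (D_elems A) X [z]) v) (mem_fm \<sigma> (\<rho> 0) l))"
    if z: "mem w \<sigma> z (appendC \<sigma> \<cdot> l \<cdot> single \<sigma> (default_tm \<sigma>))" for z
  proof -
    have "MD w ?P \<rho> (X @ [l]) ((z # v) @ [])"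
      unfolding x[symmetric]
      by (rule h[OF ext_refl]) (use z mems_single[OF v] in \<open>simp only: ex x mems.simps last_snoc append_Nil2\<close>)
    moreover have "length (z # v) = length (D_univ (fren Suc (ForallSt \<sigma> A)))" "length X = length (D_elems (fren Suc (ForallSt \<sigma> A)))"
      unfolding el using tyl_length[OF v] tyl_length[OF X] by simp_all
    ultimately show ?thesis
      by (simp only: D_matrix_And D_matrix_fren D_matrix_ForallSt) simp
  qed
  \<comment> \<open>The assumption is first used at the default, only to learn that
    \<open>\<rho> 0\<close> lies in \<open>l\<close>; this licenses the second use, at
    \<open>\<rho> 0\<close> itself.\<close>
  have "mem w \<sigma> (default_tm \<sigma>) (appendC \<sigma> \<cdot> l \<cdot> single \<sigma> (default_tm \<sigma>))"
    by (rule mem_append_I2[OF mem_single l]) simp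
  from h'[OF this] have m: "mem w \<sigma> (\<rho> 0) l" by (rule pv_AndD2)
  have "mem w \<sigma> (\<rho> 0) (appendC \<sigma> \<cdot> l \<cdot> single \<sigma> (default_tm \<sigma>))"
    by (rule mem_append_I1[OF m]) simp
  from pv_AndD1[OF h'[OF this]] have M: "MD w A \<rho> (map_sapps [\<sigma>] (D_elems A) X [\<rho> 0]) v" unfolding \<rho> .
  have i: "incls w \<tau>s (map_sapps [\<sigma>] \<tau>s X' [\<rho> 0]) (map_sappsL [] [\<sigma>] \<tau>s X' [] [l])" if "length X' = length \<tau>s" for X' \<tau>s
    using that
  proof (induction \<tau>s arbitrary: X')
    case (Cons \<tau> \<tau>s)
    then obtain s ss where s: "X' = s # ss" by (cases X') auto
    have "incl w \<tau> (sappC \<sigma> \<tau> \<cdot> s \<cdot> \<rho> 0) (sappLC \<sigma> \<tau> \<cdot> s \<cdot> l)"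
      by (rule inclI) (rule mem_sappL_I[OF pv_mono[OF m]])
    then show ?case using Cons by (simp add: s)
  qed simp
  have r: "tys w [\<rho> 0] [\<sigma>]" using mem_ty(1)[OF m] by simp
  have t: "tys w (map_sapps [\<sigma>] (D_elems A) X [\<rho> 0]) (D_exist A)"
    unfolding D_exist_def by (rule tyl_map_sapps[OF X r])
  have t': "tys w (map_sappsL [] [\<sigma>] (D_elems A) X [] [l]) (D_exist A)"
    unfolding D_exist_def by (rule tyl_map_sappsL) (use X l in simp_all)
  show "MD w A \<rho> (?U x) v"
    unfolding x butlast_snoc last_snoc by (rule MD_mono[OF wf env M i t t' v]) (use tyl_length[OF X] in simp)
qed

lemma valid_forall_st1:
  assumes wf: "wf_fm (\<sigma> # \<Gamma>) A"
  shows "valid \<Gamma> (Imp (ForallSt \<sigma> A) (Forall \<sigma> (Imp (St \<sigma> (Var 0)) A)))"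
proof (rule valid_forall_rule)
  have "wf_fm (\<sigma> # \<Gamma>) (fren Suc (ForallSt \<sigma> A))" using wf by (subst wf_fren_Suc) simp
  then show "valid (\<sigma> # \<Gamma>) (Imp (fren Suc (ForallSt \<sigma> A)) (Imp (St \<sigma> (Var 0)) A))"
    by (intro valid_exportation[OF valid_st_Imp[OF wf]]) (use wf in \<open>simp add: has_type_iff\<close>)
qed (use wf in \<open>simp add: has_type_iff\<close>)

text \<open>The standardness of \<open>z\<close> is realized by the singleton containing it, so a
  realizer of the guarded formula is turned into the function sending \<open>z\<close> to the value
  at that singleton. \<open>?L\<close> packs this function into a one-element sequence, and
  \<open>sapp_single\<close> unpacks it.\<close>

lemma valid_forall_st2:
  assumes wf: "wf_fm (\<sigma> # \<Gamma>) A"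
  shows "valid \<Gamma> (Imp (Forall \<sigma> (Imp (St \<sigma> (Var 0)) A)) (ForallSt \<sigma> A))"
proof (rule valid_ImpI)
  let ?P = "Forall \<sigma> (Imp (St \<sigma> (Var 0)) A)"
  let ?L = "\<lambda>\<tau> s. single (TFun \<sigma> (TSeq \<tau>)) (Lam \<sigma> (sappC (TSeq \<sigma>) \<tau> \<cdot> ren Suc s \<cdot> single \<sigma> (Var 0)))"
  let ?U = "map2 ?L (D_elems A)"
  let ?Y = "\<lambda>v. single (TSeq \<sigma>) (single \<sigma> (hd v)) # singles (D_univ A) (tl v)"
  let ?tX = "\<lambda>\<tau>s. map (\<lambda>\<tau>. TSeq (sapp_elem [TSeq \<sigma>] \<tau>)) \<tau>s"
  have ex: "D_exist ?P = ?tX (D_elems A)" "D_univ ?P = TSeq \<sigma> # D_univ A"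
    by simp_all
  have tL: "tyl G (map2 ?L \<tau>s x) (map (\<lambda>\<tau>. TSeq (sapp_elem [\<sigma>] \<tau>)) \<tau>s)" if "tyl G x (?tX \<tau>s)" for G x \<tau>s
    using that
  proof (induction \<tau>s arbitrary: x)
    case (Cons \<tau> \<tau>s)
    then show ?case by (cases x) auto
  qed simp
  have sL: "map (sub \<theta>) (map2 ?L \<tau>s x) = map2 ?L \<tau>s (map (sub \<theta>) x)" for \<theta> x \<tau>s
  proof (induction \<tau>s arbitrary: x)
    case (Cons \<tau> \<tau>s)
    then show ?case by (cases x) (auto simp: ren_sub)
  qed simp
  show "nat_fn (D_exist ?P) (D_exist (ForallSt \<sigma> A)) ?U"
    unfolding ex unfolding D_exist_simps by (rule nat_fnI[OF tL sL])
  show "nat_fn2 (D_exist ?P) (D_univ (ForallSt \<sigma> A)) (map TSeq (D_univ ?P)) (\<lambda>_. ?Y)" unfolding ex unfolding D_univ.simps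
  proof (rule nat_fn2I)
    fix G v assume "tyl G v (\<sigma> # D_univ A)"
    then obtain z u where "v = z # u" "typeof z G = Some \<sigma>" "tyl G u (D_univ A)" by (cases v) auto
    then show "tyl G (?Y v) (map TSeq (TSeq \<sigma> # D_univ A))" using tyl_singles[of G u "D_univ A"] by simp
  next
    fix G \<theta> v assume "tyl G v (\<sigma> # D_univ A)"
    then obtain z u where v: "v = z # u" by (cases v) auto
    then show "map (sub \<theta>) (?Y v) = ?Y (map (sub \<theta>) v)" unfolding list.map sub_singles by simp
  qed
  fix w \<rho> X v
  assume env: "env (cx w) \<Gamma> \<rho>" and X: "tys w X (D_exist ?P)" and "tys w v (D_univ (ForallSt \<sigma> A))"
    and h: "\<And>w' ys. ext w w' \<Longrightarrow> mems w' (D_univ ?P) ys (?Y v) \<Longrightarrow> MD w' ?P \<rho> X ys"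
  then obtain z u where v: "v = z # u" and z: "typeof z (cx w) = Some \<sigma>" and u: "tys w u (D_univ A)" by (cases v) auto
  let ?z = "single \<sigma> z"
  note X' = X[unfolded ex]
  have "MD w ?P \<rho> X (?z # u)"
    by (rule h[OF ext_refl]) (use mems_single[OF u] z in \<open>simp add: v mem_single\<close>)
  then have "MD w (Imp (St \<sigma> (Var 0)) A) (case_nat z \<rho>) (X @ []) ([?z] @ u)"
    using MD_ForallD[of w \<sigma> "Imp (St \<sigma> (Var 0)) A" \<rho> X "?z # u" z] tyl_length[OF X'] tyl_length[OF u] z
    by (simp del: D_matrix.simps)
  then have M: "MD w A (case_nat z \<rho>) (map_sapps (D_exist (St \<sigma> (Var 0))) (D_elems A) X [?z]) u"
  proof (rule MD_ImpD[OF _ _ env_case_nat[OF env z]])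
    fix w' ys assume "ext w w'"
      "mems w' (D_univ (St \<sigma> (Var 0))) ys (map_sapps (D_exist (St \<sigma> (Var 0)) @ D_univ A) (D_univ (St \<sigma> (Var 0))) [] ([?z] @ u))"
    then show "MD w' (St \<sigma> (Var 0)) (case_nat z \<rho>) [?z] ys"
      using mem_single[OF ty_mono[OF z]] by simp
  qed (use wf z X' u in \<open>simp_all add: has_type_iff\<close>)
  have e: "eqvs w (map TSeq \<tau>s) (map_sapps [TSeq \<sigma>] \<tau>s X [?z]) (map_sapps [\<sigma>] \<tau>s (map2 ?L \<tau>s X) [z])"
    if "tys w X (?tX \<tau>s)" for X \<tau>s
    using that
  proof (induction \<tau>s arbitrary: X)
    case (Cons \<tau> \<tau>s)
    then obtain s ss where s: "X = s # ss" "typeof s (cx w) = Some (TSeq (TFun (TSeq \<sigma>) (TSeq \<tau>)))" "tys w ss (?tX \<tau>s)"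
      by (cases X) auto
    let ?b = "sappC (TSeq \<sigma>) \<tau> \<cdot> ren Suc s \<cdot> single \<sigma> (Var 0)"
    have "eqv w (TSeq \<tau>) (sappC \<sigma> \<tau> \<cdot> ?L \<tau> s \<cdot> z) (Lam \<sigma> ?b \<cdot> z)"
      by (rule sapp_single[OF _ z]) (use s in simp)
    also have "eqv w (TSeq \<tau>) \<dots> (sappC (TSeq \<sigma>) \<tau> \<cdot> s \<cdot> ?z)"
      using eqv_beta[of ?b \<sigma> w "TSeq \<tau>" z] s z by simp
    finally show ?case using Cons.IH[OF s(3)] by (simp add: s(1) eqv_sym)
  qed simp
  have "MD w A (case_nat z \<rho>) (map_sapps [\<sigma>] (D_elems A) (?U X) [z]) u"
    by (rule MD_cong_x[OF wf env_case_nat[OF env z] M _ u]) (use e[OF X'] in \<open>simp add: D_exist_def\<close>)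
  then show "MD w (ForallSt \<sigma> A) \<rho> (?U X) v" unfolding v D_matrix_ForallSt .
qed (use wf in \<open>simp add: has_type_iff\<close>)

lemma nat_fn2_snd: "nat_fn2 \<sigma>s \<tau>s \<tau>s (\<lambda>_ v. v)"
  by (rule nat_fn2I) auto

text \<open>Both formulas carry a sequence of candidate witnesses: it comes last in the tuple for
  \<open>ExistsSt\<close>, and first, as the realizer of \<open>St\<close>, in the tuple for
  \<open>Exists\<close>. The tuple is merely rotated.\<close>

lemma valid_exists_st1:
  assumes wf: "wf_fm (\<sigma> # \<Gamma>) A"
  shows "valid \<Gamma> (Imp (ExistsSt \<sigma> A) (Exists \<sigma> (And (St \<sigma> (Var 0)) A)))"
proof (rule valid_ImpI)
  let ?Q = "Exists \<sigma> (And (St \<sigma> (Var 0)) A)"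
  show wf': "wf_fm \<Gamma> (Imp (ExistsSt \<sigma> A) ?Q)" using wf by (simp add: has_type_iff)
  show "nat_fn (D_exist (ExistsSt \<sigma> A)) (D_exist ?Q) (\<lambda>x. last x # butlast x)"
    unfolding D_exist_simps by (rule nat_fnI; erule tyl_snocE) auto
  show "nat_fn2 (D_exist (ExistsSt \<sigma> A)) (D_univ ?Q) (map TSeq (D_univ (ExistsSt \<sigma> A))) (\<lambda>_. singles (map TSeq (D_univ A)))"
    using nat_fn2_singles[of _ "map TSeq (D_univ A)"] by simp
  fix w \<rho> x v
  assume env: "env (cx w) \<Gamma> \<rho>" and x: "tys w x (D_exist (ExistsSt \<sigma> A))" and v: "tys w v (D_univ ?Q)"
    and h: "\<And>w' ys. ext w w' \<Longrightarrow> mems w' (D_univ (ExistsSt \<sigma> A)) ys (singles (map TSeq (D_univ A)) v) \<Longrightarrow> MD w' (ExistsSt \<sigma> A) \<rho> x ys"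
  from x[unfolded D_exist_simps] obtain xs l where x: "x = xs @ [l]" and xs: "tys w xs (D_exist A)" and l: "typeof l (cx w) = Some (TSeq \<sigma>)"
    by (rule tyl_snocE)
  have v': "tys w v (map TSeq (D_univ A))" using v by simp
  note len = tyl_length[OF xs] tyl_length[OF v']
  have lx: "tys w (l # xs) (D_exist ?Q)" using l xs by simp
  have E: "MD w (ExistsSt \<sigma> A) \<rho> (xs @ [l]) v"
    unfolding x[symmetric] by (rule h[OF ext_refl]) (use mems_single[OF v'] in simp)
  have "MD w ?Q \<rho> (l # xs) v"
  proof (rule MD_ExistsStE[OF E _ _ MD_wf[OF _ env lx v]])
    fix w' z assume w': "ext w w'" and z: "mem w' \<sigma> z l"
      and A: "\<And>w'' ys. ext w' w'' \<Longrightarrow> mems w'' (D_univ A) ys v \<Longrightarrow> MD w'' A (case_nat z \<rho>) xs ys"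
    show "MD w' ?Q \<rho> (l # xs) v"
    proof (rule MD_ExistsI[OF _ env_mono[OF env w'] _ _ mem_ty(1)[OF z]])
      show "tys w' (l # xs) (D_exist (And (St \<sigma> (Var 0)) A))" using tys_mono[OF lx w'] by simp
      fix w'' ys assume w'': "ext w' w''" and ys: "mems w'' (D_univ (And (St \<sigma> (Var 0)) A)) ys v"
      then show "MD w'' (And (St \<sigma> (Var 0)) A) (case_nat z \<rho>) (l # xs) ys"
        using A[OF w'', of ys] pv_mono[OF z w''] by (auto simp: Let_def intro: pv_AndI)
    qed (use wf' tys_mono[OF v w'] in auto)
  qed (use len wf' in auto)
  then show "MD w ?Q \<rho> (last x # butlast x) v" by (simp add: x del: D_matrix.simps)
qed

lemma valid_exists_st2:
  assumes wf: "wf_fm (\<sigma> # \<Gamma>) A"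
  shows "valid \<Gamma> (Imp (Exists \<sigma> (And (St \<sigma> (Var 0)) A)) (ExistsSt \<sigma> A))"
proof (rule valid_ImpI)
  let ?P = "Exists \<sigma> (And (St \<sigma> (Var 0)) A)"
  \<comment> \<open>Appending these defaults gives every sequence a member, without which the
    membership of the witness in the candidate sequence could not be extracted from the
    assumption.\<close>
  let ?d = "singles (D_univ A) (defaults (D_univ A))"
  let ?Y = "\<lambda>v. singles (map TSeq (D_univ A)) (appends (D_univ A) v ?d)"
  have ex: "D_exist ?P = TSeq \<sigma> # D_exist A" "D_univ ?P = map TSeq (D_univ A)" by simp_all
  show wf': "wf_fm \<Gamma> (Imp ?P (ExistsSt \<sigma> A))" using wf by (simp add: has_type_iff)
  have td: "tyl G ?d (map TSeq (D_univ A))" for G by (rule tyl_singles) simp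
  show "nat_fn (D_exist ?P) (D_exist (ExistsSt \<sigma> A)) (\<lambda>x. tl x @ [hd x])"
  proof (rule nat_fnI)
    fix G x assume "tyl G x (D_exist ?P)"
    then show "tyl G (tl x @ [hd x]) (D_exist (ExistsSt \<sigma> A))" by (cases x) auto
  next
    fix G \<theta> x assume "tyl G x (D_exist ?P)"
    then show "map (sub \<theta>) (tl x @ [hd x]) = tl (map (sub \<theta>) x) @ [hd (map (sub \<theta>) x)]" by (cases x) auto
  qed
  show "nat_fn2 (D_exist ?P) (D_univ (ExistsSt \<sigma> A)) (map TSeq (D_univ ?P)) (\<lambda>_. ?Y)" unfolding ex D_univ.simps append_Nil
    by (rule nat_fn2I) (simp_all only: tyl_singles tyl_appends td sub_singles sub_appends sub_defaults)
  fix w \<rho> x v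
  assume env: "env (cx w) \<Gamma> \<rho>" and "tys w x (D_exist ?P)" and "tys w v (D_univ (ExistsSt \<sigma> A))"
    and h: "\<And>w' ys. ext w w' \<Longrightarrow> mems w' (D_univ ?P) ys (?Y v) \<Longrightarrow> MD w' ?P \<rho> x ys"
  from this(2,3) obtain l xs where x: "x = l # xs" and l: "typeof l (cx w) = Some (TSeq \<sigma>)" and xs: "tys w xs (D_exist A)"
    and v: "tys w v (map TSeq (D_univ A))" by (cases x) auto
  let ?ts = "appends (D_univ A) v ?d"
  have ts: "tys w ?ts (map TSeq (D_univ A))" by (rule tyl_appends[OF v td])
  have E: "MD w ?P \<rho> x ?ts" by (rule h[OF ext_refl]) (use mems_single[OF ts] in simp)
  have xl: "tys w (xs @ [l]) (D_exist (ExistsSt \<sigma> A))" using xs l by simp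
  have v': "tys w v (D_univ (ExistsSt \<sigma> A))" using v by simp
  have "MD w (ExistsSt \<sigma> A) \<rho> (xs @ [l]) v"
  proof (rule MD_ExistsE[OF E _ _ MD_wf[OF _ env xl v']])
    fix w' z assume w': "ext w w'" and z: "typeof z (cx w') = Some \<sigma>"
      and A: "\<And>w'' ys. ext w' w'' \<Longrightarrow> mems w'' (D_univ (And (St \<sigma> (Var 0)) A)) ys ?ts \<Longrightarrow>
        MD w'' (And (St \<sigma> (Var 0)) A) (case_nat z \<rho>) x ys"
    have A': "mem w'' \<sigma> z l" "MD w'' A (case_nat z \<rho>) xs ys" if "ext w' w''" "mems w'' (D_univ A) ys ?ts" for w'' ys
      using A[OF that(1), of ys] that(2) by (auto simp: x Let_def dest: pv_AndD1 pv_AndD2)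
    have "mem w' \<sigma> z l"
      by (rule A'(1)[OF ext_refl mems_appends2[OF mems_defaults tys_mono[OF v w']]])
    then show "MD w' (ExistsSt \<sigma> A) \<rho> (xs @ [l]) v"
      by (rule MD_ExistsStI[OF wf env_mono[OF env w'] tys_mono[OF xs w'] tys_mono[OF v w']])
        (rule A'(2)[OF _ mems_appends1[OF _ td]])
  qed (use tyl_length[OF xs] tyl_length[OF ts] wf' in \<open>auto simp: x\<close>)
  then show "MD w (ExistsSt \<sigma> A) \<rho> (tl x @ [hd x]) v" by (simp only: x list.sel)
qed

section \<open>Closure of standardness under equality, closed terms and application\<close>

lemma nat_fn2_Nil: "nat_fn2 \<sigma>s \<tau>s [] (\<lambda>_ _. [])"
  by (rule nat_fn2I) auto

lemma valid_st_eq: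
  assumes "typeof s \<Gamma> = Some \<sigma>" "typeof t \<Gamma> = Some \<sigma>"
  shows "valid \<Gamma> (Imp (And (St \<sigma> s) (Eq \<sigma> s t)) (St \<sigma> t))"
proof (rule valid_ImpI)
  show "nat_fn (D_exist (And (St \<sigma> s) (Eq \<sigma> s t))) (D_exist (St \<sigma> t)) (\<lambda>x. x)"
    using nat_fn_id by simp
  show "nat_fn2 (D_exist (And (St \<sigma> s) (Eq \<sigma> s t))) (D_univ (St \<sigma> t)) (map TSeq (D_univ (And (St \<sigma> s) (Eq \<sigma> s t)))) (\<lambda>_ _. [])"
    using nat_fn2_Nil by simp
  fix w \<rho> x v
  assume "tys w x (D_exist (And (St \<sigma> s) (Eq \<sigma> s t)))"
    and h: "\<And>w' ys. ext w w' \<Longrightarrow> mems w' (D_univ (And (St \<sigma> s) (Eq \<sigma> s t))) ys [] \<Longrightarrow> MD w' (And (St \<sigma> s) (Eq \<sigma> s t)) \<rho> x ys"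
  then obtain l where x: "x = [l]" by (auto simp: map_eq_Cons_conv)
  have "pv w (And (mem_fm \<sigma> (sub \<rho> s) l) (Eq \<sigma> (sub \<rho> s) (sub \<rho> t)))"
    using h[of w "[]"] by (simp add: x Let_def D_exist_def)
  from pv_AndD1[OF this] pv_AndD2[OF this] show "MD w (St \<sigma> t) \<rho> x v"
    using mem_cong[of w \<sigma> "sub \<rho> s" l "sub \<rho> t" l] mem_ty(2)[of w \<sigma> "sub \<rho> s" l] by (simp add: x eqv_def[symmetric] eqv_refl)
qed (use assms in \<open>simp add: has_type_iff\<close>)

lemma valid_st_closed: "typeof t [] = Some \<sigma> \<Longrightarrow> valid \<Gamma> (St \<sigma> t)"
  by (rule validI[of "[single \<sigma> t]"]) (auto simp: sub_closed intro!: mem_single typeof_closed)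

text \<open>The realizers \<open>l1\<close> and \<open>l2\<close> contain the function and the
  argument at unknown places. The union, over all members of both sequences, of the singletons of
  their applications contains the value; \<open>sappsL\<close> forms it from a doubly abstracted
  singleton.\<close>

lemma valid_st_app:
  assumes "typeof f \<Gamma> = Some (TFun \<sigma> \<tau>)" "typeof t \<Gamma> = Some \<sigma>"
  shows "valid \<Gamma> (Imp (And (St (TFun \<sigma> \<tau>) f) (St \<sigma> t)) (St \<tau> (f \<cdot> t)))"
proof (rule valid_ImpI)
  let ?P = "And (St (TFun \<sigma> \<tau>) f) (St \<sigma> t)"
  let ?\<sigma>s = "[TFun \<sigma> \<tau>, \<sigma>]"
  let ?S = "slam ?\<sigma>s \<tau> (single \<tau> (Var 1 \<cdot> Var 0))"
  have S: "typeof ?S \<Gamma> = Some (TSeq (sapp_elem ?\<sigma>s \<tau>))" for \<Gamma>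
    by (rule typeof_slam) simp
  note sS = sub_closed[OF S]
  show "nat_fn (D_exist ?P) (D_exist (St \<tau> (f \<cdot> t))) (\<lambda>x. [sappsL ?\<sigma>s \<tau> ?S x])"
  proof (rule nat_fnI)
    fix G x assume x: "tyl G x (D_exist ?P)"
    have "typeof (sappsL ?\<sigma>s \<tau> ?S x) G = Some (TSeq \<tau>)"
      by (rule typeof_sappsL[OF S]) (use x in simp)
    then show "tyl G [sappsL ?\<sigma>s \<tau> ?S x] (D_exist (St \<tau> (f \<cdot> t)))" by simp
  qed (simp only: list.map sub_sappsL sS)
  show "nat_fn2 (D_exist ?P) (D_univ (St \<tau> (f \<cdot> t))) (map TSeq (D_univ ?P)) (\<lambda>_ _. [])"
    using nat_fn2_Nil by simp
  fix w \<rho> x v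
  assume env: "env (cx w) \<Gamma> \<rho>" and "tys w x (D_exist ?P)" and h: "\<And>w' ys. ext w w' \<Longrightarrow> mems w' (D_univ ?P) ys [] \<Longrightarrow> MD w' ?P \<rho> x ys"
  then obtain l1 l2 where x: "x = [l1, l2]" by (auto simp: map_eq_Cons_conv)
  have p: "pv w (And (mem_fm (TFun \<sigma> \<tau>) (sub \<rho> f) l1) (mem_fm \<sigma> (sub \<rho> t) l2))"
    using h[of w "[]"] by (simp add: x Let_def D_exist_def)
  note m = pv_AndD1[OF p] pv_AndD2[OF p]
  let ?vs = "[sub \<rho> f, sub \<rho> t]"
  have "eqv w (TSeq \<tau>) (sapps ?\<sigma>s \<tau> (sub Var ?S) ?vs) (sub (envl ?vs Var) (single \<tau> (Var 1 \<cdot> Var 0)))"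
    by (rule sapps_slam) (use S m[THEN mem_ty(1)] in simp_all)
  then have e: "eqv w (TSeq \<tau>) (sapps ?\<sigma>s \<tau> ?S ?vs) (single \<tau> (sub \<rho> f \<cdot> sub \<rho> t))"
    by (simp only: sub_Var) simp
  have "mem w \<tau> (sub \<rho> f \<cdot> sub \<rho> t) (sapps ?\<sigma>s \<tau> ?S ?vs)"
    by (rule mem_cong2[OF mem_single eqv_sym[OF e]]) (use m[THEN mem_ty(1)] in simp)
  then have "mem w \<tau> (sub \<rho> f \<cdot> sub \<rho> t) (sappsL ?\<sigma>s \<tau> ?S x)"
    by (rule mem_sappsL[rotated, OF _ S]) (use m in \<open>simp add: x\<close>)
  then show "MD w (St \<tau> (f \<cdot> t)) \<rho> [sappsL ?\<sigma>s \<tau> ?S x] v" by simp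
qed (use assms in \<open>simp add: has_type_iff\<close>)

section \<open>Soundness of the nonstandard principles\<close>

text \<open>The clause for \<open>Exists\<close> turns the standard quantifier behind it into one
  bounded by a finite sequence \<open>X\<close>, so the conclusion asks for exactly what the premise
  provides at \<open>X\<close>. The bound is the singleton of \<open>X\<close>, and there is nothing
  else to realize.\<close>

lemma valid_idealization:
  assumes "wf_int (\<sigma> # \<tau> # \<Gamma>) A"
  shows "valid \<Gamma> (Imp (ForallSt (TSeq \<sigma>) (Exists \<tau> (ball_fm \<sigma> (Var 1) (fren (skip 2) A)))) (Exists \<tau> (ForallSt \<sigma> A)))"
proof (rule valid_ImpI)
  let ?R = "Exists \<tau> (ball_fm \<sigma> (Var 1) (fren (skip 2) A))"
  let ?P = "ForallSt (TSeq \<sigma>) ?R" and ?Q = "Exists \<tau> (ForallSt \<sigma> A)"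
  have A: "wf_fm (\<sigma> # \<tau> # \<Gamma>) A" "internal A" using assms by (auto simp: wf_int_def)
  have R: "internal ?R" using A by simp
  note D = D_internal[OF A(2)] D_internal[OF R]
  have ex: "D_exist ?P = []" "D_univ ?P = [TSeq \<sigma>]" "D_exist ?Q = []" "D_univ ?Q = [TSeq \<sigma>]"
    unfolding D_exist_def D_elems.simps(9) D_univ.simps(9) D by (simp_all add: D)
  show wf: "wf_fm \<Gamma> (Imp ?P ?Q)" using A by simp
  show "nat_fn (D_exist ?P) (D_exist ?Q) (\<lambda>_. [])" unfolding ex by (rule nat_fnI) simp_all
  show "nat_fn2 (D_exist ?P) (D_univ ?Q) (map TSeq (D_univ ?P)) (\<lambda>_. singles [TSeq \<sigma>])"
    unfolding ex by (rule nat_fn2_singles)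
  fix w \<rho> x v
  assume env: "env (cx w) \<Gamma> \<rho>" and x: "tys w x (D_exist ?P)" and v: "tys w v (D_univ ?Q)"
    and h: "\<And>w' ys. ext w w' \<Longrightarrow> mems w' (D_univ ?P) ys (singles [TSeq \<sigma>] v) \<Longrightarrow> MD w' ?P \<rho> x ys"
  from v[unfolded ex] obtain X where X: "v = [X]" "typeof X (cx w) = Some (TSeq \<sigma>)" by (cases v) auto
  have "MD w ?P \<rho> x [X]" by (rule h[OF ext_refl]) (unfold ex, use X in \<open>simp add: mem_single\<close>)
  then have "pv w (fsub (case_nat X \<rho>) ?R)" unfolding D_matrix_ForallSt D_matrix_internal[OF R] .
  moreover have "(\<lambda>i. up (up (case_nat X \<rho>)) (skip 2 i)) = up (up \<rho>)"
    by (rule HOL.ext) (auto simp: skip_def up_def numeral_2_eq_2 split: nat.split)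
  ultimately have E: "pv w (Exists \<tau> (ball_fm \<sigma> (ren Suc X) (fsub (up (up \<rho>)) A)))" by simp
  have "MD w ?Q \<rho> [] v"
  proof (rule pv_ExistsE[OF E MD_wf[OF _ env _ v]])
    fix w' y assume w': "ext w w'" and y: "typeof y (cx w') = Some \<tau>"
      and "pv w' (fsub (inst y) (ball_fm \<sigma> (ren Suc X) (fsub (up (up \<rho>)) A)))"
    moreover have "(\<lambda>i. sub (up (inst y)) (up (up \<rho>) i)) = up (case_nat y \<rho>)"
      unfolding sub_up_up by simp
    ultimately have b: "pv w' (ball_fm \<sigma> X (fsub (up (case_nat y \<rho>)) A))" by simp
    show "MD w' ?Q \<rho> [] v"
    proof (rule MD_ExistsI[OF _ env_mono[OF env w'] _ _ y])
      show "wf_fm (\<tau> # \<Gamma>) (ForallSt \<sigma> A)" using A by simp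
      show "tys w' [] (D_exist (ForallSt \<sigma> A))" by (simp add: D)
      show "tys w' v (map TSeq (D_univ (ForallSt \<sigma> A)))" using tys_mono[OF v w'] by simp
      fix w'' ys assume w'': "ext w' w''" and ys: "mems w'' (D_univ (ForallSt \<sigma> A)) ys v"
      then obtain z where z: "ys = [z]" "mem w'' \<sigma> z X"
        using mems_length[OF ys] by (auto simp: X D length_Suc_conv)
      have "pv w'' (fsub (inst z) (fsub (up (case_nat y \<rho>)) A))"
        by (rule ballD[OF pv_mono[OF b w''] z(2)])
      then show "MD w'' (ForallSt \<sigma> A) (case_nat y \<rho>) [] ys"
        unfolding z D_matrix_ForallSt D_matrix_internal[OF A(2)] by simp
    qed
  qed (use A ex in auto)
  then show "MD w ?Q \<rho> [] v" .
qed

text \<open>In the premise the clause for \<open>Forall\<close> already makes the sequence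
  \<open>l\<close> of candidates independent of \<open>y\<close>. So \<open>l\<close> itself is the
  standard object sought, and the conclusion is realized by the singleton containing it.\<close>

lemma valid_NCR:
  assumes wf: "wf_fm (\<sigma> # \<tau> # \<Gamma>) A"
  shows "valid \<Gamma> (Imp (Forall \<tau> (ExistsSt \<sigma> A))
    (ExistsSt (TSeq \<sigma>) (Forall \<tau> (bex_fm \<sigma> (Var 1) (fren (skip 2) A)))))"
proof (rule valid_ImpI)
  let ?P = "Forall \<tau> (ExistsSt \<sigma> A)" and ?b = "bex_fm \<sigma> (Var 1) (fren (skip 2) A)"
  let ?B = "Forall \<tau> ?b" let ?Q = "ExistsSt (TSeq \<sigma>) ?B"
  have wfb: "wf_fm (\<tau> # TSeq \<sigma> # \<Gamma>) ?b" using wf by simp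
  show "wf_fm \<Gamma> (Imp ?P ?Q)" using wf by simp
  show "nat_fn (D_exist ?P) (D_exist ?Q) (\<lambda>x. butlast x @ [single (TSeq \<sigma>) (last x)])"
    unfolding D_exist_simps D_bex_fm by (rule nat_fnI; erule tyl_snocE) simp_all
  show "nat_fn2 (D_exist ?P) (D_univ ?Q) (map TSeq (D_univ ?P)) (\<lambda>_ v. v)"
    using nat_fn2_snd by simp
  fix w \<rho> x v
  assume env: "env (cx w) \<Gamma> \<rho>" and "tys w x (D_exist ?P)" and v: "tys w v (D_univ ?Q)"
    and h: "\<And>w' ys. ext w w' \<Longrightarrow> mems w' (D_univ ?P) ys v \<Longrightarrow> MD w' ?P \<rho> x ys"
  from this(2)[unfolded D_exist_simps] obtain xs l where x: "x = xs @ [l]" and xs: "tys w xs (D_exist A)" and l: "typeof l (cx w) = Some (TSeq \<sigma>)"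
    by (rule tyl_snocE)
  have "MD w ?Q \<rho> (xs @ [single (TSeq \<sigma>) l]) v"
  proof (rule MD_ExistsStI[OF _ env _ _ mem_single[OF l]])
    fix w1 ys assume w1: "ext w w1" and ys: "mems w1 (D_univ ?B) ys v"
    have ys': "tys w1 ys (map TSeq (D_univ A))" using mems_tys[OF ys] by simp
    note env1 = env_mono[OF env w1] and xs1 = tys_mono[OF xs w1] and l1 = ty_mono[OF l w1]
    show "MD w1 ?B (case_nat l \<rho>) xs ys"
    proof (rule MD_ForallI[OF wfb env_case_nat[OF env1 l1]])
      fix w2 y assume w2: "ext w1 w2" and y: "typeof y (cx w2) = Some \<tau>"
      note xs2 = tys_mono[OF xs1 w2] and ys2 = tys_mono[OF ys' w2] and env2 = env_mono[OF env_case_nat[OF env1 l1] w2]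
      have "MD w2 ?P \<rho> (xs @ [l]) ys"
        unfolding x[symmetric] by (rule h[OF ext_trans[OF w1 w2]]) (use mems_mono[OF ys w2] in simp)
      then have E: "MD w2 (ExistsSt \<sigma> A) (case_nat y \<rho>) (xs @ [l]) ys"
        by (rule MD_ForallD[OF _ y]) (use tyl_length[OF xs] tyl_length[OF ys'] in simp_all)
      show "MD w2 ?b (case_nat y (case_nat l \<rho>)) xs ys"
      proof (rule MD_ExistsStE[OF E _ _ MD_wf[OF wfb env_case_nat[OF env2 y]]])
        fix w3 z assume w3: "ext w2 w3" and z: "mem w3 \<sigma> z l"
          and A: "\<And>w' ys'. ext w3 w' \<Longrightarrow> mems w' (D_univ A) ys' ys \<Longrightarrow> MD w' A (case_nat z (case_nat y \<rho>)) xs ys'"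
        show "MD w3 ?b (case_nat y (case_nat l \<rho>)) xs ys"
        proof (rule MD_bexI[OF wfb env_mono[OF env_case_nat[OF env2 y] w3]])
          fix w4 ys4 assume "ext w3 w4" "mems w4 (D_univ (fren (skip 2) A)) ys4 ys"
          then show "MD w4 (fren (skip 2) A) (case_nat z (case_nat y (case_nat l \<rho>))) xs ys4"
            using A by (simp add: D_matrix_fren env_skip2)
        qed (use z tys_mono[OF xs2 w3] tys_mono[OF ys2 w3] in simp_all)
      qed (use tyl_length[OF xs] tyl_length[OF ys'] xs2 ys2 in simp_all)
    qed (use xs1 ys' in simp_all)
  qed (use wf xs v in simp_all)
  then show "MD w ?Q \<rho> (butlast x @ [single (TSeq \<sigma>) (last x)]) v" by (simp only: x butlast_snoc last_snoc)
qed

text \<open>The realizer \<open>Z\<close> of the premise is a sequence of functions, and its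
  application to \<open>z\<close> collects the candidates for \<open>z\<close>. The function
  \<open>?F Z\<close>, which maps \<open>z\<close> to \<open>Z[z]\<close>, is the
  finite-sequence-valued choice function that the principle asks for.\<close>

lemma valid_HAC:
  assumes wf: "wf_fm (\<tau> # \<sigma> # \<Gamma>) A"
  shows "valid \<Gamma> (Imp (ForallSt \<sigma> (ExistsSt \<tau> A))
    (ExistsSt (TFun \<sigma> (TSeq \<tau>)) (ForallSt \<sigma> (bex_fm \<tau> (Var 1 \<cdot> Var 0) (fren (skip 2) A)))))"
proof (rule valid_ImpI)
  let ?\<phi> = "TFun \<sigma> (TSeq \<tau>)"
  let ?P = "ForallSt \<sigma> (ExistsSt \<tau> A)" and ?b = "bex_fm \<tau> (Var 1 \<cdot> Var 0) (fren (skip 2) A)"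
  let ?B = "ForallSt \<sigma> ?b" let ?Q = "ExistsSt ?\<phi> ?B"
  let ?F = "\<lambda>Z. Lam \<sigma> (sappC \<sigma> \<tau> \<cdot> ren Suc Z \<cdot> Var 0)"
  let ?tW = "map (\<lambda>\<tau>. TSeq (sapp_elem [\<sigma>] \<tau>)) (D_elems A)"
  have wfb: "wf_fm (\<sigma> # ?\<phi> # \<Gamma>) ?b" using wf by simp
  have ex: "D_exist ?P = ?tW @ [TSeq ?\<phi>]" "D_exist ?Q = ?tW @ [TSeq ?\<phi>]" "D_exist ?B = ?tW"
    "D_univ ?P = \<sigma> # map TSeq (D_univ A)" "D_univ ?B = \<sigma> # map TSeq (D_univ A)" "D_univ ?Q = map TSeq (\<sigma> # map TSeq (D_univ A))"
    by simp_all
  show "wf_fm \<Gamma> (Imp ?P ?Q)" using wf by simp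
  show "nat_fn (D_exist ?P) (D_exist ?Q) (\<lambda>x. butlast x @ [single ?\<phi> (?F (last x))])"
    unfolding ex by (rule nat_fnI; erule tyl_snocE) (simp_all add: ren_sub)
  show "nat_fn2 (D_exist ?P) (D_univ ?Q) (map TSeq (D_univ ?P)) (\<lambda>_ v. v)"
    unfolding ex by (rule nat_fn2_snd)
  fix w \<rho> x v
  assume env: "env (cx w) \<Gamma> \<rho>" and "tys w x (D_exist ?P)" and v: "tys w v (D_univ ?Q)"
    and h: "\<And>w' ys. ext w w' \<Longrightarrow> mems w' (D_univ ?P) ys v \<Longrightarrow> MD w' ?P \<rho> x ys"
  from this(2)[unfolded ex] obtain W Z where x: "x = W @ [Z]" and W: "tys w W ?tW" and Z: "typeof Z (cx w) = Some (TSeq ?\<phi>)"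
    by (rule tyl_snocE)
  have F: "typeof (?F Z) (cx w) = Some ?\<phi>" using Z by simp
  have "MD w ?Q \<rho> (W @ [single ?\<phi> (?F Z)]) v"
  proof (rule MD_ExistsStI[OF _ env _ _ mem_single[OF F]])
    fix w1 ys assume w1: "ext w w1" and ys: "mems w1 (D_univ ?B) ys v"
    from mems_tys[OF ys] obtain z us where y: "ys = z # us" and z: "typeof z (cx w1) = Some \<sigma>" and us: "tys w1 us (map TSeq (D_univ A))"
      by (cases ys) auto
    note env1 = env_case_nat[OF env_case_nat[OF env_mono[OF env w1] ty_mono[OF F w1]] z]
      and W1 = tys_mono[OF W w1] and Z1 = ty_mono[OF Z w1]
    let ?W = "map_sapps [\<sigma>] (D_elems A) W [z]"
    have tz: "tys w1 [z] [\<sigma>]" using z by simp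
    have W': "tys w1 ?W (D_exist A)"
      unfolding D_exist_def by (rule tyl_map_sapps[OF W1 tz])
    have "MD w1 ?P \<rho> x ys" by (rule h[OF w1]) (use ys in simp)
    then have E: "MD w1 (ExistsSt \<tau> A) (case_nat z \<rho>) (?W @ [sappC \<sigma> \<tau> \<cdot> Z \<cdot> z]) us"
      unfolding y D_matrix_ForallSt x using tyl_length[OF W] by (simp del: D_matrix.simps)
    have "MD w1 ?b (case_nat z (case_nat (?F Z) \<rho>)) ?W us"
    proof (rule MD_ExistsStE[OF E _ _ MD_wf[OF wfb env1]])
      fix w2 u assume w2: "ext w1 w2" and u: "mem w2 \<tau> u (sappC \<sigma> \<tau> \<cdot> Z \<cdot> z)"
        and A: "\<And>w' ys'. ext w2 w' \<Longrightarrow> mems w' (D_univ A) ys' us \<Longrightarrow> MD w' A (case_nat u (case_nat z \<rho>)) ?W ys'"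
      have "eqv w2 (TSeq \<tau>) (?F Z \<cdot> z) (sappC \<sigma> \<tau> \<cdot> Z \<cdot> z)"
        using eqv_beta[of "sappC \<sigma> \<tau> \<cdot> ren Suc Z \<cdot> Var 0" \<sigma> w2 "TSeq \<tau>" z] ty_mono[OF Z1 w2] ty_mono[OF z w2] by simp
      from mem_cong2[OF u eqv_sym[OF this]] have m: "mem w2 \<tau> u (?F Z \<cdot> z)" .
      show "MD w2 ?b (case_nat z (case_nat (?F Z) \<rho>)) ?W us"
      proof (rule MD_bexI[OF wfb env_mono[OF env1 w2]])
        show "mem w2 \<tau> u (sub (case_nat z (case_nat (?F Z) \<rho>)) (Var 1 \<cdot> Var 0))" using m by simp
        fix w3 ys3 assume "ext w2 w3" "mems w3 (D_univ (fren (skip 2) A)) ys3 us"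
        then show "MD w3 (fren (skip 2) A) (case_nat u (case_nat z (case_nat (?F Z) \<rho>))) ?W ys3"
          using A by (simp add: D_matrix_fren env_skip2)
      next
        show "tys w2 ?W (D_exist (fren (skip 2) A))" using tys_mono[OF W' w2] unfolding D_exist_simps .
        show "tys w2 us (map TSeq (D_univ (fren (skip 2) A)))" using tys_mono[OF us w2] by simp
      qed
    next
      show "tys w1 ?W (D_exist ?b)" using W' unfolding D_bex_fm D_exist_simps .
      show "tys w1 us (D_univ ?b)" using us by simp
    qed (use tyl_length[OF W] tyl_length[OF us] in simp_all)
    then show "MD w1 ?B (case_nat (?F Z) \<rho>) W ys"
      unfolding y D_matrix_ForallSt by (simp only: D_bex_fm D_fren)
  qed (use wf W v in simp_all)
  then show "MD w ?Q \<rho> (butlast x @ [single ?\<phi> (?F (last x))]) v" by (simp only: x butlast_snoc last_snoc)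
qed

lemma map_sapps_Nil: "length ss = length \<tau>s \<Longrightarrow> map_sapps [] \<tau>s ss [] = ss"
proof (induction \<tau>s arbitrary: ss)
  case (Cons \<tau> \<tau>s)
  then show ?case by (cases ss) auto
qed simp

text \<open>The antecedent with internal body has no realizers, so the sequence \<open>y\<close> of
  candidates cannot depend on any and is available before the antecedent is assumed. It becomes the
  standard object sought; the rest is a rearrangement of the tuple.\<close>

lemma valid_HIP:
  assumes "wf_int (\<sigma> # \<Gamma>) A" and wfB: "wf_fm (\<tau> # \<Gamma>) B"
  shows "valid \<Gamma> (Imp (Imp (ForallSt \<sigma> A) (ExistsSt \<tau> B))
    (ExistsSt (TSeq \<tau>) (Imp (ForallSt \<sigma> (fren (skip 1) A)) (bex_fm \<tau> (Var 0) (fren (skip 1) B)))))"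
proof (rule valid_ImpI)
  let ?b = "bex_fm \<tau> (Var 0) (fren (skip 1) B)" and ?A = "ForallSt \<sigma> (fren (skip 1) A)"
  let ?P = "Imp (ForallSt \<sigma> A) (ExistsSt \<tau> B)" and ?C = "Imp ?A ?b"
  let ?Q = "ExistsSt (TSeq \<tau>) ?C"
  let ?vB = "map TSeq (D_univ B)"
  let ?tX = "TSeq (sapp_elem ?vB \<sigma>)"
  \<comment> \<open>A tuple consisting of \<open>u\<close>, \<open>y\<close> and \<open>X\<close> is
    sent to \<open>u\<close>, \<open>X\<close> and the singleton of \<open>y\<close>.\<close>
  let ?U = "\<lambda>x. butlast (butlast x) @ [last x] @ [single (TSeq \<tau>) (last (butlast x))]"
  have A: "wf_fm (\<sigma> # \<Gamma>) A" "internal A" using assms by (auto simp: wf_int_def)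
  note DA = D_internal[OF A(2)]
  have ex: "D_exist ?P = (D_exist B @ [TSeq \<tau>]) @ [?tX]" "D_univ ?P = ?vB" "D_exist ?C = D_exist B @ [?tX]"
    "D_univ ?C = ?vB" "D_exist ?Q = (D_exist B @ [?tX]) @ [TSeq (TSeq \<tau>)]" "D_univ ?Q = map TSeq ?vB"
    by (simp_all add: DA D_exist_def comp_def)
  have wfP: "wf_fm \<Gamma> ?P" using A wfB by simp
  have wfC: "wf_fm (TSeq \<tau> # \<Gamma>) ?C" and wfb: "wf_fm (TSeq \<tau> # \<Gamma>) ?b" using A wfB by simp_all
  show "wf_fm \<Gamma> (Imp ?P ?Q)" using wfP wfC by simp
  show "nat_fn (D_exist ?P) (D_exist ?Q) ?U"
    unfolding ex by (rule nat_fnI; erule tyl_snocE; erule tyl_snocE) (simp_all add: butlast_append)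
  show "nat_fn2 (D_exist ?P) (D_univ ?Q) (map TSeq (D_univ ?P)) (\<lambda>_ v. v)"
    unfolding ex by (rule nat_fn2_snd)
  fix w \<rho> x v
  assume env: "env (cx w) \<Gamma> \<rho>" and "tys w x (D_exist ?P)" and v: "tys w v (D_univ ?Q)"
    and h: "\<And>w' ys. ext w w' \<Longrightarrow> mems w' (D_univ ?P) ys v \<Longrightarrow> MD w' ?P \<rho> x ys"
  from this(2)[unfolded ex] obtain x' X where x': "x = x' @ [X]" "tys w x' (D_exist B @ [TSeq \<tau>])" and X: "typeof X (cx w) = Some ?tX"
    by (rule tyl_snocE)
  from x'(2) obtain u y where u: "x' = u @ [y]" "tys w u (D_exist B)" and y: "typeof y (cx w) = Some (TSeq \<tau>)"
    by (rule tyl_snocE)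
  have lu: "length u = length (D_elems B)" using tyl_length[OF u(2)] by simp
  have "MD w ?Q \<rho> ((u @ [X]) @ [single (TSeq \<tau>) y]) v"
  proof (rule MD_ExistsStI[OF wfC env _ _ mem_single[OF y]])
    show "tys w (u @ [X]) (D_exist ?C)" unfolding ex using u(2) X by simp
    show "tys w v (map TSeq (D_univ ?C))" using v unfolding ex .
    fix w1 ys assume w1: "ext w w1" and ys: "mems w1 (D_univ ?C) ys v"
    note env1 = env_case_nat[OF env_mono[OF env w1] ty_mono[OF y w1]]
      and u1 = tys_mono[OF u(2) w1] and X1 = ty_mono[OF X w1]
    have ys1: "tys w1 ys ?vB" using mems_tys[OF ys] unfolding ex .
    have P: "MD w1 ?P \<rho> ((u @ [y]) @ [X]) ([] @ ys)"
      using h[OF w1, of ys] ys unfolding ex x'(1) u(1) by simp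
    show "MD w1 ?C (case_nat y \<rho>) (u @ [X]) ys"
    proof -
      have "MD w1 ?C (case_nat y \<rho>) (u @ [X]) ([] @ ys)"
      proof (rule MD_ImpI[OF wfC env1])
        show "tys w1 u (map (\<lambda>\<tau>. TSeq (sapp_elem (D_exist ?A) \<tau>)) (D_elems ?b))"
          using u1 by (simp add: DA D_exist_def comp_def)
        show "tys w1 [X] (map (\<lambda>\<tau>. TSeq (sapp_elem (D_exist ?A @ D_univ ?b) \<tau>)) (D_univ ?A))"
          using X1 by (simp add: DA)
        show "tys w1 [] (D_exist ?A)" by (simp add: DA)
        show "tys w1 ys (D_univ ?b)" using ys1 by simp
        fix w2 assume w2: "ext w1 w2" and h2: "\<And>w' zs. ext w2 w' \<Longrightarrow>
          mems w' (D_univ ?A) zs (map_sapps (D_exist ?A @ D_univ ?b) (D_univ ?A) [X] ([] @ ys)) \<Longrightarrow> MD w' ?A (case_nat y \<rho>) [] zs"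
        have "MD w2 (ExistsSt \<tau> B) \<rho> (map_sapps (D_exist (ForallSt \<sigma> A)) (D_elems (ExistsSt \<tau> B)) (u @ [y]) []) ys"
        proof (rule MD_ImpD[OF pv_mono[OF P w2] wfP env_mono[OF env ext_trans[OF w1 w2]]])
          show "tys w2 (u @ [y]) (map (\<lambda>\<tau>. TSeq (sapp_elem (D_exist (ForallSt \<sigma> A)) \<tau>)) (D_elems (ExistsSt \<tau> B)))"
            using tys_mono[OF u1 w2] ty_mono[OF y ext_trans[OF w1 w2]] by (simp add: DA D_exist_def comp_def)
          show "tys w2 [X] (map (\<lambda>\<tau>'. TSeq (sapp_elem (D_exist (ForallSt \<sigma> A) @ D_univ (ExistsSt \<tau> B)) \<tau>')) (D_univ (ForallSt \<sigma> A)))"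
            using ty_mono[OF X1 w2] by (simp add: DA)
          show "tys w2 [] (D_exist (ForallSt \<sigma> A))" by (simp add: DA)
          show "tys w2 ys (D_univ (ExistsSt \<tau> B))" using tys_mono[OF ys1 w2] by simp
          fix w3 zs assume w3: "ext w2 w3" and zs: "mems w3 (D_univ (ForallSt \<sigma> A)) zs
            (map_sapps (D_exist (ForallSt \<sigma> A) @ D_univ (ExistsSt \<tau> B)) (D_univ (ForallSt \<sigma> A)) [X] ([] @ ys))"
          then obtain z where z: "zs = [z]" using mems_length[OF zs] by (auto simp: DA length_Suc_conv)
          have "MD w3 ?A (case_nat y \<rho>) [] zs" by (rule h2[OF w3]) (use zs in \<open>simp add: DA\<close>)
          then show "MD w3 (ForallSt \<sigma> A) \<rho> [] zs"
            unfolding z D_matrix_ForallSt by (simp add: DA D_matrix_fren env_skip1)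
        qed
        then have E: "MD w2 (ExistsSt \<tau> B) \<rho> (u @ [y]) ys"
          using map_sapps_Nil[of "u @ [y]" "D_elems B @ [\<tau>]"] lu by (simp add: DA del: D_matrix.simps)
        note env2 = env_mono[OF env1 w2] and u2 = tys_mono[OF u1 w2] and ys2 = tys_mono[OF ys1 w2]
        have "MD w2 ?b (case_nat y \<rho>) u ys"
        proof (rule MD_ExistsStE[OF E _ _ MD_wf[OF wfb env2]])
          fix w3 z assume w3: "ext w2 w3" and z: "mem w3 \<tau> z y"
            and h3: "\<And>w' ys'. ext w3 w' \<Longrightarrow> mems w' (D_univ B) ys' ys \<Longrightarrow> MD w' B (case_nat z \<rho>) u ys'"
          show "MD w3 ?b (case_nat y \<rho>) u ys"
          proof (rule MD_bexI[OF wfb env_mono[OF env2 w3]])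
            fix w4 ys4 assume "ext w3 w4" "mems w4 (D_univ (fren (skip 1) B)) ys4 ys"
            then show "MD w4 (fren (skip 1) B) (case_nat z (case_nat y \<rho>)) u ys4"
              using h3 by (simp add: D_matrix_fren env_skip1)
          qed (use z tys_mono[OF u2 w3] tys_mono[OF ys2 w3] in simp_all)
        qed (use lu u2 ys2 tyl_length[OF ys2] in simp_all)
        then show "MD w2 ?b (case_nat y \<rho>) (map_sapps (D_exist ?A) (D_elems ?b) u []) ys"
          using map_sapps_Nil[of u "D_elems B"] lu by (simp add: DA del: D_matrix.simps)
      qed
      then show ?thesis by (simp only: append_Nil)
    qed
  qed
  moreover have "?U x = (u @ [X]) @ [single (TSeq \<tau>) y]" by (simp add: x'(1) u(1) butlast_append)
  ultimately show "MD w ?Q \<rho> (?U x) v" by (simp only:)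
qed

text \<open>The realizer of the premise is a sequence \<open>X\<close> bounding the instances of the
  standard quantifier that are used for \<open>B\<close>; this is precisely the witness the
  conclusion asks for.\<close>

lemma valid_HGMP:
  assumes "wf_int (\<sigma> # \<Gamma>) A" "wf_int \<Gamma> B"
  shows "valid \<Gamma> (Imp (Imp (ForallSt \<sigma> A) B)
    (ExistsSt (TSeq \<sigma>) (Imp (ball_fm \<sigma> (Var 0) (fren (skip 1) A)) (fren Suc B))))"
proof (rule valid_ImpI)
  let ?P = "Imp (ForallSt \<sigma> A) B" and ?C = "Imp (ball_fm \<sigma> (Var 0) (fren (skip 1) A)) (fren Suc B)"
  let ?Q = "ExistsSt (TSeq \<sigma>) ?C"
  have A: "wf_fm (\<sigma> # \<Gamma>) A" "internal A" and B: "wf_fm \<Gamma> B" "internal B" using assms by (auto simp: wf_int_def)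
  have C: "internal ?C" "wf_fm (TSeq \<sigma> # \<Gamma>) ?C" using A B by auto
  note D = D_internal[OF A(2)] D_internal[OF B(2)] D_internal[OF C(1)]
  have ex: "D_exist ?P = [TSeq \<sigma>]" "D_univ ?P = []" "D_exist ?C = []" "D_exist ?Q = [TSeq (TSeq \<sigma>)]" "D_univ ?Q = []"
    using D_internal[of "ball_fm \<sigma> (Var 0) (fren (skip 1) A)"] A by (simp_all add: D D_exist_def)
  have wfP: "wf_fm \<Gamma> ?P" using A B by simp
  show "wf_fm \<Gamma> (Imp ?P ?Q)" using wfP C by simp
  show "nat_fn (D_exist ?P) (D_exist ?Q) (singles [TSeq \<sigma>])"
    unfolding ex using nat_fn2_singles[of "[]" "[TSeq \<sigma>]"] by (auto simp: nat_fn_def nat_fn2_def)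
  show "nat_fn2 (D_exist ?P) (D_univ ?Q) (map TSeq (D_univ ?P)) (\<lambda>_ _. [])"
    unfolding ex by (simp add: nat_fn2_Nil)
  fix w \<rho> x v
  assume env: "env (cx w) \<Gamma> \<rho>" and x: "tys w x (D_exist ?P)" and v: "tys w v (D_univ ?Q)"
    and h: "\<And>w' ys. ext w w' \<Longrightarrow> mems w' (D_univ ?P) ys [] \<Longrightarrow> MD w' ?P \<rho> x ys"
  from x[unfolded ex] obtain X where X: "x = [X]" "typeof X (cx w) = Some (TSeq \<sigma>)" by (cases x) auto
  have v': "v = []" using v unfolding ex by simp
  have P: "MD w ?P \<rho> ([] @ [X]) ([] @ [])" using h[OF ext_refl, of "[]"] X(1) unfolding ex by simp
  have "MD w ?Q \<rho> ([] @ [single (TSeq \<sigma>) X]) []"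
  proof (rule MD_ExistsStI[OF C(2) env _ _ mem_single[OF X(2)]])
    fix w1 ys assume w1: "ext w w1"
    have up: "(\<lambda>i. up (case_nat X \<rho>) (skip (Suc 0) i)) = up \<rho>"
      by (rule HOL.ext) (auto simp: skip_def up_def split: nat.split)
    have "pv w1 (Imp (ball_fm \<sigma> X (fsub (up \<rho>) A)) (fsub \<rho> B))"
    proof (rule pv_ImpI)
      have "wf_int (cx w1) (fsub (case_nat X \<rho>) ?C)"
        by (rule L_fsub[of "TSeq \<sigma> # \<Gamma>"]) (use C env_case_nat[OF env_mono[OF env w1] ty_mono[OF X(2) w1]] in \<open>simp_all add: wf_int_def\<close>)
      then show "wf_int (cx w1) (ball_fm \<sigma> X (fsub (up \<rho>) A))" by (simp add: up wf_int_simps)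
      fix w2 assume w2: "ext w1 w2" and b: "pv w2 (ball_fm \<sigma> X (fsub (up \<rho>) A))"
      have "MD w2 B \<rho> (map_sapps (D_exist (ForallSt \<sigma> A)) (D_elems B) [] []) []"
      proof (rule MD_ImpD[OF pv_mono[OF P ext_trans[OF w1 w2]] wfP env_mono[OF env ext_trans[OF w1 w2]]])
        fix w3 zs assume w3: "ext w2 w3"
          and zs: "mems w3 (D_univ (ForallSt \<sigma> A)) zs (map_sapps (D_exist (ForallSt \<sigma> A) @ D_univ B) (D_univ (ForallSt \<sigma> A)) [X] ([] @ []))"
        then obtain z where z: "zs = [z]" "mem w3 \<sigma> z X" using mems_length[OF zs] by (auto simp: D length_Suc_conv)
        show "MD w3 (ForallSt \<sigma> A) \<rho> [] zs"
          unfolding z(1) D_matrix_ForallSt D_matrix_internal[OF A(2)]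
          using ballD[OF pv_mono[OF b w3] z(2)] by simp
      qed (use ty_mono[OF X(2) ext_trans[OF w1 w2]] in \<open>simp_all add: D\<close>)
      then show "pv w2 (fsub \<rho> B)" by (simp add: D_matrix_internal[OF B(2)])
    qed
    then show "MD w1 ?C (case_nat X \<rho>) [] ys"
      unfolding D_matrix_internal[OF C(1)] by (simp add: up)
  qed (simp_all only: ex D list.map)
  then show "MD w ?Q \<rho> (singles [TSeq \<sigma>] x) v" unfolding X v' by (simp only: append_Nil zip_Cons_Cons list.map prod.case zip_Nil)
qed

end

section \<open>External induction and the soundness theorem\<close>

lemma fsub_Foralls [simp]: "fsub \<theta> (Foralls \<sigma>s A) = Foralls \<sigma>s (fsub (ups (length \<sigma>s) \<theta>) A)"
  by (induction \<sigma>s arbitrary: \<theta>) auto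

lemma wf_int_Foralls: "wf_int \<Gamma> (Foralls \<sigma>s A) \<longleftrightarrow> wf_int (rev \<sigma>s @ \<Gamma>) A"
  by (induction \<sigma>s arbitrary: \<Gamma>) (auto simp: wf_int_simps)

lemma (in calculus) dv_Foralls: "dv (rev \<sigma>s @ \<Gamma>) A \<Longrightarrow> dv \<Gamma> (Foralls \<sigma>s A)"
  by (induction \<sigma>s arbitrary: \<Gamma>) (auto intro: dv_Forall)

context eha
begin

lemma pv_ForallsI:
  "wf_int (rev \<sigma>s @ cx w) A \<Longrightarrow>
    (\<And>w' ys. ext w w' \<Longrightarrow> tys w' ys \<sigma>s \<Longrightarrow> pv w' (fsub (envl ys Var) A)) \<Longrightarrow> pv w (Foralls \<sigma>s A)"
proof (induction \<sigma>s arbitrary: w A)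
  case Nil
  then show ?case using Nil(2)[of w "[]"] by simp
next
  case (Cons \<sigma> \<sigma>s)
  have wf: "wf_int (\<sigma> # cx w) (Foralls \<sigma>s A)"
    using Cons.prems(1) by (simp add: wf_int_Foralls)
  have "pv w (Forall \<sigma> (Foralls \<sigma>s A))"
  proof (rule pv_ForallI[OF wf])
    fix w' a assume w': "ext w w'" and a: "typeof a (cx w') = Some \<sigma>"
    have "wf_int (cx w') (fsub (inst a) (Foralls \<sigma>s A))"
      by (rule L_inst[OF wf_mono1[OF wf w'] a])
    then have wf': "wf_int (rev \<sigma>s @ cx w') (fsub (ups (length \<sigma>s) (inst a)) A)"
      by (simp add: wf_int_Foralls)
    have "pv w' (Foralls \<sigma>s (fsub (ups (length \<sigma>s) (inst a)) A))"
    proof (rule Cons.IH[OF wf'])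
      fix w'' ys assume w'': "ext w' w''" and ys: "tys w'' ys \<sigma>s"
      have "tys w'' (a # ys) (\<sigma> # \<sigma>s)" using ys ty_mono[OF a w''] by simp
      from Cons.prems(2)[OF ext_trans[OF w' w''] this]
      show "pv w'' (fsub (envl ys Var) (fsub (ups (length \<sigma>s) (inst a)) A))"
        using tyl_length[OF ys] by (simp add: envl_ups)
    qed
    then show "pv w' (fsub (inst a) (Foralls \<sigma>s A))" by simp
  qed
  then show ?case by simp
qed

lemma pv_ForallsD: "pv w (Foralls \<sigma>s A) \<Longrightarrow> tys w ys \<sigma>s \<Longrightarrow> pv w (fsub (envl ys Var) A)"
proof (induction \<sigma>s arbitrary: ys A)
  case (Cons \<sigma> \<sigma>s)
  then obtain a us where y: "ys = a # us" "typeof a (cx w) = Some \<sigma>" "tys w us \<sigma>s" by (cases ys) auto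
  have "pv w (Foralls \<sigma>s (fsub (ups (length \<sigma>s) (inst a)) A))"
    using pv_ForallD[of w \<sigma> "Foralls \<sigma>s A" a] Cons.prems(1) y(2) by simp
  from Cons.IH[OF this y(3)] show ?case using tyl_length[OF y(3)] by (simp add: y(1) envl_ups)
qed simp

text \<open>The matrix is internal even when \<open>A\<close> is not, so internal induction applies
  to it. The universal arguments are quantified inside the induction formula, because the step may
  need its hypothesis at other values than the one at hand; \<open>R\<close> has to commute with
  substitution so that it can be formed at a variable.\<close>

lemma MD_nat_induct:
  assumes wf: "wf_fm (TNat # \<Gamma>) A" and env: "env (cx w) \<Gamma> \<rho>"
    and R: "\<And>\<Delta> n. typeof n \<Delta> = Some TNat \<Longrightarrow> tyl \<Delta> (R n) (D_exist A)"
      "\<And>\<theta> n. map (sub \<theta>) (R n) = R (sub \<theta> n)"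
    and 0: "\<And>w' v. ext w w' \<Longrightarrow> tys w' v (D_univ A) \<Longrightarrow> MD w' A (case_nat ZeroC \<rho>) (R ZeroC) v"
    and S: "\<And>w' n v. ext w w' \<Longrightarrow> typeof n (cx w') = Some TNat \<Longrightarrow> tys w' v (D_univ A) \<Longrightarrow>
      (\<And>w'' v. ext w' w'' \<Longrightarrow> tys w'' v (D_univ A) \<Longrightarrow> MD w'' A (case_nat n \<rho>) (R n) v) \<Longrightarrow>
      MD w' A (case_nat (SucC \<cdot> n) \<rho>) (R (SucC \<cdot> n)) v"
    and n: "typeof n (cx w) = Some TNat" and v: "tys w v (D_univ A)"
  shows "MD w A (case_nat n \<rho>) (R n) v"
proof -
  let ?V = "D_univ A" let ?k = "length ?V"
  let ?M = "\<lambda>\<rho> xs. D_matrix A (\<lambda>i. shift ?k (\<rho> i)) (map (shift ?k) xs) (vars ?k)"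
  let ?B = "Foralls ?V (?M (up \<rho>) (R (Var 0)))"
  have lR: "length (R n) = length (D_elems A)" if "typeof n \<Delta> = Some TNat" for n \<Delta>
    using tyl_length[OF R(1)[OF that]] by simp
  have l0: "length (R (Var 0)) = length (D_elems A)" by (rule lR[of _ "[TNat]"]) simp
  have ups: "fsub (ups ?k (inst n)) (?M (up \<rho>) (R (Var 0))) = ?M (case_nat n \<rho>) (R n)" for n
  proof -
    have "fsub (ups ?k (inst n)) (?M (up \<rho>) (R (Var 0))) =
        ?M (\<lambda>i. sub (inst n) (up \<rho> i)) (map (sub (inst n)) (R (Var 0)))"
      using l0 by (simp add: fsub_D_matrix comp_def ren_sub)
    moreover have "sub (inst n) (up \<rho> i) = case_nat n \<rho> i" for i
      by (cases i) simp_all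
    ultimately show ?thesis unfolding R(2) by simp
  qed
  have B: "fsub (inst n) ?B = Foralls ?V (?M (case_nat n \<rho>) (R n))" for n
    unfolding fsub_Foralls ups ..
  have wfM: "wf_int (rev ?V @ G) (?M \<rho>' xs)" if "env G (TNat # \<Gamma>) \<rho>'" "tyl G xs (D_exist A)" for G \<rho>' xs
    by (rule wf_D_matrix[OF wf env_shift[OF that(1)] tyl_shift[OF that(2)]]) (simp_all add: tyl_vars)
  have I: "pv w' (Foralls ?V (?M (case_nat n \<rho>) (R n)))"
    if w': "ext w w'" and n: "typeof n (cx w') = Some TNat"
      and main: "\<And>w'' v. ext w' w'' \<Longrightarrow> tys w'' v ?V \<Longrightarrow> MD w'' A (case_nat n \<rho>) (R n) v" for w' n
  proof (rule pv_ForallsI)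
    show "wf_int (rev ?V @ cx w') (?M (case_nat n \<rho>) (R n))"
      by (rule wfM[OF env_case_nat[OF env_mono[OF env w'] n] R(1)[OF n]])
    fix w'' v assume w'': "ext w' w''" and v: "tys w'' v ?V"
    show "pv w'' (fsub (envl v Var) (?M (case_nat n \<rho>) (R n)))"
      by (subst inst_D_matrix) (use lR[OF n] tyl_length[OF v] main[OF w'' v] in simp_all)
  qed
  have D: "MD w' A (case_nat n \<rho>) (R n) v"
    if "pv w' (Foralls ?V (?M (case_nat n \<rho>) (R n)))" "typeof n (cx w') = Some TNat" "tys w' v ?V" for w' n v
  proof -
    have "pv w' (fsub (envl v Var) (?M (case_nat n \<rho>) (R n)))" by (rule pv_ForallsD[OF that(1,3)])
    then show ?thesis
      by (subst (asm) inst_D_matrix) (use lR[OF that(2)] tyl_length[OF that(3)] in simp_all)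
  qed
  have "pv w (fsub (inst n) ?B)"
  proof (rule pv_nat_induct[OF _ n])
    show "wf_int (TNat # cx w) ?B"
      unfolding wf_int_Foralls by (rule wfM[OF env_up[OF env] R(1)]) simp
    show "pv w (fsub (inst ZeroC) ?B)" unfolding B
      by (rule I[OF ext_refl _ 0]) simp
    fix w' m assume w': "ext w w'" and m: "typeof m (cx w') = Some TNat" and IH: "pv w' (fsub (inst m) ?B)"
    show "pv w' (fsub (inst (SucC \<cdot> m)) ?B)" unfolding B
    proof (rule I[OF w'])
      fix w'' v assume w'': "ext w' w''" and v: "tys w'' v ?V"
      note m'' = ty_mono[OF m w'']
      show "MD w'' A (case_nat (SucC \<cdot> m) \<rho>) (R (SucC \<cdot> m)) v"
      proof (rule S[OF ext_trans[OF w' w''] m'' v])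
        fix w3 u assume w3: "ext w'' w3" and u: "tys w3 u ?V"
        show "MD w3 A (case_nat m \<rho>) (R m) u"
          by (rule D[OF pv_mono[OF IH[unfolded B] ext_trans[OF w'' w3]] ty_mono[OF m'' w3] u])
      qed
    qed (use m in simp)
  qed
  then show ?thesis unfolding B by (rule D[OF _ n v])
qed

text \<open>The realizers of \<open>A\<close> at n are defined by simultaneous recursion from those
  of base and step, and \<open>MD_nat_induct\<close> verifies them.\<close>

lemma valid_ext_induct_rule:
  assumes wf: "wf_fm (TNat # \<Gamma>) A"
    and v0: "valid \<Gamma> (fsub (inst ZeroC) A)"
    and vS: "valid \<Gamma> (ForallSt TNat (Imp A (fsub succ_sub A)))"
  shows "valid \<Gamma> (ForallSt TNat A)"
proof -
  let ?A' = "fsub succ_sub A" and ?E = "D_exist A" and ?m = "length (D_elems A)"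
  from v0 obtain ts0 where "tyl [] ts0 (D_exist (fsub (inst ZeroC) A))"
    and "\<And>w \<rho> ys. env (cx w) \<Gamma> \<rho> \<Longrightarrow> tys w ys (D_univ (fsub (inst ZeroC) A)) \<Longrightarrow> MD w (fsub (inst ZeroC) A) \<rho> ts0 ys"
    unfolding valid_def by blast
  then have ts0: "tyl [] ts0 ?E"
    and M0: "\<And>w \<rho> ys. env (cx w) \<Gamma> \<rho> \<Longrightarrow> tys w ys (D_univ A) \<Longrightarrow> MD w A (case_nat ZeroC \<rho>) ts0 ys"
    by (simp_all add: D_matrix_fsub sub_inst_env)
  let ?eU = "map (sapp_elem ?E) (D_elems A)" and ?eY = "map (sapp_elem (?E @ D_univ A)) (D_univ A)"
  have el: "D_elems (Imp A ?A') = ?eU @ ?eY" "D_univ (Imp A ?A') = ?E @ D_univ A"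
    by (simp_all add: D_exist_def)
  from vS obtain ts where "tyl [] ts (D_exist (ForallSt TNat (Imp A ?A')))"
    and M: "\<And>w \<rho> ys. env (cx w) \<Gamma> \<rho> \<Longrightarrow> tys w ys (D_univ (ForallSt TNat (Imp A ?A'))) \<Longrightarrow> MD w (ForallSt TNat (Imp A ?A')) \<rho> ts ys"
    unfolding valid_def by blast
  from this(1) have "tyl [] ts (map (\<lambda>\<tau>. TSeq (sapp_elem [TNat] \<tau>)) ?eU @ map (\<lambda>\<tau>. TSeq (sapp_elem [TNat] \<tau>)) ?eY)"
    unfolding D_exist_simps(9) el map_append .
  then obtain Us Ys where ts: "ts = Us @ Ys" and Us: "tyl [] Us (map (\<lambda>\<tau>. TSeq (sapp_elem [TNat] \<tau>)) ?eU)"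
    and Ys: "tyl [] Ys (map (\<lambda>\<tau>. TSeq (sapp_elem [TNat] \<tau>)) ?eY)"
    by (rule tyl_appendE)
  have lU: "length Us = ?m" using tyl_length[OF Us] by simp
  let ?step = "\<lambda>n xs. map_sapps (TNat # ?E) (D_elems A) Us (n # xs)"
  have step: "MD w A (case_nat (SucC \<cdot> n) \<rho>) (?step n xs) v"
    if env: "env (cx w) \<Gamma> \<rho>" and n: "typeof n (cx w) = Some TNat" and xs: "tys w xs ?E" and v: "tys w v (D_univ A)"
      and A: "\<And>w' v. ext w w' \<Longrightarrow> tys w' v (D_univ A) \<Longrightarrow> MD w' A (case_nat n \<rho>) xs v" for w \<rho> n xs v
  proof -
    let ?U = "map_sapps [TNat] ?eU Us [n]" and ?Y = "map_sapps [TNat] ?eY Ys [n]"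
    have n1: "tys w [n] [TNat]" using n by simp
    have wfI: "wf_fm (TNat # \<Gamma>) (Imp A ?A')"
      using wf by (auto simp: nth_Cons intro!: wf_fsub[of "TNat # \<Gamma>"] split: nat.split)
    have "tys w (n # xs @ v) (D_univ (ForallSt TNat (Imp A ?A')))" using n xs v by (simp add: D_exist_def)
    from M[OF env this] have "MD w (Imp A ?A') (case_nat n \<rho>) (?U @ ?Y) (xs @ v)"
      unfolding D_matrix_ForallSt el ts using map_sapps_append2[of Us ?eU "[TNat]" "[n]" ?eY Ys] lU by (simp del: D_matrix.simps)
    then have "MD w ?A' (case_nat n \<rho>) (map_sapps ?E (D_elems ?A') ?U xs) v"
    proof (rule MD_ImpD[OF _ wfI env_case_nat[OF env n]])
      show "tys w ?U (map (\<lambda>\<tau>. TSeq (sapp_elem ?E \<tau>)) (D_elems ?A'))"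
        using tyl_map_sapps[OF tyl_closed[OF Us] n1] by (simp add: comp_def)
      show "tys w ?Y (map (\<lambda>\<tau>. TSeq (sapp_elem (?E @ D_univ ?A') \<tau>)) (D_univ A))"
        using tyl_map_sapps[OF tyl_closed[OF Ys] n1] by (simp add: comp_def)
      fix w' ys assume w': "ext w w'" and ys: "mems w' (D_univ A) ys (map_sapps (?E @ D_univ ?A') (D_univ A) ?Y (xs @ v))"
      show "MD w' A (case_nat n \<rho>) xs ys" by (rule A[OF w' mems_tys[OF ys]])
    qed (use xs v in simp_all)
    moreover have "(\<lambda>i. sub (case_nat n \<rho>) (succ_sub i)) = case_nat (SucC \<cdot> n) \<rho>"
      by (rule HOL.ext) (simp split: nat.split)
    moreover have "map_sapps ?E (D_elems A) ?U xs = ?step n xs"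
      using map_sapps_append[of "[n]" "[TNat]" ?E xs "D_elems A" Us] by simp
    ultimately show ?thesis by (simp only: D_matrix_fsub D_fsub)
  qed
  \<comment> \<open>Step functions for the recursor. It supplies the previous values first and the
    number last, whereas the realizers of the step want the number first; hence \<open>Var 0\<close>
    is the number and the previous values are the shifted \<open>vars\<close>.\<close>
  define zs where "zs = map2 (\<lambda>\<tau> u. foldr Lam (?E @ [TNat]) (sapps (TNat # ?E) \<tau> u (Var 0 # map (shift 1) (vars ?m)))) (D_elems A) Us"
  define R where "R = (\<lambda>n. map (\<lambda>i. Apps (RecC ?E i \<cdot> n) (ts0 @ zs)) [0..<?m])"
  have typeof_Lams: "typeof (foldr Lam \<sigma>s b) G = Some (TFuns \<sigma>s \<tau>)" if "typeof b (rev \<sigma>s @ G) = Some \<tau>" for \<sigma>s b G \<tau>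
    using that by (induction \<sigma>s arbitrary: G) auto
  have ui: "typeof (Us ! i) [] = Some (TSeq (sapp_elem (TNat # ?E) (D_elems A ! i)))" if "i < ?m" for i
    using arg_cong[OF Us, of "\<lambda>l. l ! i"] that lU by simp
  have zi: "zs ! i = foldr Lam (?E @ [TNat]) (sapps (TNat # ?E) (D_elems A ! i) (Us ! i) (Var 0 # map (shift 1) (vars ?m)))"
    if "i < ?m" for i using that lU by (simp add: zs_def)
  have tzi: "typeof (zs ! i) G = Some (TFuns ?E (TFun TNat (?E ! i)))" if "i < ?m" for i G
  proof -
    have "tyl (rev (?E @ [TNat]) @ G) (map (shift 1) (vars ?m)) ?E"
      using tyl_shift[OF tyl_vars[of ?E ?m G], of "[TNat]" 1] by simp
    then have "typeof (sapps (TNat # ?E) (D_elems A ! i) (Us ! i) (Var 0 # map (shift 1) (vars ?m))) (rev (?E @ [TNat]) @ G) =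
        Some (TSeq (D_elems A ! i))"
      by (intro typeof_sapps typeof_closed[OF ui[OF that]]) simp_all
    from typeof_Lams[OF this] show ?thesis
      using that unfolding zi[OF that] by (simp add: D_exist_def)
  qed
  have zs: "tyl G zs (map (\<lambda>\<rho>. TFuns ?E (TFun TNat \<rho>)) ?E)" for G
    by (rule nth_equalityI) (use tzi lU in \<open>simp_all add: zs_def\<close>)
  have tR: "tyl G (R n) ?E" if n: "typeof n G = Some TNat" for G n
  proof (rule nth_equalityI)
    fix i assume "i < length (map (\<lambda>t. typeof t G) (R n))"
    then have i: "i < ?m" by (simp add: R_def)
    have "typeof (Apps (RecC ?E i \<cdot> n) (ts0 @ zs)) G = Some (?E ! i)"
      by (rule typeof_Apps[where \<sigma>s = "?E @ map (\<lambda>\<rho>. TFuns ?E (TFun TNat \<rho>)) ?E"])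
        (use n i zs tyl_closed[OF ts0] in simp_all)
    then show "map (\<lambda>t. typeof t G) (R n) ! i = map Some ?E ! i" using i by (simp add: R_def)
  qed (simp add: R_def)
  have sub_Apps: "sub \<theta> (Apps f ts) = Apps (sub \<theta> f) (map (sub \<theta>) ts)" for \<theta> f ts
    by (induction ts arbitrary: f) auto
  have sR: "map (sub \<theta>) (R n) = R (sub \<theta> n)" for \<theta> n
    by (simp add: R_def sub_Apps sub_tyl_closed[OF ts0] sub_tyl_closed[OF zs])
  have hz: "have_types G zs (map (\<lambda>\<rho>. TFuns ?E (TFun TNat \<rho>)) ?E)" "have_types G ts0 ?E" for G
    using zs tyl_closed[OF ts0] by (simp_all only: have_types_iff)
  have R0: "eqvs w ?E (R ZeroC) ts0" for w
  proof -
    have "eqv w (?E ! i) (R ZeroC ! i) (ts0 ! i)" if "i < ?m" for i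
      using that pv_EHA[of w, OF EHA_axiom.rec_zero[OF _ hz(2,1), of i]] by (simp add: R_def eqv_def)
    then show ?thesis using tyl_length[OF ts0] by (simp add: eqvs_def R_def)
  qed
  have RS: "eqvs w ?E (R (SucC \<cdot> n)) (?step n (R n))" if n: "typeof n (cx w) = Some TNat" for w n
  proof -
    have "eqv w (?E ! i) (R (SucC \<cdot> n) ! i) (?step n (R n) ! i)" if i: "i < ?m" for i
    proof -
      have "eqv w (?E ! i) (R (SucC \<cdot> n) ! i) (Apps (zs ! i) (R n) \<cdot> n)"
        using i n pv_EHA[of w, OF EHA_axiom.rec_suc[where n = n, OF _ hz(2,1), of i]] by (simp add: R_def eqv_def has_type_iff)
      also have "eqv w (?E ! i) \<dots> (sapps (TNat # ?E) (D_elems A ! i) (Us ! i) (n # R n))"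
      proof -
        let ?b = "sapps (TNat # ?E) (D_elems A ! i) (Us ! i) (Var 0 # map (shift 1) (vars ?m))"
        have "eqv w (?E ! i) (Apps (sub Var (foldr Lam (?E @ [TNat]) ?b)) (R n @ [n])) (sub (envl (R n @ [n]) Var) ?b)"
          by (rule eqv_beta_tuple) (use tzi[OF i, of "cx w"] tR[OF n] n in \<open>simp_all add: zi[OF i]\<close>)
        moreover have "sub (envl (R n @ [n]) Var) ?b = sapps (TNat # ?E) (D_elems A ! i) (Us ! i) (n # R n)"
        proof -
          have "map (sub (case_nat n (envl (R n) Var))) (map (shift 1) (vars ?m)) = R n"
            using map_sub_envl_vars[of "R n" ?m Var] by (simp add: comp_def R_def del: map_sub_envl_vars)
          then show ?thesis by (simp add: envl_append sub_closed[OF ui[OF i]] del: sapps.simps map_map)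
        qed
        ultimately show ?thesis using zi[OF i] by simp
      qed
      finally show ?thesis using i lU by simp
    qed
    then show ?thesis using lU by (simp add: eqvs_def R_def)
  qed
  have natR: "nat_fn [TNat] (map TSeq (D_elems A)) (\<lambda>x. R (hd x))"
  proof (rule nat_fnI)
    fix G x assume "tyl G x [TNat]"
    then show "tyl G (R (hd x)) (map TSeq (D_elems A))" unfolding D_exist_def[symmetric] by (intro tR) auto
  next
    fix G \<theta> x assume "tyl G x [TNat]"
    then show "map (sub \<theta>) (R (hd x)) = R (hd (map (sub \<theta>) x))" unfolding sR by auto
  qed
  show ?thesis
  proof (rule validI)
    show "tyl [] (clos [TNat] (D_elems A) (\<lambda>x. R (hd x))) (D_exist (ForallSt TNat A))"
      using tyl_clos[OF natR, of "[]"] unfolding D_exist_simps .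
    fix w \<rho> ys assume env: "env (cx w) \<Gamma> \<rho>" and "tys w ys (D_univ (ForallSt TNat A))"
    then obtain n v where ys: "ys = n # v" and n: "typeof n (cx w) = Some TNat" and v: "tys w v (D_univ A)"
      by (cases ys) auto
    have "MD w A (case_nat n \<rho>) (R n) v"
    proof (rule MD_nat_induct[OF wf env tR sR _ _ n v])
      fix w' u assume w': "ext w w'" and u: "tys w' u (D_univ A)"
      note env' = env_mono[OF env w']
      show "MD w' A (case_nat ZeroC \<rho>) (R ZeroC) u"
        by (rule MD_cong_x[OF wf env_case_nat[OF env'] M0[OF env' u] eqvs_sym[OF R0] u]) simp
    next
      fix w' m u assume w': "ext w w'" and m: "typeof m (cx w') = Some TNat" and u: "tys w' u (D_univ A)"
        and IH: "\<And>w'' v. ext w' w'' \<Longrightarrow> tys w'' v (D_univ A) \<Longrightarrow> MD w'' A (case_nat m \<rho>) (R m) v"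
      note env' = env_mono[OF env w']
      show "MD w' A (case_nat (SucC \<cdot> m) \<rho>) (R (SucC \<cdot> m)) u"
        by (rule MD_cong_x[OF wf env_case_nat[OF env'] step[OF env' m tR[OF m] u IH] eqvs_sym[OF RS[OF m]] u])
          (use m in simp)
    qed
    moreover have "eqvs w (D_exist A) (R n) (map_sapps [TNat] (D_elems A) (clos [TNat] (D_elems A) (\<lambda>x. R (hd x))) [n])"
      using eqvs_sym[OF eqvs_clos[OF natR, of w "[n]"]] n by (simp add: D_exist_def)
    ultimately show "MD w (ForallSt TNat A) \<rho> (clos [TNat] (D_elems A) (\<lambda>x. R (hd x))) ys"
      unfolding ys D_matrix_ForallSt using MD_cong_x[OF wf env_case_nat[OF env n] _ _ v] by blast
  qed
qed

section \<open>Soundness of whole derivations, and the axiom of external induction\<close>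

lemma derives_valid:
  assumes Ax: "\<And>\<Gamma> A. Ax \<Gamma> A \<Longrightarrow> wf_fm \<Gamma> A \<and> valid \<Gamma> A"
  shows "derives wf_fm Ax \<Gamma> A \<Longrightarrow> wf_fm \<Gamma> A \<and> valid \<Gamma> A"
proof (induction rule: derives.induct)
  case (axiom \<Gamma> A)
  then show ?case by (rule Ax)
next
  case (forall_elim \<Gamma> \<sigma> A t)
  then show ?case using valid_forall_elim[of \<Gamma> \<sigma> A t]
    by (auto simp: has_type_iff nth_Cons intro!: wf_fsub[of "\<sigma> # \<Gamma>"] split: nat.split)
next
  case (exists_intro \<Gamma> \<sigma> A t)
  then show ?case using valid_exists_intro[of \<Gamma> \<sigma> A t]
    by (auto simp: has_type_iff nth_Cons intro!: wf_fsub[of "\<sigma> # \<Gamma>"] split: nat.split)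
next
  case (mp \<Gamma> A B)
  then show ?case using valid_mp[of \<Gamma> A B] by simp
next
  case (syll \<Gamma> A B C)
  then show ?case using valid_syll[of \<Gamma> A B C] by simp
next
  case (exportation \<Gamma> A B C)
  then show ?case using valid_exportation[of \<Gamma> A B C] by simp
next
  case (importation \<Gamma> A B C)
  then show ?case using valid_importation[of \<Gamma> A B C] by simp
next
  case (or_expansion \<Gamma> C A B)
  then show ?case using valid_or_expansion[of \<Gamma> A B C] by simp
next
  case (forall_rule \<Gamma> B \<sigma> A)
  then show ?case using valid_forall_rule[of \<sigma> \<Gamma> B A] by simp
next
  case (exists_rule \<Gamma> B \<sigma> A)
  then show ?case using valid_exists_rule[of \<sigma> \<Gamma> A B] by simp
qed (simp_all add: valid_or_contr valid_and_contr valid_or_weak valid_and_weak valid_or_perm valid_and_perm valid_ex_falso)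

text \<open>The axiom of external induction for \<open>\<Phi>\<close> follows from the rule for \<open>H \<rightarrow> \<Phi>\<close>, where \<open>H\<close> is the
  premise of the axiom. The rule needs no bounds on counterexamples, since its premises hold outright.\<close>

lemma valid_ext_induction:
  assumes wf: "wf_fm (TNat # \<Gamma>) A"
  shows "valid \<Gamma> (Imp (And (fsub (inst ZeroC) A) (ForallSt TNat (Imp A (fsub succ_sub A)))) (ForallSt TNat A))"
proof -
  \<comment> \<open>A second calculus, over the full language, with all valid formulas as axioms. By
    \<open>derives_valid\<close> its theorems are valid again, so the forcing rules become available
    for deriving external formulas.\<close>
  interpret V: calculus wf_fm "\<lambda>\<Gamma> A. wf_fm \<Gamma> A \<and> valid \<Gamma> A"
  proof
    fix \<Gamma> \<Gamma>' A assume "wf_fm \<Gamma> A \<and> valid \<Gamma> A"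
    then show "wf_fm (\<Gamma> @ \<Gamma>') A \<and> valid (\<Gamma> @ \<Gamma>') A"
      unfolding valid_def by (auto simp: wf_append nth_append)
  qed auto
  have sound: "valid \<Gamma> B" if "V.dv \<Gamma> B" for \<Gamma> B
    using derives_valid[OF _ that] by blast
  have ax: "V.pv w B" if "wf_fm (cx w) B" "valid (cx w) B" for w B
    using that by (simp add: V.pv_ax)
  \<comment> \<open>The standard quantifiers have no forcing rules of their own; this elimination
    and the introduction \<open>st_I\<close> come from the validity of their unfolding into
    relativized quantifiers.\<close>
  have st_D: "V.pv w (fsub (inst n) B)"
    if "V.pv w (ForallSt TNat B)" "V.pv w (St TNat n)" for w n B
  proof -
    have wfB: "wf_fm (TNat # cx w) B" and n: "typeof n (cx w) = Some TNat"
      using V.pv_L[OF that(1)] V.pv_L[OF that(2)] by (simp_all add: has_type_iff)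
    have "V.pv w (Imp (ForallSt TNat B) (Forall TNat (Imp (St TNat (Var 0)) B)))"
      by (rule ax[OF _ valid_forall_st1[OF wfB]]) (use wfB in \<open>simp add: has_type_iff\<close>)
    from V.pv_ForallD[OF V.pv_ImpD[OF this that(1)] n]
    have "V.pv w (Imp (St TNat n) (fsub (inst n) B))" by simp
    then show ?thesis using that(2) by (rule V.pv_ImpD)
  qed
  have st_I: "V.pv w (ForallSt TNat B)"
    if wfB: "wf_fm (TNat # cx w) B"
      and main: "\<And>w' n. V.ext w w' \<Longrightarrow> V.pv w' (St TNat n) \<Longrightarrow> V.pv w' (fsub (inst n) B)" for w B
  proof -
    have "V.pv w (Imp (Forall TNat (Imp (St TNat (Var 0)) B)) (ForallSt TNat B))"
      by (rule ax[OF _ valid_forall_st2[OF wfB]]) (use wfB in \<open>simp add: has_type_iff\<close>)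
    moreover have "V.pv w (Forall TNat (Imp (St TNat (Var 0)) B))"
    proof (rule V.pv_ForallI)
      fix w' n assume w': "V.ext w w'" and n: "typeof n (cx w') = Some TNat"
      have "V.pv w' (Imp (St TNat n) (fsub (inst n) B))"
        by (rule V.pv_ImpI) (use n main[OF V.ext_trans[OF w']] in \<open>auto simp: has_type_iff\<close>)
      then show "V.pv w' (fsub (inst n) (Imp (St TNat (Var 0)) B))" by simp
    qed (use wfB in \<open>simp add: has_type_iff\<close>)
    ultimately show ?thesis by (rule V.pv_ImpD)
  qed
  let ?S = "ForallSt TNat (Imp A (fsub succ_sub A))"
  let ?H = "And (fsub (inst ZeroC) A) ?S"
  let ?\<Psi> = "Imp (fren Suc ?H) A" and ?w = "World \<Gamma> (Imp Bot Bot)"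
  have wfS: "wf_fm (TNat # \<Gamma>) (fsub succ_sub A)" and wf0: "wf_fm \<Gamma> (fsub (inst ZeroC) A)"
    using wf by (auto simp: nth_Cons intro!: wf_fsub[of "TNat # \<Gamma>"] split: nat.split)
  have wfH: "wf_fm \<Gamma> ?H" using wf wfS wf0 by simp
  have wf\<Psi>: "wf_fm (TNat # \<Gamma>) ?\<Psi>" using wf wf_fren_Suc[of TNat \<Gamma> ?H] wfH by (simp del: fren.simps)
  have wf\<Psi>S: "wf_fm (TNat # \<Gamma>) (Imp ?\<Psi> (fsub succ_sub ?\<Psi>))"
    using wf\<Psi> wf_fsub[OF wf\<Psi>, of succ_sub "TNat # \<Gamma>"] by (simp add: nth_Cons split: nat.splits)
  \<comment> \<open>The hypothesis does not contain the induction variable, so the instances for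
    base and step leave it fixed.\<close>
  have "fsub (inst n) (fren Suc H) = H" "fsub (inst n) (fsub succ_sub (fren Suc H)) = H" for n H
    by simp_all
  note * = this
  have \<Psi>: "fsub (inst n) ?\<Psi> = Imp ?H (fsub (inst n) A)" for n
    by (simp only: fsub.simps(6) *)
  have \<Psi>S: "fsub (inst n) (fsub succ_sub ?\<Psi>) = Imp ?H (fsub (inst n) (fsub succ_sub A))" for n
    by (simp only: fsub.simps(6) *)
  have "valid \<Gamma> (ForallSt TNat ?\<Psi>)"
  proof (rule valid_ext_induct_rule[OF wf\<Psi>])
    show "valid \<Gamma> (fsub (inst ZeroC) ?\<Psi>)" unfolding \<Psi>
      by (rule valid_and_weak[OF wf0]) (use wfH in simp)
    \<comment> \<open>The step of the rule uses the second half of \<open>?H\<close>: once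
      \<open>?H\<close> is assumed, the inner implication for the standard number \<open>n\<close>
      can be instantiated.\<close>
    have "V.pv ?w (ForallSt TNat (Imp ?\<Psi> (fsub succ_sub ?\<Psi>)))"
    proof (rule st_I)
      fix w n assume w: "V.ext ?w w" and n: "V.pv w (St TNat n)"
      have n': "typeof n (cx w) = Some TNat" using V.pv_L[OF n] by (simp add: has_type_iff)
      have H: "wf_fm (cx w) ?H" and AS: "wf_fm (TNat # cx w) (Imp A (fsub succ_sub A))"
        using V.L_mono[OF _ w, of ?H] wfH by simp_all
      have "V.pv w (Imp (Imp ?H (fsub (inst n) A)) (Imp ?H (fsub (inst n) (fsub succ_sub A))))"
      proof (rule V.pv_ImpI)
        show "wf_fm (cx w) (Imp ?H (fsub (inst n) A))"
          using H AS V.L_inst[OF _ n', of A] by simp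
        fix w1 assume w1: "V.ext w w1" and i: "V.pv w1 (Imp ?H (fsub (inst n) A))"
        show "V.pv w1 (Imp ?H (fsub (inst n) (fsub succ_sub A)))"
        proof (rule V.pv_ImpI)
          show "wf_fm (cx w1) ?H" by (rule V.L_mono[OF H w1])
          fix w2 assume w2: "V.ext w1 w2" and h: "V.pv w2 ?H"
          have "V.pv w2 (fsub (inst n) (Imp A (fsub succ_sub A)))"
            by (rule st_D[OF V.pv_AndD2[OF h] V.pv_mono[OF n V.ext_trans[OF w1 w2]]])
          then show "V.pv w2 (fsub (inst n) (fsub succ_sub A))"
            using V.pv_ImpD[OF V.pv_mono[OF i w2] h] unfolding fsub.simps by (rule V.pv_ImpD)
        qed
      qed
      then show "V.pv w (fsub (inst n) (Imp ?\<Psi> (fsub succ_sub ?\<Psi>)))"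
        unfolding fsub.simps(6)[of _ ?\<Psi>] \<Psi> \<Psi>S .
    qed (use wf\<Psi>S in simp)
    then show "valid \<Gamma> (ForallSt TNat (Imp ?\<Psi> (fsub succ_sub ?\<Psi>)))"
      by (intro sound) (simp only: V.dv_iff_pv)
  qed
  then have all: "V.pv ?w (ForallSt TNat ?\<Psi>)"
    using wf\<Psi> by (intro ax) simp_all
  have "V.pv ?w (Imp ?H (ForallSt TNat A))"
  proof (rule V.pv_ImpI)
    fix w assume w: "V.ext ?w w" and h: "V.pv w ?H"
    have "wf_fm (cx w) (ForallSt TNat A)"
      by (rule V.L_mono[OF _ w]) (use wf in simp)
    then show "V.pv w (ForallSt TNat A)"
    proof (intro st_I)
      fix w' n assume w': "V.ext w w'" and n: "V.pv w' (St TNat n)"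
      have "V.pv w' (Imp ?H (fsub (inst n) A))"
        using st_D[OF V.pv_mono[OF all V.ext_trans[OF w w']] n] unfolding \<Psi> .
      then show "V.pv w' (fsub (inst n) A)"
        using V.pv_mono[OF h w'] by (rule V.pv_ImpD)
    qed simp
  qed (use wfH in simp)
  then show ?thesis by (intro sound) (simp only: V.dv_iff_pv)
qed

lemma st_axiom_valid: "st_axiom \<Gamma> A \<Longrightarrow> wf_fm \<Gamma> A \<and> valid \<Gamma> A"
proof (induction rule: st_axiom.induct)
  case (ext_induction \<Gamma> A)
  have "wf_fm \<Gamma> (fsub (inst ZeroC) A)" "wf_fm (TNat # \<Gamma>) (fsub succ_sub A)"
    using ext_induction by (auto simp: nth_Cons intro!: wf_fsub[of "TNat # \<Gamma>"] split: nat.split)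
  then show ?case using ext_induction valid_ext_induction by simp
qed (auto simp: has_type_iff intro: typeof_closed
    intro!: valid_AndI valid_forall_st1 valid_forall_st2 valid_exists_st1 valid_exists_st2 valid_st_eq valid_st_closed valid_st_app)

lemma principle_valid:
  "idealization \<Gamma> A \<Longrightarrow> wf_fm \<Gamma> A \<and> valid \<Gamma> A" "NCR \<Gamma> A \<Longrightarrow> wf_fm \<Gamma> A \<and> valid \<Gamma> A"
  "HAC \<Gamma> A \<Longrightarrow> wf_fm \<Gamma> A \<and> valid \<Gamma> A" "HGMP \<Gamma> A \<Longrightarrow> wf_fm \<Gamma> A \<and> valid \<Gamma> A"
  "HIP \<Gamma> A \<Longrightarrow> wf_fm \<Gamma> A \<and> valid \<Gamma> A"
  by (auto elim!: idealization.cases NCR.cases HAC.cases HGMP.cases HIP.cases simp: wf_int_def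
      intro!: valid_idealization[unfolded One_nat_def] valid_NCR[unfolded One_nat_def] valid_HAC[unfolded One_nat_def]
        valid_HGMP[unfolded One_nat_def] valid_HIP[unfolded One_nat_def])

lemma soundness: "EHAst_plus_derives \<Delta> \<Gamma> A \<Longrightarrow> valid \<Gamma> A"
  unfolding EHAst_plus_derives_def
proof (drule derives_valid[rotated])
  fix \<Gamma> A
  assume "EHA_axiom \<Gamma> A \<or> st_axiom \<Gamma> A \<or> idealization \<Gamma> A \<or> NCR \<Gamma> A \<or> HAC \<Gamma> A \<or> HGMP \<Gamma> A \<or> HIP \<Gamma> A \<or> A \<in> \<Delta>"
  moreover have "wf_fm \<Gamma> A \<and> valid \<Gamma> A" if "EHA_axiom \<Gamma> A \<or> A \<in> \<Delta>"
    using that valid_internal[of \<Gamma> A] Ax_L[OF that]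
    by (auto simp: EHA_derives_def wf_int_def intro: derives.axiom)
  ultimately show "wf_fm \<Gamma> A \<and> valid \<Gamma> A"
    using st_axiom_valid principle_valid by blast
qed blast

end

theorem mainTheorem1:
  fixes \<Gamma> :: ctx and \<Phi> :: fm and \<Delta> :: "fm set"
  assumes "wf_fm \<Gamma> \<Phi>"
    and "\<forall>\<delta>\<in>\<Delta>. internal_sentence \<delta>"
    and "EHAst_plus_derives \<Delta> \<Gamma> \<Phi>"
  shows "\<exists>ts. have_types [] ts (D_exist \<Phi>) \<and>
    EHA_derives \<Delta> \<Gamma>
      (Foralls (D_univ \<Phi>)
        (D_matrix \<Phi> (\<lambda>i. Var (i + length (D_univ \<Phi>))) ts (vars (length (D_univ \<Phi>)))))"
proof -
  interpret eha \<Delta> by unfold_locales (rule assms(2))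
  let ?V = "D_univ \<Phi>"
  let ?w = "World (rev ?V @ \<Gamma>) (Imp Bot Bot)" and ?\<rho> = "\<lambda>i. Var (i + length ?V)"
  obtain ts where ts: "tyl [] ts (D_exist \<Phi>)"
    and M: "\<And>w \<rho> ys. env (cx w) \<Gamma> \<rho> \<Longrightarrow> tys w ys ?V \<Longrightarrow> MD w \<Phi> \<rho> ts ys"
    using soundness[OF assms(3)] unfolding valid_def by blast
  have "MD ?w \<Phi> ?\<rho> ts (vars (length ?V))"
    by (rule M) (use tyl_vars[of ?V "length ?V" \<Gamma>] in \<open>simp_all add: nth_append\<close>)
  then have "EHA_derives \<Delta> \<Gamma> (Foralls ?V (D_matrix \<Phi> ?\<rho> ts (vars (length ?V))))"
    unfolding EHA_derives_def by (intro dv_Foralls) (simp only: dv_iff_pv)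
  with ts show ?thesis unfolding have_types_iff by blast
qed

end
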